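(* Let $n,p\in\mathbb N$ and $\rho\in[0,\infty)$. (i) For all $d\ge1$, $\lim_{\kappa\downarrow0}\lambda_p^{(n)}(\kappa,\rho)=\lambda_p^{(n)}(0,\rho)=n\,\mu(\rho/p)$. (ii) If $1\le d\le 2$, then $\lambda_p^{(n)}(\kappa,\rho)>0$ for all $\kappa\in[0,\infty)$; moreover, $\kappa\mapsto\lambda_p^{(n)}(\kappa,\rho)$ is strictly decreasing on $[0,\infty)$ with $\lim_{\kappa\to\infty}\lambda_p^{(n)}(\kappa,\rho)=0$. (iii) If $d\ge3$, then $\lambda_p^{(n)}(\kappa,\rho)=0$ for all $\kappa\in[nG_d(0),\infty)$.
   Context: $\mathbb N=\{1,2,\dots\}$. $\Delta$ is the discrete Laplacian on $\mathbb Z^d$: $\Delta f(x)=\sum_{y\sim x}[f(y)-f(x)]$, the sum being over nearest neighbours $y$ of $x$. A simple random walk on $\mathbb Z^d$ with step rate $2d\nu$ ($\nu\ge0$) is the continuous-time Markov process with generator $\nu\Delta$ (it jumps to each nearest neighbour at rate $\nu$; it does not move if $\nu=0$). Let $Y_1^\rho,\dots,Y_n^\rho$ be independent simple random walks on $\mathbb Z^d$ with step rate $2d\rho$, all starting from $0$; $\mathbb E_0^{\otimes n}$ is expectation with respect to them. Put $\xi(x,t)=\sum_{k=1}^n\delta_x(Y_k^\rho(t))$, where $\delta_x(y)=1$ if $y=x$ and $0$ otherwise. Let $u$ be the solution of the parabolic Anderson model $\partial_t u(x,t)=\kappa\Delta u(x,t)+\xi(x,t)u(x,t)$, $u(x,0)=1$,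 given by the Feynman–Kac formula $u(x,t)=\mathrm E_x\big(\exp[\int_0^t\xi(X^\kappa(s),t-s)\,ds]\big)$, where $X^\kappa$ is a simple random walk with step rate $2d\kappa$, independent of $\xi$, started at $x$ under $\mathrm E_x$. The $p$-th annealed Lyapunov exponent is $\lambda_p^{(n)}(\kappa,\rho)=\lim_{t\to\infty}\frac1{pt}\log\mathbb E_0^{\otimes n}\big([u(x,t)]^p\big)$; the limit exists, is finite, and does not depend on $x$ if $(\kappa,\rho)\ne(0,0)$ (for $(\kappa,\rho)=(0,0)$ take $x=0$). $G_d(x)$ is the Green function at $x$ of simple random walk on $\mathbb Z^d$ with step rate $2d$ started at $0$ (expected total time spent at $x$); $G_d(0)=\infty$ for $d=1,2$ and $G_d(0)<\infty$ for $d\ge3$. $\mu(\kappa)=\sup\mathrm{Sp}(\kappa\Delta+\delta_0)$ is the supremum of the spectrum of $\kappa\Delta+\delta_0$ on $\ell^2(\mathbb Z^d)$, where $\delta_0$ acts as multiplication by the indicator function of $0$. *)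

theory Defs
  imports "HOL-Probability.Probability"
begin

text \<open>The lattice \<open>\<int>\<^sup>d\<close> is the type \<open>int ^ 'd\<close>, with \<open>d = CARD('d) \<ge> 1\<close>.\<close>

definition neighbours :: "int ^ 'd \<Rightarrow> (int ^ 'd) set" where
  "neighbours x = {y. (\<Sum>i\<in>UNIV. \<bar>y $ i - x $ i\<bar>) = 1}"

definition laplacian :: "(int ^ 'd \<Rightarrow> 'a::ab_group_add) \<Rightarrow> int ^ 'd \<Rightarrow> 'a" where
  "laplacian f x = (\<Sum>y\<in>neighbours x. f y - f x)"

text \<open>The semigroup \<open>exp (t \<nu> \<Delta>)\<close> on bounded functions; the generator is a bounded operator there,
  so that the exponential series converges.\<close>

definition walk_semigroup :: "real \<Rightarrow> real \<Rightarrow> (int ^ 'd \<Rightarrow> real) \<Rightarrow> int ^ 'd \<Rightarrow> real" where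
  "walk_semigroup \<nu> t f x =
     (\<Sum>k. t ^ k / fact k * ((\<lambda>g y. \<nu> * laplacian g y) ^^ k) f x)"

definition walk_kernel :: "real \<Rightarrow> real \<Rightarrow> int ^ 'd \<Rightarrow> int ^ 'd \<Rightarrow> real" where
  "walk_kernel \<nu> t x y = walk_semigroup \<nu> t (indicator {y}) x"

text \<open>\<open>X\<close> is a simple random walk with step rate \<open>2 d \<nu>\<close> started at \<open>x\<close>: a Markov process with
  generator \<open>\<nu> \<Delta>\<close>. The Markov property with transition function \<open>exp (t \<nu> \<Delta>)\<close> is expressed through
  the finite-dimensional distributions. Paths are right-continuous with left limits for the
  discrete topology, hence piecewise constant with finitely many jumps in bounded time.\<close>

definition simple_random_walk ::
    "'w measure \<Rightarrow> (real \<Rightarrow> 'w \<Rightarrow> int ^ 'd) \<Rightarrow> real \<Rightarrow> int ^ 'd \<Rightarrow> bool" where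
  "simple_random_walk M X \<nu> x \<longleftrightarrow>
     prob_space M \<and>
     (\<forall>t\<ge>0. X t \<in> M \<rightarrow>\<^sub>M count_space UNIV) \<and>
     (\<forall>\<omega>\<in>space M. \<forall>t\<ge>0. continuous (at_right t) (\<lambda>s. X s \<omega>)) \<and>
     (\<forall>\<omega>\<in>space M. \<forall>t>0. \<exists>y. ((\<lambda>s. X s \<omega>) \<longlongrightarrow> y) (at_left t)) \<and>
     (\<forall>(m::nat) (t::nat \<Rightarrow> real) (y::nat \<Rightarrow> int ^ 'd).
        t 0 = 0 \<and> (\<forall>i<m. t i \<le> t (Suc i)) \<longrightarrow>
        measure M {\<omega>\<in>space M. \<forall>i\<le>m. X (t i) \<omega> = y i} =
          indicator {x} (y 0) * (\<Prod>i<m. walk_kernel \<nu> (t (Suc i) - t i) (y i) (y (Suc i))))"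

text \<open>Independence of whole processes, i.e. of the associated random elements of path space.\<close>

definition indep_processes :: "'w measure \<Rightarrow> ('i \<Rightarrow> real \<Rightarrow> 'w \<Rightarrow> int ^ 'd) \<Rightarrow> 'i set \<Rightarrow> bool" where
  "indep_processes M Y I \<longleftrightarrow>
     prob_space.indep_vars M (\<lambda>_. \<Pi>\<^sub>M t\<in>{0..}. count_space UNIV)
       (\<lambda>k \<omega>. \<lambda>t\<in>{0..}. Y k t \<omega>) I"

definition catalyst ::
    "nat \<Rightarrow> (nat \<Rightarrow> real \<Rightarrow> 'w \<Rightarrow> int ^ 'd) \<Rightarrow> 'w \<Rightarrow> int ^ 'd \<Rightarrow> real \<Rightarrow> real" where
  "catalyst n Y \<omega> x t = (\<Sum>k=1..n. indicator {x} (Y k t \<omega>))"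

text \<open>The Feynman--Kac solution at time \<open>t\<close> in the potential \<open>\<xi>\<close>, evaluated at the starting point
  of the walk \<open>X\<close> on \<open>M\<close>.\<close>

definition feynman_kac ::
    "'v measure \<Rightarrow> (real \<Rightarrow> 'v \<Rightarrow> int ^ 'd) \<Rightarrow> (int ^ 'd \<Rightarrow> real \<Rightarrow> real) \<Rightarrow> real \<Rightarrow> real" where
  "feynman_kac M X \<xi> t = (\<integral>\<omega>. exp (LINT s:{0..t}|lborel. \<xi> (X s \<omega>) (t - s)) \<partial>M)"

text \<open>\<open>X \<kappa> x\<close> on \<open>MX \<kappa> x\<close> is meant to be a walk with step rate \<open>2 d \<kappa>\<close> started at \<open>x\<close>, and
  \<open>Y 1, \<dots>, Y n\<close> on \<open>MY\<close> independent walks with step rate \<open>2 d \<rho>\<close> started at \<open>0\<close>. The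
  parameter \<open>x\<close> is the site at which the solution is evaluated; if \<open>\<kappa> = \<rho> = 0\<close> nothing moves
  and, by convention, the solution is evaluated at \<open>0\<close>.\<close>

definition annealed_lyapunov ::
    "'v measure \<Rightarrow> (nat \<Rightarrow> real \<Rightarrow> 'v \<Rightarrow> int ^ 'd) \<Rightarrow>
     (real \<Rightarrow> int ^ 'd \<Rightarrow> 'w measure) \<Rightarrow> (real \<Rightarrow> int ^ 'd \<Rightarrow> real \<Rightarrow> 'w \<Rightarrow> int ^ 'd) \<Rightarrow>
     int ^ 'd \<Rightarrow> nat \<Rightarrow> nat \<Rightarrow> real \<Rightarrow> real \<Rightarrow> real" where
  "annealed_lyapunov MY Y MX X x n p \<kappa> \<rho> =
     (let z = (if \<kappa> = 0 \<and> \<rho> = 0 then 0 else x) in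
      Lim at_top (\<lambda>t. 1 / (real p * t) *
        ln (\<integral>\<omega>. feynman_kac (MX \<kappa> z) (X \<kappa> z) (catalyst n Y \<omega>) t ^ p \<partial>MY)))"

text \<open>Expected total time spent at \<open>x\<close>; for the Green function \<open>G\<^sub>d\<close> the walk \<open>X\<close> has step rate
  \<open>2 d\<close> and starts at \<open>0\<close>.\<close>

definition green_function :: "'w measure \<Rightarrow> (real \<Rightarrow> 'w \<Rightarrow> int ^ 'd) \<Rightarrow> int ^ 'd \<Rightarrow> ennreal" where
  "green_function M X x = (\<integral>\<^sup>+\<omega>. (\<integral>\<^sup>+t\<in>{0..}. indicator {x} (X t \<omega>) \<partial>lborel) \<partial>M)"

definition ell2 :: "('a \<Rightarrow> complex) set" where
  "ell2 = {f. (\<lambda>x. (cmod (f x))\<^sup>2) summable_on UNIV}"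

definition ell2_norm :: "('a \<Rightarrow> complex) \<Rightarrow> real" where
  "ell2_norm f = sqrt (\<Sum>\<^sub>\<infinity>x. (cmod (f x))\<^sup>2)"

text \<open>Complement of the resolvent set, which consists of those \<open>z\<close> for which \<open>A - z\<close> is a bijection
  of \<open>\<ell>\<^sup>2\<close> with bounded inverse.\<close>

definition ell2_spectrum :: "(('a \<Rightarrow> complex) \<Rightarrow> 'a \<Rightarrow> complex) \<Rightarrow> complex set" where
  "ell2_spectrum A = {z. \<not> (bij_betw (\<lambda>f x. A f x - z * f x) ell2 ell2 \<and>
     (\<exists>C. \<forall>f\<in>ell2. ell2_norm f \<le> C * ell2_norm (\<lambda>x. A f x - z * f x)))}"

definition pinned_laplacian ::
    "real \<Rightarrow> (int ^ 'd \<Rightarrow> complex) \<Rightarrow> int ^ 'd \<Rightarrow> complex" where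
  "pinned_laplacian \<kappa> f x = complex_of_real \<kappa> * laplacian f x + indicator {0} x * f x"

text \<open>The operator is self-adjoint, so its spectrum is a set of real numbers. The type argument
  carries the dimension.\<close>

definition sup_spectrum :: "'d::finite itself \<Rightarrow> real \<Rightarrow> real" where
  "sup_spectrum _ \<kappa> =
     Sup {r. complex_of_real r \<in> ell2_spectrum
       (pinned_laplacian \<kappa> :: (int ^ 'd \<Rightarrow> complex) \<Rightarrow> int ^ 'd \<Rightarrow> complex)}"

end

theory Submission imports Defs begin

text \<open>Expanding the power \<open>u\<^sup>p\<close> into \<open>p\<close> independent replicas of \<open>X\<close> turns the moment into a
  Feynman--Kac expectation for \<open>n + p\<close> independent walks, whose potential counts the pairs of a
  replica and a catalyst that meet. After time discretisation it is bounded above and below by powers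
  of a symmetric operator; hence its growth rate is the supremum of the quadratic form
  \<open>V - \<kappa> \<Sum>\<^sub>j D\<^sub>j - \<rho> \<Sum>\<^sub>k D\<^sub>k\<close> over normalised finitely supported functions, \<open>D\<^sub>i\<close> being the
  Dirichlet form in the \<open>i\<close>-th coordinate. Distributing \<open>\<rho> D\<^sub>k\<close> evenly over the \<open>p\<close> replicas bounds
  the form by \<open>n p\<close> one-particle forms of \<open>(\<rho>/p) \<Delta> + \<delta>\<^sub>0\<close>, and product functions show that this is
  sharp at \<open>\<kappa> = 0\<close>. Distributing \<open>\<kappa> D\<^sub>j\<close> over the \<open>n\<close> catalysts instead, the inequality
  \<open>f(0)\<^sup>2 \<le> G\<^sub>d(0) D(f)\<close> gives the vanishing for large \<open>\<kappa>\<close> in the transient case. In the recurrent case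
  functions with \<open>f(0) = 1\<close> and small Dirichlet form make the supremum positive; as the form of a
  fixed function is affine in \<open>\<kappa>\<close> and the supremum tends to \<open>0\<close>, it is strictly decreasing.\<close>

section \<open>The lattice\<close>

text \<open>The obstacle is that the moment is not of the form <f, exp (t H) f>. At catalyst time 0
  the catalysts are at the origin and the replicas are free; at the final time the replicas are at
  the given site and the catalysts are free. Neither boundary function is square summable. From
  above, an exponential weight tames both ends, and a supersolution built as a resolvent series
  controls the time steps pointwise instead of in norm. From below, the potential is switched off
  during the first and the last unit of time: this costs a bounded factor, and the positive kernel
  of unit time turns the boundary data into multiples of any profile of finite support. All
  quadratic form arguments take place on finitely supported real functions. Norm bounds come from
  positivity and polarisation, lower bounds on powers from repeated squaring. Walkers of rate 0 have
  no spreading kernel; test functions are therefore confined to the configurations that can be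
  reached, and this is what singles out \<kappa> = 0 and \<rho> = 0 in the arguments.\<close>

definition steps :: "(int ^ 'd) set" where "steps = neighbours 0"

abbreviation deg :: "'d::finite itself \<Rightarrow> real" where
  "deg _ \<equiv> real (card (steps :: (int ^ 'd) set))"

lemma neighbours_eq: "neighbours x = (\<lambda>v. x + v) ` steps"
proof -
  have "y \<in> (\<lambda>v. x + v) ` steps" if "y \<in> neighbours x" for y
    by (rule image_eqI[of _ _ "y - x"]) (use that in \<open>auto simp: steps_def neighbours_def\<close>)
  then show ?thesis by (auto simp: steps_def neighbours_def)
qed

lemma steps_uminus: "v \<in> steps \<Longrightarrow> - v \<in> steps"
  by (simp add: steps_def neighbours_def)

lemma axis_in_steps: "axis i 1 \<in> steps" "axis i (-1) \<in> steps"
proof -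
  have "\<bar>axis i a $ j\<bar> = (if j = i then \<bar>a\<bar> else 0)" for a :: int and j
    by (auto simp: axis_def)
  then show "axis i 1 \<in> steps" "axis i (-1) \<in> steps"
    by (simp_all add: steps_def neighbours_def)
qed

lemma finite_lattice_box: "finite {z :: int ^ 'd. \<forall>i. \<bar>z $ i\<bar> \<le> r}"
proof -
  have "finite (PiE (UNIV :: 'd set) (\<lambda>_. {-r..r}))"
    by (intro finite_PiE) auto
  moreover have "{z :: int ^ 'd. \<forall>i. \<bar>z $ i\<bar> \<le> r} \<subseteq> vec_lambda ` PiE UNIV (\<lambda>_. {-r..r})"
  proof
    fix z :: "int ^ 'd" assume z: "z \<in> {z. \<forall>i. \<bar>z $ i\<bar> \<le> r}"
    show "z \<in> vec_lambda ` PiE UNIV (\<lambda>_. {-r..r})"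
      by (rule image_eqI[of _ _ "vec_nth z"]) (use z in \<open>auto simp: PiE_def abs_le_iff minus_le_iff\<close>)
  qed
  ultimately show ?thesis by (rule finite_surj)
qed

lemma step_component_le: "v \<in> steps \<Longrightarrow> \<bar>v $ i\<bar> \<le> 1"
  using member_le_sum[of i UNIV "\<lambda>i. \<bar>v $ i\<bar>"] by (simp add: steps_def neighbours_def)

lemma finite_steps: "finite (steps :: (int ^ 'd) set)"
  by (rule finite_subset[OF _ finite_lattice_box[of 1]]) (auto simp: step_component_le)

lemma deg_pos: "deg TYPE('d::finite) > 0"
  using finite_steps axis_in_steps(1) by (auto simp: card_gt_0_iff)

section \<open>Path counts and the transition kernel\<close>

definition adj :: "(int ^ 'd \<Rightarrow> 'a::comm_monoid_add) \<Rightarrow> int ^ 'd \<Rightarrow> 'a" where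
  "adj g x = (\<Sum>v\<in>steps. g (x + v))"

lemma laplacian_eq: "laplacian g x = adj g x - deg TYPE('d) * g x" for g :: "int ^ 'd \<Rightarrow> real"
proof -
  have "laplacian g x = (\<Sum>v\<in>steps. g (x + v) - g x)"
    unfolding laplacian_def neighbours_eq by (subst sum.reindex) (auto simp: inj_on_def)
  then show ?thesis by (simp add: sum_subtractf adj_def)
qed

text \<open>The number of nearest-neighbour paths of length \<open>k\<close> from \<open>x\<close>
  to \<open>y\<close>, written as a matrix entry of a power of the adjacency operator.\<close>

definition walk_count :: "nat \<Rightarrow> int ^ 'd \<Rightarrow> int ^ 'd \<Rightarrow> real" where
  "walk_count k x y = (adj ^^ k) (indicator {y}) x"

lemma walk_count_0: "walk_count 0 x y = indicator {y} x"
  by (simp add: walk_count_def)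

lemma walk_count_Suc: "walk_count (Suc k) x y = (\<Sum>v\<in>steps. walk_count k (x + v) y)"
  by (simp add: walk_count_def adj_def)

lemma walk_count_nonneg: "walk_count k x y \<ge> 0"
  by (induction k arbitrary: x) (auto simp: walk_count_0 walk_count_Suc intro: sum_nonneg)

lemma walk_count_le: "walk_count k (x :: int ^ 'd) y \<le> deg TYPE('d) ^ k"
proof (induction k arbitrary: x)
  case (Suc k)
  have "walk_count (Suc k) x y \<le> (\<Sum>v\<in>(steps :: (int ^ 'd) set). deg TYPE('d) ^ k)"
    unfolding walk_count_Suc by (intro sum_mono Suc)
  then show ?case by simp
qed (simp add: walk_count_0 indicator_def)

text \<open>Splits off the last step instead of the first; \<open>steps\<close> is closed under
  negation, so \<open>y + v\<close> may stand for \<open>y - v\<close>. The two recursions together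
  give the symmetry of the path counts.\<close>

lemma walk_count_Suc': "walk_count (Suc k) x y = (\<Sum>v\<in>steps. walk_count k x (y + v))"
proof (induction k arbitrary: x)
  case 0
  have "(\<Sum>v\<in>steps. indicator {y} (x + v)) = (\<Sum>v\<in>steps. indicator {y + v} x :: real)"
    by (rule sum.reindex_bij_witness[of _ uminus uminus])
      (auto simp: steps_uminus indicator_def)
  then show ?case by (simp add: walk_count_Suc walk_count_0)
next
  case (Suc k)
  have "walk_count (Suc (Suc k)) x y = (\<Sum>v\<in>steps. \<Sum>w\<in>steps. walk_count k (x + v) (y + w))"
    by (subst walk_count_Suc) (simp add: Suc)
  also have "\<dots> = (\<Sum>w\<in>steps. walk_count (Suc k) x (y + w))"
    by (subst sum.swap) (simp add: walk_count_Suc)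
  finally show ?case .
qed

lemma walk_count_sym: "walk_count k x y = walk_count k y x"
proof (induction k arbitrary: x y)
  case (Suc k)
  show ?case by (subst walk_count_Suc, subst walk_count_Suc') (simp add: Suc)
qed (simp add: walk_count_0 indicator_def)

text \<open>\<open>laplacian\<close> is \<open>adj\<close> minus a scalar and the two parts commute,
  so the binomial theorem applies.\<close>

lemma laplacian_power:
  fixes x y :: "int ^ 'd"
  shows "((\<lambda>g y. \<nu> * laplacian g y) ^^ k) (indicator {y}) x =
    \<nu> ^ k * (\<Sum>j\<le>k. real (k choose j) * walk_count j x y * (- deg TYPE('d)) ^ (k - j))"
proof (induction k arbitrary: x)
  case (Suc k)
  define D where "D = deg TYPE('d)"
  define a where "a j = walk_count j x y" for j
  let ?S = "\<lambda>x. \<nu> ^ k * (\<Sum>j\<le>k. real (k choose j) * walk_count j x y * (- D) ^ (k - j))"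
  have "((\<lambda>g y. \<nu> * laplacian g y) ^^ Suc k) (indicator {y}) x = \<nu> * laplacian ?S x"
  proof -
    have "((\<lambda>g y. \<nu> * laplacian g y) ^^ k) (indicator {y}) = ?S"
      unfolding D_def by (rule ext) (rule Suc)
    then show ?thesis by simp
  qed
  also have "laplacian ?S x = \<nu> ^ k * ((\<Sum>j\<le>k. real (k choose j) * a (Suc j) * (- D) ^ (k - j))
      + (\<Sum>j\<le>k. real (k choose j) * a j * (- D) ^ (Suc k - j)))"
  proof -
    have "adj ?S x = \<nu> ^ k * (\<Sum>j\<le>k. real (k choose j) * a (Suc j) * (- D) ^ (k - j))"
      unfolding adj_def a_def walk_count_Suc
      by (simp add: sum_distrib_left sum_distrib_right sum.swap[of _ _ steps])
    moreover have "D * ?S x = - (\<nu> ^ k * (\<Sum>j\<le>k. real (k choose j) * a j * (- D) ^ (Suc k - j)))"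
      unfolding a_def by (simp add: sum_distrib_left Suc_diff_le sum_negf mult_ac)
    ultimately show ?thesis
      unfolding laplacian_eq D_def[symmetric] by (simp add: algebra_simps)
  qed
  also have "(\<Sum>j\<le>k. real (k choose j) * a (Suc j) * (- D) ^ (k - j))
      + (\<Sum>j\<le>k. real (k choose j) * a j * (- D) ^ (Suc k - j))
      = (\<Sum>j\<le>Suc k. real (Suc k choose j) * a j * (- D) ^ (Suc k - j))"
  proof -
    \<comment> \<open>The extra term j = Suc k vanishes with its binomial coefficient; after the
      index shift Pascal's rule merges the two sums.\<close>
    have "(\<Sum>j\<le>k. real (k choose j) * a j * (- D) ^ (Suc k - j)) =
        (\<Sum>j\<le>Suc k. real (k choose j) * a j * (- D) ^ (Suc k - j))" by simp
    also have "\<dots> = a 0 * (-D) ^ Suc k + (\<Sum>j\<le>k. real (k choose Suc j) * a (Suc j) * (- D) ^ (k - j))"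
      by (subst sum.atMost_Suc_shift) simp
    finally have e: "(\<Sum>j\<le>k. real (k choose j) * a j * (- D) ^ (Suc k - j)) =
        a 0 * (-D) ^ Suc k + (\<Sum>j\<le>k. real (k choose Suc j) * a (Suc j) * (- D) ^ (k - j))" .
    show ?thesis
      unfolding e by (subst sum.atMost_Suc_shift) (simp add: sum.distrib distrib_right)
  qed
  finally show ?case by (simp add: a_def D_def)
qed (simp add: walk_count_0)

lemma summable_exp_bound:
  assumes "\<And>k. \<bar>a k\<bar> \<le> C ^ k"
  shows "summable (\<lambda>k. norm (b ^ k / fact k * a k :: real))"
proof (rule summable_comparison_test')
  show "summable (\<lambda>k. (\<bar>b\<bar> * C) ^ k / fact k)"
    using summable_exp[of "\<bar>b\<bar> * C"] by (simp add: divide_inverse mult.commute)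
  show "norm (norm (b ^ k / fact k * a k)) \<le> (\<bar>b\<bar> * C) ^ k / fact k" if "k \<ge> 0" for k
    using assms[of k]
    by (simp add: abs_mult power_abs power_mult_distrib divide_right_mono mult_left_mono)
qed

text \<open>For \<nu>, h \<ge> 0 the number of jumps up to time \<open>h\<close> is Poisson with
  mean deg \<nu> h, and all paths of a given length are equally likely. The proof splits the
  exponential of the two commuting parts by the Cauchy product. In this form positivity and symmetry
  of the kernel are visible.\<close>

lemma walk_kernel_sums:
  fixes x y :: "int ^ 'd"
  shows "(\<lambda>k. exp (- deg TYPE('d) * \<nu> * h) * ((\<nu> * h) ^ k / fact k * walk_count k x y))
    sums walk_kernel \<nu> h x y"
proof -
  define D where "D = deg TYPE('d)"
  define a where "a k = (\<nu> * h) ^ k / fact k * walk_count k x y" for k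
  define b where "b k = (\<nu> * h) ^ k / fact k * (- D) ^ k" for k
  have a: "summable (\<lambda>k. norm (a k))" unfolding a_def
    by (rule summable_exp_bound[of _ "deg TYPE('d)"]) (simp add: walk_count_nonneg walk_count_le)
  have b: "summable (\<lambda>k. norm (b k))" unfolding b_def
    by (rule summable_exp_bound[of _ D]) (simp add: power_abs D_def)
  have sb: "(\<Sum>k. b k) = exp (- D * \<nu> * h)"
  proof -
    have "b k = (- D * \<nu> * h) ^ k /\<^sub>R fact k" for k
      by (simp add: b_def divide_inverse power_mult_distrib[symmetric] mult_ac)
    then show ?thesis by (simp add: exp_def)
  qed
  have "walk_kernel \<nu> h x y = (\<Sum>k. \<Sum>j\<le>k. a j * b (k - j))"
    unfolding walk_kernel_def walk_semigroup_def laplacian_power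
  proof (rule suminf_cong)
    fix k
    have "h ^ k / fact k * (\<nu> ^ k * (real (k choose j) * walk_count j x y * (- deg TYPE('d)) ^ (k - j))) =
        a j * b (k - j)" if "j \<le> k" for j
    proof -
      have "h ^ k * \<nu> ^ k = (\<nu> * h) ^ j * (\<nu> * h) ^ (k - j)"
        using that by (simp flip: power_add power_mult_distrib add: mult.commute)
      then show ?thesis
        unfolding a_def b_def D_def binomial_fact[OF that] by (simp add: field_simps)
    qed
    then show "h ^ k / fact k * (\<nu> ^ k * (\<Sum>j\<le>k. real (k choose j) * walk_count j x y * (- deg TYPE('d)) ^ (k - j)))
        = (\<Sum>j\<le>k. a j * b (k - j))"
      by (simp add: sum_distrib_left)
  qed
  also have "\<dots> = exp (- D * \<nu> * h) * (\<Sum>k. a k)"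
    using Cauchy_product[OF a b] sb by (simp add: mult.commute)
  finally show ?thesis
    using summable_sums[OF summable_norm_cancel[OF a], THEN sums_mult, of "exp (- D * \<nu> * h)"]
    by (simp add: a_def D_def)
qed

lemma walk_kernel_nonneg:
  assumes "\<nu> \<ge> 0" "h \<ge> 0"
  shows "walk_kernel \<nu> h x y \<ge> 0"
  by (rule sums_le[OF _ sums_zero walk_kernel_sums]) (use assms in \<open>auto simp: walk_count_nonneg\<close>)

lemma walk_kernel_sym: "walk_kernel \<nu> h x y = walk_kernel \<nu> h y x"
  using walk_kernel_sums[of \<nu> h x y] walk_kernel_sums[of \<nu> h y x]
  by (simp add: walk_count_sym[of _ y x] sums_iff)

lemma walk_kernel_rate_0: "walk_kernel 0 h x y = indicator {y} x"
proof -
  \<comment> \<open>The convention 0 ^ 0 = 1 leaves exactly the term k = 0.\<close>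
  have "(\<lambda>k. 0 ^ k / fact k * walk_count k x y) = (\<lambda>k. if k = 0 then indicator {y} x else 0)"
    by (auto simp: walk_count_0 fun_eq_iff)
  then show ?thesis
    using walk_kernel_sums[of 0 h x y] sums_unique2[OF _ sums_single[of 0 "\<lambda>_. indicator {y} x :: real"]]
    by simp
qed

lemma walk_kernel_ge:
  fixes x y :: "int ^ 'd"
  assumes "\<nu> \<ge> 0" "h \<ge> 0" "finite A"
  shows "(\<Sum>k\<in>A. exp (- deg TYPE('d) * \<nu> * h) * ((\<nu> * h) ^ k / fact k * walk_count k x y)) \<le> walk_kernel \<nu> h x y"
  using walk_kernel_sums[of \<nu> h x y]
  by (metis (no_types, lifting) assms sum_le_suminf sums_iff exp_ge_zero mult_nonneg_nonneg
      divide_nonneg_pos fact_gt_zero walk_count_nonneg zero_le_power)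

text \<open>Concatenation: the left side counts the paths that are at \<open>y\<close> after
  \<open>j\<close> steps.\<close>

lemma walk_count_add_ge: "walk_count j x y * walk_count k y z \<le> walk_count (j + k) x z"
proof (induction j arbitrary: x)
  case 0
  then show ?case by (simp add: walk_count_0 indicator_def walk_count_nonneg)
next
  case (Suc j)
  show ?case by (simp add: walk_count_Suc sum_distrib_right sum_mono Suc)
qed

lemma walk_count_pos: "\<exists>k. walk_count k x y > 0"
proof (induction "nat (\<Sum>i\<in>UNIV. \<bar>y $ i - x $ i\<bar>)" arbitrary: x rule: less_induct)
  case less
  show ?case
  proof (cases "x = y")
    case True
    then show ?thesis by (intro exI[of _ 0]) (simp add: walk_count_0)
  next
    case False
    then obtain i where i: "x $ i \<noteq> y $ i" by (auto simp: vec_eq_iff)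
    \<comment> \<open>A unit step towards \<open>y\<close> in a coordinate where the points differ;
      it lowers the l1 distance by one.\<close>
    define v where "v = axis i (sgn (y $ i - x $ i))"
    have v: "v \<in> steps"
      using i axis_in_steps[of i] by (auto simp: v_def sgn_if)
    have "\<bar>y $ j - (x + v) $ j\<bar> = \<bar>y $ j - x $ j\<bar> - (if j = i then 1 else 0)" for j
      using i by (auto simp: v_def axis_def sgn_if)
    then have e: "(\<Sum>j\<in>UNIV. \<bar>y $ j - (x + v) $ j\<bar>) = (\<Sum>j\<in>UNIV. \<bar>y $ j - x $ j\<bar>) - 1"
      by (simp add: sum_subtractf)
    have "(\<Sum>j\<in>UNIV. \<bar>y $ j - (x + v) $ j\<bar>) \<ge> 0" by (intro sum_nonneg) auto
    with e have "nat (\<Sum>j\<in>UNIV. \<bar>y $ j - (x + v) $ j\<bar>) < nat (\<Sum>j\<in>UNIV. \<bar>y $ j - x $ j\<bar>)"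
      by linarith
    then obtain k where "walk_count k (x + v) y > 0" using less by blast
    then have "walk_count (Suc k) x y > 0"
      unfolding walk_count_Suc using v finite_steps
      by (intro sum_pos2[of _ v]) (auto simp: walk_count_nonneg)
    then show ?thesis by blast
  qed
qed

lemma walk_kernel_pos:
  fixes x y :: "int ^ 'd"
  assumes "\<nu> > 0" "h > 0"
  shows "walk_kernel \<nu> h x y > 0"
proof -
  obtain k where "walk_count k x y > 0" using walk_count_pos by blast
  then have "0 < exp (- deg TYPE('d) * \<nu> * h) * ((\<nu> * h) ^ k / fact k * walk_count k x y)"
    using assms by simp
  also have "\<dots> \<le> walk_kernel \<nu> h x y"
    using walk_kernel_ge[of \<nu> h "{k}" x y] assms by simp
  finally show ?thesis .
qed

text \<open>With values in \<open>ennreal\<close> all rearrangements are free, so the expansion also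
  serves functions that may be infinite a priori, such as the supersolution of the upper
  bound.\<close>

lemma walk_kernel_nn_integral:
  fixes x :: "int ^ 'd" and g :: "int ^ 'd \<Rightarrow> ennreal"
  assumes "\<nu> \<ge> 0" "h \<ge> 0"
  shows "(\<integral>\<^sup>+y. ennreal (walk_kernel \<nu> h x y) * g y \<partial>count_space UNIV) =
    (\<Sum>k. ennreal (exp (- deg TYPE('d) * \<nu> * h) * ((\<nu> * h) ^ k / fact k)) * (adj ^^ k) g x)"
proof -
  have adj: "(\<integral>\<^sup>+y. ennreal (walk_count k x y) * g y \<partial>count_space UNIV) = (adj ^^ k) g x" for k
  proof (induction k arbitrary: x)
    case 0
    have "(\<integral>\<^sup>+y. ennreal (walk_count 0 x y) * g y \<partial>count_space UNIV) =
        (\<integral>\<^sup>+y. g y * indicator {x} y \<partial>count_space UNIV)"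
      by (intro nn_integral_cong) (auto simp: walk_count_0 indicator_def)
    then show ?case by simp
  next
    case (Suc k)
    have "(\<integral>\<^sup>+y. ennreal (walk_count (Suc k) x y) * g y \<partial>count_space UNIV) =
        (\<integral>\<^sup>+y. (\<Sum>v\<in>steps. ennreal (walk_count k (x + v) y) * g y) \<partial>count_space UNIV)"
      unfolding walk_count_Suc
      by (intro nn_integral_cong) (simp add: sum_distrib_right[symmetric] sum_ennreal walk_count_nonneg)
    also have "\<dots> = (\<Sum>v\<in>steps. (adj ^^ k) g (x + v))"
      by (subst nn_integral_sum) (auto simp: Suc)
    finally show ?case by (simp add: adj_def[of "(adj ^^ k) g"])
  qed
  have "ennreal (walk_kernel \<nu> h x y) = (\<Sum>k. ennreal (exp (- deg TYPE('d) * \<nu> * h) * ((\<nu> * h) ^ k / fact k)) * ennreal (walk_count k x y))" for y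
  proof -
    have "(\<Sum>k. ennreal (exp (- deg TYPE('d) * \<nu> * h) * ((\<nu> * h) ^ k / fact k * walk_count k x y))) = ennreal (walk_kernel \<nu> h x y)"
      using walk_kernel_sums[of \<nu> h x y] assms
      by (subst suminf_ennreal2) (auto simp: walk_count_nonneg sums_iff)
    moreover have "ennreal (exp (- deg TYPE('d) * \<nu> * h) * ((\<nu> * h) ^ k / fact k * walk_count k x y)) =
        ennreal (exp (- deg TYPE('d) * \<nu> * h) * ((\<nu> * h) ^ k / fact k)) * ennreal (walk_count k x y)" for k
      using assms by (subst ennreal_mult[symmetric]) (auto simp: walk_count_nonneg mult_ac)
    ultimately show ?thesis by simp
  qed
  then have "(\<integral>\<^sup>+y. ennreal (walk_kernel \<nu> h x y) * g y \<partial>count_space UNIV) =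
    (\<integral>\<^sup>+y. (\<Sum>k. ennreal (exp (- deg TYPE('d) * \<nu> * h) * ((\<nu> * h) ^ k / fact k)) *
      (ennreal (walk_count k x y) * g y)) \<partial>count_space UNIV)"
    by (simp only: ennreal_suminf_multc[symmetric] mult.assoc)
  also have "\<dots> = (\<Sum>k. ennreal (exp (- deg TYPE('d) * \<nu> * h) * ((\<nu> * h) ^ k / fact k)) * (adj ^^ k) g x)"
    by (subst nn_integral_suminf) (auto simp: nn_integral_cmult adj)
  finally show ?thesis .
qed

section \<open>Several walkers\<close>

definition adj_at :: "nat \<Rightarrow> ((nat \<Rightarrow> int ^ 'd) \<Rightarrow> 'a::comm_monoid_add) \<Rightarrow> (nat \<Rightarrow> int ^ 'd) \<Rightarrow> 'a" where
  "adj_at i g s = (\<Sum>v\<in>steps. g (s(i := s i + v)))"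

definition walk_op ::
    "(nat \<Rightarrow> real) \<Rightarrow> real \<Rightarrow> nat \<Rightarrow> ((nat \<Rightarrow> int ^ 'd) \<Rightarrow> ennreal) \<Rightarrow> (nat \<Rightarrow> int ^ 'd) \<Rightarrow> ennreal" where
  "walk_op \<nu> h i g s = (\<integral>\<^sup>+z. ennreal (walk_kernel (\<nu> i) h (s i) z) * g (s(i := z)) \<partial>count_space UNIV)"

text \<open>Semigroups of different coordinates commute; the list fixes an order in which estimates
  can proceed by induction.\<close>

definition walk_ops ::
    "(nat \<Rightarrow> real) \<Rightarrow> real \<Rightarrow> nat list \<Rightarrow> ((nat \<Rightarrow> int ^ 'd) \<Rightarrow> ennreal) \<Rightarrow> (nat \<Rightarrow> int ^ 'd) \<Rightarrow> ennreal" where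
  "walk_ops \<nu> h is g = foldr (walk_op \<nu> h) is g"

lemma walk_ops_Nil [simp]: "walk_ops \<nu> h [] g = g"
  and walk_ops_Cons: "walk_ops \<nu> h (i # is) g = walk_op \<nu> h i (walk_ops \<nu> h is g)"
  by (simp_all add: walk_ops_def)

lemma adj_at_power: "(adj ^^ k) (\<lambda>z. g (s(i := z))) x = (adj_at i ^^ k) g (s(i := x))"
  by (induction k arbitrary: x) (simp_all add: adj_def[of "(adj ^^ _) _"] adj_at_def[of _ "(adj_at _ ^^ _) _"])

lemma walk_op_series:
  fixes g :: "(nat \<Rightarrow> int ^ 'd) \<Rightarrow> ennreal"
  assumes "\<nu> i \<ge> 0" "h \<ge> 0"
  shows "walk_op \<nu> h i g s =
    (\<Sum>k. ennreal (exp (- deg TYPE('d) * \<nu> i * h) * ((\<nu> i * h) ^ k / fact k)) * (adj_at i ^^ k) g s)"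
  unfolding walk_op_def by (subst walk_kernel_nn_integral) (simp_all add: assms adj_at_power)

lemma walk_op_mono: "(\<And>s. f s \<le> g s) \<Longrightarrow> walk_op \<nu> h i f s \<le> walk_op \<nu> h i g s"
  unfolding walk_op_def by (intro nn_integral_mono mult_left_mono) auto

lemma walk_ops_mono: "(\<And>s. f s \<le> g s) \<Longrightarrow> walk_ops \<nu> h is f s \<le> walk_ops \<nu> h is g s"
  by (induction "is" arbitrary: s) (auto simp: walk_ops_Cons intro!: walk_op_mono)

lemma walk_op_add: "walk_op \<nu> h i (\<lambda>s. f s + g s) s = walk_op \<nu> h i f s + walk_op \<nu> h i g s"
  unfolding walk_op_def by (simp add: distrib_left nn_integral_add)

lemma walk_op_cmult: "walk_op \<nu> h i (\<lambda>s. c * f s) s = c * walk_op \<nu> h i f s"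
  unfolding walk_op_def by (simp add: mult.left_commute nn_integral_cmult)

lemma walk_ops_cmult: "walk_ops \<nu> h is (\<lambda>s. c * f s) s = c * walk_ops \<nu> h is f s"
proof (induction "is" arbitrary: s)
  case (Cons i "is")
  have "walk_ops \<nu> h is (\<lambda>s. c * f s) = (\<lambda>s. c * walk_ops \<nu> h is f s)"
    by (rule ext) (rule Cons)
  then show ?case by (simp add: walk_ops_Cons walk_op_cmult)
qed simp

lemma walk_op_sum_list:
  "walk_op \<nu> h i (\<lambda>s. \<Sum>j\<leftarrow>js. f j s) s = (\<Sum>j\<leftarrow>js. walk_op \<nu> h i (f j) s)"
  by (induction js) (simp_all add: walk_op_add walk_op_cmult[of _ _ _ 0, simplified])

lemma adj_at_mono:
  fixes f g :: "(nat \<Rightarrow> int ^ 'd) \<Rightarrow> 'a::ordered_comm_monoid_add"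
  shows "(\<And>s. f s \<le> g s) \<Longrightarrow> adj_at i f s \<le> adj_at i g s"
  unfolding adj_at_def by (intro sum_mono)

lemma adj_at_add: "adj_at i (\<lambda>s. f s + g s) s = adj_at i f s + adj_at i g s"
  by (simp add: adj_at_def sum.distrib)

lemma adj_at_cmult:
  fixes f :: "(nat \<Rightarrow> int ^ 'd) \<Rightarrow> 'a::comm_semiring_0"
  shows "adj_at i (\<lambda>s. c * f s) s = c * adj_at i f s"
  by (simp add: adj_at_def sum_distrib_left)

text \<open>Only zero or one jump is kept; the prefactor is the probability of no jump.\<close>

lemma walk_op_ge:
  fixes g :: "(nat \<Rightarrow> int ^ 'd) \<Rightarrow> ennreal"
  assumes "\<nu> i \<ge> 0" "h \<ge> 0"
  shows "ennreal (exp (- deg TYPE('d) * \<nu> i * h)) * (g s + ennreal h * (ennreal (\<nu> i) * adj_at i g s))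
    \<le> walk_op \<nu> h i g s"
proof -
  let ?f = "\<lambda>k. ennreal (exp (- deg TYPE('d) * \<nu> i * h) * ((\<nu> i * h) ^ k / fact k)) * (adj_at i ^^ k) g s"
  have "sum ?f {..<2} \<le> (\<Sum>k. ?f k)"
    by (intro sum_le_suminf) auto
  moreover have "sum ?f {..<2} =
    ennreal (exp (- deg TYPE('d) * \<nu> i * h)) * (g s + ennreal h * (ennreal (\<nu> i) * adj_at i g s))"
    using assms by (simp add: numeral_2_eq_2 ennreal_mult distrib_left mult_ac)
  ultimately show ?thesis
    using assms by (simp add: walk_op_series)
qed

text \<open>Products of several hops are nonnegative and are dropped, so the composition dominates
  the sum of the single hops. The prefactor is the probability that nobody moves.\<close>

lemma walk_ops_ge:
  fixes g :: "(nat \<Rightarrow> int ^ 'd) \<Rightarrow> ennreal"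
  assumes "\<And>i. i \<in> set is \<Longrightarrow> \<nu> i \<ge> 0" "h \<ge> 0"
  shows "ennreal (exp (- deg TYPE('d) * (\<Sum>i\<leftarrow>is. \<nu> i) * h)) *
      (g s + ennreal h * (\<Sum>i\<leftarrow>is. ennreal (\<nu> i) * adj_at i g s)) \<le> walk_ops \<nu> h is g s"
  using assms(1)
proof (induction "is" arbitrary: s)
  case (Cons i "is")
  define D where "D = deg TYPE('d)"
  let ?e = "exp (- D * \<nu> i * h)" and ?e' = "exp (- D * (\<Sum>i\<leftarrow>is. \<nu> i) * h)"
  let ?S = "\<lambda>s. \<Sum>i\<leftarrow>is. ennreal (\<nu> i) * adj_at i g s"
  let ?G = "walk_ops \<nu> h is g"
  have IH: "ennreal ?e' * (g s + ennreal h * ?S s) \<le> ?G s" for s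
    using Cons by (simp add: D_def)
  \<comment> \<open>The hopping term already carries a factor h, so the zeroth-order bound on
    \<open>?G\<close> suffices there.\<close>
  have "ennreal ?e' * g s \<le> ?G s" for s
    by (rule order_trans[OF _ IH]) (auto intro!: mult_left_mono)
  then have A: "ennreal ?e' * adj_at i g s \<le> adj_at i ?G s"
    unfolding adj_at_cmult[symmetric] by (intro adj_at_mono)
  have "ennreal (exp (- D * (\<Sum>i\<leftarrow>i # is. \<nu> i) * h)) = ennreal ?e * ennreal ?e'"
    by (simp add: ennreal_mult[symmetric] exp_add[symmetric] algebra_simps)
  then have "ennreal (exp (- D * (\<Sum>i\<leftarrow>i # is. \<nu> i) * h)) *
      (g s + ennreal h * (\<Sum>i\<leftarrow>i # is. ennreal (\<nu> i) * adj_at i g s)) =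
    ennreal ?e * (ennreal ?e' * (g s + ennreal h * ?S s) + ennreal h * (ennreal (\<nu> i) * (ennreal ?e' * adj_at i g s)))"
    by (simp add: distrib_left mult_ac add_ac)
  also have "\<dots> \<le> ennreal ?e * (?G s + ennreal h * (ennreal (\<nu> i) * adj_at i ?G s))"
    by (intro mult_left_mono add_mono IH A) auto
  also have "\<dots> \<le> walk_ops \<nu> h (i # is) g s"
    unfolding walk_ops_Cons D_def using Cons.prems assms(2) by (intro walk_op_ge) auto
  finally show ?case by (simp add: D_def)
qed simp

text \<open>One summand of the multiple sum: every listed walker goes from \<open>s i\<close> to the
  prescribed \<open>z i\<close>.\<close>

lemma walk_ops_ge_kernel:
  assumes "distinct is"
  shows "(\<Prod>i\<in>set is. ennreal (walk_kernel (\<nu> i) h (s i) (z i))) * g (\<lambda>i. if i \<in> set is then z i else s i)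
    \<le> walk_ops \<nu> h is g s"
  using assms
proof (induction "is" arbitrary: s)
  case (Cons i "is")
  let ?s = "s(i := z i)"
  have "(\<Prod>j\<in>set (i # is). ennreal (walk_kernel (\<nu> j) h (s j) (z j))) * g (\<lambda>j. if j \<in> set (i # is) then z j else s j) =
    ennreal (walk_kernel (\<nu> i) h (s i) (z i)) *
    ((\<Prod>j\<in>set is. ennreal (walk_kernel (\<nu> j) h (?s j) (z j))) * g (\<lambda>j. if j \<in> set is then z j else ?s j))"
  proof -
    have "(\<lambda>j. if j \<in> set (i # is) then z j else s j) = (\<lambda>j. if j \<in> set is then z j else ?s j)" by auto
    moreover have "(\<Prod>j\<in>set is. ennreal (walk_kernel (\<nu> j) h (?s j) (z j))) = (\<Prod>j\<in>set is. ennreal (walk_kernel (\<nu> j) h (s j) (z j)))"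
      using Cons.prems by (intro prod.cong) auto
    ultimately show ?thesis using Cons.prems by (simp add: mult_ac)
  qed
  also have "\<dots> \<le> ennreal (walk_kernel (\<nu> i) h (s i) (z i)) * walk_ops \<nu> h is g ?s"
    by (intro mult_left_mono Cons.IH) (use Cons.prems in simp_all)
  also have "\<dots> = (\<integral>\<^sup>+y. ennreal (walk_kernel (\<nu> i) h (s i) y) * walk_ops \<nu> h is g (s(i := y)) * indicator {z i} y \<partial>count_space UNIV)"
    by simp
  also have "\<dots> \<le> walk_ops \<nu> h (i # is) g s"
    unfolding walk_ops_Cons walk_op_def by (intro nn_integral_mono) (auto split: split_indicator)
  finally show ?case .
qed simp

lemma suminf_ennreal_single: "(\<Sum>k. if k = m then f k else 0) = (f m :: ennreal)"
  by (rule sums_unique[symmetric, OF sums_single])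

lemma suminf_exp_ennreal:
  assumes "c \<ge> 0" "b \<ge> 0"
  shows "(\<Sum>k. ennreal (c * (b ^ k / fact k)) * r) \<le> ennreal (c * exp b) * r"
proof -
  have s: "(\<lambda>k. c * (b ^ k / fact k)) sums (c * exp b)"
    using exp_converges[of b] by (intro sums_mult) (simp add: divide_inverse mult.commute)
  have "(\<Sum>k. ennreal (c * (b ^ k / fact k))) = ennreal (c * exp b)"
    using s assms by (subst suminf_ennreal2) (auto simp: sums_iff)
  then show ?thesis by (simp add: ennreal_suminf_multc)
qed

text \<open>A function \<open>\<phi>\<close> is a supersolution if \<open>\<nu>\<^sub>i adj\<^sub>i \<phi> \<le> \<beta> \<phi>\<close>; then all iterates of the
  hopping operators are dominated by powers of \<open>\<beta>\<close> and the exponential series may be truncated.\<close>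

lemma adj_at_power_le:
  fixes \<phi> :: "(nat \<Rightarrow> int ^ 'd) \<Rightarrow> ennreal"
  assumes "\<And>s. ennreal (\<nu> i) * adj_at i \<phi> s \<le> ennreal \<beta> * \<phi> s" "\<nu> i \<ge> 0" "\<beta> \<ge> 0"
    and "\<And>s. f s \<le> c * \<phi> s"
  shows "ennreal (\<nu> i ^ k) * (adj_at i ^^ k) f s \<le> c * (ennreal (\<beta> ^ k) * \<phi> s)"
proof (induction k arbitrary: s)
  case (Suc k)
  have "ennreal (\<nu> i ^ Suc k) * (adj_at i ^^ Suc k) f s =
      ennreal (\<nu> i) * adj_at i (\<lambda>s. ennreal (\<nu> i ^ k) * (adj_at i ^^ k) f s) s"
    using assms by (simp add: adj_at_cmult ennreal_mult mult_ac)
  also have "\<dots> \<le> ennreal (\<nu> i) * adj_at i (\<lambda>s. c * (ennreal (\<beta> ^ k) * \<phi> s)) s"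
    by (intro mult_left_mono adj_at_mono Suc) auto
  also have "\<dots> = c * ennreal (\<beta> ^ k) * (ennreal (\<nu> i) * adj_at i \<phi> s)"
    unfolding adj_at_cmult by (simp add: mult_ac)
  also have "\<dots> \<le> c * ennreal (\<beta> ^ k) * (ennreal \<beta> * \<phi> s)"
    by (intro mult_left_mono assms) auto
  also have "\<dots> = c * (ennreal (\<beta> ^ Suc k) * \<phi> s)"
    using assms by (simp add: ennreal_mult mult_ac)
  finally show ?case .
qed (use assms in auto)

text \<open>Pairs each power of \<open>\<nu> i\<close> with the same power of
  \<open>adj_at i\<close>, which is the combination that a supersolution controls.\<close>

lemma walk_op_factor:
  fixes g :: "(nat \<Rightarrow> int ^ 'd) \<Rightarrow> ennreal"
  assumes "\<nu> i \<ge> 0" "h \<ge> 0"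
  shows "walk_op \<nu> h i g s = ennreal (exp (- deg TYPE('d) * \<nu> i * h)) *
    (\<Sum>k. ennreal (h ^ k / fact k) * (ennreal (\<nu> i ^ k) * (adj_at i ^^ k) g s))"
proof -
  have "ennreal (exp (- deg TYPE('d) * \<nu> i * h) * ((\<nu> i * h) ^ k / fact k)) * (adj_at i ^^ k) g s =
    ennreal (exp (- deg TYPE('d) * \<nu> i * h)) * (ennreal (h ^ k / fact k) * (ennreal (\<nu> i ^ k) * (adj_at i ^^ k) g s))" for k
  proof -
    have "exp (- deg TYPE('d) * \<nu> i * h) * ((\<nu> i * h) ^ k / fact k) =
      exp (- deg TYPE('d) * \<nu> i * h) * ((h ^ k / fact k) * \<nu> i ^ k)"
      by (simp add: power_mult_distrib)
    then show ?thesis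
      using assms by (simp only: ennreal_mult exp_ge_zero mult_nonneg_nonneg divide_nonneg_pos
          zero_le_power fact_gt_zero mult.assoc)
  qed
  then show ?thesis
    by (simp add: walk_op_series assms ennreal_suminf_cmult)
qed

text \<open>For h \<le> 1 every term with k \<ge> 1 satisfies h^k \<le> h, and the supersolution
  sums the rest to exp \<beta>. It is stated for any \<open>f\<close> dominated by
  \<open>\<phi>\<close> because it is applied to the hopping images of
  \<open>\<phi>\<close>.\<close>

lemma walk_op_le_first_order:
  fixes \<phi> :: "(nat \<Rightarrow> int ^ 'd) \<Rightarrow> ennreal"
  assumes sup: "\<And>s. ennreal (\<nu> i) * adj_at i \<phi> s \<le> ennreal \<beta> * \<phi> s" and "\<nu> i \<ge> 0" "\<beta> \<ge> 0"
    and f: "\<And>s. f s \<le> ennreal c * \<phi> s" and c: "c \<ge> 0" and h: "0 \<le> h" "h \<le> 1"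
  shows "walk_op \<nu> h i f s \<le> ennreal (exp (- deg TYPE('d) * \<nu> i * h)) * (f s + ennreal (h * c * exp \<beta>) * \<phi> s)"
  unfolding walk_op_factor[of \<nu> i h, OF \<open>\<nu> i \<ge> 0\<close> h(1)]
proof (intro mult_left_mono)
  have "ennreal (h ^ k / fact k) * (ennreal (\<nu> i ^ k) * (adj_at i ^^ k) f s) \<le>
      (if k = 0 then f s else 0) + ennreal (h * c * (\<beta> ^ k / fact k)) * \<phi> s" for k
  proof (cases "k = 0")
    case False
    then have hk: "h ^ k \<le> h" using h power_decreasing[of 1 k h] by simp
    have "ennreal (h ^ k / fact k) * (ennreal (\<nu> i ^ k) * (adj_at i ^^ k) f s) \<le>
        ennreal (h ^ k / fact k) * (ennreal c * (ennreal (\<beta> ^ k) * \<phi> s))"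
      by (intro mult_left_mono adj_at_power_le assms) auto
    also have "\<dots> = ennreal (h ^ k * c * (\<beta> ^ k / fact k)) * \<phi> s"
    proof -
      have e: "h ^ k * c * (\<beta> ^ k / fact k) = (h ^ k / fact k) * (c * \<beta> ^ k)" by simp
      have "0 \<le> h ^ k / fact k" "0 \<le> c * \<beta> ^ k" "0 \<le> \<beta> ^ k" using h c \<open>\<beta> \<ge> 0\<close> by auto
      then show ?thesis unfolding e using c by (simp only: ennreal_mult mult.assoc)
    qed
    also have "\<dots> \<le> ennreal (h * c * (\<beta> ^ k / fact k)) * \<phi> s"
      using hk c \<open>\<beta> \<ge> 0\<close> by (intro mult_right_mono ennreal_leI) auto
    finally show ?thesis using False by simp
  qed simp
  then have "(\<Sum>k. ennreal (h ^ k / fact k) * (ennreal (\<nu> i ^ k) * (adj_at i ^^ k) f s)) \<le>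
      (\<Sum>k. (if k = 0 then f s else 0) + ennreal (h * c * (\<beta> ^ k / fact k)) * \<phi> s)"
    by (intro suminf_le) auto
  also have "\<dots> = f s + (\<Sum>k. ennreal (h * c * (\<beta> ^ k / fact k)) * \<phi> s)"
    by (subst suminf_add[symmetric]) (auto simp: suminf_ennreal_single)
  also have "\<dots> \<le> f s + ennreal (h * c * exp \<beta>) * \<phi> s"
    using h c \<open>\<beta> \<ge> 0\<close> by (intro add_left_mono suminf_exp_ennreal) auto
  finally show "(\<Sum>k. ennreal (h ^ k / fact k) * (ennreal (\<nu> i ^ k) * (adj_at i ^^ k) f s))
    \<le> f s + ennreal (h * c * exp \<beta>) * \<phi> s" .
qed simp

text \<open>Here the linear term has to survive exactly, since it is compared with \<beta> later;
  only k \<ge> 2 is estimated, by h^k \<le> h^2.\<close>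

lemma walk_op_le_second_order:
  fixes \<phi> :: "(nat \<Rightarrow> int ^ 'd) \<Rightarrow> ennreal"
  assumes sup: "\<And>s. ennreal (\<nu> i) * adj_at i \<phi> s \<le> ennreal \<beta> * \<phi> s" and "\<nu> i \<ge> 0" "\<beta> \<ge> 0"
    and h: "0 \<le> h" "h \<le> 1"
  shows "walk_op \<nu> h i \<phi> s \<le> ennreal (exp (- deg TYPE('d) * \<nu> i * h)) *
    (\<phi> s + ennreal h * (ennreal (\<nu> i) * adj_at i \<phi> s) + ennreal (h\<^sup>2 * exp \<beta>) * \<phi> s)"
  unfolding walk_op_factor[of \<nu> i h, OF \<open>\<nu> i \<ge> 0\<close> h(1)]
proof (intro mult_left_mono)
  have "ennreal (h ^ k / fact k) * (ennreal (\<nu> i ^ k) * (adj_at i ^^ k) \<phi> s) \<le>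
      (if k = 0 then \<phi> s else 0) + (if k = 1 then ennreal h * (ennreal (\<nu> i) * adj_at i \<phi> s) else 0)
      + ennreal (h\<^sup>2 * (\<beta> ^ k / fact k)) * \<phi> s" for k
  proof (cases "k \<le> 1")
    case True
    then have "k = 0 \<or> k = 1" by auto
    then show ?thesis by auto
  next
    case False
    then have hk: "h ^ k \<le> h\<^sup>2" using h power_decreasing[of 2 k h] by simp
    have "ennreal (h ^ k / fact k) * (ennreal (\<nu> i ^ k) * (adj_at i ^^ k) \<phi> s) \<le>
        ennreal (h ^ k / fact k) * (1 * (ennreal (\<beta> ^ k) * \<phi> s))"
      by (intro mult_left_mono adj_at_power_le assms) auto
    also have "\<dots> = ennreal (h ^ k * (\<beta> ^ k / fact k)) * \<phi> s"
    proof -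
      have e: "h ^ k * (\<beta> ^ k / fact k) = (h ^ k / fact k) * \<beta> ^ k" by simp
      have "0 \<le> h ^ k / fact k" "0 \<le> \<beta> ^ k" using h \<open>\<beta> \<ge> 0\<close> by auto
      then show ?thesis unfolding e by (simp only: ennreal_mult mult.assoc mult_1)
    qed
    also have "\<dots> \<le> ennreal (h\<^sup>2 * (\<beta> ^ k / fact k)) * \<phi> s"
      using hk \<open>\<beta> \<ge> 0\<close> by (intro mult_right_mono ennreal_leI) auto
    finally show ?thesis using False by simp
  qed
  then have "(\<Sum>k. ennreal (h ^ k / fact k) * (ennreal (\<nu> i ^ k) * (adj_at i ^^ k) \<phi> s)) \<le>
      (\<Sum>k. (if k = 0 then \<phi> s else 0) + (if k = 1 then ennreal h * (ennreal (\<nu> i) * adj_at i \<phi> s) else 0)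
      + ennreal (h\<^sup>2 * (\<beta> ^ k / fact k)) * \<phi> s)"
    by (intro suminf_le) auto
  also have "\<dots> = \<phi> s + ennreal h * (ennreal (\<nu> i) * adj_at i \<phi> s) + (\<Sum>k. ennreal (h\<^sup>2 * (\<beta> ^ k / fact k)) * \<phi> s)"
    by (subst suminf_add[symmetric], simp, simp)+ (simp only: suminf_ennreal_single)
  also have "\<dots> \<le> \<phi> s + ennreal h * (ennreal (\<nu> i) * adj_at i \<phi> s) + ennreal (h\<^sup>2 * exp \<beta>) * \<phi> s"
    using h \<open>\<beta> \<ge> 0\<close> by (intro add_left_mono suminf_exp_ennreal) auto
  finally show "(\<Sum>k. ennreal (h ^ k / fact k) * (ennreal (\<nu> i ^ k) * (adj_at i ^^ k) \<phi> s))
    \<le> \<phi> s + ennreal h * (ennreal (\<nu> i) * adj_at i \<phi> s) + ennreal (h\<^sup>2 * exp \<beta>) * \<phi> s" .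
qed simp

text \<open>The next coordinate is applied to the bound for the others: to second order on
  \<open>\<phi>\<close> itself, to first order on the terms with a factor h, and crudely on the
  remainder of order h^2.\<close>

lemma walk_ops_le:
  fixes \<phi> :: "(nat \<Rightarrow> int ^ 'd) \<Rightarrow> ennreal"
  assumes "\<And>i s. i \<in> set is \<Longrightarrow> ennreal (\<nu> i) * adj_at i \<phi> s \<le> ennreal \<beta> * \<phi> s"
    and "\<And>i. i \<in> set is \<Longrightarrow> \<nu> i \<ge> 0" and \<beta>: "\<beta> \<ge> 0"
  shows "\<exists>C\<ge>0. \<forall>h. 0 \<le> h \<longrightarrow> h \<le> 1 \<longrightarrow> (\<forall>s. walk_ops \<nu> h is \<phi> s \<le>
    ennreal (exp (- deg TYPE('d) * (\<Sum>i\<leftarrow>is. \<nu> i) * h)) *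
      (\<phi> s + ennreal h * (\<Sum>i\<leftarrow>is. ennreal (\<nu> i) * adj_at i \<phi> s) + ennreal (C * h\<^sup>2) * \<phi> s))"
  using assms(1,2)
proof (induction "is")
  case Nil
  then show ?case by (intro exI[of _ 0]) auto
next
  case (Cons i "is")
  define D where "D = deg TYPE('d)"
  let ?A = "\<lambda>j s. ennreal (\<nu> j) * adj_at j \<phi> s"
  from Cons obtain C where C: "C \<ge> 0" and IH: "\<And>h s. 0 \<le> h \<Longrightarrow> h \<le> 1 \<Longrightarrow> walk_ops \<nu> h is \<phi> s \<le>
    ennreal (exp (- D * (\<Sum>i\<leftarrow>is. \<nu> i) * h)) *
      (\<phi> s + ennreal h * (\<Sum>i\<leftarrow>is. ?A i s) + ennreal (C * h\<^sup>2) * \<phi> s)"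
    unfolding D_def by auto
  have \<nu>: "\<nu> i \<ge> 0" and sup: "?A i s \<le> ennreal \<beta> * \<phi> s" for s using Cons.prems by auto
  \<comment> \<open>The summands come from the quadratic remainder on \<open>\<phi>\<close>, from
    the linear remainders on the \<open>length is\<close> hopping terms, and from the old remainder
    after the crude bound by 1 + exp \<beta>.\<close>
  define C' where "C' = exp \<beta> + real (length is) * \<beta> * exp \<beta> + C * (1 + exp \<beta>)"
  have "walk_ops \<nu> h (i # is) \<phi> s \<le> ennreal (exp (- D * (\<Sum>i\<leftarrow>i # is. \<nu> i) * h)) *
      (\<phi> s + ennreal h * (\<Sum>i\<leftarrow>i # is. ?A i s) + ennreal (C' * h\<^sup>2) * \<phi> s)"
    if h: "0 \<le> h" "h \<le> 1" for h s
  proof -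
    let ?e = "ennreal (exp (- D * \<nu> i * h))" and ?e' = "ennreal (exp (- D * (\<Sum>i\<leftarrow>is. \<nu> i) * h))"
    have 1: "walk_op \<nu> h i \<phi> s \<le> ?e * (\<phi> s + ennreal h * ?A i s + ennreal (h\<^sup>2 * exp \<beta>) * \<phi> s)"
      unfolding D_def using sup \<nu> \<beta> h by (rule walk_op_le_second_order)
    have 2: "walk_op \<nu> h i (?A j) s \<le> ?e * (?A j s + ennreal (h * \<beta> * exp \<beta>) * \<phi> s)" if "j \<in> set is" for j
      unfolding D_def using that Cons.prems \<beta> h by (intro walk_op_le_first_order sup \<nu>) auto
    have 3: "walk_op \<nu> h i \<phi> s \<le> ?e * (\<phi> s + ennreal (h * 1 * exp \<beta>) * \<phi> s)"
      unfolding D_def using \<nu> \<beta> h sup by (intro walk_op_le_first_order) auto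
    have 3: "walk_op \<nu> h i \<phi> s \<le> ?e * (ennreal (1 + exp \<beta>) * \<phi> s)"
    proof -
      have "\<phi> s + ennreal (h * 1 * exp \<beta>) * \<phi> s = ennreal (1 + h * exp \<beta>) * \<phi> s"
        using h by (simp add: distrib_right)
      also have "\<dots> \<le> ennreal (1 + exp \<beta>) * \<phi> s"
        using h by (intro mult_right_mono ennreal_leI) auto
      finally show ?thesis by (intro order_trans[OF 3] mult_left_mono) auto
    qed
    have 4: "(\<Sum>j\<leftarrow>is. walk_op \<nu> h i (?A j) s) \<le>
        ?e * ((\<Sum>j\<leftarrow>is. ?A j s) + ennreal (real (length is) * (h * \<beta> * exp \<beta>)) * \<phi> s)"
    proof -
      have "(\<Sum>j\<leftarrow>is. walk_op \<nu> h i (?A j) s) \<le> (\<Sum>j\<leftarrow>is. ?e * (?A j s + ennreal (h * \<beta> * exp \<beta>) * \<phi> s))"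
        by (intro sum_list_mono 2)
      also have "\<dots> = ?e * ((\<Sum>j\<leftarrow>is. ?A j s) + ennreal (real (length is) * (h * \<beta> * exp \<beta>)) * \<phi> s)"
        using h \<beta> by (simp add: sum_list_const_mult sum_list_addf sum_list_triv ennreal_mult ennreal_of_nat_eq_real_of_nat mult_ac)
      finally show ?thesis .
    qed
    have "walk_ops \<nu> h (i # is) \<phi> s \<le> walk_op \<nu> h i (\<lambda>s. ?e' *
      (\<phi> s + ennreal h * (\<Sum>i\<leftarrow>is. ?A i s) + ennreal (C * h\<^sup>2) * \<phi> s)) s"
      unfolding walk_ops_Cons by (intro walk_op_mono IH h)
    also have "\<dots> = ?e' * (walk_op \<nu> h i \<phi> s + ennreal h * (\<Sum>j\<leftarrow>is. walk_op \<nu> h i (?A j) s)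
        + ennreal (C * h\<^sup>2) * walk_op \<nu> h i \<phi> s)"
      by (simp only: walk_op_cmult walk_op_add walk_op_sum_list)
    also have "\<dots> \<le> ?e' * (?e * (\<phi> s + ennreal h * ?A i s + ennreal (h\<^sup>2 * exp \<beta>) * \<phi> s)
        + ennreal h * (?e * ((\<Sum>j\<leftarrow>is. ?A j s) + ennreal (real (length is) * (h * \<beta> * exp \<beta>)) * \<phi> s))
        + ennreal (C * h\<^sup>2) * (?e * (ennreal (1 + exp \<beta>) * \<phi> s)))"
      by (intro mult_left_mono add_mono 1 3 4) auto
    also have "\<dots> = (?e' * ?e) * (\<phi> s + (ennreal h * ?A i s + ennreal h * (\<Sum>j\<leftarrow>is. ?A j s)) +
        (ennreal (h\<^sup>2 * exp \<beta>) + ennreal h * ennreal (real (length is) * (h * \<beta> * exp \<beta>)) + ennreal (C * h\<^sup>2) * ennreal (1 + exp \<beta>)) * \<phi> s)"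
      by (simp only: distrib_left distrib_right add_ac mult_ac)
    also have "ennreal (h\<^sup>2 * exp \<beta>) + ennreal h * ennreal (real (length is) * (h * \<beta> * exp \<beta>)) + ennreal (C * h\<^sup>2) * ennreal (1 + exp \<beta>)
        = ennreal (C' * h\<^sup>2)"
      using h \<beta> C by (simp add: C'_def ennreal_mult[symmetric] ennreal_plus[symmetric] algebra_simps power2_eq_square
          del: ennreal_plus)
    also have "?e' * ?e = ennreal (exp (- D * (\<Sum>i\<leftarrow>i # is. \<nu> i) * h))"
      by (simp add: ennreal_mult[symmetric] exp_add[symmetric] algebra_simps)
    finally show ?thesis by (simp add: distrib_left)
  qed
  moreover have "C' \<ge> 0" using C \<beta> by (simp add: C'_def)
  ultimately show ?case unfolding D_def by blast
qed

text \<open>The hopping part of the supersolution inequality is at most (\<beta> - V) \<phi>, and 1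
  + h (\<beta> - V) \<le> exp (h (\<beta> - V)). The potential therefore cancels and an error of
  order h^2 in the exponent remains, which is harmless over t / h steps.\<close>

lemma exp_walk_ops_le:
  fixes \<phi> :: "(nat \<Rightarrow> int ^ 'd) \<Rightarrow> ennreal"
  assumes sup: "\<And>s. ennreal (V s) * \<phi> s + (\<Sum>i\<leftarrow>is. ennreal (\<nu> i) * adj_at i \<phi> s) \<le> ennreal \<beta> * \<phi> s"
    and \<nu>: "\<And>i. i \<in> set is \<Longrightarrow> \<nu> i \<ge> 0" and \<beta>: "\<beta> \<ge> 0"
    and V: "\<And>s. 0 \<le> V s" "\<And>s. V s \<le> v"
  shows "\<exists>C\<ge>0. \<forall>h. 0 \<le> h \<longrightarrow> h \<le> 1 \<longrightarrow> (\<forall>s. ennreal (exp (h * V s)) * walk_ops \<nu> h is \<phi> s \<le>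
    ennreal (exp (h * (\<beta> - deg TYPE('d) * (\<Sum>i\<leftarrow>is. \<nu> i)) + C * h\<^sup>2)) * \<phi> s)"
proof -
  have sup1: "ennreal (\<nu> i) * adj_at i \<phi> s \<le> ennreal \<beta> * \<phi> s" if "i \<in> set is" for i s
  proof -
    have "ennreal (\<nu> i) * adj_at i \<phi> s \<le> (\<Sum>i\<leftarrow>is. ennreal (\<nu> i) * adj_at i \<phi> s)"
      using that by (intro member_le_sum_list) auto
    also have "\<dots> \<le> ennreal \<beta> * \<phi> s" by (rule order_trans[OF _ sup]) auto
    finally show ?thesis .
  qed
  from walk_ops_le[of "is", OF sup1 \<nu> \<beta>] obtain C where C: "C \<ge> 0" and *: "\<And>h s. 0 \<le> h \<Longrightarrow> h \<le> 1 \<Longrightarrow>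
    walk_ops \<nu> h is \<phi> s \<le> ennreal (exp (- deg TYPE('d) * (\<Sum>i\<leftarrow>is. \<nu> i) * h)) *
      (\<phi> s + ennreal h * (\<Sum>i\<leftarrow>is. ennreal (\<nu> i) * adj_at i \<phi> s) + ennreal (C * h\<^sup>2) * \<phi> s)"
    by auto
  define c where "c = deg TYPE('d) * (\<Sum>i\<leftarrow>is. \<nu> i)"
  have "ennreal (exp (h * V s)) * walk_ops \<nu> h is \<phi> s \<le> ennreal (exp (h * (\<beta> - c) + C * exp v * h\<^sup>2)) * \<phi> s"
    if h: "0 \<le> h" "h \<le> 1" for h s
  proof (cases "\<phi> s = \<top>")
    case True
    then show ?thesis by (simp add: ennreal_mult_top)
  next
    case False
    then obtain r where r: "\<phi> s = ennreal r" "r \<ge> 0" by (cases "\<phi> s") auto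
    \<comment> \<open>Finiteness at \<open>s\<close> passes to the hopping sum, so the inequality
      can be read in the reals.\<close>
    have "(\<Sum>i\<leftarrow>is. ennreal (\<nu> i) * adj_at i \<phi> s) \<le> ennreal (\<beta> * r)"
      using sup[of s] r \<beta> by (auto simp: ennreal_mult intro: order_trans[rotated])
    then obtain a where a: "(\<Sum>i\<leftarrow>is. ennreal (\<nu> i) * adj_at i \<phi> s) = ennreal a" "a \<ge> 0"
      by (cases "\<Sum>i\<leftarrow>is. ennreal (\<nu> i) * adj_at i \<phi> s") (auto simp: top_unique)
    have ab: "V s * r + a \<le> \<beta> * r"
      using sup[of s] V r a \<beta> by (simp add: ennreal_mult[symmetric] ennreal_plus[symmetric] del: ennreal_plus)
    have "ennreal (exp (h * V s)) * walk_ops \<nu> h is \<phi> s \<le>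
      ennreal (exp (h * V s)) * (ennreal (exp (- c * h)) * (ennreal r + ennreal h * ennreal a + ennreal (C * h\<^sup>2) * ennreal r))"
      using *[OF h, of s] by (intro mult_left_mono) (auto simp: r a c_def)
    also have "\<dots> = ennreal (exp (h * V s) * (exp (- c * h) * (r + h * a + C * h\<^sup>2 * r)))"
      using h r a C by (simp add: ennreal_mult[symmetric] ennreal_plus[symmetric] del: ennreal_plus)
    also have "\<dots> \<le> ennreal (exp (h * (\<beta> - c) + C * exp v * h\<^sup>2) * r)"
    proof (rule ennreal_leI)
      have "h * a \<le> h * (\<beta> * r - V s * r)" using ab h by (intro mult_left_mono) auto
      then have "r + h * a + C * h\<^sup>2 * r \<le> (1 + h * (\<beta> - V s)) * r + C * h\<^sup>2 * r"
        by (simp add: algebra_simps)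
      then have "exp (h * V s) * (r + h * a + C * h\<^sup>2 * r) \<le> exp (h * V s) * ((1 + h * (\<beta> - V s)) * r + C * h\<^sup>2 * r)"
        by (intro mult_left_mono) auto
      also have "\<dots> \<le> exp (h * V s) * (exp (h * (\<beta> - V s)) * r + C * h\<^sup>2 * r)"
        using r by (intro mult_left_mono add_mono mult_right_mono exp_ge_add_one_self) auto
      also have "\<dots> = exp (h * \<beta>) * r + exp (h * V s) * (C * h\<^sup>2 * r)"
        by (simp add: distrib_left mult.assoc[symmetric] exp_add[symmetric]) (simp add: algebra_simps)
      also have "\<dots> \<le> exp (h * \<beta>) * r + exp (h * \<beta>) * (exp v * (C * h\<^sup>2 * r))"
      proof -
        have "h * V s \<le> v"
          using h V mult_mono[of h 1 "V s" v] V[of s] by simp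
        then have "exp (h * V s) \<le> exp v" by simp
        also have "\<dots> \<le> exp (h * \<beta>) * exp v" using h \<beta> by simp
        finally have "exp (h * V s) * (C * h\<^sup>2 * r) \<le> (exp (h * \<beta>) * exp v) * (C * h\<^sup>2 * r)"
          using C r by (intro mult_right_mono) auto
        then show ?thesis by (simp add: mult.assoc)
      qed
      also have "\<dots> = exp (h * \<beta>) * (1 + C * exp v * h\<^sup>2) * r" by (simp add: algebra_simps)
      also have "\<dots> \<le> exp (h * \<beta>) * exp (C * exp v * h\<^sup>2) * r"
        using r by (intro mult_right_mono mult_left_mono exp_ge_add_one_self) auto
      finally have "exp (- c * h) * (exp (h * V s) * (r + h * a + C * h\<^sup>2 * r)) \<le>
          exp (- c * h) * (exp (h * \<beta>) * exp (C * exp v * h\<^sup>2) * r)"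
        by (intro mult_left_mono) auto
      moreover have "exp (- c * h) * (exp (h * \<beta>) * exp (C * exp v * h\<^sup>2) * r) = exp (h * (\<beta> - c) + C * exp v * h\<^sup>2) * r"
      proof -
        have "h * (\<beta> - c) + C * exp v * h\<^sup>2 = - c * h + (h * \<beta> + C * exp v * h\<^sup>2)" by (simp add: algebra_simps)
        then show ?thesis by (simp only: exp_add mult.assoc)
      qed
      ultimately show "exp (h * V s) * (exp (- c * h) * (r + h * a + C * h\<^sup>2 * r)) \<le> exp (h * (\<beta> - c) + C * exp v * h\<^sup>2) * r"
        by (simp only: mult.left_commute[of "exp (h * V s)"])
    qed
    finally show ?thesis using r by (simp add: ennreal_mult)
  qed
  moreover have "C * exp v \<ge> 0" using C by simp
  ultimately show ?thesis unfolding c_def by blast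
qed

section \<open>Quadratic forms on finitely supported functions\<close>

abbreviation fin_supp :: "('a \<Rightarrow> real) \<Rightarrow> bool" where
  "fin_supp f \<equiv> finite {x. f x \<noteq> 0}"

definition ip :: "('a \<Rightarrow> real) \<Rightarrow> ('a \<Rightarrow> real) \<Rightarrow> real" where
  "ip f g = (\<Sum>\<^sub>\<infinity>x. f x * g x)"

lemma infsum_fin_supp:
  assumes "finite A" "\<And>x. x \<notin> A \<Longrightarrow> f x = 0"
  shows "(\<Sum>\<^sub>\<infinity>x. f x :: real) = sum f A"
  using infsum_cong_neutral[of A UNIV f f] assms by simp

lemma fin_supp_summable: "fin_supp f \<Longrightarrow> f summable_on UNIV"
  by (rule finite_nonzero_values_imp_summable_on) auto

lemma fin_supp_intros:
  "fin_supp f \<Longrightarrow> fin_supp g \<Longrightarrow> fin_supp (\<lambda>x. f x + g x)"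
  "fin_supp f \<Longrightarrow> fin_supp g \<Longrightarrow> fin_supp (\<lambda>x. f x - g x)"
  "fin_supp f \<Longrightarrow> fin_supp (\<lambda>x. f x * h x)"
  "fin_supp f \<Longrightarrow> fin_supp (\<lambda>x. h x * f x)"
  "fin_supp f \<Longrightarrow> fin_supp (\<lambda>x. (f x)\<^sup>2)"
  "fin_supp f \<Longrightarrow> fin_supp (\<lambda>x. \<bar>f x\<bar>)"
proof -
  assume f: "fin_supp f"
  show "fin_supp (\<lambda>x. f x + g x)" "fin_supp (\<lambda>x. f x - g x)" if "fin_supp g"
    using f that by (auto intro: finite_subset[of _ "{x. f x \<noteq> 0} \<union> {x. g x \<noteq> 0}"])
  show "fin_supp (\<lambda>x. f x * h x)" "fin_supp (\<lambda>x. h x * f x)" "fin_supp (\<lambda>x. (f x)\<^sup>2)" "fin_supp (\<lambda>x. \<bar>f x\<bar>)"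
    by (rule finite_subset[OF _ f], auto)+
qed

lemma fin_supp_sum:
  assumes "finite A" "\<And>i. i \<in> A \<Longrightarrow> fin_supp (f i)"
  shows "fin_supp (\<lambda>x. \<Sum>i\<in>A. f i x)"
  using assms
proof (induction A)
  case (insert i A)
  then show ?case using fin_supp_intros(1)[of "f i" "\<lambda>x. \<Sum>i\<in>A. f i x"] by simp
qed simp

lemma fin_supp_bij: "bij \<sigma> \<Longrightarrow> fin_supp f \<Longrightarrow> fin_supp (\<lambda>x. f (\<sigma> x))"
  using finite_vimageI[of "{x. f x \<noteq> 0}" \<sigma>] by (simp add: vimage_def bij_is_inj)

lemma infsum_bij: "bij \<sigma> \<Longrightarrow> (\<Sum>\<^sub>\<infinity>x. f (\<sigma> x)) = (\<Sum>\<^sub>\<infinity>x. f x :: real)"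
  by (rule infsum_reindex_bij_betw)

lemma infsum_add_fin: "fin_supp f \<Longrightarrow> fin_supp g \<Longrightarrow> (\<Sum>\<^sub>\<infinity>x. f x + g x) = (\<Sum>\<^sub>\<infinity>x. f x) + (\<Sum>\<^sub>\<infinity>x. g x)"
  by (intro infsum_add fin_supp_summable)

lemma infsum_diff_fin: "fin_supp f \<Longrightarrow> fin_supp g \<Longrightarrow> (\<Sum>\<^sub>\<infinity>x. f x - g x) = (\<Sum>\<^sub>\<infinity>x. f x) - (\<Sum>\<^sub>\<infinity>x. g x)"
  using infsum_add_fin[of f "\<lambda>x. - g x"] by (simp add: infsum_uminus)

lemma infsum_cmult_fin: "(\<Sum>\<^sub>\<infinity>x. c * f x) = c * (\<Sum>\<^sub>\<infinity>x. f x :: real)"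
  by (rule infsum_cmult_right')

lemma infsum_sum_fin:
  assumes "finite A" "\<And>i. i \<in> A \<Longrightarrow> fin_supp (f i)"
  shows "(\<Sum>\<^sub>\<infinity>x. \<Sum>i\<in>A. f i x) = (\<Sum>i\<in>A. \<Sum>\<^sub>\<infinity>x. f i x)"
  using assms
proof (induction A)
  case (insert i A)
  have "fin_supp (f i)" "fin_supp (\<lambda>x. \<Sum>i\<in>A. f i x)"
    using insert by (auto intro!: fin_supp_sum)
  then show ?case
    using insert infsum_add_fin[of "f i" "\<lambda>x. \<Sum>i\<in>A. f i x"] by simp
qed simp

lemma infsum_mono_fin:
  "fin_supp f \<Longrightarrow> fin_supp g \<Longrightarrow> (\<And>x. f x \<le> g x) \<Longrightarrow> (\<Sum>\<^sub>\<infinity>x. f x) \<le> (\<Sum>\<^sub>\<infinity>x. g x)"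
  by (intro infsum_mono fin_supp_summable)

lemma ip_sym: "ip f g = ip g f"
  by (simp add: ip_def mult.commute)

lemma ip_self: "ip f f = (\<Sum>\<^sub>\<infinity>x. (f x)\<^sup>2)"
  by (simp add: ip_def power2_eq_square)

lemma ip_self_nonneg: "0 \<le> ip f f"
  unfolding ip_self by (intro infsum_nonneg) auto

lemma ip_add: "fin_supp f \<Longrightarrow> fin_supp g \<Longrightarrow> ip (\<lambda>x. f x + g x) h = ip f h + ip g h"
  unfolding ip_def by (subst infsum_add_fin[symmetric]) (auto simp: distrib_right intro: fin_supp_intros)

lemma ip_diff: "fin_supp f \<Longrightarrow> fin_supp g \<Longrightarrow> ip (\<lambda>x. f x - g x) h = ip f h - ip g h"
  unfolding ip_def by (subst infsum_diff_fin[symmetric]) (auto simp: left_diff_distrib intro: fin_supp_intros)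

lemma ip_cmult: "ip (\<lambda>x. c * f x) h = c * ip f h"
  unfolding ip_def by (simp add: mult.assoc infsum_cmult_fin)

lemma ip_cmult_right: "ip h (\<lambda>x. c * f x) = c * ip h f"
  by (metis ip_sym ip_cmult)

lemma ip_add_right: "fin_supp h \<Longrightarrow> ip h (\<lambda>x. f x + g x) = ip h f + ip h g"
  unfolding ip_def by (subst infsum_add_fin[symmetric]) (auto simp: distrib_left intro: fin_supp_intros)

lemma ip_diff_right: "fin_supp h \<Longrightarrow> ip h (\<lambda>x. f x - g x) = ip h f - ip h g"
  unfolding ip_def by (subst infsum_diff_fin[symmetric]) (auto simp: right_diff_distrib intro: fin_supp_intros)

lemma ip_Cauchy_Schwarz:
  assumes "fin_supp f" "fin_supp g"
  shows "ip f g \<le> sqrt (ip f f) * sqrt (ip g g)"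
proof -
  define A where "A = {x. f x \<noteq> 0} \<union> {x. g x \<noteq> 0}"
  have A: "finite A" using assms by (simp add: A_def)
  have "ip f g = (\<Sum>x\<in>A. f x * g x)" unfolding ip_def
    using A by (intro infsum_fin_supp) (auto simp: A_def)
  also have "\<dots> \<le> (\<Sum>x\<in>A. \<bar>f x\<bar> * \<bar>g x\<bar>)"
    by (intro sum_mono) (metis abs_ge_self abs_mult)
  also have "\<dots> \<le> L2_set f A * L2_set g A" by (rule L2_set_mult_ineq)
  also have "L2_set f A = sqrt (ip f f)" unfolding L2_set_def ip_self
    using A by (subst infsum_fin_supp[of A]) (auto simp: A_def)
  also have "L2_set g A = sqrt (ip g g)" unfolding L2_set_def ip_self
    using A by (subst infsum_fin_supp[of A]) (auto simp: A_def)
  finally show ?thesis .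
qed

lemma ip_Cauchy_Schwarz_square:
  assumes "fin_supp f" "fin_supp g"
  shows "(ip f g)\<^sup>2 \<le> ip f f * ip g g"
proof -
  have "ip f g \<le> sqrt (ip f f) * sqrt (ip g g)" by (intro ip_Cauchy_Schwarz assms)
  moreover have "- ip f g \<le> sqrt (ip f f) * sqrt (ip g g)"
  proof -
    have "ip (\<lambda>x. (-1) * f x) (\<lambda>x. (-1) * f x) = ip f f" "ip (\<lambda>x. (-1) * f x) g = - ip f g"
      unfolding ip_cmult ip_cmult_right by simp_all
    then show ?thesis
      using ip_Cauchy_Schwarz[of "\<lambda>x. (-1) * f x" g] fin_supp_intros(4)[OF assms(1), of "\<lambda>_. -1"] assms(2) by simp
  qed
  ultimately have "\<bar>ip f g\<bar> \<le> sqrt (ip f f * ip g g)"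
    by (simp add: real_sqrt_mult abs_le_iff)
  then show ?thesis
    by (metis ip_self_nonneg mult_nonneg_nonneg power2_abs real_le_lsqrt real_sqrt_ge_0_iff
        abs_ge_zero power_mono real_sqrt_pow2)
qed

section \<open>Coordinatewise shifts and Dirichlet forms\<close>

abbreviation shift_at :: "nat \<Rightarrow> int ^ 'd \<Rightarrow> (nat \<Rightarrow> int ^ 'd) \<Rightarrow> (nat \<Rightarrow> int ^ 'd)" where
  "shift_at i v s \<equiv> s(i := s i + v)"

lemma bij_shift_at: "bij (shift_at i v)"
  by (rule bij_betw_byWitness[of _ "shift_at i (- v)"]) auto

lemma fin_supp_shift: "fin_supp f \<Longrightarrow> fin_supp (\<lambda>s. f (shift_at i v s))"
  by (rule fin_supp_bij[OF bij_shift_at])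

lemma infsum_shift: "(\<Sum>\<^sub>\<infinity>s. f (shift_at i v s)) = (\<Sum>\<^sub>\<infinity>s. f s :: real)"
  by (rule infsum_bij[OF bij_shift_at])

lemma fin_supp_adj_at: "fin_supp f \<Longrightarrow> fin_supp (adj_at i f)"
  unfolding adj_at_def[abs_def] by (intro fin_supp_sum finite_steps fin_supp_shift)

text \<open>Summation by parts: a shift by v on one side is a shift by -v on the other, and
  \<open>steps\<close> is symmetric.\<close>

lemma ip_adj_at:
  fixes f g :: "(nat \<Rightarrow> int ^ 'd) \<Rightarrow> real"
  assumes "fin_supp f"
  shows "ip f (adj_at i g) = ip (adj_at i f) g"
proof -
  have "ip f (adj_at i g) = (\<Sum>v\<in>steps. \<Sum>\<^sub>\<infinity>s. f s * g (shift_at i v s))"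
    unfolding ip_def adj_at_def sum_distrib_left
    by (intro infsum_sum_fin finite_steps fin_supp_intros assms)
  also have "\<dots> = (\<Sum>v\<in>steps. \<Sum>\<^sub>\<infinity>s. f (shift_at i (- v) s) * g s)"
  proof (intro sum.cong refl)
    fix a :: "int ^ 'd"
    show "(\<Sum>\<^sub>\<infinity>s. f s * g (shift_at i a s)) = (\<Sum>\<^sub>\<infinity>s. f (shift_at i (- a) s) * g s)"
      using infsum_shift[of "\<lambda>s. f s * g (shift_at i a s)" i "- a"] by simp
  qed
  also have "\<dots> = (\<Sum>v\<in>steps. \<Sum>\<^sub>\<infinity>s. f (shift_at i v s) * g s)"
    by (rule sum.reindex_bij_witness[of _ uminus uminus]) (auto simp: steps_uminus)
  also have "\<dots> = ip (adj_at i f) g"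
    unfolding ip_def adj_at_def sum_distrib_right
    by (intro infsum_sum_fin[symmetric] finite_steps fin_supp_intros fin_supp_shift assms)
  finally show ?thesis .
qed

text \<open>Every edge in the direction of coordinate \<open>i\<close> is seen from both of its end
  points, hence the division by 2.\<close>

definition dirichlet_at :: "nat \<Rightarrow> ((nat \<Rightarrow> int ^ 'd) \<Rightarrow> real) \<Rightarrow> real" where
  "dirichlet_at i f = (\<Sum>v\<in>steps. \<Sum>\<^sub>\<infinity>s. (f (shift_at i v s) - f s)\<^sup>2) / 2"

lemma dirichlet_at_nonneg: "0 \<le> dirichlet_at i f"
  unfolding dirichlet_at_def by (intro divide_nonneg_pos sum_nonneg infsum_nonneg) auto

lemma dirichlet_at_eq:
  fixes f :: "(nat \<Rightarrow> int ^ 'd) \<Rightarrow> real"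
  assumes f: "fin_supp f"
  shows "dirichlet_at i f = deg TYPE('d) * ip f f - ip f (adj_at i f)"
proof -
  have "(\<Sum>\<^sub>\<infinity>s. (f (shift_at i v s) - f s)\<^sup>2) = 2 * ip f f - 2 * (\<Sum>\<^sub>\<infinity>s. f s * f (shift_at i v s))" for v
  proof -
    have "(\<Sum>\<^sub>\<infinity>s. (f (shift_at i v s) - f s)\<^sup>2) =
        (\<Sum>\<^sub>\<infinity>s. ((f (shift_at i v s))\<^sup>2 + (f s)\<^sup>2) - 2 * (f s * f (shift_at i v s)))"
      by (simp add: power2_diff algebra_simps)
    also have "\<dots> = (\<Sum>\<^sub>\<infinity>s. (f (shift_at i v s))\<^sup>2) + (\<Sum>\<^sub>\<infinity>s. (f s)\<^sup>2) - 2 * (\<Sum>\<^sub>\<infinity>s. f s * f (shift_at i v s))"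
    proof -
      have fs: "fin_supp (\<lambda>s. (f (shift_at i v s))\<^sup>2)" "fin_supp (\<lambda>s. (f s)\<^sup>2)"
        "fin_supp (\<lambda>s. 2 * (f s * f (shift_at i v s)))"
        using fin_supp_intros(5)[OF fin_supp_shift[OF f]] fin_supp_intros(5)[OF f]
          fin_supp_intros(4)[OF fin_supp_intros(3)[OF f]] by auto
      show ?thesis
        by (simp only: infsum_diff_fin[OF fin_supp_intros(1)[OF fs(1,2)] fs(3)] infsum_add_fin[OF fs(1,2)] infsum_cmult_fin)
    qed
    also have "(\<Sum>\<^sub>\<infinity>s. (f (shift_at i v s))\<^sup>2) = ip f f"
      unfolding ip_self by (rule infsum_shift)
    also have "(\<Sum>\<^sub>\<infinity>s. (f s)\<^sup>2) = ip f f" by (rule ip_self[symmetric])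
    finally show ?thesis by (simp only: mult_2)
  qed
  moreover have "ip f (adj_at i f) = (\<Sum>v\<in>steps. \<Sum>\<^sub>\<infinity>s. f s * f (shift_at i v s))"
    unfolding ip_def adj_at_def sum_distrib_left
    by (intro infsum_sum_fin finite_steps fin_supp_intros f)
  ultimately show ?thesis
    by (simp add: dirichlet_at_def sum_subtractf sum_distrib_left[symmetric])
qed

text \<open>Lets near-optimal test functions be taken nonnegative.\<close>

lemma dirichlet_at_abs_le: "fin_supp f \<Longrightarrow> dirichlet_at i (\<lambda>s. \<bar>f s\<bar>) \<le> dirichlet_at i f"
  unfolding dirichlet_at_def
  by (intro divide_right_mono sum_mono infsum_mono_fin fin_supp_intros(2)[THEN fin_supp_intros(5)]
      fin_supp_shift[of "\<lambda>s. \<bar>f s\<bar>"] fin_supp_shift[of f] fin_supp_intros(6)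
      abs_le_square_iff[THEN iffD1, OF abs_triangle_ineq3]) simp_all

text \<open>A configuration assigns a site to every natural number. Only the indices in
  \<open>I\<close> are walkers; \<open>base\<close> fixes all others, so that the relevant
  configurations form a countable set.\<close>

locale walkers =
  fixes \<nu> :: "nat \<Rightarrow> real" and I :: "nat set" and V :: "(nat \<Rightarrow> int ^ 'd) \<Rightarrow> real" and v :: real
    and base :: "nat \<Rightarrow> int ^ 'd"
  assumes fin_I: "finite I" and rate_nonneg: "\<And>i. \<nu> i \<ge> 0"
    and V_nonneg: "\<And>s. 0 \<le> V s" and V_le: "\<And>s. V s \<le> v"
begin

text \<open>The generator with potential, shifted by the constant \<open>speed\<close>: the negative
  diagonal of the Laplacians is left out, which makes the operator positivity preserving.\<close>

definition hop :: "((nat \<Rightarrow> int ^ 'd) \<Rightarrow> real) \<Rightarrow> (nat \<Rightarrow> int ^ 'd) \<Rightarrow> real" where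
  "hop f s = V s * f s + (\<Sum>i\<in>I. \<nu> i * adj_at i f s)"

definition energy :: "((nat \<Rightarrow> int ^ 'd) \<Rightarrow> real) \<Rightarrow> real" where
  "energy f = ip f (\<lambda>s. V s * f s) - (\<Sum>i\<in>I. \<nu> i * dirichlet_at i f)"

text \<open>Walkers of rate \<open>0\<close> never leave their base point.\<close>

definition reach :: "(nat \<Rightarrow> int ^ 'd) set" where
  "reach = {s. \<forall>i. \<nu> i = 0 \<or> i \<notin> I \<longrightarrow> s i = base i}"

definition tests :: "((nat \<Rightarrow> int ^ 'd) \<Rightarrow> real) set" where
  "tests = {f. fin_supp f \<and> (\<forall>s. s \<notin> reach \<longrightarrow> f s = 0)}"

text \<open>By the variational principle this is the upper end of the spectrum of the generator with
  potential \<open>V\<close> on the square summable functions on \<open>reach\<close>. The supremum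
  over finitely supported functions need not be attained.\<close>

definition top :: real where
  "top = Sup (energy ` {f \<in> tests. ip f f = 1})"

text \<open>The total jump rate of all walkers.\<close>

definition speed :: real where
  "speed = deg TYPE('d) * (\<Sum>i\<in>I. \<nu> i)"

lemma ip_hop:
  assumes f: "fin_supp f"
  shows "ip f (hop f) = energy f + speed * ip f f"
proof -
  have "ip f (hop f) = ip f (\<lambda>s. V s * f s) + ip f (\<lambda>s. \<Sum>i\<in>I. \<nu> i * adj_at i f s)"
    unfolding hop_def[abs_def] by (rule ip_add_right[OF f])
  also have "ip f (\<lambda>s. \<Sum>i\<in>I. \<nu> i * adj_at i f s) = (\<Sum>i\<in>I. \<nu> i * ip f (adj_at i f))"
    unfolding ip_def sum_distrib_left
    by (subst infsum_sum_fin[OF fin_I])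
      (auto intro!: fin_supp_intros f simp: mult.left_commute infsum_cmult_fin[symmetric])
  finally show ?thesis
    by (simp add: energy_def dirichlet_at_eq[OF f] speed_def sum_subtractf sum_distrib_left sum_distrib_right algebra_simps)
qed

lemma tests_fin_supp: "f \<in> tests \<Longrightarrow> fin_supp f"
  by (simp add: tests_def)

lemma tests_cmult: "f \<in> tests \<Longrightarrow> (\<lambda>s. c * f s) \<in> tests"
  by (auto simp: tests_def fin_supp_intros)

lemma tests_add: "f \<in> tests \<Longrightarrow> g \<in> tests \<Longrightarrow> (\<lambda>s. f s + g s) \<in> tests"
  by (auto simp: tests_def intro!: fin_supp_intros)

lemma tests_diff: "f \<in> tests \<Longrightarrow> g \<in> tests \<Longrightarrow> (\<lambda>s. f s - g s) \<in> tests"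
  using fin_supp_intros(2)[of f g] by (auto simp: tests_def)

lemma tests_abs: "f \<in> tests \<Longrightarrow> (\<lambda>s. \<bar>f s\<bar>) \<in> tests"
  by (auto simp: tests_def)

lemma reach_shift: "i \<in> I \<Longrightarrow> \<nu> i \<noteq> 0 \<Longrightarrow> shift_at i a s \<in> reach \<longleftrightarrow> s \<in> reach"
  by (auto simp: reach_def)

text \<open>Only coordinates of positive rate are moved, so \<open>reach\<close> is
  invariant.\<close>

lemma tests_hop:
  assumes "f \<in> tests"
  shows "hop f \<in> tests"
proof -
  have "fin_supp (hop f)"
    unfolding hop_def[abs_def] using assms
    by (intro fin_supp_intros fin_supp_sum fin_I fin_supp_adj_at) (auto simp: tests_def)
  moreover have "hop f s = 0" if "s \<notin> reach" for s
  proof -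
    have "\<nu> i * adj_at i f s = 0" if "i \<in> I" for i
      using assms \<open>s \<notin> reach\<close> reach_shift[OF that] by (cases "\<nu> i = 0") (auto simp: tests_def adj_at_def)
    then have "(\<Sum>i\<in>I. \<nu> i * adj_at i f s) = 0" by (intro sum.neutral) blast
    then show ?thesis using assms that by (simp add: hop_def tests_def)
  qed
  ultimately show ?thesis by (simp add: tests_def)
qed

lemma tests_hop_power: "f \<in> tests \<Longrightarrow> (hop ^^ k) f \<in> tests"
  by (induction k) (auto intro: tests_hop)

lemma energy_cmult: "energy (\<lambda>s. c * f s) = c\<^sup>2 * energy f"
proof -
  have "dirichlet_at i (\<lambda>s. c * f s) = c\<^sup>2 * dirichlet_at i f" for i
    by (simp add: dirichlet_at_def right_diff_distrib[symmetric] power_mult_distrib infsum_cmult_fin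
        sum_distrib_left[symmetric])
  moreover have "ip (\<lambda>s. c * f s) (\<lambda>s. V s * (c * f s)) = c\<^sup>2 * ip f (\<lambda>s. V s * f s)"
    by (simp add: ip_cmult ip_cmult_right[symmetric] power2_eq_square mult_ac)
  ultimately show ?thesis
    by (simp add: energy_def right_diff_distrib sum_distrib_left mult_ac)
qed

lemma energy_le: 
  assumes "fin_supp f"
  shows "energy f \<le> v * ip f f"
proof -
  have "ip f (\<lambda>s. V s * f s) \<le> (\<Sum>\<^sub>\<infinity>s. v * (f s * f s))"
    unfolding ip_def using assms mult_right_mono[OF V_le]
    by (intro infsum_mono_fin fin_supp_intros) (auto simp: mult.left_commute[of "f _"])
  also have "\<dots> = v * ip f f" by (simp add: ip_def infsum_cmult_fin)
  moreover have "0 \<le> (\<Sum>i\<in>I. \<nu> i * dirichlet_at i f)"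
    by (intro sum_nonneg mult_nonneg_nonneg rate_nonneg dirichlet_at_nonneg)
  ultimately show ?thesis by (simp add: energy_def)
qed

lemma energy_abs: 
  assumes "fin_supp f"
  shows "energy f \<le> energy (\<lambda>s. \<bar>f s\<bar>)"
proof -
  have "ip (\<lambda>s. \<bar>f s\<bar>) (\<lambda>s. V s * \<bar>f s\<bar>) = ip f (\<lambda>s. V s * f s)"
    by (simp add: ip_def mult.left_commute[of _ "V _"])
  then show ?thesis
    using assms by (auto simp: energy_def intro!: sum_mono mult_left_mono rate_nonneg dirichlet_at_abs_le)
qed

lemma base_in_reach: "base \<in> reach"
  by (simp add: reach_def)

lemma ip_delta: "ip (indicator {a}) (indicator {a}) = (1 :: real)"
  unfolding ip_self by (subst infsum_fin_supp[of "{a}"]) auto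

lemma tests_base: "indicator {base} \<in> tests"
  using base_in_reach by (auto simp: tests_def indicator_def)

lemma energies_nonempty: "energy ` {f \<in> tests. ip f f = 1} \<noteq> {}"
proof -
  have "indicator {base} \<in> {f \<in> tests. ip f f = 1}" using tests_base ip_delta[of base] by simp
  then show ?thesis by blast
qed

lemma bdd_above_energy: "bdd_above (energy ` {f \<in> tests. ip f f = 1})"
  by (rule bdd_aboveI[of _ v]) (auto dest: energy_le[OF tests_fin_supp])

lemma energy_le_top:
  assumes "f \<in> tests"
  shows "energy f \<le> top * ip f f"
proof (cases "ip f f = 0")
  case True
  then show ?thesis using energy_le[OF tests_fin_supp[OF assms]] by simp
next
  case False
  then have pos: "ip f f > 0" using ip_self_nonneg[of f] by linarith
  define c where "c = 1 / sqrt (ip f f)"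
  have c2: "c\<^sup>2 = 1 / ip f f" using pos by (simp add: c_def power_divide)
  have "ip (\<lambda>s. c * f s) (\<lambda>s. c * f s) = 1"
    using pos c2 by (simp add: ip_cmult ip_cmult_right power2_eq_square[symmetric] mult.assoc[symmetric])
  then have "energy (\<lambda>s. c * f s) \<le> top"
    unfolding top_def using assms by (intro cSup_upper bdd_above_energy) (auto intro: tests_cmult)
  then show ?thesis using pos by (simp add: energy_cmult c2 field_simps)
qed

lemma top_le:
  assumes "\<And>f. f \<in> tests \<Longrightarrow> energy f \<le> L * ip f f"
  shows "top \<le> L"
  unfolding top_def
  by (rule cSup_least[OF energies_nonempty]) (use assms in fastforce)

lemma less_top_obtains:
  assumes "L < top"
  obtains f where "f \<in> tests" "\<And>s. f s \<ge> 0" "ip f f = 1" "energy f > L"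
proof -
  from less_cSupE[OF assms[unfolded top_def] energies_nonempty] obtain f where
    f: "f \<in> tests" "ip f f = 1" "energy f > L" by auto
  show thesis
  proof (rule that[of "\<lambda>s. \<bar>f s\<bar>"])
    show "ip (\<lambda>s. \<bar>f s\<bar>) (\<lambda>s. \<bar>f s\<bar>) = 1" using f by (simp add: ip_self)
    show "energy (\<lambda>s. \<bar>f s\<bar>) > L" using f energy_abs[OF tests_fin_supp] by fastforce
  qed (use f tests_abs in auto)
qed

lemma hop_nonneg: "(\<And>s. 0 \<le> f s) \<Longrightarrow> 0 \<le> hop f s"
  unfolding hop_def adj_at_def
  by (intro add_nonneg_nonneg mult_nonneg_nonneg sum_nonneg V_nonneg rate_nonneg)

lemma hop_mono: "(\<And>s. f s \<le> g s) \<Longrightarrow> hop f s \<le> hop g s"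
  unfolding hop_def by (intro add_mono mult_left_mono sum_mono adj_at_mono V_nonneg rate_nonneg)

lemma hop_power_nonneg: "(\<And>s. 0 \<le> f s) \<Longrightarrow> 0 \<le> (hop ^^ k) f s"
  by (induction k arbitrary: s) (auto intro: hop_nonneg)

lemma hop_cmult: "hop (\<lambda>s. c * f s) s = c * hop f s"
  by (simp add: hop_def adj_at_cmult sum_distrib_left algebra_simps)

lemma hop_add: "hop (\<lambda>s. f s + g s) s = hop f s + hop g s"
  by (simp add: hop_def adj_at_add sum.distrib algebra_simps)

lemma hop_diff: "hop (\<lambda>s. f s - g s) s = hop f s - hop g s"
  using hop_add[of f "\<lambda>s. (-1) * g s" s] hop_cmult[of "-1" g s] by simp

lemma ip_hop_sym:
  assumes "fin_supp f"
  shows "ip f (hop g) = ip (hop f) g"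
proof -
  have "ip f (hop g) = ip f (\<lambda>s. V s * g s) + (\<Sum>i\<in>I. \<nu> i * ip f (adj_at i g))"
    if "fin_supp f" for f g
  proof -
    have "ip f (\<lambda>s. \<Sum>i\<in>I. \<nu> i * adj_at i g s) = (\<Sum>i\<in>I. \<nu> i * ip f (adj_at i g))"
      unfolding ip_def sum_distrib_left using that
      by (subst infsum_sum_fin[OF fin_I])
        (auto intro!: fin_supp_intros simp: mult.left_commute infsum_cmult_fin[symmetric])
    then show ?thesis unfolding hop_def[abs_def] by (simp add: ip_add_right[OF that])
  qed
  moreover have "ip (hop f) g = ip (\<lambda>s. V s * f s) g + (\<Sum>i\<in>I. \<nu> i * ip (adj_at i f) g)"
  proof -
    have "ip (\<lambda>s. \<Sum>i\<in>I. \<nu> i * adj_at i f s) g = (\<Sum>i\<in>I. \<nu> i * ip (adj_at i f) g)"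
      unfolding ip_def sum_distrib_right using assms
      by (subst infsum_sum_fin[OF fin_I])
        (auto intro!: fin_supp_intros fin_supp_adj_at simp: mult.assoc infsum_cmult_fin[symmetric])
    then show ?thesis unfolding hop_def[abs_def] using assms
      by (subst ip_add) (auto intro!: fin_supp_intros fin_supp_sum fin_I fin_supp_adj_at)
  qed
  moreover have "ip f (\<lambda>s. V s * g s) = ip (\<lambda>s. V s * f s) g"
    by (simp add: ip_def mult_ac)
  ultimately show ?thesis using assms by (simp add: ip_adj_at)
qed

text \<open>Since \<open>hop\<close> preserves positivity, |hop f| \<le> hop |f|. The form is thus
  largest in absolute value at nonnegative functions, and the upper bound by \<open>top\<close>
  controls it from below as well.\<close>

lemma ip_hop_le:
  assumes "f \<in> tests"
  shows "\<bar>ip f (hop f)\<bar> \<le> (top + speed) * ip f f"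
proof -
  let ?f = "\<lambda>s. \<bar>f s\<bar>"
  have f: "fin_supp f" using assms by (rule tests_fin_supp)
  have le: "\<bar>hop f s\<bar> \<le> hop ?f s" for s
    unfolding abs_le_iff using hop_mono[of f ?f s] hop_mono[of "\<lambda>s. (-1) * f s" ?f s] hop_cmult[of "-1" f s]
    by auto
  have le: "\<bar>f s * hop f s\<bar> \<le> ?f s * hop ?f s" for s
    unfolding abs_mult by (intro mult_left_mono le) auto
  have "ip f (hop f) \<le> ip ?f (hop ?f)"
    unfolding ip_def using le f by (intro infsum_mono_fin fin_supp_intros) (auto simp: abs_le_iff)
  moreover have "- ip f (hop f) \<le> ip ?f (hop ?f)"
    unfolding ip_def infsum_uminus[symmetric] using le f
    by (intro infsum_mono_fin) (auto simp: abs_le_iff fin_supp_intros)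
  ultimately have "\<bar>ip f (hop f)\<bar> \<le> ip ?f (hop ?f)" by (simp add: abs_le_iff)
  also have "\<dots> = energy ?f + speed * ip ?f ?f"
    by (intro ip_hop fin_supp_intros f)
  also have "\<dots> \<le> (top + speed) * ip ?f ?f"
    using energy_le_top[OF tests_abs[OF assms]] by (simp add: algebra_simps)
  finally show ?thesis by (simp add: ip_self)
qed

lemma top_plus_speed_nonneg: "0 \<le> top + speed"
  using ip_hop_le[OF tests_base] by (simp add: ip_delta)

text \<open>The norm of a symmetric operator is governed by its quadratic form: polarisation bounds
  \<open>ip f (hop g)\<close> for all \<open>f\<close>, and \<open>f\<close> is then taken parallel
  to \<open>hop g\<close>.\<close>

lemma hop_norm_le:
  assumes g: "g \<in> tests" and \<beta>: "top + speed \<le> \<beta>" "0 < \<beta>"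
  shows "ip (hop g) (hop g) \<le> \<beta>\<^sup>2 * ip g g"
proof -
  have polar: "ip f (hop g) \<le> \<beta> / 2 * (ip f f + ip g g)" if f: "f \<in> tests" for f
  proof -
    note fs = tests_fin_supp[OF f] tests_fin_supp[OF g]
    have gh: "fin_supp (hop f)" "fin_supp (hop g)"
      using tests_hop[OF f] tests_hop[OF g] by (auto simp: tests_def)
    have hop_a: "hop (\<lambda>s. f s + g s) = (\<lambda>s. hop f s + hop g s)" "hop (\<lambda>s. f s - g s) = (\<lambda>s. hop f s - hop g s)"
      by (auto simp: hop_add hop_diff)
    have exp: "ip (\<lambda>s. f s + g s) (hop (\<lambda>s. f s + g s)) = ip f (hop f) + ip f (hop g) + ip g (hop f) + ip g (hop g)"
      "ip (\<lambda>s. f s - g s) (hop (\<lambda>s. f s - g s)) = ip f (hop f) - ip f (hop g) - ip g (hop f) + ip g (hop g)"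
      unfolding hop_a by (simp_all add: ip_add ip_diff ip_add_right ip_diff_right fs)
    have exp2: "ip (\<lambda>s. f s + g s) (\<lambda>s. f s + g s) = ip f f + ip f g + ip g f + ip g g"
      "ip (\<lambda>s. f s - g s) (\<lambda>s. f s - g s) = ip f f - ip f g - ip g f + ip g g"
      by (simp_all add: ip_add ip_diff ip_add_right ip_diff_right fs)
    have "ip g (hop f) = ip f (hop g)" using ip_hop_sym[OF fs(2), of f] by (simp add: ip_sym)
    then have "4 * ip f (hop g) = ip (\<lambda>s. f s + g s) (hop (\<lambda>s. f s + g s)) - ip (\<lambda>s. f s - g s) (hop (\<lambda>s. f s - g s))"
      by (simp add: exp)
    also have "\<dots> \<le> (top + speed) * ip (\<lambda>s. f s + g s) (\<lambda>s. f s + g s) + (top + speed) * ip (\<lambda>s. f s - g s) (\<lambda>s. f s - g s)"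
      using ip_hop_le[OF tests_add[OF f g]] ip_hop_le[OF tests_diff[OF f g]] by (simp add: abs_le_iff)
    also have "\<dots> = (top + speed) * (2 * (ip f f + ip g g))"
      unfolding exp2 by (simp add: algebra_simps)
    also have "\<dots> \<le> \<beta> * (2 * (ip f f + ip g g))"
      using \<beta> ip_self_nonneg[of f] ip_self_nonneg[of g] by (intro mult_right_mono) auto
    finally show ?thesis by (simp add: algebra_simps)
  qed
  \<comment> \<open>Polarisation with f = hop g / \<beta>; this scaling lets half of the left side
    be absorbed.\<close>
  have "ip (hop g) (hop g) / \<beta> \<le> \<beta> / 2 * (ip (hop g) (hop g) / \<beta>\<^sup>2 + ip g g)"
  proof -
    have "ip (\<lambda>s. (1 / \<beta>) * hop g s) (hop g) = ip (hop g) (hop g) / \<beta>"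
      "ip (\<lambda>s. (1 / \<beta>) * hop g s) (\<lambda>s. (1 / \<beta>) * hop g s) = ip (hop g) (hop g) / \<beta>\<^sup>2"
      unfolding ip_cmult ip_cmult_right by (simp_all add: power2_eq_square)
    then show ?thesis using polar[OF tests_cmult[OF tests_hop[OF g]], of "1 / \<beta>"] by simp
  qed
  then show ?thesis using \<beta> by (simp add: field_simps power2_eq_square)
qed

lemma hop_power_norm_le:
  assumes g: "g \<in> tests" and \<beta>: "top + speed \<le> \<beta>" "0 < \<beta>"
  shows "ip ((hop ^^ k) g) ((hop ^^ k) g) \<le> (\<beta> ^ k)\<^sup>2 * ip g g"
proof (induction k)
  case (Suc k)
  have "ip ((hop ^^ Suc k) g) ((hop ^^ Suc k) g) \<le> \<beta>\<^sup>2 * ip ((hop ^^ k) g) ((hop ^^ k) g)"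
    using hop_norm_le[OF tests_hop_power[OF g] \<beta>] by simp
  also have "\<dots> \<le> \<beta>\<^sup>2 * ((\<beta> ^ k)\<^sup>2 * ip g g)"
    by (intro mult_left_mono Suc) auto
  finally show ?case by (simp add: power_mult_distrib mult_ac)
qed simp

lemma ip_hop_power_le:
  assumes "fin_supp f" "g \<in> tests" "top + speed \<le> \<beta>" "0 < \<beta>"
  shows "ip f ((hop ^^ k) g) \<le> \<beta> ^ k * (sqrt (ip f f) * sqrt (ip g g))"
proof -
  have "ip f ((hop ^^ k) g) \<le> sqrt (ip f f) * sqrt (ip ((hop ^^ k) g) ((hop ^^ k) g))"
    using assms tests_hop_power[of g k] by (intro ip_Cauchy_Schwarz) (auto simp: tests_def)
  also have "\<dots> \<le> sqrt (ip f f) * sqrt ((\<beta> ^ k)\<^sup>2 * ip g g)"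
    using assms by (intro mult_left_mono real_sqrt_le_mono hop_power_norm_le) (auto simp: ip_self_nonneg)
  also have "\<dots> = \<beta> ^ k * (sqrt (ip f f) * sqrt (ip g g))"
    using assms by (simp add: real_sqrt_mult)
  finally show ?thesis .
qed

text \<open>One explicit Euler step for exp (h hop). It is symmetric and preserves positivity, and
  its powers bound the discretised Feynman-Kac operator from below.\<close>

definition euler :: "real \<Rightarrow> ((nat \<Rightarrow> int ^ 'd) \<Rightarrow> real) \<Rightarrow> (nat \<Rightarrow> int ^ 'd) \<Rightarrow> real" where
  "euler h f s = f s + h * hop f s"

lemma tests_euler: "f \<in> tests \<Longrightarrow> euler h f \<in> tests"
  unfolding euler_def[abs_def] by (intro tests_add tests_cmult tests_hop)

lemma tests_euler_power: "f \<in> tests \<Longrightarrow> (euler h ^^ k) f \<in> tests"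
  by (induction k) (auto intro: tests_euler)

lemma euler_nonneg: "h \<ge> 0 \<Longrightarrow> (\<And>s. 0 \<le> f s) \<Longrightarrow> 0 \<le> euler h f s"
  unfolding euler_def by (intro add_nonneg_nonneg mult_nonneg_nonneg hop_nonneg)

lemma euler_power_nonneg: "h \<ge> 0 \<Longrightarrow> (\<And>s. 0 \<le> f s) \<Longrightarrow> 0 \<le> (euler h ^^ k) f s"
  by (induction k arbitrary: s) (auto intro: euler_nonneg)

lemma ip_euler_sym: "f \<in> tests \<Longrightarrow> ip f (euler h g) = ip (euler h f) g"
  unfolding euler_def[abs_def] using tests_hop[of f]
  by (simp add: ip_add_right ip_cmult_right ip_add ip_cmult tests_fin_supp fin_supp_intros ip_hop_sym)

lemma ip_euler_power_sym: "f \<in> tests \<Longrightarrow> ip f ((euler h ^^ k) g) = ip ((euler h ^^ k) f) g"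
proof (induction k arbitrary: f)
  case (Suc k)
  have "ip f ((euler h ^^ Suc k) g) = ip ((euler h ^^ k) (euler h f)) g"
    using Suc by (simp add: ip_euler_sym tests_euler)
  then show ?case by (simp add: funpow_swap1)
qed simp

text \<open>Cauchy--Schwarz in the form \<open>\<langle>f, S\<^sup>m f\<rangle>\<^sup>2 \<le> \<langle>f, S\<^sup>2\<^sup>m f\<rangle>\<close> replaces the spectral theorem.\<close>

lemma ip_euler_power_ge:
  assumes f: "f \<in> tests" "\<And>s. f s \<ge> 0" "ip f f = 1" and h: "h \<ge> 0"
  shows "(1 + h * (energy f + speed)) ^ (2 ^ k) \<le> ip f ((euler h ^^ (2 ^ k)) f)"
proof (induction k)
  case 0
  have "ip f (euler h f) = 1 + h * ip f (hop f)"
    unfolding euler_def[abs_def] using f by (simp add: ip_add_right ip_cmult_right tests_fin_supp)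
  then show ?case using f by (simp add: ip_hop tests_fin_supp)
next
  case (Suc k)
  let ?m = "2 ^ k" and ?a = "1 + h * (energy f + speed)"
  \<comment> \<open>Allows the induction hypothesis to be squared; it rests on \<open>f\<close>
    being nonnegative.\<close>
  have nn: "0 \<le> ?a"
  proof -
    have "0 \<le> ip f (hop f)" unfolding ip_def by (intro infsum_nonneg mult_nonneg_nonneg hop_nonneg f)
    then show ?thesis using h f by (simp add: ip_hop tests_fin_supp)
  qed
  have "?a ^ 2 ^ Suc k = (?a ^ ?m)\<^sup>2" by (simp add: power_mult[symmetric] mult.commute)
  also have "\<dots> \<le> (ip f ((euler h ^^ ?m) f))\<^sup>2"
    using Suc nn by (intro power_mono) auto
  also have "\<dots> \<le> ip f f * ip ((euler h ^^ ?m) f) ((euler h ^^ ?m) f)"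
    using f by (intro ip_Cauchy_Schwarz_square tests_fin_supp tests_euler_power)
  also have "\<dots> = ip f ((euler h ^^ ?m) ((euler h ^^ ?m) f))"
    using f by (simp add: ip_euler_power_sym)
  also have "\<dots> = ip f ((euler h ^^ 2 ^ Suc k) f)"
    by (simp add: funpow_add mult_2)
  finally show ?case .
qed

end

section \<open>Growth of the discretised moments\<close>

lemma nn_integral_count_space_le:
  fixes f :: "'a \<Rightarrow> ennreal"
  assumes A: "countable A" and le: "\<And>B. finite B \<Longrightarrow> B \<subseteq> A \<Longrightarrow> sum f B \<le> c"
  shows "(\<integral>\<^sup>+x. f x \<partial>count_space A) \<le> c"
proof (cases "finite A")
  case True
  then show ?thesis using le[OF True] by (simp add: nn_integral_count_space_finite)
next
  case False
  note b = bij_betw_from_nat_into[OF A False]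
  have "(\<integral>\<^sup>+x. f x \<partial>count_space A) = (\<Sum>n. f (from_nat_into A n))"
    using nn_integral_bij_count_space[OF b, of f] by (simp add: nn_integral_count_space_nat)
  also have "\<dots> \<le> c"
  proof (rule suminf_le_const)
    fix N
    have "(\<Sum>n<N. f (from_nat_into A n)) = sum f (from_nat_into A ` {..<N})"
      using b by (subst sum.reindex) (auto simp: bij_betw_def inj_on_def)
    also have "\<dots> \<le> c" using b by (intro le) (auto simp: bij_betw_def)
    finally show "(\<Sum>n<N. f (from_nat_into A n)) \<le> c" .
  qed simp
  finally show ?thesis .
qed

text \<open>A finite set of functions lies in a finite product set, over which the sum of products
  factorises.\<close>

lemma sum_prod_PiE_le:
  fixes f :: "'b \<Rightarrow> real"
  assumes K: "finite K" and f: "\<And>z. 0 \<le> f z" "\<And>Z. finite Z \<Longrightarrow> sum f Z \<le> T"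
    and B: "finite B" "B \<subseteq> PiE K (\<lambda>_. UNIV)"
  shows "(\<Sum>y\<in>B. \<Prod>k\<in>K. f (y k)) \<le> T ^ card K"
proof -
  define Z where "Z = (\<Union>y\<in>B. y ` K)"
  have Z: "finite Z" using K B by (auto simp: Z_def)
  have BZ: "B \<subseteq> PiE K (\<lambda>_. Z)"
  proof
    fix y assume "y \<in> B"
    then show "y \<in> PiE K (\<lambda>_. Z)" using B(2) by (auto simp: Z_def PiE_iff)
  qed
  have "(\<Sum>y\<in>B. \<Prod>k\<in>K. f (y k)) \<le> (\<Sum>y\<in>PiE K (\<lambda>_. Z). \<Prod>k\<in>K. f (y k))"
    using Z K f by (intro sum_mono2 BZ finite_PiE prod_nonneg) auto
  also have "\<dots> = (\<Prod>k\<in>K. \<Sum>z\<in>Z. f z)"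
    using Z K by (intro prod_sum_PiE[symmetric]) auto
  also have "\<dots> \<le> (\<Prod>k\<in>K. T)"
    using f Z by (intro prod_mono conjI sum_nonneg) auto
  finally show ?thesis by simp
qed

section \<open>Exponential weights and the growth of path sums\<close>

definition site_norm :: "int ^ 'd \<Rightarrow> real" where
  "site_norm z = (\<Sum>i\<in>UNIV. \<bar>real_of_int (z $ i)\<bar>)"

lemma site_norm_step: "v \<in> steps \<Longrightarrow> site_norm (z + v) \<le> site_norm z + 1" "v \<in> steps \<Longrightarrow> site_norm z \<le> site_norm (z + v) + 1"
proof -
  assume "v \<in> steps"
  then have v: "(\<Sum>i\<in>UNIV. \<bar>real_of_int (v $ i)\<bar>) = 1"
    unfolding steps_def neighbours_def by (simp flip: of_int_abs of_int_sum)
  have "site_norm (z + v) \<le> (\<Sum>i\<in>UNIV. \<bar>real_of_int (z $ i)\<bar> + \<bar>real_of_int (v $ i)\<bar>)"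
    unfolding site_norm_def by (intro sum_mono) auto
  then show "site_norm (z + v) \<le> site_norm z + 1" using v by (simp add: sum.distrib site_norm_def)
  have "site_norm z \<le> (\<Sum>i\<in>UNIV. \<bar>real_of_int ((z + v) $ i)\<bar> + \<bar>real_of_int (v $ i)\<bar>)"
    unfolding site_norm_def by (intro sum_mono) auto
  then show "site_norm z \<le> site_norm (z + v) + 1" using v by (simp add: sum.distrib site_norm_def)
qed

lemma sum_geometric_le:
  assumes q: "0 < q" "q < 1" and "finite (A :: int set)"
  shows "(\<Sum>m\<in>A. q ^ nat \<bar>m\<bar>) \<le> 2 / (1 - q :: real)"
proof -
  define N where "N = Suc (Max (insert 0 ((\<lambda>m. nat \<bar>m\<bar>) ` A)))"
  have sub: "A \<subseteq> int ` {..<N} \<union> (\<lambda>k. - int k) ` {..<N}"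
  proof
    fix m assume "m \<in> A"
    then have "nat \<bar>m\<bar> < N" using assms(3) by (auto simp: N_def less_Suc_eq_le)
    then show "m \<in> int ` {..<N} \<union> (\<lambda>k. - int k) ` {..<N}"
      by (cases "m \<ge> 0") (auto simp: image_iff intro: bexI[of _ "nat \<bar>m\<bar>"])
  qed
  have "(\<Sum>m\<in>A. q ^ nat \<bar>m\<bar>) \<le> (\<Sum>m\<in>int ` {..<N} \<union> (\<lambda>k. - int k) ` {..<N}. q ^ nat \<bar>m\<bar>)"
    using sub q by (intro sum_mono2) auto
  also have "\<dots> \<le> (\<Sum>m\<in>int ` {..<N}. q ^ nat \<bar>m\<bar>) + (\<Sum>m\<in>(\<lambda>k. - int k) ` {..<N}. q ^ nat \<bar>m\<bar>)"
    using q by (simp add: sum_Un sum_nonneg)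
  also have "\<dots> = 2 * (\<Sum>k<N. q ^ k)"
    by (subst (1 2) sum.reindex) (auto simp: inj_on_def)
  also have "(\<Sum>k<N. q ^ k) \<le> 1 / (1 - q)"
    using q by (simp add: sum_gp_strict divide_right_mono)
  finally show ?thesis by simp
qed

text \<open>The exponential of the l1 norm is a product over coordinates, so d geometric series are
  multiplied.\<close>

lemma sum_exp_site_norm_le:
  assumes "\<epsilon> > 0"
  shows "\<exists>T\<ge>0. \<forall>Z :: (int ^ 'd) set. finite Z \<longrightarrow> (\<Sum>z\<in>Z. exp (- \<epsilon> * site_norm z)) \<le> T"
proof (intro exI conjI allI impI)
  define q where "q = exp (- \<epsilon>)"
  have q: "0 < q" "q < 1" using assms by (auto simp: q_def)
  show "0 \<le> (2 / (1 - q)) ^ CARD('d)" using q by simp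
  fix Z :: "(int ^ 'd) set" assume Z: "finite Z"
  have "exp (- \<epsilon> * site_norm z) = (\<Prod>i\<in>UNIV. q ^ nat \<bar>z $ i\<bar>)" for z :: "int ^ 'd"
  proof -
    have "q ^ nat \<bar>m\<bar> = exp (- \<epsilon> * \<bar>real_of_int m\<bar>)" for m :: int
      by (simp add: q_def exp_of_nat_mult[symmetric] mult.commute)
    then show ?thesis by (simp add: site_norm_def exp_sum[symmetric] sum_distrib_left)
  qed
  then have "(\<Sum>z\<in>Z. exp (- \<epsilon> * site_norm z)) = (\<Sum>y\<in>vec_nth ` Z. \<Prod>i\<in>UNIV. q ^ nat \<bar>y i\<bar>)"
    by (subst sum.reindex) (auto simp: inj_on_def vec_nth_inject)
  also have "\<dots> \<le> (2 / (1 - q)) ^ CARD('d)"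
    using q Z by (intro sum_prod_PiE_le sum_geometric_le) auto
  finally show "(\<Sum>z\<in>Z. exp (- \<epsilon> * site_norm z)) \<le> (2 / (1 - q)) ^ CARD('d)" .
qed

text \<open>The catalysts have indices \<open>1, \<dots>, n\<close>, the \<open>p\<close> replicas of the reactant have indices
  \<open>n + 1, \<dots>, n + p\<close>; a configuration assigns a site to every index.\<close>

locale catalysts =
  fixes n p :: nat and \<kappa> \<rho> :: real and x :: "int ^ 'd"
  assumes rates_nonneg: "\<kappa> \<ge> 0" "\<rho> \<ge> 0"
begin

definition K :: "nat set" where "K = {1..n}"
definition J :: "nat set" where "J = {n+1..n+p}"
definition idx :: "nat list" where "idx = [1..<n+p+1]"
definition rates :: "nat \<Rightarrow> real" where "rates i = (if i \<in> K then \<rho> else if i \<in> J then \<kappa> else 0)"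
definition start :: "nat \<Rightarrow> int ^ 'd" where "start i = (if i \<in> J then x else 0)"
definition pot :: "(nat \<Rightarrow> int ^ 'd) \<Rightarrow> real" where "pot s = (\<Sum>j\<in>J. \<Sum>k\<in>K. indicator {s k} (s j))"

lemma finite_KJ: "finite K" "finite J" and KJ_disjoint: "K \<inter> J = {}"
  and set_idx: "set idx = K \<union> J" and distinct_idx: "distinct idx"
  by (auto simp: K_def J_def idx_def)

sublocale walkers rates "K \<union> J" pot "real (n * p)" start
proof
  show "pot s \<le> real (n * p)" for s
  proof -
    have "pot s \<le> (\<Sum>j\<in>J. \<Sum>k\<in>K. 1)"
      unfolding pot_def by (intro sum_mono) (auto simp: indicator_def)
    then show ?thesis by (simp add: J_def K_def mult.commute)
  qed
qed (auto simp: finite_KJ rates_def rates_nonneg pot_def intro!: sum_nonneg)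

text \<open>Catalyst time 0: the catalysts are at the origin, while the replicas, which run
  backwards in catalyst time, are at the free ends of their paths, where the solution equals
  1.\<close>

definition init :: "(nat \<Rightarrow> int ^ 'd) \<Rightarrow> real" where
  "init s = (if \<forall>k\<in>K. s k = 0 then 1 else 0)"

text \<open>The final time: the catalysts may be anywhere, the replicas are at their starting
  site.\<close>

definition cfg :: "(nat \<Rightarrow> int ^ 'd) \<Rightarrow> nat \<Rightarrow> int ^ 'd" where
  "cfg y i = (if i \<in> K then y i else start i)"

text \<open>It decays in the replicas, over which \<open>init\<close> is constant; its inverse
  decays in the catalysts, over which the final functional is constant. Hence the opposite
  signs.\<close>

definition wt :: "real \<Rightarrow> (nat \<Rightarrow> int ^ 'd) \<Rightarrow> real" where
  "wt \<epsilon> s = exp (\<epsilon> * ((\<Sum>k\<in>K. site_norm (s k)) - (\<Sum>j\<in>J. site_norm (s j))))"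

lemma wt_pos: "wt \<epsilon> s > 0" by (simp add: wt_def)

lemma wt_shift:
  assumes "\<epsilon> \<ge> 0" "a \<in> steps"
  shows "wt \<epsilon> s \<le> exp \<epsilon> * wt \<epsilon> (shift_at i a s)"
proof -
  let ?s = "shift_at i a s"
  have aux: "(\<Sum>k\<in>A. site_norm (?s k)) = (\<Sum>k\<in>A. site_norm (s k)) + (if i \<in> A then site_norm (s i + a) - site_norm (s i) else 0)"
    if "finite A" for A
  proof -
    have "(\<Sum>k\<in>A. site_norm (?s k)) = (\<Sum>k\<in>A. site_norm (s k) + (if k = i then site_norm (s i + a) - site_norm (s i) else 0))"
      by (intro sum.cong) auto
    then show ?thesis using that by (simp add: sum.distrib)
  qed
  have "(\<Sum>k\<in>K. site_norm (s k)) - (\<Sum>j\<in>J. site_norm (s j)) \<le> 1 + ((\<Sum>k\<in>K. site_norm (?s k)) - (\<Sum>j\<in>J. site_norm (?s j)))"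
    unfolding aux[OF finite_KJ(1)] aux[OF finite_KJ(2)]
    using KJ_disjoint site_norm_step[OF assms(2), of "s i"] by auto
  then have "\<epsilon> * ((\<Sum>k\<in>K. site_norm (s k)) - (\<Sum>j\<in>J. site_norm (s j))) \<le>
      \<epsilon> * (1 + ((\<Sum>k\<in>K. site_norm (?s k)) - (\<Sum>j\<in>J. site_norm (?s j))))"
    using assms(1) by (rule mult_left_mono)
  then show ?thesis
    unfolding wt_def exp_add[symmetric] exp_le_cancel_iff by (simp add: distrib_left)
qed

lemma wt_hop_le:
  assumes "\<epsilon> \<ge> 0" "\<And>s. 0 \<le> g s"
  shows "wt \<epsilon> s * hop g s \<le> exp \<epsilon> * hop (\<lambda>s. wt \<epsilon> s * g s) s"
proof -
  have 1: "wt \<epsilon> s * adj_at i g s \<le> exp \<epsilon> * adj_at i (\<lambda>s. wt \<epsilon> s * g s) s" for i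
    unfolding adj_at_def sum_distrib_left mult.assoc[symmetric]
    by (intro sum_mono mult_right_mono wt_shift assms)
  have "wt \<epsilon> s * hop g s = pot s * (wt \<epsilon> s * g s) + (\<Sum>i\<in>K \<union> J. rates i * (wt \<epsilon> s * adj_at i g s))"
    by (simp add: hop_def distrib_left sum_distrib_left mult_ac)
  also have "\<dots> \<le> exp \<epsilon> * (pot s * (wt \<epsilon> s * g s)) + (\<Sum>i\<in>K \<union> J. rates i * (exp \<epsilon> * adj_at i (\<lambda>s. wt \<epsilon> s * g s) s))"
  proof (intro add_mono sum_mono mult_left_mono 1 rate_nonneg)
    have "0 \<le> pot s * (wt \<epsilon> s * g s)"
      using assms wt_pos[of \<epsilon> s] V_nonneg[of s] by (intro mult_nonneg_nonneg) auto
    then show "pot s * (wt \<epsilon> s * g s) \<le> exp \<epsilon> * (pot s * (wt \<epsilon> s * g s))"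
      using assms(1) mult_right_mono[of 1 "exp \<epsilon>" "pot s * (wt \<epsilon> s * g s)"] by simp
  qed
  also have "\<dots> = exp \<epsilon> * hop (\<lambda>s. wt \<epsilon> s * g s) s"
    by (simp add: hop_def distrib_left sum_distrib_left mult_ac)
  finally show ?thesis .
qed

lemma wt_hop_power_le:
  assumes "\<epsilon> \<ge> 0" "\<And>s. 0 \<le> g s"
  shows "wt \<epsilon> s * (hop ^^ k) g s \<le> exp \<epsilon> ^ k * (hop ^^ k) (\<lambda>s. wt \<epsilon> s * g s) s"
proof (induction k arbitrary: s)
  case (Suc k)
  have "wt \<epsilon> s * (hop ^^ Suc k) g s \<le> exp \<epsilon> * hop (\<lambda>s. wt \<epsilon> s * (hop ^^ k) g s) s"
    using wt_hop_le[OF assms(1) hop_power_nonneg[OF assms(2)]] by simp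
  also have "\<dots> \<le> exp \<epsilon> * hop (\<lambda>s. exp \<epsilon> ^ k * (hop ^^ k) (\<lambda>s. wt \<epsilon> s * g s) s) s"
    by (intro mult_left_mono hop_mono Suc) auto
  finally show ?case by (simp add: hop_cmult)
qed simp

text \<open>\<open>hop\<close> has finite range. This allows \<open>init\<close> to be cut off to a
  finitely supported function without changing the iterates at finitely many configurations.\<close>

lemma hop_power_local:
  assumes "s \<in> reach"
  shows "\<exists>A. finite A \<and> A \<subseteq> reach \<and> (\<forall>f g. (\<forall>s\<in>A. f s = g s) \<longrightarrow> (hop ^^ k) f s = (hop ^^ k) g s)"
  using assms
proof (induction k arbitrary: s)
  case 0
  then show ?case by (intro exI[of _ "{s}"]) auto
next
  case (Suc k)
  then have "\<exists>A. \<forall>s\<in>reach. finite (A s) \<and> A s \<subseteq> reach \<and> (\<forall>f g. (\<forall>s\<in>A s. f s = g s) \<longrightarrow> (hop ^^ k) f s = (hop ^^ k) g s)"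
    by (intro bchoice) blast
  then obtain A where A: "\<And>s. s \<in> reach \<Longrightarrow> finite (A s)" "\<And>s. s \<in> reach \<Longrightarrow> A s \<subseteq> reach"
    "\<And>s f g. s \<in> reach \<Longrightarrow> (\<And>s'. s' \<in> A s \<Longrightarrow> f s' = g s') \<Longrightarrow> (hop ^^ k) f s = (hop ^^ k) g s"
    by metis
  let ?B = "A s \<union> (\<Union>i\<in>{i \<in> K \<union> J. rates i \<noteq> 0}. \<Union>a\<in>steps. A (shift_at i a s))"
  have sh: "shift_at i a s \<in> reach" if "i \<in> K \<union> J" "rates i \<noteq> 0" for i a
    using reach_shift[OF that] Suc.prems by blast
  show ?case
  proof (intro exI[of _ ?B] conjI allI impI)
    show "finite ?B" using A(1) sh Suc.prems finite_KJ finite_steps by auto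
    show "?B \<subseteq> reach" using A(2) sh Suc.prems by blast
    fix f g :: "(nat \<Rightarrow> int ^ 'd) \<Rightarrow> real" assume e: "\<forall>s\<in>?B. f s = g s"
    have 0: "(hop ^^ k) f s = (hop ^^ k) g s" using e Suc.prems by (intro A(3)) auto
    have 1: "rates i * adj_at i ((hop ^^ k) f) s = rates i * adj_at i ((hop ^^ k) g) s" if "i \<in> K \<union> J" for i
    proof (cases "rates i = 0")
      case False
      have "(hop ^^ k) f (shift_at i a s) = (hop ^^ k) g (shift_at i a s)" if a: "a \<in> steps" for a
        by (rule A(3)[OF sh[OF \<open>i \<in> K \<union> J\<close> False]]) (use e a False \<open>i \<in> K \<union> J\<close> in blast)
      then show ?thesis by (simp add: adj_at_def)
    qed simp
    show "(hop ^^ Suc k) f s = (hop ^^ Suc k) g s"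
      unfolding funpow.simps comp_def hop_def[of "(hop ^^ k) f"] hop_def[of "(hop ^^ k) g"] 0
      by (intro arg_cong2[of _ _ _ _ "(+)"] refl sum.cong 1)
  qed
qed

text \<open>A frozen catalyst away from the origin cannot have started there; hence final
  configurations outside \<open>reach\<close> contribute nothing.\<close>

lemma hop_power_init_unreachable:
  assumes "k \<in> K" "rates k = 0" "s k \<noteq> 0"
  shows "(hop ^^ m) init s = 0"
  using assms(3)
proof (induction m arbitrary: s)
  case 0
  then show ?case using assms by (auto simp: init_def)
next
  case (Suc m)
  have "rates i * adj_at i ((hop ^^ m) init) s = 0" for i
    using Suc assms by (cases "i = k") (auto simp: adj_at_def)
  then have "(\<Sum>i\<in>K \<union> J. rates i * adj_at i ((hop ^^ m) init) s) = 0" by (intro sum.neutral) blast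
  then show ?case using Suc by (simp add: hop_def[of "(hop ^^ m) init"])
qed

lemma cfg_reach: "(\<And>k. k \<in> K \<Longrightarrow> rates k = 0 \<Longrightarrow> y k = 0) \<Longrightarrow> cfg y \<in> reach"
  using KJ_disjoint by (auto simp: reach_def cfg_def start_def)

lemma init_nonneg: "0 \<le> init s" by (simp add: init_def)

lemma countable_PiE_K: "countable (PiE K (\<lambda>_. UNIV :: (int ^ 'd) set))"
  by (intro countable_PiE finite_KJ) auto

lemma inj_on_cfg: "inj_on cfg (PiE K (\<lambda>_. UNIV))"
proof (rule inj_onI)
  fix y y' assume *: "y \<in> PiE K (\<lambda>_. UNIV)" "y' \<in> PiE K (\<lambda>_. UNIV)" "cfg y = cfg y'"
  show "y = y'"
  proof (rule PiE_ext[OF *(1,2)])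
    fix k assume "k \<in> K"
    then show "y k = y' k" using fun_cong[OF *(3), of k] by (simp add: cfg_def)
  qed
qed

text \<open>The initial function and the final functional are not square summable; they become so after
  conjugation with the weight \<open>wt \<epsilon>\<close>, which changes the norm of the hopping operator by a factor
  of at most \<open>exp \<epsilon>\<close>.\<close>

lemma sum_hop_power_init_le:
  assumes \<epsilon>: "\<epsilon> > 0" and \<beta>: "top + speed \<le> \<beta>" "0 < \<beta>"
  shows "\<exists>C\<ge>0. \<forall>k B. finite B \<longrightarrow> B \<subseteq> PiE K (\<lambda>_. UNIV) \<longrightarrow>
    (\<Sum>y\<in>B. (hop ^^ k) init (cfg y)) \<le> C * (exp \<epsilon> * \<beta>) ^ k"
proof -
  from sum_exp_site_norm_le[of "2 * \<epsilon>"] \<epsilon> obtain T where T: "T \<ge> 0"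
    "\<And>Z :: (int ^ 'd) set. finite Z \<Longrightarrow> (\<Sum>z\<in>Z. exp (- (2 * \<epsilon>) * site_norm z)) \<le> T" by fastforce
  \<comment> \<open>Bounds for the squared norms of the two conjugated vectors. For
    \<open>C1\<close> the replicas are at \<open>x\<close> and the catalysts are summed over; for
    \<open>C2\<close> the catalysts are at 0 and the replicas are summed over.\<close>
  define C1 where "C1 = exp (2 * \<epsilon> * (\<Sum>j\<in>J. site_norm x)) * T ^ card K"
  define C2 where "C2 = T ^ card J"
  have C: "C1 \<ge> 0" "C2 \<ge> 0" using T by (auto simp: C1_def C2_def)
  have wt2: "(wt \<epsilon> s)\<^sup>2 = exp (2 * \<epsilon> * (\<Sum>k\<in>K. site_norm (s k))) * (\<Prod>j\<in>J. exp (- (2 * \<epsilon>) * site_norm (s j)))"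
    "(1 / wt \<epsilon> s)\<^sup>2 = exp (2 * \<epsilon> * (\<Sum>j\<in>J. site_norm (s j))) * (\<Prod>k\<in>K. exp (- (2 * \<epsilon>) * site_norm (s k)))" for s
  proof -
    have e: "(\<Prod>j\<in>A. exp (- (2 * \<epsilon>) * site_norm (s j))) = exp (- (2 * \<epsilon>) * (\<Sum>j\<in>A. site_norm (s j)))" if "finite A" for A
      using that by (simp add: exp_sum[symmetric] sum_distrib_left)
    show "(wt \<epsilon> s)\<^sup>2 = exp (2 * \<epsilon> * (\<Sum>k\<in>K. site_norm (s k))) * (\<Prod>j\<in>J. exp (- (2 * \<epsilon>) * site_norm (s j)))"
      unfolding e[OF finite_KJ(2)] wt_def by (simp add: exp_double[symmetric] exp_add[symmetric] algebra_simps)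
    have "(1 / wt \<epsilon> s)\<^sup>2 = exp (- (2 * (\<epsilon> * ((\<Sum>k\<in>K. site_norm (s k)) - (\<Sum>j\<in>J. site_norm (s j))))))"
      unfolding wt_def by (simp add: exp_minus exp_double power_divide inverse_eq_divide)
    then show "(1 / wt \<epsilon> s)\<^sup>2 = exp (2 * \<epsilon> * (\<Sum>j\<in>J. site_norm (s j))) * (\<Prod>k\<in>K. exp (- (2 * \<epsilon>) * site_norm (s k)))"
      unfolding e[OF finite_KJ(1)] by (simp add: exp_add[symmetric] algebra_simps)
  qed
  have "(\<Sum>y\<in>B. (hop ^^ k) init (cfg y)) \<le> sqrt C1 * sqrt C2 * (exp \<epsilon> * \<beta>) ^ k"
    if B: "finite B" "B \<subseteq> PiE K (\<lambda>_. UNIV)" for k B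
  proof -
    define B' where "B' = {y \<in> B. cfg y \<in> reach}"
    have B': "finite B'" "B' \<subseteq> PiE K (\<lambda>_. UNIV)" using B by (auto simp: B'_def)
    have inj: "inj_on cfg B'" using inj_on_cfg B'(2) by (rule inj_on_subset)
    have "\<exists>A. \<forall>s\<in>reach. finite (A s) \<and> A s \<subseteq> reach \<and> (\<forall>f g. (\<forall>s\<in>A s. f s = g s) \<longrightarrow> (hop ^^ k) f s = (hop ^^ k) g s)"
      by (intro bchoice ballI hop_power_local)
    then obtain A where A: "\<And>s. s \<in> reach \<Longrightarrow> finite (A s)" "\<And>s. s \<in> reach \<Longrightarrow> A s \<subseteq> reach"
      "\<And>s f g. s \<in> reach \<Longrightarrow> (\<And>s'. s' \<in> A s \<Longrightarrow> f s' = g s') \<Longrightarrow> (hop ^^ k) f s = (hop ^^ k) g s"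
      by metis
    define A' where "A' = (\<Union>y\<in>B'. A (cfg y))"
    have reach_B': "cfg y \<in> reach" if "y \<in> B'" for y using that by (simp add: B'_def)
    have A': "finite A'" using B' A(1) reach_B' by (auto simp: A'_def)
    have A'': "A' \<subseteq> reach" using A(2) reach_B' unfolding A'_def by blast
    note A' = A' A''
    \<comment> \<open>\<open>init\<close> cut off to the finitely many configurations that influence
      the values on \<open>B'\<close>.\<close>
    define g where "g s = (if s \<in> A' then init s else 0)" for s
    have g: "g \<in> tests" "\<And>s. 0 \<le> g s"
      using A' by (auto simp: tests_def g_def init_nonneg intro: finite_subset[of _ A'])
    \<comment> \<open>The final functional on \<open>B'\<close>, conjugated by the weight.\<close>
    define f where "f s = (if s \<in> cfg ` B' then 1 / wt \<epsilon> s else 0)" for s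
    have f: "fin_supp f" using B' by (auto simp: f_def intro: finite_subset[of _ "cfg ` B'"])
    let ?g = "\<lambda>s. wt \<epsilon> s * g s"
    have wg: "?g \<in> tests" using g(1) by (auto simp: tests_def fin_supp_intros)
    have "(\<Sum>y\<in>B. (hop ^^ k) init (cfg y)) = (\<Sum>y\<in>B'. (hop ^^ k) init (cfg y))"
    proof (rule sum.mono_neutral_right)
      show "\<forall>y\<in>B - B'. (hop ^^ k) init (cfg y) = 0"
      proof
        fix y assume "y \<in> B - B'"
        then have "cfg y \<notin> reach" by (auto simp: B'_def)
        then obtain m where "m \<in> K" "rates m = 0" "y m \<noteq> 0" using cfg_reach by blast
        then show "(hop ^^ k) init (cfg y) = 0"
          by (intro hop_power_init_unreachable[of m]) (auto simp: cfg_def)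
      qed
    qed (use B in \<open>auto simp: B'_def\<close>)
    also have "\<dots> = (\<Sum>y\<in>B'. (hop ^^ k) g (cfg y))"
      by (intro sum.cong refl A(3)) (auto simp: B'_def g_def A'_def)
    also have "\<dots> \<le> (\<Sum>y\<in>B'. exp \<epsilon> ^ k * (1 / wt \<epsilon> (cfg y) * (hop ^^ k) ?g (cfg y)))"
    proof (rule sum_mono)
      fix y
      have "wt \<epsilon> (cfg y) * (hop ^^ k) g (cfg y) \<le> exp \<epsilon> ^ k * (hop ^^ k) ?g (cfg y)"
        using \<epsilon> by (intro wt_hop_power_le g) auto
      then show "(hop ^^ k) g (cfg y) \<le> exp \<epsilon> ^ k * (1 / wt \<epsilon> (cfg y) * (hop ^^ k) ?g (cfg y))"
        using wt_pos[of \<epsilon> "cfg y"] by (simp add: field_simps)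
    qed
    also have "\<dots> = exp \<epsilon> ^ k * ip f ((hop ^^ k) ?g)"
    proof -
      have "ip f ((hop ^^ k) ?g) = (\<Sum>s\<in>cfg ` B'. f s * (hop ^^ k) ?g s)"
        unfolding ip_def using B' by (intro infsum_fin_supp) (auto simp: f_def)
      also have "\<dots> = (\<Sum>y\<in>B'. 1 / wt \<epsilon> (cfg y) * (hop ^^ k) ?g (cfg y))"
        by (subst sum.reindex[OF inj]) (auto simp: f_def)
      finally show ?thesis by (simp add: sum_distrib_left)
    qed
    also have "\<dots> \<le> exp \<epsilon> ^ k * (\<beta> ^ k * (sqrt (ip f f) * sqrt (ip ?g ?g)))"
      by (intro mult_left_mono ip_hop_power_le f wg \<beta>) auto
    also have "\<dots> \<le> exp \<epsilon> ^ k * (\<beta> ^ k * (sqrt C1 * sqrt C2))"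
    proof (intro mult_left_mono mult_mono real_sqrt_le_mono)
      have "ip f f = (\<Sum>y\<in>B'. (1 / wt \<epsilon> (cfg y))\<^sup>2)"
        unfolding ip_self using B' by (subst infsum_fin_supp[of "cfg ` B'"]) (auto simp: f_def sum.reindex[OF inj])
      also have "\<dots> = exp (2 * \<epsilon> * (\<Sum>j\<in>J. site_norm x)) * (\<Sum>y\<in>B'. \<Prod>k\<in>K. exp (- (2 * \<epsilon>) * site_norm (y k)))"
      proof -
        have "(\<Sum>j\<in>J. site_norm (cfg y j)) = (\<Sum>j\<in>J. site_norm x)" for y
          using KJ_disjoint by (intro sum.cong refl) (auto simp: cfg_def start_def)
        moreover have "(\<Prod>k\<in>K. exp (- (2 * \<epsilon>) * site_norm (cfg y k))) = (\<Prod>k\<in>K. exp (- (2 * \<epsilon>) * site_norm (y k)))" for y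
          by (intro prod.cong refl) (auto simp: cfg_def)
        ultimately show ?thesis unfolding wt2 by (simp only: sum_distrib_left)
      qed
      also have "\<dots> \<le> C1"
        unfolding C1_def using T B' finite_KJ by (intro mult_left_mono sum_prod_PiE_le) auto
      finally show "ip f f \<le> C1" .
      define A'' where "A'' = {s \<in> A'. init s = 1}"
      let ?r = "\<lambda>s. restrict s J"
      \<comment> \<open>The catalysts are at 0 by \<open>init\<close> and the coordinates that
        belong to no walker are fixed by \<open>reach\<close>, so the replicas determine the
        configuration.\<close>
      have inj: "inj_on ?r A''"
      proof (rule inj_onI)
        fix s s' assume *: "s \<in> A''" "s' \<in> A''" "?r s = ?r s'"
        show "s = s'"
        proof
          fix i
          consider "i \<in> K" | "i \<in> J" | "i \<notin> K \<union> J" by blast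
          then show "s i = s' i"
          proof cases
            case 1
            then show ?thesis using * by (auto simp: A''_def init_def split: if_splits)
          next
            case 2
            then show ?thesis using fun_cong[OF *(3), of i] by simp
          next
            case 3
            have "s \<in> reach" "s' \<in> reach" using * A'(2) by (auto simp: A''_def)
            then have "s i = start i" "s' i = start i" using 3 unfolding reach_def by blast+
            then show ?thesis by simp
          qed
        qed
      qed
      have "ip ?g ?g = (\<Sum>s\<in>A''. (wt \<epsilon> s)\<^sup>2)"
        unfolding ip_self using A'
        by (subst infsum_fin_supp[of A'']) (auto simp: g_def A''_def init_def split: if_splits)
      also have "\<dots> = (\<Sum>s\<in>A''. \<Prod>j\<in>J. exp (- (2 * \<epsilon>) * site_norm (?r s j)))"
      proof (rule sum.cong[OF refl])
        fix s assume "s \<in> A''"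
        then have "(\<Sum>k\<in>K. site_norm (s k)) = 0"
          by (intro sum.neutral) (auto simp: A''_def init_def site_norm_def split: if_splits)
        then show "(wt \<epsilon> s)\<^sup>2 = (\<Prod>j\<in>J. exp (- (2 * \<epsilon>) * site_norm (?r s j)))"
          unfolding wt2 by simp
      qed
      also have "\<dots> = (\<Sum>y\<in>?r ` A''. \<Prod>j\<in>J. exp (- (2 * \<epsilon>) * site_norm (y j)))"
        by (subst sum.reindex[OF inj]) simp
      also have "\<dots> \<le> C2"
        unfolding C2_def using T A' finite_KJ by (intro sum_prod_PiE_le) (auto simp: A''_def)
      finally show "ip ?g ?g \<le> C2" .
    qed (use \<beta> C in \<open>auto simp: ip_self_nonneg\<close>)
    finally show ?thesis by (simp add: power_mult_distrib mult_ac)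
  qed
  then show ?thesis using C by (intro exI[of _ "sqrt C1 * sqrt C2"]) auto
qed

end

section \<open>The discrete moment: a supersolution from above, Euler steps from below\<close>

lemma suminf_Suc_le: "(\<Sum>k. f (Suc k)) \<le> (\<Sum>k. f k :: ennreal)"
proof (rule suminf_le_const)
  fix m
  have "(\<Sum>k<m. f (Suc k)) \<le> (\<Sum>k<Suc m. f k)"
    unfolding sum.lessThan_Suc_shift by simp
  also have "\<dots> \<le> (\<Sum>k. f k)" by (intro sum_le_suminf) auto
  finally show "(\<Sum>k<m. f (Suc k)) \<le> (\<Sum>k. f k)" .
qed simp

context catalysts
begin

text \<open>One factor of a Trotter product: the free semigroup for time \<open>h\<close>, then
  multiplication by the exponential of the potential.\<close>

definition step_op :: "real \<Rightarrow> ((nat \<Rightarrow> int ^ 'd) \<Rightarrow> ennreal) \<Rightarrow> (nat \<Rightarrow> int ^ 'd) \<Rightarrow> ennreal" where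
  "step_op h g s = ennreal (exp (h * pot s)) * walk_ops rates h idx g s"

text \<open>The two factors of unit time without potential are buffers: they connect the boundary
  data with every reachable configuration before and after the time steps.\<close>

definition discrete_moment :: "nat \<Rightarrow> real \<Rightarrow> ennreal" where
  "discrete_moment N t = (\<integral>\<^sup>+y. walk_ops rates 1 idx
     ((step_op (t / N) ^^ N) (walk_ops rates 1 idx (\<lambda>s. ennreal (init s)))) (cfg y)
     \<partial>count_space (PiE K (\<lambda>_. UNIV)))"

lemma sum_idx: "(\<Sum>i\<leftarrow>idx. f i) = (\<Sum>i\<in>K \<union> J. f i)"
  using distinct_idx by (simp add: sum_list_distinct_conv_sum_set set_idx)

lemma speed_idx: "deg TYPE('d) * (\<Sum>i\<leftarrow>idx. rates i) = speed"
  by (simp add: speed_def sum_idx)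

lemma ennreal_hop:
  assumes "\<And>s. 0 \<le> f s"
  shows "ennreal (hop f s) = ennreal (pot s) * ennreal (f s) +
    (\<Sum>i\<leftarrow>idx. ennreal (rates i) * adj_at i (\<lambda>s. ennreal (f s)) s)"
proof -
  have "ennreal (rates i) * adj_at i (\<lambda>s. ennreal (f s)) s = ennreal (rates i * adj_at i f s)" for i
    unfolding adj_at_def using assms
    by (subst sum_ennreal) (auto simp: ennreal_mult rate_nonneg sum_nonneg)
  moreover have nn: "0 \<le> adj_at i f s" for i using assms by (simp add: adj_at_def sum_nonneg)
  ultimately have "(\<Sum>i\<leftarrow>idx. ennreal (rates i) * adj_at i (\<lambda>s. ennreal (f s)) s) = ennreal (\<Sum>i\<in>K \<union> J. rates i * adj_at i f s)"
    unfolding sum_idx by (simp add: sum_ennreal rate_nonneg)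
  moreover have "0 \<le> (\<Sum>i\<in>K \<union> J. rates i * adj_at i f s)"
    by (intro sum_nonneg mult_nonneg_nonneg rate_nonneg nn)
  ultimately show ?thesis
    using assms V_nonneg[of s] by (simp add: hop_def ennreal_mult)
qed

lemma step_op_mono: "(\<And>s. f s \<le> g s) \<Longrightarrow> step_op h f s \<le> step_op h g s"
  unfolding step_op_def by (intro mult_left_mono walk_ops_mono) auto

lemma step_op_cmult: "step_op h (\<lambda>s. c * f s) s = c * step_op h f s"
  by (simp add: step_op_def walk_ops_cmult mult.left_commute)

lemma step_op_power_mono: "(\<And>s. f s \<le> g s) \<Longrightarrow> (step_op h ^^ k) f s \<le> (step_op h ^^ k) g s"
  by (induction k arbitrary: s) (auto intro: step_op_mono)

lemma step_op_power_le:
  assumes "\<And>s. step_op h \<phi> s \<le> c * \<phi> s"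
  shows "(step_op h ^^ k) \<phi> s \<le> c ^ k * \<phi> s"
proof (induction k arbitrary: s)
  case (Suc k)
  have "(step_op h ^^ Suc k) \<phi> s \<le> step_op h (\<lambda>s. c ^ k * \<phi> s) s"
    by (simp add: step_op_mono Suc)
  also have "\<dots> \<le> c ^ k * (c * \<phi> s)"
    unfolding step_op_cmult by (intro mult_left_mono assms) auto
  finally show ?case by (simp add: mult_ac)
qed simp

lemma step_op_power_cmult: "(step_op h ^^ k) (\<lambda>s. c * f s) = (\<lambda>s. c * (step_op h ^^ k) f s)"
  by (induction k) (auto simp: step_op_cmult)

text \<open>The supersolution is the resolvent series \<phi>, the sum of hop^k init /
  \<beta>'^(k+1), which formally solves hop \<phi> = \<beta>' \<phi> - init. It dominates
  \<open>init\<close> up to a factor, and its sum over all final configurations is finite because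
  the path sums grow at a rate below \<beta>'.\<close>

lemma discrete_moment_le:
  assumes L: "top < L"
  shows "\<exists>C0\<ge>0. \<exists>C\<ge>0. \<forall>t N. 0 < t \<longrightarrow> t \<le> real N \<longrightarrow> discrete_moment N t \<le> ennreal (C0 * exp (t * L + C * t\<^sup>2 / N))"
proof -
  define \<beta>' where "\<beta>' = L + speed"
  define \<beta> where "\<beta> = (top + speed + \<beta>') / 2"
  have \<beta>: "top + speed < \<beta>" "\<beta> < \<beta>'" "0 < \<beta>" "0 < \<beta>'"
    using L top_plus_speed_nonneg by (auto simp: \<beta>_def \<beta>'_def)
  \<comment> \<open>Then exp (2 \<epsilon>) = \<beta>' / \<beta>: the weight raises the rate from
    \<beta> to exp \<epsilon> \<beta>, and its ratio \<open>q\<close> to \<beta>' is still exp (-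
    \<epsilon>) < 1.\<close>
  define \<epsilon> where "\<epsilon> = ln (\<beta>' / \<beta>) / 2"
  define q where "q = exp \<epsilon> * \<beta> / \<beta>'"
  have \<epsilon>: "0 < \<epsilon>" using \<beta> by (auto simp: \<epsilon>_def)
  have q: "0 < q" "q < 1"
  proof -
    show "0 < q" using \<beta> by (simp add: q_def)
    have "exp \<epsilon> < exp (2 * \<epsilon>)" using \<epsilon> by simp
    also have "\<dots> = \<beta>' / \<beta>" using \<beta> by (simp add: \<epsilon>_def)
    finally show "q < 1" using \<beta> by (simp add: q_def field_simps)
  qed
  from sum_hop_power_init_le[OF \<epsilon>, of \<beta>] \<beta> obtain C1 where C1: "C1 \<ge> 0"
    "\<And>k B. finite B \<Longrightarrow> B \<subseteq> PiE K (\<lambda>_. UNIV) \<Longrightarrow> (\<Sum>y\<in>B. (hop ^^ k) init (cfg y)) \<le> C1 * (exp \<epsilon> * \<beta>) ^ k"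
    by auto
  let ?h = "\<lambda>k s. (hop ^^ k) init s"
  have h_nonneg: "0 \<le> ?h k s" for k s by (intro hop_power_nonneg init_nonneg)
  define \<phi> where "\<phi> s = (\<Sum>k. ennreal ((1 / \<beta>') ^ Suc k * ?h k s))" for s
  have init_le: "ennreal (init s) \<le> ennreal \<beta>' * \<phi> s" for s
  proof -
    have "ennreal (init s) = ennreal \<beta>' * ennreal ((1 / \<beta>') ^ Suc 0 * ?h 0 s)"
      using \<beta> by (simp add: ennreal_mult[symmetric] init_nonneg)
    also have "\<dots> \<le> ennreal \<beta>' * \<phi> s"
      unfolding \<phi>_def using sum_le_suminf[of "\<lambda>k. ennreal ((1 / \<beta>') ^ Suc k * ?h k s)" "{0}"]
      by (intro mult_left_mono) auto
    finally show ?thesis .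
  qed
  have sup: "ennreal (pot s) * \<phi> s + (\<Sum>i\<leftarrow>idx. ennreal (rates i) * adj_at i \<phi> s) \<le> ennreal \<beta>' * \<phi> s" for s
  proof -
    let ?c = "\<lambda>k. ennreal ((1 / \<beta>') ^ Suc k)"
    have \<phi>: "\<phi> s = (\<Sum>k. ?c k * ennreal (?h k s))" for s
      unfolding \<phi>_def using \<beta> h_nonneg by (simp only: ennreal_mult zero_le_power divide_nonneg_pos zero_le_one)
    have A: "adj_at i \<phi> s = (\<Sum>k. ?c k * adj_at i (\<lambda>s. ennreal (?h k s)) s)" for i
      unfolding adj_at_def \<phi> by (subst suminf_sum[symmetric]) (simp_all only: sum_distrib_left summableI)
    have "ennreal (pot s) * \<phi> s + (\<Sum>i\<leftarrow>idx. ennreal (rates i) * adj_at i \<phi> s) =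
       (\<Sum>k. ennreal (pot s) * (?c k * ennreal (?h k s))) +
       (\<Sum>i\<in>K \<union> J. \<Sum>k. ennreal (rates i) * (?c k * adj_at i (\<lambda>s. ennreal (?h k s)) s))"
      unfolding sum_idx A \<phi> by (simp only: ennreal_suminf_cmult)
    also have "\<dots> = (\<Sum>k. ennreal (pot s) * (?c k * ennreal (?h k s)) +
       (\<Sum>i\<in>K \<union> J. ennreal (rates i) * (?c k * adj_at i (\<lambda>s. ennreal (?h k s)) s)))"
      by (subst suminf_sum[symmetric], simp) (simp only: suminf_add summableI)
    also have "\<dots> = (\<Sum>k. ?c k * ennreal (?h (Suc k) s))"
    proof (intro suminf_cong)
      fix k
      have "?h (Suc k) s = hop (?h k) s" by simp
      show "ennreal (pot s) * (?c k * ennreal (?h k s)) +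
       (\<Sum>i\<in>K \<union> J. ennreal (rates i) * (?c k * adj_at i (\<lambda>s. ennreal (?h k s)) s)) = ?c k * ennreal (?h (Suc k) s)"
        unfolding \<open>?h (Suc k) s = hop (?h k) s\<close> ennreal_hop[OF h_nonneg] sum_idx
        by (simp only: distrib_left sum_distrib_left mult.left_commute)
    qed
    also have "\<dots> = (\<Sum>k. ennreal \<beta>' * (?c (Suc k) * ennreal (?h (Suc k) s)))"
    proof (intro suminf_cong)
      fix k
      have "?c k = ennreal \<beta>' * ?c (Suc k)" using \<beta> by (simp add: ennreal_mult[symmetric])
      then show "?c k * ennreal (?h (Suc k) s) = ennreal \<beta>' * (?c (Suc k) * ennreal (?h (Suc k) s))"
        by (simp only: mult.assoc)
    qed
    also have "\<dots> = ennreal \<beta>' * (\<Sum>k. ?c (Suc k) * ennreal (?h (Suc k) s))" by (rule ennreal_suminf_cmult)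
    also have "\<dots> \<le> ennreal \<beta>' * \<phi> s"
      unfolding \<phi> by (intro mult_left_mono suminf_Suc_le) auto
    finally show ?thesis .
  qed
  from exp_walk_ops_le[of pot \<phi> rates idx \<beta>' "real (n * p)", OF sup rate_nonneg less_imp_le[OF \<beta>(4)] V_nonneg V_le]
  obtain C where C: "C \<ge> 0" "\<And>h s. 0 \<le> h \<Longrightarrow> h \<le> 1 \<Longrightarrow> step_op h \<phi> s \<le> ennreal (exp (h * L + C * h\<^sup>2)) * \<phi> s"
    unfolding step_op_def speed_idx \<beta>'_def by (auto simp: )
  \<comment> \<open>A free move of unit time is dominated by a step with h = 1, since the potential
    is nonnegative.\<close>
  define M where "M = exp (L + C)"
  have M: "walk_ops rates 1 idx \<phi> s \<le> ennreal M * \<phi> s" for s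
  proof -
    have "1 \<le> ennreal (exp (1 * pot s))" using V_nonneg[of s] ennreal_leI[of 1 "exp (pot s)"] by simp
    then have "1 * walk_ops rates 1 idx \<phi> s \<le> step_op 1 \<phi> s" unfolding step_op_def by (rule mult_right_mono) simp
    then show ?thesis using C(2)[of 1 s] by (auto simp: M_def intro: order_trans)
  qed
  have int: "(\<integral>\<^sup>+y. \<phi> (cfg y) \<partial>count_space (PiE K (\<lambda>_. UNIV))) \<le> ennreal (C1 / \<beta>' / (1 - q))"
  proof -
    have "(\<integral>\<^sup>+y. \<phi> (cfg y) \<partial>count_space (PiE K (\<lambda>_. UNIV))) =
        (\<Sum>k. \<integral>\<^sup>+y. ennreal ((1 / \<beta>') ^ Suc k * ?h k (cfg y)) \<partial>count_space (PiE K (\<lambda>_. UNIV)))"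
      unfolding \<phi>_def by (intro nn_integral_suminf) simp
    also have "\<dots> \<le> (\<Sum>k. ennreal (C1 / \<beta>' * q ^ k))"
    proof (intro suminf_le summableI)
      fix k
      show "(\<integral>\<^sup>+y. ennreal ((1 / \<beta>') ^ Suc k * ?h k (cfg y)) \<partial>count_space (PiE K (\<lambda>_. UNIV))) \<le> ennreal (C1 / \<beta>' * q ^ k)"
      proof (rule nn_integral_count_space_le[OF countable_PiE_K])
        fix B assume B: "finite B" "B \<subseteq> PiE K (\<lambda>_. UNIV :: (int ^ 'd) set)"
        have "(\<Sum>y\<in>B. ennreal ((1 / \<beta>') ^ Suc k * ?h k (cfg y))) = ennreal ((1 / \<beta>') ^ Suc k * (\<Sum>y\<in>B. ?h k (cfg y)))"
          using \<beta> h_nonneg by (subst sum_ennreal) (auto simp: sum_distrib_left)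
        also have "\<dots> \<le> ennreal ((1 / \<beta>') ^ Suc k * (C1 * (exp \<epsilon> * \<beta>) ^ k))"
          using \<beta> by (intro ennreal_leI mult_left_mono C1 B) auto
        also have "(1 / \<beta>') ^ Suc k * (C1 * (exp \<epsilon> * \<beta>) ^ k) = C1 / \<beta>' * q ^ k"
          using \<beta> by (simp add: q_def power_mult_distrib power_divide)
        finally show "(\<Sum>y\<in>B. ennreal ((1 / \<beta>') ^ Suc k * ?h k (cfg y))) \<le> ennreal (C1 / \<beta>' * q ^ k)" .
      qed
    qed
    also have "\<dots> = ennreal (\<Sum>k. C1 / \<beta>' * q ^ k)"
      using C1 \<beta> q by (intro suminf_ennreal2 summable_mult summable_geometric) auto
    also have "(\<Sum>k. C1 / \<beta>' * q ^ k) = C1 / \<beta>' / (1 - q)"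
      using q by (subst suminf_mult) (auto simp: suminf_geometric summable_geometric)
    finally show ?thesis .
  qed
  \<comment> \<open>One factor M for each buffer, \<beta>' from init \<le> \<beta>' \<phi>, and the
    sum of \<phi> over the final configurations.\<close>
  define C0 where "C0 = M * M * \<beta>' * (C1 / \<beta>' / (1 - q))"
  have "discrete_moment N t \<le> ennreal (C0 * exp (t * L + C * t\<^sup>2 / N))" if t: "0 < t" "t \<le> real N" for t N
  proof -
    have N: "0 < real N" using t by linarith
    define h where "h = t / N"
    have h: "0 \<le> h" "h \<le> 1" using t N by (auto simp: h_def)
    let ?e = "ennreal (exp (h * L + C * h\<^sup>2))"
    have e: "?e ^ N = ennreal (exp (t * L + C * t\<^sup>2 / N))"
    proof -
      have "?e ^ N = ennreal (exp (real N * (h * L + C * h\<^sup>2)))"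
        by (simp add: ennreal_power exp_of_nat_mult)
      also have "real N * (h * L + C * h\<^sup>2) = t * L + C * t\<^sup>2 / N"
        using N by (simp add: h_def distrib_left power2_eq_square)
      finally show ?thesis .
    qed
    have 1: "walk_ops rates 1 idx (\<lambda>s. ennreal (init s)) s \<le> ennreal (\<beta>' * M) * \<phi> s" for s
    proof -
      have "walk_ops rates 1 idx (\<lambda>s. ennreal (init s)) s \<le> walk_ops rates 1 idx (\<lambda>s. ennreal \<beta>' * \<phi> s) s"
        by (intro walk_ops_mono init_le)
      also have "\<dots> \<le> ennreal \<beta>' * (ennreal M * \<phi> s)"
        unfolding walk_ops_cmult by (intro mult_left_mono M) auto
      finally show ?thesis using \<beta> by (simp add: ennreal_mult M_def mult.assoc)
    qed
    have 2: "(step_op h ^^ N) (walk_ops rates 1 idx (\<lambda>s. ennreal (init s))) s \<le> ennreal (\<beta>' * M) * (?e ^ N * \<phi> s)" for s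
    proof -
      have "(step_op h ^^ N) (walk_ops rates 1 idx (\<lambda>s. ennreal (init s))) s \<le> (step_op h ^^ N) (\<lambda>s. ennreal (\<beta>' * M) * \<phi> s) s"
        by (intro step_op_power_mono 1)
      also have "\<dots> \<le> ennreal (\<beta>' * M) * (?e ^ N * \<phi> s)"
        unfolding step_op_power_cmult using h by (intro mult_left_mono step_op_power_le C) auto
      finally show ?thesis .
    qed
    have 3: "walk_ops rates 1 idx ((step_op h ^^ N) (walk_ops rates 1 idx (\<lambda>s. ennreal (init s)))) s \<le>
        ennreal (\<beta>' * M) * ?e ^ N * (ennreal M * \<phi> s)" for s
    proof -
      have "walk_ops rates 1 idx ((step_op h ^^ N) (walk_ops rates 1 idx (\<lambda>s. ennreal (init s)))) s \<le>
        walk_ops rates 1 idx (\<lambda>s. (ennreal (\<beta>' * M) * ?e ^ N) * \<phi> s) s"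
        using 2 by (intro walk_ops_mono) (simp add: mult.assoc)
      also have "\<dots> \<le> ennreal (\<beta>' * M) * ?e ^ N * (ennreal M * \<phi> s)"
        unfolding walk_ops_cmult by (intro mult_left_mono M) auto
      finally show ?thesis .
    qed
    have "discrete_moment N t \<le> (\<integral>\<^sup>+y. ennreal (\<beta>' * M) * ?e ^ N * ennreal M * \<phi> (cfg y) \<partial>count_space (PiE K (\<lambda>_. UNIV)))"
      unfolding discrete_moment_def h_def[symmetric] using 3 by (intro nn_integral_mono) (simp add: mult.assoc)
    also have "\<dots> = ennreal (\<beta>' * M) * ?e ^ N * ennreal M * (\<integral>\<^sup>+y. \<phi> (cfg y) \<partial>count_space (PiE K (\<lambda>_. UNIV)))"
      by (rule nn_integral_cmult) simp
    also have "\<dots> \<le> ennreal (\<beta>' * M) * ?e ^ N * ennreal M * ennreal (C1 / \<beta>' / (1 - q))"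
      by (intro mult_left_mono int) auto
    also have "\<dots> = ennreal (C0 * exp (t * L + C * t\<^sup>2 / N))"
    proof -
      have "0 \<le> C1 / \<beta>' / (1 - q)" using C1 \<beta> q by auto
      then show ?thesis using \<beta> q
        unfolding e C0_def by (simp add: ennreal_mult[symmetric] M_def mult_ac)
    qed
    finally show ?thesis .
  qed
  moreover have "C0 \<ge> 0" using C1 \<beta> q by (simp add: C0_def M_def)
  ultimately show ?thesis using C(1) by blast
qed

text \<open>Uses 1 + h pot \<le> exp (h pot) and at most one jump in all. The factor exp (- speed h)
  will cancel the shift by \<open>speed\<close> contained in \<open>hop\<close>.\<close>

lemma step_op_ge_euler:
  assumes h: "h \<ge> 0" and f: "\<And>s. 0 \<le> f s" and g: "\<And>s. ennreal (f s) \<le> g s"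
  shows "ennreal (exp (- speed * h) * euler h f s) \<le> step_op h g s"
proof -
  let ?S = "\<Sum>i\<leftarrow>idx. ennreal (rates i) * adj_at i (\<lambda>s. ennreal (f s)) s"
  have e: "0 \<le> euler h f s" by (intro euler_nonneg h f)
  have nn: "0 \<le> h * (pot s * f s)" "0 \<le> hop f s" using h V_nonneg[of s] f hop_nonneg[OF f] by auto
  have "ennreal (euler h f s) = ennreal (f s) + ennreal h * (ennreal (pot s) * ennreal (f s) + ?S)"
    unfolding euler_def using h nn f by (simp add: ennreal_mult ennreal_hop[OF f])
  also have "\<dots> = ennreal (1 + h * pot s) * ennreal (f s) + ennreal h * ?S"
    using h V_nonneg[of s] f[of s] by (simp add: distrib_left distrib_right ennreal_mult add_ac mult_ac)
  also have "\<dots> \<le> ennreal (exp (h * pot s)) * ennreal (f s) + ennreal (exp (h * pot s)) * (ennreal h * ?S)"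
  proof (intro add_mono mult_right_mono ennreal_leI)
    show "1 + h * pot s \<le> exp (h * pot s)" by (rule exp_ge_add_one_self)
    have "1 \<le> ennreal (exp (h * pot s))" using h V_nonneg[of s] ennreal_leI[of 1 "exp (h * pot s)"] by simp
    then show "ennreal h * ?S \<le> ennreal (exp (h * pot s)) * (ennreal h * ?S)"
      using mult_right_mono[of 1 _ "ennreal h * ?S"] by simp
  qed auto
  finally have *: "ennreal (euler h f s) \<le> ennreal (exp (h * pot s)) * (ennreal (f s) + ennreal h * ?S)"
    by (simp only: distrib_left)
  have "ennreal (exp (- speed * h) * euler h f s) = ennreal (exp (- speed * h)) * ennreal (euler h f s)"
    using e by (simp add: ennreal_mult)
  also have "\<dots> \<le> ennreal (exp (- speed * h)) * (ennreal (exp (h * pot s)) * (ennreal (f s) + ennreal h * ?S))"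
    by (intro mult_left_mono *) auto
  also have "\<dots> = ennreal (exp (h * pot s)) * (ennreal (exp (- deg TYPE('d) * (\<Sum>i\<leftarrow>idx. rates i) * h)) * (ennreal (f s) + ennreal h * ?S))"
    by (simp add: speed_idx[symmetric] mult.left_commute)
  also have "\<dots> \<le> ennreal (exp (h * pot s)) * walk_ops rates h idx (\<lambda>s. ennreal (f s)) s"
    by (intro mult_left_mono walk_ops_ge rate_nonneg h) auto
  also have "\<dots> \<le> step_op h g s"
    unfolding step_op_def by (intro mult_left_mono walk_ops_mono g) auto
  finally show ?thesis .
qed

lemma step_op_power_ge_euler:
  assumes h: "h \<ge> 0" and f: "\<And>s. 0 \<le> f s" and g: "\<And>s. ennreal (f s) \<le> g s"
  shows "ennreal (exp (- speed * h) ^ k * (euler h ^^ k) f s) \<le> (step_op h ^^ k) g s"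
proof (induction k arbitrary: s)
  case (Suc k)
  let ?f = "\<lambda>s. exp (- speed * h) ^ k * (euler h ^^ k) f s"
  have "euler h ?f s = exp (- speed * h) ^ k * euler h ((euler h ^^ k) f) s"
    by (simp add: euler_def hop_cmult algebra_simps)
  then show ?case
    using step_op_ge_euler[OF h, of ?f "(step_op h ^^ k) g" s] Suc euler_power_nonneg[OF h f]
    by (simp add: mult.assoc)
qed (use g in simp)

lemma kernel_pos:
  assumes "rates i = 0 \<Longrightarrow> a = b"
  shows "walk_kernel (rates i) 1 a b > 0"
  using assms walk_kernel_pos[of "rates i" 1 a b] rate_nonneg[of i]
  by (cases "rates i = 0") (auto simp: walk_kernel_rate_0)

text \<open>A near-optimal nonnegative \<open>f\<close> has finite support. The first buffer bounds
  the initial data below by a multiple of \<open>f\<close>, and the last one reads off the result on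
  the support of \<open>f\<close>. The number of steps is a power of two because Euler powers are
  bounded by repeated squaring.\<close>

lemma discrete_moment_ge:
  assumes L: "L < top"
  shows "\<exists>a>0. \<exists>E>L. \<forall>t k. 0 < t \<longrightarrow>
    ennreal (a * exp (- speed * t) * (1 + t / 2 ^ k * (E + speed)) ^ (2 ^ k)) \<le> discrete_moment (2 ^ k) t"
proof -
  obtain f where f: "f \<in> tests" "\<And>s. f s \<ge> 0" "ip f f = 1" "energy f > L"
    using less_top_obtains[OF L] by blast
  define A where "A = {s. f s \<noteq> 0}"
  have A: "finite A" "A \<subseteq> reach" using f(1) by (auto simp: A_def tests_def)
  have ne: "A \<noteq> {}"
  proof
    assume "A = {}"
    then have "f = (\<lambda>_. 0)" by (auto simp: A_def)
    then show False using f(3) by (simp add: ip_def)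
  qed
  let ?F = "walk_ops rates 1 idx (\<lambda>s. ennreal (init s))"
  \<comment> \<open>One way through the first buffer: the catalysts go between 0 and their places in
    \<open>s\<close>, the replicas end where they began.\<close>
  define r where "r s = (\<Prod>i\<in>set idx. walk_kernel (rates i) 1 (s i) (if i \<in> K then 0 else s i))" for s :: "nat \<Rightarrow> int ^ 'd"
  have kn: "0 \<le> walk_kernel (rates i) 1 a b" for i a b by (intro walk_kernel_nonneg rate_nonneg) simp
  have r: "r s > 0" if "s \<in> A" for s
    unfolding r_def
  proof (intro prod_pos kernel_pos)
    fix i assume "i \<in> set idx" "rates i = 0"
    moreover have "s \<in> reach" using that A(2) by auto
    ultimately show "s i = (if i \<in> K then 0 else s i)"
      using KJ_disjoint by (auto simp: reach_def start_def)
  qed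
  have F_ge: "ennreal (r s) \<le> ?F s" for s
  proof -
    have "init (\<lambda>i. if i \<in> set idx then (if i \<in> K then 0 else s i) else s i) = 1"
      by (auto simp: init_def set_idx)
    then show ?thesis
      using walk_ops_ge_kernel[OF distinct_idx, of rates 1 s "\<lambda>i. if i \<in> K then 0 else s i" "\<lambda>s. ennreal (init s)"]
      by (simp add: r_def prod_ennreal kn)
  qed
  define a1 where "a1 = Min ((\<lambda>s. r s / f s) ` A)"
  have fpos: "f s > 0" if "s \<in> A" for s using that f(2)[of s] by (auto simp: A_def)
  have a1: "a1 > 0" using A ne r fpos by (auto simp: a1_def)
  have a1_le: "ennreal (a1 * f s) \<le> ?F s" for s
  proof (cases "s \<in> A")
    case True
    then have "a1 \<le> r s / f s" using A by (auto simp: a1_def)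
    then have "a1 * f s \<le> r s" using fpos[OF True] by (simp add: field_simps)
    then show ?thesis using F_ge by (meson ennreal_leI order_trans)
  qed (simp add: A_def)
  \<comment> \<open>In the last buffer it is the catalysts that return to their places, while the
    replicas travel between \<open>x\<close> and \<open>s\<close>.\<close>
  define q where "q s = (\<Prod>i\<in>set idx. walk_kernel (rates i) 1 (cfg (restrict s K) i) (s i))" for s :: "nat \<Rightarrow> int ^ 'd"
  have q: "q s > 0" if "s \<in> A" for s
    unfolding q_def
  proof (intro prod_pos kernel_pos)
    fix i assume "i \<in> set idx" "rates i = 0"
    moreover have "s \<in> reach" using that A(2) by auto
    ultimately show "cfg (restrict s K) i = s i"
      using KJ_disjoint by (auto simp: reach_def cfg_def)
  qed
  define a2 where "a2 = Min (q ` A)"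
  have a2: "a2 > 0" "\<And>s. s \<in> A \<Longrightarrow> a2 \<le> q s" using A ne q by (auto simp: a2_def)
  \<comment> \<open>Dividing by the total mass of \<open>f\<close> turns the inner product with
    \<open>f\<close> into a weighted mean, which is at most the maximum over the support.\<close>
  define a where "a = a1 * a2 / (\<Sum>s\<in>A. f s)"
  have fs: "(\<Sum>s\<in>A. f s) > 0" using A ne fpos by (intro sum_pos) auto
  have a: "a > 0" using a1 a2 fs by (simp add: a_def)
  have "ennreal (a * exp (- speed * t) * (1 + t / 2 ^ k * (energy f + speed)) ^ (2 ^ k)) \<le> discrete_moment (2 ^ k) t"
    if t: "0 < t" for t k
  proof -
    let ?N = "2 ^ k :: nat"
    define h where "h = t / ?N"
    have h: "0 \<le> h" using t by (simp add: h_def)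
    define G where "G = (step_op h ^^ ?N) ?F"
    define u where "u s = a1 * (exp (- speed * t) * (euler h ^^ ?N) f s)" for s
    have u0: "0 \<le> u s" for s using a1 euler_power_nonneg[OF h f(2)] by (simp add: u_def)
    have G: "ennreal (u s) \<le> G s" for s
    proof -
      have hom: "(euler h ^^ m) (\<lambda>s. a1 * f s) = (\<lambda>s. a1 * (euler h ^^ m) f s)" for m
        by (induction m) (auto simp: euler_def hop_cmult algebra_simps)
      have "exp (- speed * h) ^ ?N = exp (- speed * t)"
        by (simp add: exp_of_nat_mult[symmetric] h_def)
      then show ?thesis
        using step_op_power_ge_euler[OF h, of "\<lambda>s. a1 * f s" ?F ?N s] a1 f(2) a1_le
        by (simp add: hom u_def G_def mult_ac)
    qed
    have D: "ennreal (a2 * u s) \<le> discrete_moment ?N t" if "s \<in> A" for s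
    proof -
      let ?y = "restrict s K"
      have s_eq: "(\<lambda>i. if i \<in> set idx then s i else cfg ?y i) = s"
      proof -
        have "s \<in> reach" using that A(2) by auto
        then show ?thesis by (auto simp: fun_eq_iff set_idx cfg_def reach_def)
      qed
      have "ennreal (a2 * u s) \<le> ennreal (q s) * ennreal (u s)"
        using a2(2)[OF that] a2(1) u0 by (simp add: ennreal_mult[symmetric] ennreal_leI mult_right_mono)
      also have "\<dots> \<le> ennreal (q s) * G s" by (intro mult_left_mono G) auto
      also have "\<dots> \<le> walk_ops rates 1 idx G (cfg ?y)"
        using walk_ops_ge_kernel[OF distinct_idx, of rates 1 "cfg ?y" s G]
        by (simp add: q_def prod_ennreal kn s_eq)
      also have "\<dots> = (\<integral>\<^sup>+y. walk_ops rates 1 idx G (cfg y) * indicator {?y} y \<partial>count_space (PiE K (\<lambda>_. UNIV)))"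
        by (subst nn_integral_indicator_singleton) auto
      also have "\<dots> \<le> discrete_moment ?N t"
        unfolding discrete_moment_def G_def h_def
        by (intro nn_integral_mono) (auto split: split_indicator)
      finally show ?thesis .
    qed
    have "a * exp (- speed * t) * (1 + t / 2 ^ k * (energy f + speed)) ^ (2 ^ k) \<le>
        a * exp (- speed * t) * ip f ((euler h ^^ ?N) f)"
      using ip_euler_power_ge[OF f(1-3) h, of k] a by (intro mult_left_mono) (auto simp: h_def)
    also have "ip f ((euler h ^^ ?N) f) = (\<Sum>s\<in>A. f s * (euler h ^^ ?N) f s)"
      unfolding ip_def using A by (intro infsum_fin_supp) (auto simp: A_def)
    also have "a * exp (- speed * t) * \<dots> = (\<Sum>s\<in>A. f s * (a2 * u s)) / (\<Sum>s\<in>A. f s)"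
      by (simp add: a_def u_def sum_distrib_left sum_divide_distrib mult_ac)
    also have "\<dots> \<le> Max ((\<lambda>s. a2 * u s) ` A)"
    proof -
      have "(\<Sum>s\<in>A. f s * (a2 * u s)) \<le> (\<Sum>s\<in>A. f s * Max ((\<lambda>s. a2 * u s) ` A))"
        using A(1) f(2) by (intro sum_mono mult_left_mono Max_ge finite_imageI imageI)
      then show ?thesis using fs by (simp add: sum_distrib_right[symmetric] field_simps)
    qed
    finally have le: "a * exp (- speed * t) * (1 + t / 2 ^ k * (energy f + speed)) ^ (2 ^ k) \<le> Max ((\<lambda>s. a2 * u s) ` A)" .
    have "Max ((\<lambda>s. a2 * u s) ` A) \<in> (\<lambda>s. a2 * u s) ` A"
      using A(1) ne by (intro Max_in finite_imageI) simp_all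
    then obtain s where "s \<in> A" "Max ((\<lambda>s. a2 * u s) ` A) = a2 * u s" by blast
    note s = this
    show ?thesis by (rule order_trans[OF ennreal_leI[OF le[unfolded s(2)]] D[OF s(1)]])
  qed
  then show ?thesis using a f(4) by blast
qed

end

section \<open>From path integrals to the discretised moments\<close>

lemma borel_measurable_nn_integral_count_space:
  fixes f :: "'i \<Rightarrow> 'a \<Rightarrow> ennreal"
  assumes "countable A" and f: "\<And>i. i \<in> A \<Longrightarrow> f i \<in> borel_measurable M"
  shows "(\<lambda>\<omega>. \<integral>\<^sup>+i. f i \<omega> \<partial>count_space A) \<in> borel_measurable M"
proof (cases "finite A")
  case True
  then show ?thesis using f by (simp add: nn_integral_count_space_finite)
next
  case False
  note b = bij_betw_from_nat_into[OF assms(1) False]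
  have mem: "from_nat_into A k \<in> A" for k using False by (intro from_nat_into) auto
  have "(\<integral>\<^sup>+i. g i \<partial>count_space A) = (\<Sum>k. g (from_nat_into A k))" for g :: "'i \<Rightarrow> ennreal"
    using nn_integral_bij_count_space[OF b, of g] by (simp add: nn_integral_count_space_nat)
  then show ?thesis using f[OF mem] by simp
qed

lemma nn_integral_countable_valued:
  fixes f :: "'c \<Rightarrow> ennreal"
  assumes A: "countable A" and \<zeta>: "\<zeta> \<in> M \<rightarrow>\<^sub>M count_space A" and B: "B \<in> sets M"
  shows "(\<integral>\<^sup>+\<omega>. f (\<zeta> \<omega>) * indicator B \<omega> \<partial>M) = (\<integral>\<^sup>+c. f c * emeasure M ({\<omega>\<in>space M. \<zeta> \<omega> = c} \<inter> B) \<partial>count_space A)"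
proof -
  have E: "{\<omega>\<in>space M. \<zeta> \<omega> = c} \<inter> B \<in> sets M" if "c \<in> A" for c
  proof -
    have "\<zeta> -` {c} \<inter> space M \<in> sets M" using that by (intro measurable_sets[OF \<zeta>]) auto
    also have "\<zeta> -` {c} \<inter> space M = {\<omega>\<in>space M. \<zeta> \<omega> = c}" by auto
    finally show ?thesis using B by auto
  qed
  have "(\<integral>\<^sup>+\<omega>. f (\<zeta> \<omega>) * indicator B \<omega> \<partial>M) =
      (\<integral>\<^sup>+\<omega>. \<integral>\<^sup>+c. f c * indicator ({\<omega>\<in>space M. \<zeta> \<omega> = c} \<inter> B) \<omega> \<partial>count_space A \<partial>M)"
  proof (rule nn_integral_cong)
    fix \<omega> assume \<omega>: "\<omega> \<in> space M"
    then have mem: "\<zeta> \<omega> \<in> A" using measurable_space[OF \<zeta>] by simp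
    have "(\<integral>\<^sup>+c. f c * indicator ({\<omega>\<in>space M. \<zeta> \<omega> = c} \<inter> B) \<omega> \<partial>count_space A) =
        (\<integral>\<^sup>+c. (f c * indicator B \<omega>) * indicator {\<zeta> \<omega>} c \<partial>count_space A)"
      using \<omega> by (intro nn_integral_cong) (auto simp: indicator_def)
    also have "\<dots> = f (\<zeta> \<omega>) * indicator B \<omega>"
      using mem by (subst nn_integral_indicator_singleton) auto
    finally show "f (\<zeta> \<omega>) * indicator B \<omega> = (\<integral>\<^sup>+c. f c * indicator ({\<omega>\<in>space M. \<zeta> \<omega> = c} \<inter> B) \<omega> \<partial>count_space A)" ..
  qed
  also have "\<dots> = (\<integral>\<^sup>+c. \<integral>\<^sup>+\<omega>. f c * indicator ({\<omega>\<in>space M. \<zeta> \<omega> = c} \<inter> B) \<omega> \<partial>M \<partial>count_space A)"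
    using E by (intro nn_integral_count_space_nn_integral A) auto
  also have "\<dots> = (\<integral>\<^sup>+c. f c * emeasure M ({\<omega>\<in>space M. \<zeta> \<omega> = c} \<inter> B) \<partial>count_space A)"
    using E by (intro nn_integral_cong) (auto simp: nn_integral_cmult_indicator)
  finally show ?thesis .
qed

lemma countable_lists: "countable C \<Longrightarrow> countable (lists C)"
proof -
  assume C: "countable C"
  have "lists C = (\<Union>k. {xs. set xs \<subseteq> C \<and> length xs = k})" by auto
  moreover have "countable {xs. set xs \<subseteq> C \<and> length xs = k}" for k
  proof (induction k)
    case (Suc k)
    have "{xs. set xs \<subseteq> C \<and> length xs = Suc k} \<subseteq> (\<lambda>(x, xs). x # xs) ` (C \<times> {xs. set xs \<subseteq> C \<and> length xs = k})"
    proof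
      fix xs assume "xs \<in> {xs. set xs \<subseteq> C \<and> length xs = Suc k}"
      then obtain a ys where "xs = a # ys" "a \<in> C" "set ys \<subseteq> C" "length ys = k"
        by (cases xs) auto
      then show "xs \<in> (\<lambda>(x, xs). x # xs) ` (C \<times> {xs. set xs \<subseteq> C \<and> length xs = k})"
        by (intro image_eqI[of _ _ "(a, ys)"]) simp_all
    qed
    then show ?case using Suc C by (auto intro: countable_subset)
  qed (rule countable_subset[of _ "{[]}"], auto)
  ultimately show ?thesis by simp
qed

lemma map_upt_eq_iff: "length c = m \<Longrightarrow> map f [0..<m] = c \<longleftrightarrow> (\<forall>i<m. f i = c ! i)"
  by (simp add: list_eq_iff_nth_eq)

lemma measurable_path_list:
  assumes C: "countable C" and Z: "\<And>i. i < m \<Longrightarrow> Z i \<in> M \<rightarrow>\<^sub>M count_space C"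
  shows "(\<lambda>\<omega>. map (\<lambda>i. Z i \<omega>) [0..<m]) \<in> M \<rightarrow>\<^sub>M count_space (lists C)"
  unfolding measurable_count_space_eq_countable[OF countable_lists[OF C]]
proof (intro conjI ballI)
  show "(\<lambda>\<omega>. map (\<lambda>i. Z i \<omega>) [0..<m]) \<in> space M \<rightarrow> lists C"
    using measurable_space[OF Z] by auto
  fix c assume c: "c \<in> lists C"
  show "(\<lambda>\<omega>. map (\<lambda>i. Z i \<omega>) [0..<m]) -` {c} \<inter> space M \<in> sets M"
  proof (cases "length c = m")
    case True
    have "(\<lambda>\<omega>. map (\<lambda>i. Z i \<omega>) [0..<m]) -` {c} \<inter> space M = {\<omega>\<in>space M. \<forall>i\<in>{..<m}. Z i \<omega> = c ! i}"
    proof -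
      have "map (\<lambda>i. Z i \<omega>) [0..<m] = c \<longleftrightarrow> (\<forall>i\<in>{..<m}. Z i \<omega> = c ! i)" for \<omega>
        using map_upt_eq_iff[OF True] by auto
      then show ?thesis by blast
    qed
    also have "\<dots> \<in> sets M"
    proof (intro sets.sets_Collect_finite_All)
      fix i assume i: "i \<in> {..<m}"
      have "Z i -` {c ! i} \<inter> space M \<in> sets M"
        using i c True by (intro measurable_sets[OF Z]) (auto simp: lists_eq_set)
      also have "Z i -` {c ! i} \<inter> space M = {\<omega>\<in>space M. Z i \<omega> = c ! i}" by auto
      finally show "{\<omega>\<in>space M. Z i \<omega> = c ! i} \<in> sets M" .
    qed auto
    finally show ?thesis .
  next
    case False
    then have "(\<lambda>\<omega>. map (\<lambda>i. Z i \<omega>) [0..<m]) -` {c} \<inter> space M = {}" by auto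
    then show ?thesis by simp
  qed
qed

text \<open>Conditioning on the history. Histories take countably many values, so the factorisation
  of cylinder probabilities suffices to average the next state over the kernel against an arbitrary
  function of the past.\<close>

lemma nn_integral_markov_step:
  fixes Z :: "nat \<Rightarrow> 'w \<Rightarrow> 'c" and U :: "'c list \<Rightarrow> ennreal"
  assumes "finite_measure M" and C: "countable C" and Z: "\<And>i. i \<le> Suc l \<Longrightarrow> Z i \<in> M \<rightarrow>\<^sub>M count_space C"
    and cyl: "\<And>y. (\<And>i. i \<le> Suc l \<Longrightarrow> y i \<in> C) \<Longrightarrow> measure M {\<omega>\<in>space M. \<forall>i\<le>Suc l. Z i \<omega> = y i} =
      measure M {\<omega>\<in>space M. \<forall>i\<le>l. Z i \<omega> = y i} * kern (y l) (y (Suc l))"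
    and kern: "\<And>a b. 0 \<le> kern a b"
  shows "(\<integral>\<^sup>+\<omega>. U (map (\<lambda>i. Z i \<omega>) [0..<Suc l]) * g (Z (Suc l) \<omega>) \<partial>M) =
    (\<integral>\<^sup>+\<omega>. U (map (\<lambda>i. Z i \<omega>) [0..<Suc l]) * (\<integral>\<^sup>+y. ennreal (kern (Z l \<omega>) y) * g y \<partial>count_space C) \<partial>M)"
proof -
  interpret finite_measure M by fact
  define \<zeta> where "\<zeta> \<omega> = map (\<lambda>i. Z i \<omega>) [0..<Suc l]" for \<omega>
  have \<zeta>: "\<zeta> \<in> M \<rightarrow>\<^sub>M count_space (lists C)"
    unfolding \<zeta>_def by (intro measurable_path_list C Z) auto
  have meas: "(\<lambda>\<omega>. F (\<zeta> \<omega>)) \<in> borel_measurable M" for F :: "'c list \<Rightarrow> ennreal"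
    by (rule measurable_compose[OF \<zeta>]) simp
  define E where "E y = {\<omega>\<in>space M. Z (Suc l) \<omega> = y}" for y
  have E: "E y \<in> sets M" if "y \<in> C" for y
  proof -
    have "Z (Suc l) -` {y} \<inter> space M \<in> sets M" using that by (intro measurable_sets[OF Z]) auto
    also have "Z (Suc l) -` {y} \<inter> space M = E y" by (auto simp: E_def)
    finally show ?thesis .
  qed
  have last: "Z l \<omega> = last (\<zeta> \<omega>)" for \<omega> by (simp add: \<zeta>_def)
  have key: "(\<integral>\<^sup>+\<omega>. U (\<zeta> \<omega>) * indicator (E y) \<omega> \<partial>M) = (\<integral>\<^sup>+\<omega>. U (\<zeta> \<omega>) * ennreal (kern (last (\<zeta> \<omega>)) y) \<partial>M)"
    if y: "y \<in> C" for y
  proof -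
    have "(\<integral>\<^sup>+\<omega>. U (\<zeta> \<omega>) * indicator (E y) \<omega> \<partial>M) =
        (\<integral>\<^sup>+c. U c * emeasure M ({\<omega>\<in>space M. \<zeta> \<omega> = c} \<inter> E y) \<partial>count_space (lists C))"
      by (rule nn_integral_countable_valued[OF countable_lists[OF C] \<zeta> E[OF y]])
    also have "\<dots> = (\<integral>\<^sup>+c. U c * ennreal (kern (last c) y) * emeasure M ({\<omega>\<in>space M. \<zeta> \<omega> = c} \<inter> space M) \<partial>count_space (lists C))"
    proof (intro nn_integral_cong)
      fix c assume "c \<in> space (count_space (lists C))"
      then have c: "set c \<subseteq> C" by auto
      show "U c * emeasure M ({\<omega>\<in>space M. \<zeta> \<omega> = c} \<inter> E y) =
        U c * ennreal (kern (last c) y) * emeasure M ({\<omega>\<in>space M. \<zeta> \<omega> = c} \<inter> space M)"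
      proof (cases "length c = Suc l")
        case False
        then have e: "{\<omega>\<in>space M. \<zeta> \<omega> = c} = {}" by (auto simp: \<zeta>_def)
        show ?thesis by (simp only: e Int_empty_left emeasure_empty mult_zero_right)
      next
        case True
        \<comment> \<open>The history \<open>c\<close> prolonged by the state
          \<open>y\<close>.\<close>
        define z where "z i = (if i = Suc l then y else c ! i)" for i
        have "z i \<in> C" if "i \<le> Suc l" for i
          using that True c y by (auto simp: z_def intro: subsetD[OF c] nth_mem)
        note cy = cyl[of z, OF this]
        have 1: "{\<omega>\<in>space M. \<forall>i\<le>Suc l. Z i \<omega> = z i} = {\<omega>\<in>space M. \<zeta> \<omega> = c} \<inter> E y"
        proof -
          have "(\<forall>i\<le>Suc l. Z i \<omega> = z i) \<longleftrightarrow> (\<forall>i<Suc l. Z i \<omega> = c ! i) \<and> Z (Suc l) \<omega> = y" for \<omega>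
            unfolding z_def by (metis less_Suc_eq_le le_Suc_eq not_less_eq_eq)
          then show ?thesis unfolding \<zeta>_def E_def map_upt_eq_iff[OF True] by blast
        qed
        have 2: "{\<omega>\<in>space M. \<forall>i\<le>l. Z i \<omega> = z i} = {\<omega>\<in>space M. \<zeta> \<omega> = c} \<inter> space M"
        proof -
          have "(\<forall>i\<le>l. Z i \<omega> = z i) \<longleftrightarrow> (\<forall>i<Suc l. Z i \<omega> = c ! i)" for \<omega>
          proof -
            have "z i = c ! i \<and> (i \<le> l \<longleftrightarrow> i < Suc l)" if "i \<le> l" for i using that by (simp add: z_def)
            then show ?thesis by (auto simp: less_Suc_eq_le)
          qed
          then show ?thesis unfolding \<zeta>_def map_upt_eq_iff[OF True] by blast
        qed
        have 3: "z l = last c" proof -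
          have "c \<noteq> []" using True by auto
          then show ?thesis using True by (simp add: z_def last_conv_nth)
        qed
        have "emeasure M ({\<omega>\<in>space M. \<zeta> \<omega> = c} \<inter> E y) = emeasure M ({\<omega>\<in>space M. \<zeta> \<omega> = c} \<inter> space M) * ennreal (kern (last c) y)"
          using cy kern unfolding 1 2 3 by (simp add: emeasure_eq_measure ennreal_mult z_def)
        then show ?thesis by (simp add: mult_ac)
      qed
    qed
    also have "\<dots> = (\<integral>\<^sup>+\<omega>. U (\<zeta> \<omega>) * ennreal (kern (last (\<zeta> \<omega>)) y) * indicator (space M) \<omega> \<partial>M)"
      by (rule nn_integral_countable_valued[OF countable_lists[OF C] \<zeta>, symmetric]) simp
    also have "\<dots> = (\<integral>\<^sup>+\<omega>. U (\<zeta> \<omega>) * ennreal (kern (last (\<zeta> \<omega>)) y) \<partial>M)"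
      by (intro nn_integral_cong) simp
    finally show ?thesis .
  qed
  have "(\<integral>\<^sup>+\<omega>. U (\<zeta> \<omega>) * g (Z (Suc l) \<omega>) \<partial>M) = (\<integral>\<^sup>+\<omega>. \<integral>\<^sup>+y. g y * (U (\<zeta> \<omega>) * indicator (E y) \<omega>) \<partial>count_space C \<partial>M)"
  proof (rule nn_integral_cong)
    fix \<omega> assume \<omega>: "\<omega> \<in> space M"
    then have mem: "Z (Suc l) \<omega> \<in> C" using measurable_space[OF Z] by auto
    have "(\<integral>\<^sup>+y. g y * (U (\<zeta> \<omega>) * indicator (E y) \<omega>) \<partial>count_space C) =
        (\<integral>\<^sup>+y. (g y * U (\<zeta> \<omega>)) * indicator {Z (Suc l) \<omega>} y \<partial>count_space C)"
      using \<omega> by (intro nn_integral_cong) (auto simp: indicator_def E_def)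
    also have "\<dots> = U (\<zeta> \<omega>) * g (Z (Suc l) \<omega>)"
      using mem by (subst nn_integral_indicator_singleton) (auto simp: mult.commute)
    finally show "U (\<zeta> \<omega>) * g (Z (Suc l) \<omega>) = (\<integral>\<^sup>+y. g y * (U (\<zeta> \<omega>) * indicator (E y) \<omega>) \<partial>count_space C)" ..
  qed
  also have "\<dots> = (\<integral>\<^sup>+y. \<integral>\<^sup>+\<omega>. g y * (U (\<zeta> \<omega>) * indicator (E y) \<omega>) \<partial>M \<partial>count_space C)"
    using E by (intro nn_integral_count_space_nn_integral C borel_measurable_times_ennreal meas) auto
  also have "\<dots> = (\<integral>\<^sup>+y. \<integral>\<^sup>+\<omega>. g y * (U (\<zeta> \<omega>) * ennreal (kern (last (\<zeta> \<omega>)) y)) \<partial>M \<partial>count_space C)"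
  proof (rule nn_integral_cong)
    fix y assume "y \<in> space (count_space C)"
    then have y: "y \<in> C" by simp
    show "(\<integral>\<^sup>+\<omega>. g y * (U (\<zeta> \<omega>) * indicator (E y) \<omega>) \<partial>M) = (\<integral>\<^sup>+\<omega>. g y * (U (\<zeta> \<omega>) * ennreal (kern (last (\<zeta> \<omega>)) y)) \<partial>M)"
    proof -
      have m1: "(\<lambda>\<omega>. U (\<zeta> \<omega>) * indicator (E y) \<omega>) \<in> borel_measurable M"
        using E[OF y] by (intro borel_measurable_times_ennreal meas) auto
      have m2: "(\<lambda>\<omega>. U (\<zeta> \<omega>) * ennreal (kern (last (\<zeta> \<omega>)) y)) \<in> borel_measurable M"
        by (rule meas[of "\<lambda>c. U c * ennreal (kern (last c) y)"])
      show ?thesis unfolding nn_integral_cmult[OF m1] nn_integral_cmult[OF m2] key[OF y] ..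
    qed
  qed
  also have "\<dots> = (\<integral>\<^sup>+\<omega>. \<integral>\<^sup>+y. g y * (U (\<zeta> \<omega>) * ennreal (kern (last (\<zeta> \<omega>)) y)) \<partial>count_space C \<partial>M)"
    by (rule nn_integral_count_space_nn_integral[symmetric, OF C])
      (rule meas[of "\<lambda>c. g i * (U c * ennreal (kern (last c) i))" for i])
  also have "\<dots> = (\<integral>\<^sup>+\<omega>. U (\<zeta> \<omega>) * (\<integral>\<^sup>+y. ennreal (kern (Z l \<omega>) y) * g y \<partial>count_space C) \<partial>M)"
    unfolding last by (intro nn_integral_cong, subst nn_integral_cmult[symmetric]) (auto simp: mult_ac)
  finally show ?thesis unfolding \<zeta>_def .
qed

text \<open>The discretised Feynman--Kac solution, built forward in the time of the catalysts.\<close>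

primrec fk :: "real \<Rightarrow> (nat \<Rightarrow> int ^ 'd \<Rightarrow> ennreal) \<Rightarrow> (nat \<Rightarrow> real) \<Rightarrow> nat \<Rightarrow> int ^ 'd \<Rightarrow> ennreal" where
  "fk \<kappa> W \<tau> 0 = W 0"
| "fk \<kappa> W \<tau> (Suc k) = (\<lambda>z. W (Suc k) z *
     (\<integral>\<^sup>+y. ennreal (walk_kernel \<kappa> (\<tau> k) z y) * fk \<kappa> W \<tau> k y \<partial>count_space UNIV))"

lemma fk_cong: "(\<And>i. i \<le> k \<Longrightarrow> W i = W' i) \<Longrightarrow> fk \<kappa> W \<tau> k = fk \<kappa> W' \<tau> k"
  by (induction k) auto

lemma walk_cylinder_Suc:
  assumes "simple_random_walk M X \<nu> x" "t 0 = 0" "\<And>i. i \<le> l \<Longrightarrow> t i \<le> t (Suc i)"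
  shows "measure M {\<omega>\<in>space M. \<forall>i\<le>Suc l. X (t i) \<omega> = y i} =
    measure M {\<omega>\<in>space M. \<forall>i\<le>l. X (t i) \<omega> = y i} * walk_kernel \<nu> (t (Suc l) - t l) (y l) (y (Suc l))"
proof -
  have *: "measure M {\<omega>\<in>space M. \<forall>i\<le>m. X (t i) \<omega> = y i} =
      indicator {x} (y 0) * (\<Prod>i<m. walk_kernel \<nu> (t (Suc i) - t i) (y i) (y (Suc i)))" if "m \<le> Suc l" for m
    using assms that unfolding simple_random_walk_def by auto
  show ?thesis using *[of "Suc l"] *[of l] by simp
qed

lemma walk_start:
  assumes "simple_random_walk M X \<nu> x"
  shows "AE \<omega> in M. X 0 \<omega> = x"
proof -
  interpret prob_space M using assms by (simp add: simple_random_walk_def)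
  have "measure M {\<omega>\<in>space M. \<forall>i\<le>0::nat. X ((\<lambda>_. 0) i) \<omega> = (\<lambda>_. x) i} = 1"
    using assms unfolding simple_random_walk_def
    by (elim conjE allE[of _ "0::nat"] allE[of _ "\<lambda>_. 0::real"] allE[of _ "\<lambda>_. x"]) auto
  then have one: "prob {\<omega>\<in>space M. X 0 \<omega> = x} = 1" by simp
  \<comment> \<open>\<open>measure\<close> is 0 on nonmeasurable sets, so probability one forces
    measurability.\<close>
  then have "{\<omega>\<in>space M. X 0 \<omega> = x} \<in> events" by (metis measure_notin_sets zero_neq_one)
  then have "AE \<omega> in M. \<omega> \<in> {\<omega>\<in>space M. X 0 \<omega> = x}" using one by (simp only: prob_eq_1)
  then show ?thesis by (auto elim: AE_mp)
qed

lemma walk_measurable: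
  "simple_random_walk M X \<nu> x \<Longrightarrow> t \<ge> 0 \<Longrightarrow> X t \<in> M \<rightarrow>\<^sub>M count_space UNIV"
  by (simp add: simple_random_walk_def)

text \<open>Catalyst time \<open>t i\<close> is walk time \<open>t m - t i\<close>. The factors with
  small index belong to the latest walk times and are integrated out first, by the Markov
  property.\<close>

lemma nn_integral_fk:
  fixes W :: "nat \<Rightarrow> int ^ 'd \<Rightarrow> ennreal"
  assumes X: "simple_random_walk M X \<kappa> x" and \<kappa>: "\<kappa> \<ge> 0" and t: "\<And>i. i < m \<Longrightarrow> t i \<le> t (Suc i)"
  shows "(\<integral>\<^sup>+\<omega>. (\<Prod>i\<le>m. W i (X (t m - t i) \<omega>)) \<partial>M) = fk \<kappa> W (\<lambda>k. t (Suc k) - t k) m x"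
proof -
  interpret prob_space M using X by (simp add: simple_random_walk_def)
  let ?\<tau> = "\<lambda>k. t (Suc k) - t k"
  \<comment> \<open>The walk at its observation times, reindexed so that walk time increases, as
    cylinder probabilities require.\<close>
  define Z where "Z i = X (t m - t (m - i))" for i
  have tm: "t i \<le> t m" if "i \<le> m" for i
    using that by (induction rule: inc_induct) (use t in \<open>auto intro: order_trans\<close>)
  have Zm: "Z i \<in> M \<rightarrow>\<^sub>M count_space UNIV" for i
    unfolding Z_def using tm[of "m - i"] by (intro walk_measurable[OF X]) auto
  \<comment> \<open>The factors with index at most \<open>l\<close> have been absorbed into
    \<open>fk\<close>.\<close>
  have main: "(\<integral>\<^sup>+\<omega>. (\<Prod>i\<in>{l<..m}. W i (X (t m - t i) \<omega>)) * fk \<kappa> W ?\<tau> l (X (t m - t l) \<omega>) \<partial>M) =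
      (\<integral>\<^sup>+\<omega>. (\<Prod>i\<le>m. W i (X (t m - t i) \<omega>)) \<partial>M)" if "l \<le> m" for l
    using that
  proof (induction l)
    case 0
    have "(\<Prod>i\<le>m. W i (X (t m - t i) \<omega>)) = (\<Prod>i\<in>{0<..m}. W i (X (t m - t i) \<omega>)) * W 0 (X (t m - t 0) \<omega>)" for \<omega>
    proof -
      have "{..m} = insert 0 {0<..m}" by auto
      then show ?thesis by (simp add: mult.commute)
    qed
    then show ?case by simp
  next
    case (Suc l)
    define q where "q = m - Suc l"
    define U where "U xs = (\<Prod>i\<in>{l<..m}. W i (xs ! (m - i)))" for xs :: "(int ^ 'd) list"
    have U: "U (map (\<lambda>i. Z i \<omega>) [0..<Suc q]) = (\<Prod>i\<in>{l<..m}. W i (X (t m - t i) \<omega>))" for \<omega>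
    proof -
      have "map (\<lambda>i. Z i \<omega>) [0..<Suc q] ! (m - i) = X (t m - t i) \<omega>" if "i \<in> {l<..m}" for i
      proof -
        have "m - i < Suc q" "m - (m - i) = i" using that by (auto simp: q_def)
        then show ?thesis by (simp add: Z_def del: upt_Suc)
      qed
      then show ?thesis unfolding U_def by (intro prod.cong refl) simp
    qed
    have Zq: "Z (Suc q) \<omega> = X (t m - t l) \<omega>" "Z q \<omega> = X (t m - t (Suc l)) \<omega>" for \<omega>
      using Suc.prems by (auto simp: Z_def q_def Suc_diff_Suc)
    have "(\<integral>\<^sup>+\<omega>. (\<Prod>i\<le>m. W i (X (t m - t i) \<omega>)) \<partial>M) =
        (\<integral>\<^sup>+\<omega>. U (map (\<lambda>i. Z i \<omega>) [0..<Suc q]) * fk \<kappa> W ?\<tau> l (Z (Suc q) \<omega>) \<partial>M)"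
      using Suc by (simp add: U Zq del: upt_Suc)
    also have "\<dots> = (\<integral>\<^sup>+\<omega>. U (map (\<lambda>i. Z i \<omega>) [0..<Suc q]) *
        (\<integral>\<^sup>+y. ennreal (walk_kernel \<kappa> (?\<tau> l) (Z q \<omega>) y) * fk \<kappa> W ?\<tau> l y \<partial>count_space UNIV) \<partial>M)"
    proof (rule nn_integral_markov_step)
      show "0 \<le> walk_kernel \<kappa> (?\<tau> l) a b" for a b :: "int ^ 'd"
        using Suc.prems t[of l] \<kappa> by (intro walk_kernel_nonneg) auto
      fix y :: "nat \<Rightarrow> int ^ 'd"
      let ?r = "\<lambda>i. t m - t (m - i)"
      have "?r (Suc q) - ?r q = ?\<tau> l" using Suc.prems by (simp add: q_def Suc_diff_Suc)
      moreover have "?r i \<le> ?r (Suc i)" if "i \<le> q" for i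
      proof -
        have "Suc (m - Suc i) = m - i" using that Suc.prems by (simp add: q_def Suc_diff_Suc)
        then show ?thesis using t[of "m - Suc i"] that Suc.prems by (simp add: q_def)
      qed
      ultimately show "measure M {\<omega>\<in>space M. \<forall>i\<le>Suc q. Z i \<omega> = y i} =
          measure M {\<omega>\<in>space M. \<forall>i\<le>q. Z i \<omega> = y i} * walk_kernel \<kappa> (?\<tau> l) (y q) (y (Suc q))"
        unfolding Z_def using walk_cylinder_Suc[OF X, of ?r q y] by simp
    qed (use Zm in \<open>auto intro: finite_measure_axioms\<close>)
    also have "\<dots> = (\<integral>\<^sup>+\<omega>. (\<Prod>i\<in>{Suc l<..m}. W i (X (t m - t i) \<omega>)) * fk \<kappa> W ?\<tau> (Suc l) (X (t m - t (Suc l)) \<omega>) \<partial>M)"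
    proof (intro nn_integral_cong)
      fix \<omega>
      have "{l<..m} = insert (Suc l) {Suc l<..m}" using Suc.prems by auto
      then show "U (map (\<lambda>i. Z i \<omega>) [0..<Suc q]) *
          (\<integral>\<^sup>+y. ennreal (walk_kernel \<kappa> (?\<tau> l) (Z q \<omega>) y) * fk \<kappa> W ?\<tau> l y \<partial>count_space UNIV) =
          (\<Prod>i\<in>{Suc l<..m}. W i (X (t m - t i) \<omega>)) * fk \<kappa> W ?\<tau> (Suc l) (X (t m - t (Suc l)) \<omega>)"
        unfolding U Zq by (simp add: mult_ac)
    qed
    finally show ?case ..
  qed
  have "(\<integral>\<^sup>+\<omega>. (\<Prod>i\<le>m. W i (X (t m - t i) \<omega>)) \<partial>M) = (\<integral>\<^sup>+\<omega>. fk \<kappa> W ?\<tau> m (X 0 \<omega>) \<partial>M)"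
    using main[of m] by simp
  also have "\<dots> = (\<integral>\<^sup>+\<omega>. fk \<kappa> W ?\<tau> m x \<partial>M)"
    using walk_start[OF X] by (intro nn_integral_cong_AE) auto
  finally show ?thesis by (simp add: emeasure_space_1)
qed

lemma walk_ops_cmult_indep:
  assumes "\<And>j s z. j \<in> set is \<Longrightarrow> c (s(j := z)) = c s"
  shows "walk_ops \<nu> h is (\<lambda>s. c s * f s) s = c s * walk_ops \<nu> h is f s"
  using assms
proof (induction "is" arbitrary: s)
  case (Cons i "is")
  have "walk_ops \<nu> h is (\<lambda>s. c s * f s) = (\<lambda>s. c s * walk_ops \<nu> h is f s)"
    using Cons by (intro ext Cons.IH) auto
  then have "walk_ops \<nu> h (i # is) (\<lambda>s. c s * f s) s =
      (\<integral>\<^sup>+z. c s * (ennreal (walk_kernel (\<nu> i) h (s i) z) * walk_ops \<nu> h is f (s(i := z))) \<partial>count_space UNIV)"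
  proof -
    have "c (s(i := z)) = c s" for z by (rule Cons.prems) simp
    then show ?thesis using \<open>walk_ops \<nu> h is (\<lambda>s. c s * f s) = (\<lambda>s. c s * walk_ops \<nu> h is f s)\<close>
      by (simp only: walk_ops_Cons walk_op_def mult.left_commute)
  qed
  also have "\<dots> = c s * walk_ops \<nu> h (i # is) f s"
    by (simp add: walk_ops_Cons walk_op_def nn_integral_cmult)
  finally show ?case .
qed simp

text \<open>Coordinates evolve independently, so product functions stay products; this is what keeps
  the replicas apart.\<close>

lemma walk_ops_prod:
  assumes "distinct is"
  shows "walk_ops \<nu> h is (\<lambda>s. \<Prod>i\<in>set is. u i (s i)) s =
    (\<Prod>i\<in>set is. \<integral>\<^sup>+z. ennreal (walk_kernel (\<nu> i) h (s i) z) * u i z \<partial>count_space UNIV)"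
  using assms
proof (induction "is" arbitrary: s)
  case (Cons i "is")
  let ?G = "\<lambda>s. \<Prod>j\<in>set is. \<integral>\<^sup>+z. ennreal (walk_kernel (\<nu> j) h (s j) z) * u j z \<partial>count_space UNIV"
  have G: "?G (s(i := z)) = ?G s" for z
    using Cons.prems by (intro prod.cong refl) auto
  have IH: "walk_ops \<nu> h is (\<lambda>s. \<Prod>i\<in>set is. u i (s i)) s = ?G s" for s
    using Cons by simp
  have "walk_ops \<nu> h is (\<lambda>s. \<Prod>i\<in>set (i # is). u i (s i)) = (\<lambda>s. u i (s i) * ?G s)"
    unfolding IH[symmetric] using Cons.prems by (subst walk_ops_cmult_indep[symmetric]) auto
  then have "walk_ops \<nu> h (i # is) (\<lambda>s. \<Prod>i\<in>set (i # is). u i (s i)) s =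
      (\<integral>\<^sup>+z. ennreal (walk_kernel (\<nu> i) h (s i) z) * u i z * ?G s \<partial>count_space UNIV)"
    by (simp only: walk_ops_Cons walk_op_def fun_upd_same G mult.assoc)
  also have "\<dots> = (\<integral>\<^sup>+z. ennreal (walk_kernel (\<nu> i) h (s i) z) * u i z \<partial>count_space UNIV) * ?G s"
    by (rule nn_integral_multc) simp
  finally show ?case using Cons.prems by simp
qed simp

lemma nn_integral_walk_ops:
  fixes f :: "'w \<Rightarrow> (nat \<Rightarrow> int ^ 'd) \<Rightarrow> ennreal"
  assumes "\<And>s. (\<lambda>\<omega>. f \<omega> s) \<in> borel_measurable M"
  shows "(\<lambda>\<omega>. walk_ops \<nu> h is (f \<omega>) s) \<in> borel_measurable M"
    and "(\<integral>\<^sup>+\<omega>. walk_ops \<nu> h is (f \<omega>) s \<partial>M) = walk_ops \<nu> h is (\<lambda>s. \<integral>\<^sup>+\<omega>. f \<omega> s \<partial>M) s"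
proof (induction "is" arbitrary: s)
  case Nil
  { case 1 then show ?case using assms by simp }
  { case 2 then show ?case by simp }
next
  case (Cons i "is")
  have meas: "(\<lambda>\<omega>. ennreal (walk_kernel (\<nu> i) h (s i) z) * walk_ops \<nu> h is (f \<omega>) (s(i := z))) \<in> borel_measurable M" for s z
    by (intro borel_measurable_times_ennreal Cons.IH(1)) simp
  { case 1
    show ?case unfolding walk_ops_Cons walk_op_def
      by (intro borel_measurable_nn_integral_count_space meas) simp }
  { case 2
    have "(\<integral>\<^sup>+\<omega>. walk_ops \<nu> h (i # is) (f \<omega>) s \<partial>M) =
        (\<integral>\<^sup>+z. \<integral>\<^sup>+\<omega>. ennreal (walk_kernel (\<nu> i) h (s i) z) * walk_ops \<nu> h is (f \<omega>) (s(i := z)) \<partial>M \<partial>count_space UNIV)"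
      unfolding walk_ops_Cons walk_op_def by (intro nn_integral_count_space_nn_integral meas) simp
    also have "\<dots> = walk_ops \<nu> h (i # is) (\<lambda>s. \<integral>\<^sup>+\<omega>. f \<omega> s \<partial>M) s"
    proof -
      have m: "(\<lambda>\<omega>. walk_ops \<nu> h is (f \<omega>) (s(i := z))) \<in> borel_measurable M" for z by (rule Cons.IH(1))
      show ?thesis by (simp only: walk_ops_Cons walk_op_def nn_integral_cmult[OF m] Cons.IH(2))
    qed
    finally show ?case . }
qed

section \<open>Replicas driven by the same catalyst paths\<close>

locale pam = catalysts n p \<kappa> \<rho> x for n p \<kappa> \<rho> and x :: "int ^ 'd" +
  fixes MY :: "'v measure" and Y :: "nat \<Rightarrow> real \<Rightarrow> 'v \<Rightarrow> int ^ 'd"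
    and M :: "'w measure" and X :: "real \<Rightarrow> 'w \<Rightarrow> int ^ 'd"
  assumes n_pos: "n \<ge> 1" and Y: "\<And>k. k \<in> K \<Longrightarrow> simple_random_walk MY (Y k) \<rho> 0"
    and indep: "indep_processes MY Y K" and X: "simple_random_walk M X \<kappa> x"
begin

lemma K_nonempty: "K \<noteq> {}" using n_pos by (auto simp: K_def)

sublocale MY: prob_space MY
  using K_nonempty Y unfolding simple_random_walk_def by blast

sublocale M: prob_space M
  using X unfolding simple_random_walk_def by blast

text \<open>Independence is given for whole paths; a cylinder over finitely many times is a
  measurable event in the path space of each catalyst.\<close>

lemma catalyst_cylinder:
  fixes m :: nat
  assumes t: "\<And>i. i \<le> m \<Longrightarrow> 0 \<le> t i" and y: "\<And>i. i \<le> m \<Longrightarrow> y i \<in> PiE K (\<lambda>_. UNIV)"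
  shows "measure MY {\<omega>\<in>space MY. \<forall>i\<le>m. restrict (\<lambda>k. Y k (t i) \<omega>) K = y i} =
    (\<Prod>k\<in>K. measure MY {\<omega>\<in>space MY. \<forall>i\<le>m. Y k (t i) \<omega> = y i k})"
proof -
  let ?P = "\<lambda>_. \<Pi>\<^sub>M t\<in>{0::real..}. count_space (UNIV :: (int ^ 'd) set)"
  let ?X = "\<lambda>k \<omega>. \<lambda>t\<in>{0..}. Y k t \<omega>"
  define A where "A k = {f \<in> space (?P k). \<forall>i\<in>{..m}. f (t i) = y i k}" for k
  have A: "A k \<in> sets (?P k)" for k
    unfolding A_def
  proof (intro sets.sets_Collect_finite_All)
    fix i assume "i \<in> {..m}"
    then have [measurable]: "(\<lambda>f. f (t i)) \<in> ?P k \<rightarrow>\<^sub>M count_space UNIV"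
      using t by (intro measurable_component_singleton) auto
    show "{f \<in> space (?P k). f (t i) = y i k} \<in> sets (?P k)" by measurable
  qed (rule finite_atMost)
  have eq: "?X k -` A k \<inter> space MY = {\<omega>\<in>space MY. \<forall>i\<le>m. Y k (t i) \<omega> = y i k}" for k
    using t by (auto simp: A_def space_PiM)
  have "MY.prob (\<Inter>k\<in>K. ?X k -` A k \<inter> space MY) = (\<Prod>k\<in>K. MY.prob (?X k -` A k \<inter> space MY))"
    using indep A K_nonempty finite_KJ unfolding indep_processes_def
    by (intro MY.indep_varsD_finite) auto
  moreover have "(\<Inter>k\<in>K. ?X k -` A k \<inter> space MY) = {\<omega>\<in>space MY. \<forall>i\<le>m. restrict (\<lambda>k. Y k (t i) \<omega>) K = y i}"
  proof -
    have "restrict (\<lambda>k. Y k (t i) \<omega>) K = y i \<longleftrightarrow> (\<forall>k\<in>K. Y k (t i) \<omega> = y i k)" if "i \<le> m" for i \<omega>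
      using y[OF that] by (auto simp: fun_eq_iff restrict_def PiE_def extensional_def)
    then show ?thesis unfolding eq using K_nonempty by auto
  qed
  ultimately show ?thesis unfolding eq by simp
qed

context
  fixes t \<theta> :: "nat \<Rightarrow> real"
  assumes t0: "t 0 = 0" and t_mono: "\<And>i. t i \<le> t (Suc i)"
begin

definition place :: "nat \<Rightarrow> 'v \<Rightarrow> nat \<Rightarrow> int ^ 'd" where
  "place i \<omega> = restrict (\<lambda>k. Y k (t i) \<omega>) K"

definition history :: "nat \<Rightarrow> 'v \<Rightarrow> (nat \<Rightarrow> int ^ 'd) list" where
  "history l \<omega> = map (\<lambda>i. place i \<omega>) [0..<Suc l]"

definition weight :: "'v \<Rightarrow> nat \<Rightarrow> int ^ 'd \<Rightarrow> ennreal" where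
  "weight \<omega> i z = ennreal (exp (\<theta> i * catalyst n Y \<omega> z (t i)))"

text \<open>The weight computed from the recorded positions alone. It exhibits \<open>fk\<close> as
  a function of a countably valued random variable, which settles measurability and fits the Markov
  step.\<close>

definition weight_list :: "(nat \<Rightarrow> int ^ 'd) list \<Rightarrow> nat \<Rightarrow> int ^ 'd \<Rightarrow> ennreal" where
  "weight_list c i z = ennreal (exp (\<theta> i * (\<Sum>k\<in>K. indicator {z} ((c ! i) k))))"

abbreviation dt :: "nat \<Rightarrow> real" where "dt \<equiv> \<lambda>l. t (Suc l) - t l"

text \<open>Given the catalyst paths, the p-th power of the quenched solution is a product over
  replicas. With the replica positions free and the catalysts pinned, the expectation becomes a
  function of configurations that obeys a closed recursion.\<close>

definition joint :: "nat \<Rightarrow> 'v \<Rightarrow> (nat \<Rightarrow> int ^ 'd) \<Rightarrow> ennreal" where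
  "joint l \<omega> s = (\<Prod>i\<in>K \<union> J. if i \<in> K then indicator {s i} (Y i (t l) \<omega>) else fk \<kappa> (weight \<omega>) dt l (s i))"

lemma t_nonneg: "0 \<le> t i"
proof (induction i)
  case (Suc i)
  then show ?case using t_mono[of i] by linarith
qed (simp add: t0)

lemma place_measurable: "place i \<in> MY \<rightarrow>\<^sub>M count_space (PiE K (\<lambda>_. UNIV))"
  unfolding measurable_count_space_eq_countable[OF countable_PiE_K]
proof (intro conjI ballI)
  show "place i \<in> space MY \<rightarrow> PiE K (\<lambda>_. UNIV)" by (auto simp: place_def)
  fix y assume y: "y \<in> PiE K (\<lambda>_. UNIV :: (int ^ 'd) set)"
  have "place i -` {y} \<inter> space MY = {\<omega>\<in>space MY. \<forall>k\<in>K. Y k (t i) \<omega> = y k}"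
    using y by (auto simp: place_def fun_eq_iff restrict_def PiE_def extensional_def)
  also have "\<dots> \<in> sets MY"
  proof (intro sets.sets_Collect_finite_All finite_KJ)
    fix k assume "k \<in> K"
    then have [measurable]: "Y k (t i) \<in> MY \<rightarrow>\<^sub>M count_space UNIV"
      by (intro walk_measurable[OF Y] t_nonneg)
    show "{\<omega>\<in>space MY. Y k (t i) \<omega> = y k} \<in> sets MY" by measurable
  qed
  finally show "place i -` {y} \<inter> space MY \<in> sets MY" .
qed

lemma history_measurable: "history l \<in> MY \<rightarrow>\<^sub>M count_space (lists (PiE K (\<lambda>_. UNIV)))"
  unfolding history_def[abs_def] by (intro measurable_path_list countable_PiE_K place_measurable)

lemma weight_list_history: "i \<le> l \<Longrightarrow> weight_list (history l \<omega>) i = weight \<omega> i"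
proof -
  assume "i \<le> l"
  then have "history l \<omega> ! i = place i \<omega>" unfolding history_def by (subst nth_map) (auto simp del: upt_Suc)
  moreover have "(\<Sum>k\<in>K. indicator {z} (place i \<omega> k)) = catalyst n Y \<omega> z (t i)" for z
    unfolding catalyst_def K_def[symmetric] by (intro sum.cong) (auto simp: place_def)
  ultimately show ?thesis by (simp add: weight_list_def[abs_def] weight_def[abs_def])
qed

lemma fk_history: "fk \<kappa> (weight \<omega>) dt l = fk \<kappa> (weight_list (history l \<omega>)) dt l"
  by (rule fk_cong) (simp add: weight_list_history)

lemma history_fun_measurable: "(\<lambda>\<omega>. F (history l \<omega>)) \<in> borel_measurable MY" for F :: "_ \<Rightarrow> ennreal"
  by (rule measurable_compose[OF history_measurable]) simp

lemma joint_measurable: "(\<lambda>\<omega>. joint l \<omega> s) \<in> borel_measurable MY"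
proof -
  have "(if i \<in> K then indicator {s i} (Y i (t l) \<omega>) else fk \<kappa> (weight \<omega>) dt l (s i)) =
    (if i \<in> K then indicator {s i} ((history l \<omega> ! l) i) else fk \<kappa> (weight_list (history l \<omega>)) dt l (s i))" for i \<omega>
  proof -
    have "history l \<omega> ! l = place l \<omega>" unfolding history_def by (subst nth_map) (auto simp del: upt_Suc)
    then show ?thesis by (simp add: place_def fk_history)
  qed
  then have "(\<lambda>\<omega>. joint l \<omega> s) = (\<lambda>\<omega>. (\<lambda>c. \<Prod>i\<in>K \<union> J. if i \<in> K then indicator {s i} ((c ! l) i) else fk \<kappa> (weight_list c) dt l (s i)) (history l \<omega>))"
    unfolding joint_def by simp
  then show ?thesis
    using history_fun_measurable[of "\<lambda>c. \<Prod>i\<in>K \<union> J. if i \<in> K then indicator {s i} ((c ! l) i) else fk \<kappa> (weight_list c) dt l (s i)" l]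
    by simp
qed

lemma joint_split: "joint l \<omega> s = (\<Prod>k\<in>K. indicator {s k} (Y k (t l) \<omega>)) * (\<Prod>j\<in>J. fk \<kappa> (weight \<omega>) dt l (s j))"
proof -
  have "joint l \<omega> s = (\<Prod>i\<in>K. if i \<in> K then indicator {s i} (Y i (t l) \<omega>) else fk \<kappa> (weight \<omega>) dt l (s i)) *
    (\<Prod>i\<in>J. if i \<in> K then indicator {s i} (Y i (t l) \<omega>) else fk \<kappa> (weight \<omega>) dt l (s i))"
    unfolding joint_def by (rule prod.union_disjoint) (use finite_KJ KJ_disjoint in auto)
  moreover have "(\<Prod>i\<in>J. if i \<in> K then indicator {s i} (Y i (t l) \<omega>) else fk \<kappa> (weight \<omega>) dt l (s i)) =
      (\<Prod>j\<in>J. fk \<kappa> (weight \<omega>) dt l (s j))"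
    using KJ_disjoint by (intro prod.cong) auto
  ultimately show ?thesis by simp
qed

lemma prod_indicator_place: "(\<Prod>k\<in>K. indicator {s k} (Y k (t l) \<omega>)) = (indicator {restrict s K} (place l \<omega>) :: ennreal)"
proof (cases "\<forall>k\<in>K. Y k (t l) \<omega> = s k")
  case True
  then have "place l \<omega> = restrict s K" by (auto simp: place_def restrict_def)
  then show ?thesis using True by simp
next
  case False
  then obtain k where k: "k \<in> K" "Y k (t l) \<omega> \<noteq> s k" by auto
  then have "place l \<omega> \<noteq> restrict s K" by (auto simp: place_def fun_eq_iff)
  moreover have "(\<Prod>k\<in>K. indicator {s k} (Y k (t l) \<omega>)) = (0 :: ennreal)"
    using k finite_KJ by (intro prod_zero bexI[of _ k]) auto
  ultimately show ?thesis by simp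
qed

text \<open>The last catalyst step is averaged by the Markov property. Symmetry of the kernel turns
  this forward transition into an operator in \<open>s\<close> of the same form as for the replicas,
  and on the event that the catalysts are at \<open>s\<close> the new weights multiply to the
  exponential of the potential.\<close>

lemma nn_integral_joint_Suc:
  "(\<integral>\<^sup>+\<omega>. joint (Suc l) \<omega> s \<partial>MY) =
    ennreal (exp (\<theta> (Suc l) * pot s)) * walk_ops rates (dt l) idx (\<lambda>s. \<integral>\<^sup>+\<omega>. joint l \<omega> s \<partial>MY) s"
proof -
  let ?S = "PiE K (\<lambda>_. UNIV :: (int ^ 'd) set)"
  let ?P = "\<lambda>\<omega> z. \<integral>\<^sup>+y. ennreal (walk_kernel \<kappa> (dt l) z y) * fk \<kappa> (weight \<omega>) dt l y \<partial>count_space UNIV"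
  define U where "U c = (\<Prod>j\<in>J. \<integral>\<^sup>+y. ennreal (walk_kernel \<kappa> (dt l) (s j) y) * fk \<kappa> (weight_list c) dt l y \<partial>count_space UNIV)" for c
  define kern where "kern a b = (\<Prod>k\<in>K. walk_kernel \<rho> (dt l) (a k) (b k))" for a b :: "nat \<Rightarrow> int ^ 'd"
  let ?g = "indicator {restrict s K} :: (nat \<Rightarrow> int ^ 'd) \<Rightarrow> ennreal"
  let ?c = "ennreal (exp (\<theta> (Suc l) * pot s))"
  have dt: "0 \<le> dt l" using t_mono[of l] by simp
  have U: "U (history l \<omega>) = (\<Prod>j\<in>J. ?P \<omega> (s j))" for \<omega>
    by (simp only: U_def fk_history)
  have 1: "joint (Suc l) \<omega> s = ?c * (U (history l \<omega>) * ?g (place (Suc l) \<omega>))" for \<omega>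
  proof (cases "place (Suc l) \<omega> = restrict s K")
    case False
    then show ?thesis by (simp add: joint_split prod_indicator_place)
  next
    case True
    have "Y k (t (Suc l)) \<omega> = s k" if "k \<in> K" for k
      using fun_cong[OF True, of k] that by (simp add: place_def)
    then have "catalyst n Y \<omega> z (t (Suc l)) = (\<Sum>k\<in>K. indicator {s k} z)" for z
      unfolding catalyst_def K_def[symmetric] by (intro sum.cong refl) (auto simp: indicator_def)
    then have w: "weight \<omega> (Suc l) z = ennreal (exp (\<theta> (Suc l) * (\<Sum>k\<in>K. indicator {s k} z)))" for z
      by (simp add: weight_def)
    have "(\<Prod>j\<in>J. weight \<omega> (Suc l) (s j)) = ?c"
      unfolding w by (simp add: prod_ennreal exp_sum[OF finite_KJ(2), symmetric] pot_def sum_distrib_left)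
    then show ?thesis
      unfolding joint_split prod_indicator_place U by (simp add: True prod.distrib)
  qed
  have nonneg: "0 \<le> walk_kernel (rates i) (dt l) a b" for i a b
    by (intro walk_kernel_nonneg rate_nonneg dt)
  have rK: "rates k = \<rho>" if "k \<in> K" for k using that by (simp add: rates_def)
  have kern0: "0 \<le> kern a b" for a b
    unfolding kern_def using rates_nonneg dt by (intro prod_nonneg ballI walk_kernel_nonneg)
  have 2: "(\<integral>\<^sup>+\<omega>. U (history l \<omega>) * ?g (place (Suc l) \<omega>) \<partial>MY) =
      (\<integral>\<^sup>+\<omega>. U (history l \<omega>) * (\<integral>\<^sup>+y. ennreal (kern (place l \<omega>) y) * ?g y \<partial>count_space ?S) \<partial>MY)"
    unfolding history_def
  proof (rule nn_integral_markov_step[OF MY.finite_measure_axioms countable_PiE_K place_measurable _ kern0])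
    fix y :: "nat \<Rightarrow> nat \<Rightarrow> int ^ 'd" assume y: "\<And>i. i \<le> Suc l \<Longrightarrow> y i \<in> ?S"
    have "measure MY {\<omega>\<in>space MY. \<forall>i\<le>Suc l. place i \<omega> = y i} =
        (\<Prod>k\<in>K. measure MY {\<omega>\<in>space MY. \<forall>i\<le>Suc l. Y k (t i) \<omega> = y i k})"
      unfolding place_def by (intro catalyst_cylinder t_nonneg y)
    also have "\<dots> = (\<Prod>k\<in>K. measure MY {\<omega>\<in>space MY. \<forall>i\<le>l. Y k (t i) \<omega> = y i k} *
        walk_kernel \<rho> (dt l) (y l k) (y (Suc l) k))"
      by (intro prod.cong refl walk_cylinder_Suc[OF Y, where y = "\<lambda>i. y i k" for k] t0 t_mono)
    also have "\<dots> = measure MY {\<omega>\<in>space MY. \<forall>i\<le>l. place i \<omega> = y i} * kern (y l) (y (Suc l))"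
      unfolding place_def kern_def prod.distrib using y by (subst catalyst_cylinder) (auto simp: t_nonneg)
    finally show "measure MY {\<omega>\<in>space MY. \<forall>i\<le>Suc l. place i \<omega> = y i} =
        measure MY {\<omega>\<in>space MY. \<forall>i\<le>l. place i \<omega> = y i} * kern (y l) (y (Suc l))" .
  qed
  have 3: "U (history l \<omega>) * (\<integral>\<^sup>+y. ennreal (kern (place l \<omega>) y) * ?g y \<partial>count_space ?S) =
      walk_ops rates (dt l) idx (joint l \<omega>) s" for \<omega>
  proof -
    have "(\<integral>\<^sup>+y. ennreal (kern (place l \<omega>) y) * ?g y \<partial>count_space ?S) = ennreal (kern (place l \<omega>) (restrict s K))"
      by (subst nn_integral_indicator_singleton) auto
    also have "\<dots> = (\<Prod>k\<in>K. ennreal (walk_kernel (rates k) (dt l) (s k) (Y k (t l) \<omega>)))"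
    proof -
      have "kern (place l \<omega>) (restrict s K) = (\<Prod>k\<in>K. walk_kernel (rates k) (dt l) (s k) (Y k (t l) \<omega>))"
        unfolding kern_def by (intro prod.cong refl) (simp add: place_def rK walk_kernel_sym[of _ _ "s _"])
      then show ?thesis by (simp add: prod_ennreal nonneg)
    qed
    also have "\<dots> = (\<Prod>i\<in>K. \<integral>\<^sup>+z. ennreal (walk_kernel (rates i) (dt l) (s i) z) *
       (if i \<in> K then indicator {z} (Y i (t l) \<omega>) else fk \<kappa> (weight \<omega>) dt l z) \<partial>count_space UNIV)"
    proof (intro prod.cong refl)
      fix i assume i: "i \<in> K"
      have "(\<integral>\<^sup>+z. ennreal (walk_kernel (rates i) (dt l) (s i) z) *
       (if i \<in> K then indicator {z} (Y i (t l) \<omega>) else fk \<kappa> (weight \<omega>) dt l z) \<partial>count_space UNIV) =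
       (\<integral>\<^sup>+z. ennreal (walk_kernel (rates i) (dt l) (s i) z) * indicator {Y i (t l) \<omega>} z \<partial>count_space UNIV)"
        using i by (intro nn_integral_cong) (auto simp: indicator_def)
      then show "ennreal (walk_kernel (rates i) (dt l) (s i) (Y i (t l) \<omega>)) = (\<integral>\<^sup>+z. ennreal (walk_kernel (rates i) (dt l) (s i) z) *
       (if i \<in> K then indicator {z} (Y i (t l) \<omega>) else fk \<kappa> (weight \<omega>) dt l z) \<partial>count_space UNIV)"
        by simp
    qed
    finally have a: "(\<integral>\<^sup>+y. ennreal (kern (place l \<omega>) y) * ?g y \<partial>count_space ?S) =
      (\<Prod>i\<in>K. \<integral>\<^sup>+z. ennreal (walk_kernel (rates i) (dt l) (s i) z) *
       (if i \<in> K then indicator {z} (Y i (t l) \<omega>) else fk \<kappa> (weight \<omega>) dt l z) \<partial>count_space UNIV)" .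
    have b: "U (history l \<omega>) = (\<Prod>i\<in>J. \<integral>\<^sup>+z. ennreal (walk_kernel (rates i) (dt l) (s i) z) *
       (if i \<in> K then indicator {z} (Y i (t l) \<omega>) else fk \<kappa> (weight \<omega>) dt l z) \<partial>count_space UNIV)"
      unfolding U
    proof (intro prod.cong refl)
      fix j assume "j \<in> J"
      then have "rates j = \<kappa>" "j \<notin> K" using KJ_disjoint by (auto simp: rates_def)
      then show "?P \<omega> (s j) = (\<integral>\<^sup>+z. ennreal (walk_kernel (rates j) (dt l) (s j) z) *
       (if j \<in> K then indicator {z} (Y j (t l) \<omega>) else fk \<kappa> (weight \<omega>) dt l z) \<partial>count_space UNIV)"
        by simp
    qed
    have "walk_ops rates (dt l) idx (joint l \<omega>) s = (\<Prod>i\<in>set idx. \<integral>\<^sup>+z. ennreal (walk_kernel (rates i) (dt l) (s i) z) *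
       (if i \<in> K then indicator {z} (Y i (t l) \<omega>) else fk \<kappa> (weight \<omega>) dt l z) \<partial>count_space UNIV)"
      using walk_ops_prod[OF distinct_idx, of rates "dt l" "\<lambda>i z. if i \<in> K then indicator {z} (Y i (t l) \<omega>) else fk \<kappa> (weight \<omega>) dt l z" s]
      by (simp add: joint_def[abs_def] set_idx)
    also have "\<dots> = U (history l \<omega>) * (\<integral>\<^sup>+y. ennreal (kern (place l \<omega>) y) * ?g y \<partial>count_space ?S)"
      unfolding a b set_idx by (subst prod.union_disjoint) (use finite_KJ KJ_disjoint in \<open>auto simp: mult.commute\<close>)
    finally show ?thesis ..
  qed
  have "(\<integral>\<^sup>+\<omega>. joint (Suc l) \<omega> s \<partial>MY) = ?c * (\<integral>\<^sup>+\<omega>. U (history l \<omega>) * ?g (place (Suc l) \<omega>) \<partial>MY)"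
    unfolding 1
    by (intro nn_integral_cmult borel_measurable_times_ennreal history_fun_measurable
        measurable_compose[OF place_measurable]) simp
  also have "\<dots> = ?c * (\<integral>\<^sup>+\<omega>. walk_ops rates (dt l) idx (joint l \<omega>) s \<partial>MY)"
    unfolding 2 3 ..
  also have "\<dots> = ?c * walk_ops rates (dt l) idx (\<lambda>s. \<integral>\<^sup>+\<omega>. joint l \<omega> s \<partial>MY) s"
    by (simp only: nn_integral_walk_ops(2)[OF joint_measurable])
  finally show ?thesis .
qed

lemma nn_integral_joint_0: "\<theta> 0 = 0 \<Longrightarrow> (\<integral>\<^sup>+\<omega>. joint 0 \<omega> s \<partial>MY) = ennreal (init s)"
proof -
  assume th: "\<theta> 0 = 0"
  have "AE \<omega> in MY. \<forall>k\<in>K. Y k 0 \<omega> = 0"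
    using walk_start[OF Y] finite_KJ by (intro AE_finite_allI) auto
  then have "AE \<omega> in MY. joint 0 \<omega> s = ennreal (init s)"
  proof eventually_elim
    case (elim \<omega>)
    have "(\<Prod>j\<in>J. fk \<kappa> (weight \<omega>) dt 0 (s j)) = 1" using th by (simp add: weight_def)
    moreover have "(\<Prod>k\<in>K. indicator {s k} (Y k (t 0) \<omega>)) = ennreal (init s)"
    proof (cases "\<forall>k\<in>K. s k = 0")
      case True
      then show ?thesis using elim by (simp add: t0 init_def)
    next
      case False
      then obtain k where "k \<in> K" "s k \<noteq> 0" by auto
      then have "(\<Prod>k\<in>K. indicator {s k} (Y k (t 0) \<omega>)) = (0 :: ennreal)"
        using elim finite_KJ by (intro prod_zero bexI[of _ k]) (auto simp: t0)
      moreover have "init s = 0" using False by (simp only: init_def if_False)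
      ultimately show ?thesis by (simp only: ennreal_0)
    qed
    ultimately show ?case by (simp add: joint_split)
  qed
  then have "(\<integral>\<^sup>+\<omega>. joint 0 \<omega> s \<partial>MY) = (\<integral>\<^sup>+\<omega>. ennreal (init s) \<partial>MY)"
    by (rule nn_integral_cong_AE)
  then show ?thesis by (simp add: MY.emeasure_space_1)
qed

text \<open>Summing over the pinned catalyst positions removes the indicator; putting all replicas
  at \<open>x\<close> makes their product a power.\<close>

lemma nn_integral_fk_power:
  "(\<integral>\<^sup>+\<omega>. fk \<kappa> (weight \<omega>) dt m x ^ p \<partial>MY) =
    (\<integral>\<^sup>+y. (\<integral>\<^sup>+\<omega>. joint m \<omega> (cfg y) \<partial>MY) \<partial>count_space (PiE K (\<lambda>_. UNIV)))"
proof -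
  have "(\<integral>\<^sup>+y. joint m \<omega> (cfg y) \<partial>count_space (PiE K (\<lambda>_. UNIV))) = fk \<kappa> (weight \<omega>) dt m x ^ p" for \<omega>
  proof -
    have "(\<integral>\<^sup>+y. joint m \<omega> (cfg y) \<partial>count_space (PiE K (\<lambda>_. UNIV))) =
      (\<integral>\<^sup>+y. fk \<kappa> (weight \<omega>) dt m x ^ p * indicator {place m \<omega>} y \<partial>count_space (PiE K (\<lambda>_. UNIV)))"
    proof (intro nn_integral_cong)
      fix y assume "y \<in> space (count_space (PiE K (\<lambda>_. UNIV :: (int ^ 'd) set)))"
      then have y: "y \<in> PiE K (\<lambda>_. UNIV)" by simp
      have "restrict (cfg y) K = y"
        using y by (auto simp: fun_eq_iff cfg_def PiE_def extensional_def)
      moreover have "(\<Prod>j\<in>J. fk \<kappa> (weight \<omega>) dt m (cfg y j)) = fk \<kappa> (weight \<omega>) dt m x ^ p"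
      proof -
        have "(\<Prod>j\<in>J. fk \<kappa> (weight \<omega>) dt m (cfg y j)) = (\<Prod>j\<in>J. fk \<kappa> (weight \<omega>) dt m x)"
          using KJ_disjoint by (intro prod.cong refl) (auto simp: cfg_def start_def)
        then show ?thesis by (simp add: J_def)
      qed
      ultimately show "joint m \<omega> (cfg y) = fk \<kappa> (weight \<omega>) dt m x ^ p * indicator {place m \<omega>} y"
        unfolding joint_split prod_indicator_place by (auto simp: indicator_def)
    qed
    also have "\<dots> = fk \<kappa> (weight \<omega>) dt m x ^ p"
      by (subst nn_integral_indicator_singleton) (auto simp: place_def)
    finally show ?thesis .
  qed
  then show ?thesis
    by (subst nn_integral_count_space_nn_integral[OF countable_PiE_K joint_measurable, symmetric]) simp
qed

end

end

section \<open>Riemann sums along right-continuous paths\<close>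

definition locally_constant_at :: "(real \<Rightarrow> 'a) \<Rightarrow> real \<Rightarrow> bool" where
  "locally_constant_at f s \<longleftrightarrow> (\<exists>d>0. \<forall>r. \<bar>r - s\<bar> < d \<longrightarrow> f r = f s)"

lemma eventually_eq_site:
  fixes f :: "real \<Rightarrow> int ^ 'd"
  assumes "(f \<longlongrightarrow> y) F"
  shows "eventually (\<lambda>r. f r = y) F"
proof -
  have "eventually (\<lambda>r. f r $ i = y $ i) F" for i
    using tendsto_vec_nth[OF assms, of i] by (simp only: tendsto_discrete)
  then have "eventually (\<lambda>r. \<forall>i. f r $ i = y $ i) F" by (rule eventually_all_finite)
  then show ?thesis by (simp add: vec_eq_iff)
qed

text \<open>A cadlag path in a discrete space is constant on both sides of every time, so its jump times
  do not accumulate.\<close>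

lemma countable_jumps:
  fixes f :: "real \<Rightarrow> int ^ 'd"
  assumes right: "\<And>t. 0 \<le> t \<Longrightarrow> continuous (at_right t) f"
    and left: "\<And>t. 0 < t \<Longrightarrow> \<exists>y. (f \<longlongrightarrow> y) (at_left t)"
  shows "countable {s. 0 < s \<and> \<not> locally_constant_at f s}" (is "countable ?D")
proof -
  have nolim: "\<not> t islimpt ?D" if t: "0 < t" for t
  proof -
    have "eventually (\<lambda>r. f r = f t) (at_right t)"
      using right[of t] t by (intro eventually_eq_site) (simp add: continuous_within)
    then obtain b where b: "b > t" "\<And>r. t < r \<Longrightarrow> r < b \<Longrightarrow> f r = f t"
      by (auto simp: eventually_at_right_field)
    obtain y where "eventually (\<lambda>r. f r = y) (at_left t)"
      using left[OF t] eventually_eq_site by blast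
    then obtain a where a: "a < t" "\<And>r. a < r \<Longrightarrow> r < t \<Longrightarrow> f r = y"
      by (auto simp: eventually_at_left_field)
    have "locally_constant_at f r" if r: "a < r" "r < b" "r \<noteq> t" for r
      unfolding locally_constant_at_def
    proof (cases "r < t")
      case True
      have *: "f q = f r" if "\<bar>q - r\<bar> < min (r - a) (t - r)" for q
      proof -
        have "a < q" "q < t" using that by (auto simp: abs_less_iff)
        then show ?thesis using a(2)[of q] a(2)[of r] r True by simp
      qed
      show "\<exists>d>0. \<forall>q. \<bar>q - r\<bar> < d \<longrightarrow> f q = f r"
        by (intro exI[of _ "min (r - a) (t - r)"] conjI allI impI *) (use r True in auto)
    next
      case False
      have *: "f q = f r" if "\<bar>q - r\<bar> < min (b - r) (r - t)" for q
      proof -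
        have "t < q" "q < b" using that by (auto simp: abs_less_iff)
        then show ?thesis using b(2)[of q] b(2)[of r] r False by simp
      qed
      show "\<exists>d>0. \<forall>q. \<bar>q - r\<bar> < d \<longrightarrow> f q = f r"
        by (intro exI[of _ "min (b - r) (r - t)"] conjI allI impI *) (use r False in auto)
    qed
    then show ?thesis
      using a(1) b(1) by (auto simp: islimpt_def intro!: exI[of _ "{a<..<b}"])
  qed
  \<comment> \<open>By Bolzano-Weierstrass infinitely many jumps in a compact interval away from 0
    would accumulate.\<close>
  have "finite (?D \<inter> {1 / real (Suc m)..real m})" for m
  proof (rule ccontr)
    assume "infinite (?D \<inter> {1 / real (Suc m)..real m})"
    moreover have "compact {1 / real (Suc m)..real m}" by simp
    ultimately obtain t where "t \<in> {1 / real (Suc m)..real m}" "t islimpt (?D \<inter> {1 / real (Suc m)..real m})"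
      unfolding compact_eq_Bolzano_Weierstrass by blast
    moreover then have "0 < t" by (auto intro: less_le_trans[rotated])
    ultimately show False using nolim[of t] islimpt_subset by blast
  qed
  then have "countable (\<Union>m. ?D \<inter> {1 / real (Suc m)..real m})"
    by (intro countable_UN[OF countableI_type] countable_finite)
  moreover have "?D \<subseteq> (\<Union>m. ?D \<inter> {1 / real (Suc m)..real m})"
  proof
    fix s assume s: "s \<in> ?D"
    then have "0 < s" by simp
    then obtain m1 where m1: "1 / real (Suc m1) < s" using reals_Archimedean by (auto simp: inverse_eq_divide)
    obtain m2 where m2: "s \<le> real m2" using real_arch_simple by blast
    have "1 / real (Suc (max m1 m2)) \<le> 1 / real (Suc m1)" by (intro divide_left_mono) auto
    then show "s \<in> (\<Union>m. ?D \<inter> {1 / real (Suc m)..real m})"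
      using s m1 m2 by (intro UN_I[of "max m1 m2"]) auto
  qed
  ultimately show ?thesis by (rule countable_subset[rotated])
qed

definition riemann_sum :: "real \<Rightarrow> real \<Rightarrow> nat \<Rightarrow> (real \<Rightarrow> real) \<Rightarrow> real" where
  "riemann_sum a b N f = (b - a) / N * (\<Sum>j<N. f (a + real j * ((b - a) / N)))"

text \<open>Dominated convergence for the step functions behind the left Riemann sums, which
  converge at continuity points, that is off a countable set. Measurability of \<open>f\<close> on
  the interval is obtained along the way, as that of a limit.\<close>

lemma riemann_sum_tendsto:
  fixes f :: "real \<Rightarrow> real"
  assumes ab: "a < b" and bound: "\<And>s. \<bar>f s\<bar> \<le> B" and D: "countable D"
    and cont: "\<And>s. a < s \<Longrightarrow> s < b \<Longrightarrow> s \<notin> D \<Longrightarrow> isCont f s"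
  shows "set_integrable lborel {a..b} f"
    and "(\<lambda>N. riemann_sum a b N f) \<longlonglongrightarrow> (LINT s:{a..b}|lborel. f s)"
proof -
  have B: "0 \<le> B" using bound[of 0] by linarith
  define C where "C = insert a (insert b D)"
  have C: "countable C" using D by (simp add: C_def)
  define h where "h N = (b - a) / real (Suc N)" for N
  have h: "h N > 0" "a + real (Suc N) * h N = b" for N using ab by (auto simp: h_def)
  define J where "J N j = {a + real j * h N..<a + real (Suc j) * h N}" for N j
  define g where "g N s = (\<Sum>j<Suc N. indicator (J N j) s * f (a + real j * h N))" for N s
  have g_meas: "g N \<in> borel_measurable borel" for N unfolding g_def J_def by measurable
  have J_emeasure: "emeasure lborel (J N j) = ennreal (h N)" for N j
    using h(1)[of N] by (simp add: J_def algebra_simps)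
  have g_int: "integral\<^sup>L lborel (g N) = riemann_sum a b (Suc N) f" for N
  proof -
    have "integral\<^sup>L lborel (g N) = (\<Sum>j<Suc N. \<integral>s. indicator (J N j) s * f (a + real j * h N) \<partial>lborel)"
      unfolding g_def
      by (intro Bochner_Integration.integral_sum integrable_mult_left integrable_real_indicator)
        (auto simp: J_emeasure, simp add: J_def)
    also have "\<dots> = (\<Sum>j<Suc N. h N * f (a + real j * h N))"
      using h(1)[of N] by (intro sum.cong refl) (simp add: J_emeasure measure_def)
    finally show ?thesis by (simp only: riemann_sum_def h_def sum_distrib_left)
  qed
  have inside: "\<exists>r. g N s = f r \<and> \<bar>r - s\<bar> \<le> h N" if s: "a < s" "s < b" for N s
  proof -
    define j where "j = nat \<lfloor>(s - a) / h N\<rfloor>"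
    have fl: "real j \<le> (s - a) / h N" "(s - a) / h N < real j + 1"
      using s h(1)[of N] by (auto simp: j_def)
    then have j1: "a + real j * h N \<le> s" "s < a + (real j + 1) * h N"
      using h(1)[of N] by (auto simp: field_simps)
    have "real j * h N < real (Suc N) * h N" using j1 s h(2)[of N] by linarith
    then have jN: "j < Suc N" using h(1)[of N] by simp
    have uniq: "s \<in> J N i \<longleftrightarrow> i = j" for i
    proof
      assume "s \<in> J N i"
      then have "a + real i * h N \<le> s" "s < a + (real i + 1) * h N" by (auto simp: J_def add.commute[of 1])
      then have "real i * h N < (real j + 1) * h N" "real j * h N < (real i + 1) * h N" using j1 by linarith+
      then have "real i < real j + 1" "real j < real i + 1" using h(1)[of N] by simp_all
      then show "i = j" by linarith
    qed (use j1 in \<open>simp add: J_def algebra_simps\<close>)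
    have "g N s = (\<Sum>i<Suc N. if i = j then f (a + real i * h N) else 0)"
      unfolding g_def by (intro sum.cong refl) (simp add: indicator_def uniq)
    then have "g N s = f (a + real j * h N)" using jN by simp
    moreover have "\<bar>a + real j * h N - s\<bar> \<le> h N" using j1 by (simp add: algebra_simps abs_le_iff)
    ultimately show ?thesis by blast
  qed
  have outside: "g N s = 0" if "s < a \<or> b < s" for N s
  proof -
    have "s \<notin> J N j" if "j < Suc N" for j
    proof -
      have "a \<le> a + real j * h N" using h(1)[of N] by simp
      moreover have "real (Suc j) * h N \<le> real (Suc N) * h N" using that h(1)[of N] by (intro mult_right_mono) auto
      ultimately show ?thesis using \<open>s < a \<or> b < s\<close> h(2)[of N] unfolding J_def by force
    qed
    then show ?thesis by (simp add: g_def)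
  qed
  have h0: "h \<longlonglongrightarrow> 0"
    unfolding h_def using LIMSEQ_Suc[OF lim_const_over_n[of "b - a"]] by simp
  let ?F = "\<lambda>s. indicator {a..b} s * f s"
  have lim: "(\<lambda>N. g N s) \<longlonglongrightarrow> ?F s" if "s \<notin> C" for s
  proof (cases "a < s \<and> s < b")
    case True
    then obtain r where r: "\<And>N. g N s = f (r N)" "\<And>N. \<bar>r N - s\<bar> \<le> h N" using inside[of s] by metis
    have "(\<lambda>N. r N - s) \<longlonglongrightarrow> 0"
      by (rule tendsto_rabs_zero_cancel, rule tendsto_sandwich[OF _ _ tendsto_const h0]) (auto simp: r(2))
    then have "r \<longlonglongrightarrow> s" by (simp add: LIM_zero_iff)
    moreover have "isCont f s" using True that by (intro cont) (auto simp: C_def)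
    ultimately have "(\<lambda>N. f (r N)) \<longlonglongrightarrow> f s" by (rule isCont_tendsto_compose[rotated])
    then show ?thesis using True by (simp add: r(1))
  next
    case False
    then have "s < a \<or> b < s" using that by (auto simp: C_def)
    then show ?thesis using outside[of s] by (auto simp: indicator_def)
  qed
  have F_meas: "?F \<in> borel_measurable borel"
  proof (rule measurable_discrete_difference[where X = C])
    show "(\<lambda>s. indicator (- C) s * ?F s) \<in> borel_measurable borel"
    proof (rule borel_measurable_LIMSEQ_real)
      have "C \<in> sets borel" by (rule sets.countable[OF _ C]) simp
      then show "(\<lambda>s. indicator (- C) s * g N s) \<in> borel_measurable borel" for N
        using g_meas[of N] by (intro borel_measurable_times borel_measurable_indicator) auto
      show "(\<lambda>N. indicator (- C) s * g N s) \<longlonglongrightarrow> indicator (- C) s * ?F s" for s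
        using lim[of s] by (cases "s \<in> C") (auto intro: tendsto_mult_left)
    qed
  qed (use C in auto)
  have g_bound: "\<bar>g N s\<bar> \<le> B * indicator {a..b} s" if "s \<notin> C" for N s
  proof (cases "a < s \<and> s < b")
    case True
    then obtain r where "g N s = f r" using inside by blast
    then show ?thesis using True bound[of r] by simp
  next
    case False
    then have "s < a \<or> b < s" using that by (auto simp: C_def)
    then show ?thesis using outside[of s N] B by auto
  qed
  have AE_C: "AE s in lborel. s \<notin> C"
    using C by (intro AE_not_in countable_imp_null_set_lborel)
  have ind: "integrable lborel (\<lambda>s. B * indicator {a..b} s :: real)"
    by (intro integrable_mult_right integrable_real_indicator) (auto simp: emeasure_lborel_Icc_eq)
  have AE_lim: "AE s in lborel. (\<lambda>N. g N s) \<longlonglongrightarrow> ?F s"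
    using AE_C by eventually_elim (rule lim)
  have AE_bound: "AE s in lborel. norm (g N s) \<le> B * indicator {a..b} s" for N
    using AE_C by eventually_elim (simp add: g_bound)
  have meas: "?F \<in> borel_measurable lborel" "\<And>N. g N \<in> borel_measurable lborel"
    using F_meas g_meas by auto
  have "integrable lborel ?F"
    by (rule integrable_dominated_convergence[OF meas ind AE_lim AE_bound])
  moreover have "(\<lambda>N. riemann_sum a b (Suc N) f) \<longlonglongrightarrow> integral\<^sup>L lborel ?F"
    using integral_dominated_convergence[OF meas ind AE_lim AE_bound] unfolding g_int .
  ultimately
  show "set_integrable lborel {a..b} f" "(\<lambda>N. riemann_sum a b N f) \<longlonglongrightarrow> (LINT s:{a..b}|lborel. f s)"
    unfolding set_integrable_def set_lebesgue_integral_def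
    by (auto intro: LIMSEQ_imp_Suc)
qed

context pam
begin

definition path_pot :: "real \<Rightarrow> 'v \<Rightarrow> 'w \<Rightarrow> real \<Rightarrow> real" where
  "path_pot t \<omega> \<omega>' s = catalyst n Y \<omega> (X s \<omega>') (t - s)"

lemma path_pot_bounds: "0 \<le> path_pot t \<omega> \<omega>' s" "path_pot t \<omega> \<omega>' s \<le> n"
proof -
  show "0 \<le> path_pot t \<omega> \<omega>' s" unfolding path_pot_def catalyst_def by (intro sum_nonneg) auto
  have "path_pot t \<omega> \<omega>' s \<le> (\<Sum>k=1..n. 1)"
    unfolding path_pot_def catalyst_def by (intro sum_mono) (auto simp: indicator_def)
  then show "path_pot t \<omega> \<omega>' s \<le> n" by simp
qed

text \<open>The potential along a path can change only at a jump of the reactant or at the time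
  reversal of a jump of a catalyst.\<close>

lemma path_pot_continuous:
  assumes \<omega>: "\<omega> \<in> space MY" "\<omega>' \<in> space M"
  shows "\<exists>D. countable D \<and> (\<forall>s. 0 < s \<longrightarrow> s < t \<longrightarrow> s \<notin> D \<longrightarrow> isCont (path_pot t \<omega> \<omega>') s)"
proof -
  define DX where "DX = {s. 0 < s \<and> \<not> locally_constant_at (\<lambda>s. X s \<omega>') s}"
  define DY where "DY k = {s. 0 < s \<and> \<not> locally_constant_at (\<lambda>s. Y k s \<omega>) s}" for k
  have DX: "countable DX"
    unfolding DX_def using X \<omega> unfolding simple_random_walk_def by (intro countable_jumps) blast+
  have DY: "countable (DY k)" if "k \<in> K" for k
    unfolding DY_def using Y[OF that] \<omega> unfolding simple_random_walk_def by (intro countable_jumps) blast+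
  define D where "D = DX \<union> (\<Union>k\<in>K. (\<lambda>r. t - r) ` DY k)"
  have "countable D" unfolding D_def using DX DY finite_KJ
    by (intro countable_Un countable_UN countable_image) (auto intro: countable_finite)
  moreover have "isCont (path_pot t \<omega> \<omega>') s" if s: "0 < s" "s < t" "s \<notin> D" for s
  proof -
    have "locally_constant_at (\<lambda>s. X s \<omega>') s" using s by (auto simp: D_def DX_def)
    then obtain d where d: "d > 0" "\<And>r. \<bar>r - s\<bar> < d \<Longrightarrow> X r \<omega>' = X s \<omega>'"
      by (auto simp: locally_constant_at_def)
    have "\<exists>e>0. \<forall>r. \<bar>r - (t - s)\<bar> < e \<longrightarrow> Y k r \<omega> = Y k (t - s) \<omega>" if "k \<in> K" for k
    proof -
      have "t - s \<notin> DY k"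
      proof
        assume "t - s \<in> DY k"
        then have "t - (t - s) \<in> (\<lambda>r. t - r) ` DY k" by (rule imageI)
        then show False using s that by (auto simp: D_def)
      qed
      then show ?thesis using s by (auto simp: DY_def locally_constant_at_def)
    qed
    then obtain e where e: "\<And>k. k \<in> K \<Longrightarrow> e k > 0"
      "\<And>k r. k \<in> K \<Longrightarrow> \<bar>r - (t - s)\<bar> < e k \<Longrightarrow> Y k r \<omega> = Y k (t - s) \<omega>" by metis
    define c where "c = Min (insert d (e ` K))"
    have c: "c > 0" "c \<le> d" "\<And>k. k \<in> K \<Longrightarrow> c \<le> e k"
      using d(1) e(1) finite_KJ by (auto simp: c_def)
    have "path_pot t \<omega> \<omega>' r = path_pot t \<omega> \<omega>' s" if "\<bar>r - s\<bar> < c" for r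
      unfolding path_pot_def catalyst_def K_def[symmetric]
    proof (rule sum.cong[OF refl])
      fix k assume k: "k \<in> K"
      have "X r \<omega>' = X s \<omega>'" using that c by (intro d(2)) auto
      moreover have "Y k (t - r) \<omega> = Y k (t - s) \<omega>" using that c(3)[OF k] by (intro e(2) k) auto
      ultimately show "indicator {X r \<omega>'} (Y k (t - r) \<omega>) = indicator {X s \<omega>'} (Y k (t - s) \<omega>)" by simp
    qed
    then have "eventually (\<lambda>r. path_pot t \<omega> \<omega>' r = path_pot t \<omega> \<omega>' s) (at s)"
      unfolding eventually_at dist_real_def by (intro exI[of _ c] conjI c(1) ballI impI) blast
    then show ?thesis unfolding isCont_def by (rule tendsto_eventually)
  qed
  ultimately show ?thesis by blast
qed

text \<open>The window is a parameter because the full interval is compared with the one from 1 to t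
  - 1.\<close>

definition exponent :: "real \<Rightarrow> real \<Rightarrow> real \<Rightarrow> 'v \<Rightarrow> 'w \<Rightarrow> real" where
  "exponent a b t \<omega> \<omega>' = (LINT s:{a..b}|lborel. path_pot t \<omega> \<omega>' s)"

abbreviation approx :: "real \<Rightarrow> real \<Rightarrow> real \<Rightarrow> nat \<Rightarrow> 'v \<Rightarrow> 'w \<Rightarrow> real" where
  "approx a b t N \<omega> \<omega>' \<equiv> riemann_sum a b N (path_pot t \<omega> \<omega>')"

definition quenched :: "real \<Rightarrow> real \<Rightarrow> real \<Rightarrow> 'v \<Rightarrow> real" where
  "quenched a b t \<omega> = (\<integral>\<omega>'. exp (exponent a b t \<omega> \<omega>') \<partial>M)"

lemma path_pot_integrable:
  assumes \<omega>: "\<omega> \<in> space MY" "\<omega>' \<in> space M" and ab: "0 \<le> a" "a < b" "b \<le> t"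
  shows "set_integrable lborel {a..b} (path_pot t \<omega> \<omega>')"
    and "(\<lambda>N. approx a b t N \<omega> \<omega>') \<longlonglongrightarrow> exponent a b t \<omega> \<omega>'"
proof -
  obtain D where D: "countable D" "\<And>s. 0 < s \<Longrightarrow> s < t \<Longrightarrow> s \<notin> D \<Longrightarrow> isCont (path_pot t \<omega> \<omega>') s"
    using path_pot_continuous[OF \<omega>] by blast
  have bd: "\<bar>path_pot t \<omega> \<omega>' s\<bar> \<le> n" for s using path_pot_bounds[of t \<omega> \<omega>' s] by simp
  show "set_integrable lborel {a..b} (path_pot t \<omega> \<omega>')"
    using ab by (intro riemann_sum_tendsto(1)[OF ab(2) bd D(1)] D(2)) auto
  show "(\<lambda>N. approx a b t N \<omega> \<omega>') \<longlonglongrightarrow> exponent a b t \<omega> \<omega>'"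
    unfolding exponent_def using ab by (intro riemann_sum_tendsto(2)[OF ab(2) bd D(1)] D(2)) auto
qed

lemma approx_bounds:
  assumes "a < b"
  shows "0 \<le> approx a b t N \<omega> \<omega>'" "approx a b t N \<omega> \<omega>' \<le> (b - a) * n"
proof -
  show "0 \<le> approx a b t N \<omega> \<omega>'"
    unfolding riemann_sum_def using assms by (intro mult_nonneg_nonneg sum_nonneg path_pot_bounds) auto
  have "(\<Sum>j<N. path_pot t \<omega> \<omega>' (a + real j * ((b - a) / N))) \<le> (\<Sum>j<N. real n)"
    by (intro sum_mono path_pot_bounds)
  then have "approx a b t N \<omega> \<omega>' \<le> (b - a) / N * (N * n)"
    unfolding riemann_sum_def using assms by (intro mult_left_mono) auto
  also have "\<dots> \<le> (b - a) * n" using assms by (cases "N = 0") auto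
  finally show "approx a b t N \<omega> \<omega>' \<le> (b - a) * n" .
qed

lemma grid_le: "a < b \<Longrightarrow> j < N \<Longrightarrow> a + real j * ((b - a) / real N) \<le> b"
proof -
  assume *: "a < b" "j < N"
  then have "real j * ((b - a) / real N) \<le> real N * ((b - a) / real N)" by (intro mult_right_mono) auto
  then show ?thesis using * by simp
qed

lemma approx_measurable:
  assumes "0 \<le> a" "a < b"
  shows "approx a b t N \<omega> \<in> borel_measurable M"
  unfolding riemann_sum_def path_pot_def
proof (intro borel_measurable_times borel_measurable_const borel_measurable_sum)
  fix j
  have "X (a + real j * ((b - a) / N)) \<in> M \<rightarrow>\<^sub>M count_space UNIV"
    using assms by (intro walk_measurable[OF X]) auto
  then show "(\<lambda>\<omega>'. catalyst n Y \<omega> (X (a + real j * ((b - a) / N)) \<omega>') (t - (a + real j * ((b - a) / N)))) \<in> borel_measurable M"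
    by (rule measurable_compose) simp
qed

lemma place_measurable':
  "0 \<le> r \<Longrightarrow> (\<lambda>\<omega>. restrict (\<lambda>k. Y k r \<omega>) K) \<in> MY \<rightarrow>\<^sub>M count_space (PiE K (\<lambda>_. UNIV))"
proof -
  assume r: "0 \<le> r"
  \<comment> \<open>An auxiliary grid that has \<open>r\<close> at index 1.\<close>
  let ?t = "\<lambda>i. real i * r"
  have t: "?t 0 = 0" "\<And>i. ?t i \<le> ?t (Suc i)" using r by (auto simp: mult_right_mono)
  have "place ?t 1 = (\<lambda>\<omega>. restrict (\<lambda>k. Y k r \<omega>) K)"
    by (rule ext) (simp add: place_def[OF t])
  then show ?thesis using place_measurable[OF t, of 1] by simp
qed

text \<open>A Riemann sum looks at the catalysts at finitely many times only, so it factors through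
  a countably valued list.\<close>

lemma quenched_approx_measurable:
  assumes "0 \<le> a" "a < b" "b \<le> t"
  shows "(\<lambda>\<omega>. \<integral>\<omega>'. exp (approx a b t N \<omega> \<omega>') \<partial>M) \<in> borel_measurable MY"
proof -
  let ?s = "\<lambda>j. a + real j * ((b - a) / real N)"
  let ?H = "\<lambda>\<omega>. map (\<lambda>j. restrict (\<lambda>k. Y k (t - ?s j) \<omega>) K) [0..<N]"
  have H: "?H \<in> MY \<rightarrow>\<^sub>M count_space (lists (PiE K (\<lambda>_. UNIV)))"
    using assms grid_le[of a b _ N] by (intro measurable_path_list countable_PiE_K place_measurable') fastforce
  let ?F = "\<lambda>c. \<integral>\<omega>'. exp ((b - a) / N * (\<Sum>j<N. \<Sum>k\<in>K. indicator {X (?s j) \<omega>'} ((c ! j) k))) \<partial>M"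
  have "approx a b t N \<omega> \<omega>' = (b - a) / N * (\<Sum>j<N. \<Sum>k\<in>K. indicator {X (?s j) \<omega>'} ((?H \<omega> ! j) k))" for \<omega> \<omega>'
    unfolding riemann_sum_def path_pot_def catalyst_def K_def[symmetric]
    by (intro arg_cong2[of _ _ _ _ "(*)"] refl sum.cong) auto
  then have "(\<lambda>\<omega>. \<integral>\<omega>'. exp (approx a b t N \<omega> \<omega>') \<partial>M) = (\<lambda>\<omega>. ?F (?H \<omega>))" by simp
  also have "\<dots> \<in> borel_measurable MY" by (rule measurable_compose[OF H]) simp
  finally show ?thesis .
qed

lemma exponent_measurable:
  assumes "\<omega> \<in> space MY" "0 \<le> a" "a < b" "b \<le> t"
  shows "exponent a b t \<omega> \<in> borel_measurable M"
  by (rule borel_measurable_LIMSEQ_real[OF path_pot_integrable(2)[OF assms(1)]]) 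
    (use assms in \<open>auto intro: approx_measurable\<close>)

lemma exponent_bounds:
  assumes "\<omega> \<in> space MY" "\<omega>' \<in> space M" "0 \<le> a" "a < b" "b \<le> t"
  shows "0 \<le> exponent a b t \<omega> \<omega>'" "exponent a b t \<omega> \<omega>' \<le> (b - a) * n"
  using LIMSEQ_le_const[OF path_pot_integrable(2)[OF assms]] LIMSEQ_le_const2[OF path_pot_integrable(2)[OF assms]]
    approx_bounds[OF assms(4)] by blast+

lemma quenched_tendsto:
  assumes \<omega>: "\<omega> \<in> space MY" and ab: "0 \<le> a" "a < b" "b \<le> t"
  shows "(\<lambda>N. \<integral>\<omega>'. exp (approx a b t N \<omega> \<omega>') \<partial>M) \<longlonglongrightarrow> quenched a b t \<omega>"
  unfolding quenched_def
proof (rule integral_dominated_convergence[where w = "\<lambda>_. exp ((b - a) * n)"])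
  show "(\<lambda>\<omega>'. exp (exponent a b t \<omega> \<omega>')) \<in> borel_measurable M"
    by (intro measurable_compose[OF _ borel_measurable_exp] exponent_measurable assms)
  show "(\<lambda>\<omega>'. exp (approx a b t N \<omega> \<omega>')) \<in> borel_measurable M" for N
    by (intro measurable_compose[OF _ borel_measurable_exp] approx_measurable assms)
  show "AE \<omega>' in M. (\<lambda>N. exp (approx a b t N \<omega> \<omega>')) \<longlonglongrightarrow> exp (exponent a b t \<omega> \<omega>')"
    by (intro AE_I2 tendsto_exp path_pot_integrable assms)
  show "AE \<omega>' in M. norm (exp (approx a b t N \<omega> \<omega>')) \<le> exp ((b - a) * n)" for N
    by (intro AE_I2) (simp add: approx_bounds[OF ab(2)])
qed simp

lemma integrable_exp_approx:
  assumes "0 \<le> a" "a < b"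
  shows "integrable M (\<lambda>\<omega>'. exp (approx a b t N \<omega> \<omega>'))"
  by (rule M.integrable_const_bound[where B = "exp ((b - a) * n)"])
    (use assms in \<open>auto intro!: measurable_compose[OF _ borel_measurable_exp] approx_measurable AE_I2 simp: approx_bounds\<close>)

lemma integrable_exp_exponent:
  assumes "\<omega> \<in> space MY" "0 \<le> a" "a < b" "b \<le> t"
  shows "integrable M (\<lambda>\<omega>'. exp (exponent a b t \<omega> \<omega>'))"
  by (rule M.integrable_const_bound[where B = "exp ((b - a) * n)"])
    (use assms in \<open>auto intro!: measurable_compose[OF _ borel_measurable_exp] exponent_measurable AE_I2 simp: exponent_bounds\<close>)

lemma quenched_approx_bounds:
  assumes "0 \<le> a" "a < b"
  shows "0 \<le> (\<integral>\<omega>'. exp (approx a b t N \<omega> \<omega>') \<partial>M)" "(\<integral>\<omega>'. exp (approx a b t N \<omega> \<omega>') \<partial>M) \<le> exp ((b - a) * n)"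
proof -
  show "0 \<le> (\<integral>\<omega>'. exp (approx a b t N \<omega> \<omega>') \<partial>M)" by (intro Bochner_Integration.integral_nonneg) auto
  have "(\<integral>\<omega>'. exp (approx a b t N \<omega> \<omega>') \<partial>M) \<le> (\<integral>\<omega>'. exp ((b - a) * n) \<partial>M)"
    using assms by (intro integral_mono integrable_exp_approx) (auto simp: approx_bounds)
  then show "(\<integral>\<omega>'. exp (approx a b t N \<omega> \<omega>') \<partial>M) \<le> exp ((b - a) * n)" by (simp add: M.prob_space)
qed

lemma quenched_measurable:
  assumes "0 \<le> a" "a < b" "b \<le> t"
  shows "quenched a b t \<in> borel_measurable MY"
  by (rule borel_measurable_LIMSEQ_real[OF quenched_tendsto]) (use assms quenched_approx_measurable in auto)

lemma quenched_bounds: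
  assumes "\<omega> \<in> space MY" "0 \<le> a" "a < b" "b \<le> t"
  shows "0 \<le> quenched a b t \<omega>" "quenched a b t \<omega> \<le> exp ((b - a) * n)"
  using LIMSEQ_le_const[OF quenched_tendsto[OF assms]] LIMSEQ_le_const2[OF quenched_tendsto[OF assms]]
    quenched_approx_bounds[OF assms(2,3)] by blast+

lemma integrable_quenched_power:
  assumes "0 \<le> a" "a < b" "b \<le> t"
  shows "integrable MY (\<lambda>\<omega>. quenched a b t \<omega> ^ p)"
  by (rule MY.integrable_const_bound[where B = "exp ((b - a) * n) ^ p"])
    (use assms in \<open>auto intro!: borel_measurable_power quenched_measurable AE_I2 power_mono simp: quenched_bounds\<close>)

lemma annealed_tendsto:
  assumes ab: "0 \<le> a" "a < b" "b \<le> t"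
  shows "(\<lambda>N. \<integral>\<omega>. (\<integral>\<omega>'. exp (approx a b t N \<omega> \<omega>') \<partial>M) ^ p \<partial>MY) \<longlonglongrightarrow> (\<integral>\<omega>. quenched a b t \<omega> ^ p \<partial>MY)"
proof (rule integral_dominated_convergence[where w = "\<lambda>_. exp ((b - a) * n) ^ p"])
  show "AE \<omega> in MY. (\<lambda>N. (\<integral>\<omega>'. exp (approx a b t N \<omega> \<omega>') \<partial>M) ^ p) \<longlonglongrightarrow> quenched a b t \<omega> ^ p"
    by (intro AE_I2 tendsto_power quenched_tendsto ab)
  show "AE \<omega> in MY. norm ((\<integral>\<omega>'. exp (approx a b t N \<omega> \<omega>') \<partial>M) ^ p) \<le> exp ((b - a) * n) ^ p" for N
    using quenched_approx_bounds[OF ab(1,2)] by (intro AE_I2) (auto intro!: power_mono)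
qed (use ab in \<open>auto intro!: borel_measurable_power quenched_measurable quenched_approx_measurable\<close>)

text \<open>The potential lies between 0 and n, so removing the two unit intervals at the ends
  lowers the exponent by at most 2 n.\<close>

lemma quenched_compare:
  assumes \<omega>: "\<omega> \<in> space MY" and t: "2 < t"
  shows "quenched 1 (t - 1) t \<omega> \<le> quenched 0 t t \<omega>" "quenched 0 t t \<omega> \<le> exp (2 * real n) * quenched 1 (t - 1) t \<omega>"
proof -
  have split: "exponent 1 (t - 1) t \<omega> \<omega>' \<le> exponent 0 t t \<omega> \<omega>' \<and> exponent 0 t t \<omega> \<omega>' \<le> 2 * real n + exponent 1 (t - 1) t \<omega> \<omega>'"
    if \<omega>': "\<omega>' \<in> space M" for \<omega>'
  proof -
    let ?f = "path_pot t \<omega> \<omega>'"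
    have i: "set_integrable lborel {0..t} ?f" "set_integrable lborel {1..t-1} ?f"
      using t by (auto intro!: path_pot_integrable \<omega> \<omega>')
    have c: "integrable lborel (\<lambda>s. real n * indicator ({0..1} \<union> {t-1..t}) s :: real)"
    proof (intro integrable_mult_right integrable_real_indicator)
      have "emeasure lborel ({0..1} \<union> {t-1..t}) \<le> emeasure lborel {0..t}"
        using t by (intro emeasure_mono) auto
      also have "\<dots> < \<infinity>" using t by (simp add: emeasure_lborel_Icc_eq)
      finally show "emeasure lborel ({0..1} \<union> {t-1..t}) < \<infinity>" .
    qed simp
    have 1: "exponent 1 (t - 1) t \<omega> \<omega>' \<le> exponent 0 t t \<omega> \<omega>'"
      unfolding exponent_def set_lebesgue_integral_def
      using i t path_pot_bounds(1)[of t \<omega> \<omega>'] unfolding set_integrable_def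
      by (intro integral_mono) (auto split: split_indicator)
    have "exponent 0 t t \<omega> \<omega>' \<le> (\<integral>s. real n * indicator ({0..1} \<union> {t-1..t}) s + indicator {1..t-1} s * ?f s \<partial>lborel)"
      unfolding exponent_def set_lebesgue_integral_def
      using i t c path_pot_bounds[of t \<omega> \<omega>'] unfolding set_integrable_def
      by (intro integral_mono integrable_add) (auto split: split_indicator)
    also have "\<dots> = real n * measure lborel ({0..1} \<union> {t-1..t}) + exponent 1 (t - 1) t \<omega> \<omega>'"
      using i c unfolding set_integrable_def exponent_def set_lebesgue_integral_def
      by (subst Bochner_Integration.integral_add) auto
    also have "measure lborel ({0..1} \<union> {t-1..t}) \<le> measure lborel {0..1::real} + measure lborel {t-1..t}"
      by (rule measure_Un_le) auto
    finally show ?thesis using 1 by (simp add: mult_left_mono)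
  qed
  have ii: "integrable M (\<lambda>\<omega>'. exp (exponent 0 t t \<omega> \<omega>'))" "integrable M (\<lambda>\<omega>'. exp (exponent 1 (t - 1) t \<omega> \<omega>'))"
    using t by (auto intro!: integrable_exp_exponent \<omega>)
  show "quenched 1 (t - 1) t \<omega> \<le> quenched 0 t t \<omega>"
    unfolding quenched_def using split by (intro integral_mono ii) auto
  have "quenched 0 t t \<omega> \<le> (\<integral>\<omega>'. exp (2 * real n) * exp (exponent 1 (t - 1) t \<omega> \<omega>') \<partial>M)"
    unfolding quenched_def using split by (intro integral_mono ii integrable_mult_right) (auto simp: exp_add[symmetric])
  then show "quenched 0 t t \<omega> \<le> exp (2 * real n) * quenched 1 (t - 1) t \<omega>"
    unfolding quenched_def by simp
qed

section \<open>Annealed moments and their growth rate\<close>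

definition annealed :: "real \<Rightarrow> real" where
  "annealed t = (\<integral>\<omega>. feynman_kac M X (catalyst n Y \<omega>) t ^ p \<partial>MY)"

definition annealed_mid :: "real \<Rightarrow> real" where
  "annealed_mid t = (\<integral>\<omega>. quenched 1 (t - 1) t \<omega> ^ p \<partial>MY)"

lemma annealed_eq: "annealed t = (\<integral>\<omega>. quenched 0 t t \<omega> ^ p \<partial>MY)"
  by (simp add: annealed_def feynman_kac_def quenched_def exponent_def path_pot_def)

lemma annealed_compare:
  assumes t: "2 < t"
  shows "annealed_mid t \<le> annealed t" "annealed t \<le> exp (2 * real n) ^ p * annealed_mid t"
proof -
  have i: "integrable MY (\<lambda>\<omega>. quenched 0 t t \<omega> ^ p)" "integrable MY (\<lambda>\<omega>. quenched 1 (t - 1) t \<omega> ^ p)"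
    using t by (auto intro!: integrable_quenched_power)
  have q0: "0 \<le> quenched 1 (t - 1) t \<omega>" "0 \<le> quenched 0 t t \<omega>" if "\<omega> \<in> space MY" for \<omega>
    using t that by (auto intro!: quenched_bounds)
  show "annealed_mid t \<le> annealed t"
    unfolding annealed_mid_def annealed_eq
    by (intro integral_mono i power_mono quenched_compare t q0)
  have "annealed t \<le> (\<integral>\<omega>. exp (2 * real n) ^ p * quenched 1 (t - 1) t \<omega> ^ p \<partial>MY)"
    unfolding annealed_eq power_mult_distrib[symmetric]
    by (intro integral_mono i power_mono quenched_compare t q0, simp add: power_mult_distrib i)
  then show "annealed t \<le> exp (2 * real n) ^ p * annealed_mid t" by (simp add: annealed_mid_def)
qed

text \<open>With h = T / N the times are 0, 1, 1 + h, ..., 1 + N h = T + 1, T + 2: N steps with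
  potential between two buffers.\<close>

definition grid :: "nat \<Rightarrow> real \<Rightarrow> nat \<Rightarrow> real" where
  "grid N T i = (if i = 0 then 0 else if i \<le> N + 1 then 1 + real (i - 1) * (T / N) else T + 2)"

text \<open>The weights sit at right end points in catalyst time, which are left end points in the
  reversed time of the reactant, as in \<open>riemann_sum\<close>.\<close>

definition grid_weight :: "nat \<Rightarrow> real \<Rightarrow> nat \<Rightarrow> real" where
  "grid_weight N T i = (if 2 \<le> i \<and> i \<le> N + 1 then T / N else 0)"

lemma grid_0: "grid N T 0 = 0" by (simp add: grid_def)

lemma grid_mono: "0 < T \<Longrightarrow> 0 < N \<Longrightarrow> grid N T i \<le> grid N T (Suc i)"
proof -
  assume T: "0 < T" and N: "0 < N"
  have "real (i - 1) * (T / N) \<le> T" if "i \<le> N + 1"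
  proof -
    have "real (i - 1) * (T / N) \<le> real N * (T / N)" using that T by (intro mult_right_mono) auto
    then show ?thesis using N by simp
  qed
  moreover have "real (i - 1) * (T / N) \<le> real i * (T / N)" using T by (intro mult_right_mono) auto
  ultimately show ?thesis using T by (auto simp: grid_def)
qed

text \<open>Along the grid the recursion for \<open>joint\<close> reproduces the operators of the
  discrete moment, while each quenched factor is the exponential moment of a Riemann sum.\<close>

lemma discrete_moment_eq:
  assumes T: "0 < T" and N: "0 < N"
  shows "discrete_moment N T = ennreal (\<integral>\<omega>. (\<integral>\<omega>'. exp (approx 1 (T + 1) (T + 2) N \<omega> \<omega>') \<partial>M) ^ p \<partial>MY)"
proof -
  let ?t = "grid N T" and ?\<theta> = "grid_weight N T"
  define h where "h = T / N"
  have Nh: "real N * h = T" using N by (simp add: h_def)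
  note g = grid_0[of N T] grid_mono[OF T N]
  let ?dt = "\<lambda>l. ?t (Suc l) - ?t l"
  let ?F = "\<lambda>l s. \<integral>\<^sup>+\<omega>. joint ?t ?\<theta> l \<omega> s \<partial>MY"
  have F_Suc: "?F (Suc l) s = ennreal (exp (?\<theta> (Suc l) * pot s)) * walk_ops rates (?dt l) idx (?F l) s" for l s
    by (rule nn_integral_joint_Suc[OF g])
  have "?F 0 = (\<lambda>s. ennreal (init s))"
    by (rule ext, rule nn_integral_joint_0[OF g]) (simp add: grid_weight_def)
  moreover have "?dt 0 = 1" "?\<theta> (Suc 0) = 0" by (auto simp: grid_def grid_weight_def)
  ultimately have F1: "?F (Suc 0) = walk_ops rates 1 idx (\<lambda>s. ennreal (init s))"
    using F_Suc[of 0] by (intro ext) simp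
  have F2: "?F (Suc i) = (step_op h ^^ i) (?F (Suc 0))" if "i \<le> N" for i
    using that
  proof (induction i)
    case (Suc i)
    have "?dt (Suc i) = h" using Suc.prems by (simp add: grid_def h_def algebra_simps add_divide_distrib)
    moreover have "?\<theta> (Suc (Suc i)) = h" using Suc.prems by (simp add: grid_weight_def h_def)
    ultimately have "?F (Suc (Suc i)) = step_op h (?F (Suc i))"
      using F_Suc[of "Suc i"] by (intro ext) (simp add: step_op_def)
    then show ?case using Suc by simp
  qed simp
  have "?dt (Suc N) = 1" "?\<theta> (Suc (Suc N)) = 0"
    using Nh N by (auto simp: grid_def grid_weight_def h_def)
  then have F3: "?F (Suc (Suc N)) = walk_ops rates 1 idx ((step_op h ^^ N) (walk_ops rates 1 idx (\<lambda>s. ennreal (init s))))"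
    using F_Suc[of "Suc N"] F2[of N] F1 by (intro ext) simp
  have 1: "discrete_moment N T = (\<integral>\<^sup>+\<omega>. fk \<kappa> (weight ?t ?\<theta> \<omega>) ?dt (Suc (Suc N)) x ^ p \<partial>MY)"
    unfolding nn_integral_fk_power[OF g] discrete_moment_def
    by (rule nn_integral_cong) (simp only: fun_cong[OF F3] h_def)
  have 2: "fk \<kappa> (weight ?t ?\<theta> \<omega>) ?dt (Suc (Suc N)) x = ennreal (\<integral>\<omega>'. exp (approx 1 (T + 1) (T + 2) N \<omega> \<omega>') \<partial>M)" for \<omega>
  proof -
    have tm: "?t (Suc (Suc N)) = T + 2" by (simp add: grid_def)
    have "(\<Prod>i\<le>Suc (Suc N). weight ?t ?\<theta> \<omega> i (X (T + 2 - ?t i) \<omega>')) = ennreal (exp (approx 1 (T + 1) (T + 2) N \<omega> \<omega>'))" for \<omega>'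
    proof -
      let ?c = "\<lambda>i. catalyst n Y \<omega> (X (T + 2 - ?t i) \<omega>') (?t i)"
      have "(\<Prod>i\<le>Suc (Suc N). weight ?t ?\<theta> \<omega> i (X (T + 2 - ?t i) \<omega>')) = ennreal (exp (\<Sum>i\<le>Suc (Suc N). ?\<theta> i * ?c i))"
        by (simp only: weight_def[OF g] prod_ennreal exp_ge_zero exp_sum finite_atMost)
      also have "(\<Sum>i\<le>Suc (Suc N). ?\<theta> i * ?c i) = (\<Sum>i\<in>{2..N+1}. h * ?c i)"
        by (rule sum.mono_neutral_cong_right) (auto simp: grid_weight_def h_def)
      \<comment> \<open>Time reversal: the catalyst index i belongs to the node j = N + 1 - i of the
        Riemann sum.\<close>
      also have "\<dots> = (\<Sum>j<N. h * path_pot (T + 2) \<omega> \<omega>' (1 + real j * h))"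
      proof (rule sum.reindex_bij_witness[of _ "\<lambda>j. N + 1 - j" "\<lambda>i. N + 1 - i"])
        fix i assume i: "i \<in> {2..N+1}"
        have "?t i = 1 + real (i - 1) * h" using i by (simp add: grid_def h_def)
        moreover have "real (N + 1 - i) * h = T - real (i - 1) * h"
          using i Nh by (simp add: of_nat_diff algebra_simps)
        ultimately have "T + 2 - ?t i = 1 + real (N + 1 - i) * h" "?t i = T + 2 - (1 + real (N + 1 - i) * h)" by auto
        then show "h * path_pot (T + 2) \<omega> \<omega>' (1 + real (N + 1 - i) * h) = h * ?c i"
          by (simp only: path_pot_def)
      qed auto
      also have "\<dots> = approx 1 (T + 1) (T + 2) N \<omega> \<omega>'"
        by (simp add: riemann_sum_def h_def sum_distrib_left)
      finally show ?thesis .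
    qed
    then have "fk \<kappa> (weight ?t ?\<theta> \<omega>) ?dt (Suc (Suc N)) x = (\<integral>\<^sup>+\<omega>'. ennreal (exp (approx 1 (T + 1) (T + 2) N \<omega> \<omega>')) \<partial>M)"
      using nn_integral_fk[OF X rates_nonneg(1), of "Suc (Suc N)" ?t "weight ?t ?\<theta> \<omega>"] g(2) unfolding tm by simp
    also have "\<dots> = ennreal (\<integral>\<omega>'. exp (approx 1 (T + 1) (T + 2) N \<omega> \<omega>') \<partial>M)"
      using T by (intro nn_integral_eq_integral integrable_exp_approx) auto
    finally show ?thesis .
  qed
  have nn: "0 \<le> (\<integral>\<omega>'. exp (approx 1 (T + 1) (T + 2) N \<omega> \<omega>') \<partial>M)" for \<omega>
    using T by (intro quenched_approx_bounds) auto
  have "integrable MY (\<lambda>\<omega>. (\<integral>\<omega>'. exp (approx 1 (T + 1) (T + 2) N \<omega> \<omega>') \<partial>M) ^ p)"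
    by (rule MY.integrable_const_bound[where B = "exp ((T + 1 - 1) * n) ^ p"])
      (use T in \<open>auto intro!: borel_measurable_power quenched_approx_measurable AE_I2 power_mono nn
        simp: quenched_approx_bounds(2)[of 1 "T + 1", simplified] nn power_abs\<close>)
  then show ?thesis
    unfolding 1 2 using nn by (simp add: ennreal_power nn_integral_eq_integral)
qed

lemma annealed_mid_tendsto:
  assumes T: "0 < T"
  shows "(\<lambda>N. \<integral>\<omega>. (\<integral>\<omega>'. exp (approx 1 (T + 1) (T + 2) N \<omega> \<omega>') \<partial>M) ^ p \<partial>MY) \<longlonglongrightarrow> annealed_mid (T + 2)"
proof -
  have "T + 2 - 1 = T + 1" by simp
  show ?thesis unfolding annealed_mid_def \<open>T + 2 - 1 = T + 1\<close> using T by (intro annealed_tendsto) auto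
qed

text \<open>With T fixed, the error C T^2 / N in the exponent vanishes as the mesh is
  refined.\<close>

lemma annealed_mid_le:
  assumes L: "top < L"
  shows "\<exists>C\<ge>0. \<forall>T>0. annealed_mid (T + 2) \<le> C * exp (T * L)"
proof -
  obtain C0 C where C: "C0 \<ge> 0" "\<And>t N. 0 < t \<Longrightarrow> t \<le> real N \<Longrightarrow> discrete_moment N t \<le> ennreal (C0 * exp (t * L + C * t\<^sup>2 / N))"
    using discrete_moment_le[OF L] by blast
  have "annealed_mid (T + 2) \<le> C0 * exp (T * L)" if T: "T > 0" for T
  proof (rule LIMSEQ_le[OF annealed_mid_tendsto[OF T]])
    have "(\<lambda>N. C0 * exp (T * L + C * T\<^sup>2 / real N)) \<longlonglongrightarrow> C0 * exp (T * L + 0)"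
      by (intro tendsto_intros lim_const_over_n)
    then show "(\<lambda>N. C0 * exp (T * L + C * T\<^sup>2 / real N)) \<longlonglongrightarrow> C0 * exp (T * L)" by simp
    obtain N0 where N0: "T \<le> real N0" using real_arch_simple by blast
    show "\<exists>N. \<forall>k\<ge>N. (\<integral>\<omega>. (\<integral>\<omega>'. exp (approx 1 (T + 1) (T + 2) k \<omega> \<omega>') \<partial>M) ^ p \<partial>MY) \<le> C0 * exp (T * L + C * T\<^sup>2 / real k)"
    proof (intro exI[of _ N0] allI impI)
      fix k assume "N0 \<le> k"
      then have k: "T \<le> real k" using N0 by linarith
      then have "0 < k" using T by (cases k) auto
      then show "(\<integral>\<omega>. (\<integral>\<omega>'. exp (approx 1 (T + 1) (T + 2) k \<omega> \<omega>') \<partial>M) ^ p \<partial>MY) \<le> C0 * exp (T * L + C * T\<^sup>2 / real k)"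
        using C(2)[OF T k] C(1) unfolding discrete_moment_eq[OF T \<open>0 < k\<close>] by simp
    qed
  qed
  then show ?thesis using C(1) by blast
qed

text \<open>Along N = 2^k the Euler factors tend to exp (T (E + speed)), and the accumulated factor
  exp (- speed T) removes the shift.\<close>

lemma annealed_mid_ge:
  assumes L: "L < top"
  shows "\<exists>a>0. \<forall>T>0. a * exp (T * L) \<le> annealed_mid (T + 2)"
proof -
  obtain a E where a: "a > 0" "E > L" "\<And>t k. 0 < t \<Longrightarrow>
    ennreal (a * exp (- speed * t) * (1 + t / 2 ^ k * (E + speed)) ^ (2 ^ k)) \<le> discrete_moment (2 ^ k) t"
    using discrete_moment_ge[OF L] by blast
  have "a * exp (T * L) \<le> annealed_mid (T + 2)" if T: "T > 0" for T
  proof -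
    have pow: "filterlim (\<lambda>k. 2 ^ k :: nat) sequentially sequentially"
      by (rule filterlim_subseq) (auto simp: strict_mono_def)
    have "a * exp (- speed * T) * exp (T * (E + speed)) \<le> annealed_mid (T + 2)"
    proof (rule LIMSEQ_le)
      show "(\<lambda>k. a * exp (- speed * T) * (1 + T * (E + speed) / real (2 ^ k)) ^ (2 ^ k)) \<longlonglongrightarrow> a * exp (- speed * T) * exp (T * (E + speed))"
        by (intro tendsto_intros filterlim_compose[OF tendsto_exp_limit_sequentially pow])
      show "(\<lambda>k. \<integral>\<omega>. (\<integral>\<omega>'. exp (approx 1 (T + 1) (T + 2) (2 ^ k) \<omega> \<omega>') \<partial>M) ^ p \<partial>MY) \<longlonglongrightarrow> annealed_mid (T + 2)"
        by (rule filterlim_compose[OF annealed_mid_tendsto[OF T] pow])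
      have "a * exp (- speed * T) * (1 + T * (E + speed) / real (2 ^ k)) ^ (2 ^ k)
        \<le> (\<integral>\<omega>. (\<integral>\<omega>'. exp (approx 1 (T + 1) (T + 2) (2 ^ k) \<omega> \<omega>') \<partial>M) ^ p \<partial>MY)" for k
      proof -
        have "0 \<le> (\<integral>\<omega>. (\<integral>\<omega>'. exp (approx 1 (T + 1) (T + 2) (2 ^ k) \<omega> \<omega>') \<partial>M) ^ p \<partial>MY)"
          using T by (intro Bochner_Integration.integral_nonneg zero_le_power quenched_approx_bounds) auto
        then show ?thesis
          using a(3)[OF T, of k] unfolding discrete_moment_eq[OF T, of "2 ^ k", simplified]
          by (simp add: ennreal_le_iff)
      qed
      then show "\<exists>N. \<forall>k\<ge>N. a * exp (- speed * T) * (1 + T * (E + speed) / real (2 ^ k)) ^ (2 ^ k)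
        \<le> (\<integral>\<omega>. (\<integral>\<omega>'. exp (approx 1 (T + 1) (T + 2) (2 ^ k) \<omega> \<omega>') \<partial>M) ^ p \<partial>MY)" by blast
    qed
    moreover have "exp (- speed * T) * exp (T * (E + speed)) = exp (T * E)"
      by (simp add: exp_add[symmetric] algebra_simps)
    moreover have "a * exp (T * L) \<le> a * exp (T * E)" using a T by simp
    ultimately show ?thesis by (simp add: mult.assoc)
  qed
  then show ?thesis using a(1) by blast
qed

lemma annealed_ge_1:
  assumes "2 < t"
  shows "1 \<le> annealed t"
proof -
  have q: "1 \<le> quenched 0 t t \<omega>" if "\<omega> \<in> space MY" for \<omega>
  proof -
    have "(\<integral>\<omega>'. 1 \<partial>M) \<le> quenched 0 t t \<omega>"
      unfolding quenched_def using assms that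
      by (intro integral_mono integrable_exp_exponent) (auto simp: exponent_bounds)
    then show ?thesis by (simp add: M.prob_space)
  qed
  have "(\<integral>\<omega>. 1 \<partial>MY) \<le> annealed t"
    unfolding annealed_eq using assms q
    by (intro integral_mono integrable_quenched_power) (auto intro: one_le_power)
  then show ?thesis by (simp add: MY.prob_space)
qed

lemma affine_over_tendsto: "((\<lambda>t. (c + (t - 2) * L) / t) \<longlongrightarrow> L) at_top" for c L :: real
proof -
  have "((\<lambda>t. (c - 2 * L) / t + L) \<longlongrightarrow> 0 + L) at_top"
    by (intro tendsto_intros tendsto_divide_0[OF tendsto_const] filterlim_at_top_imp_at_infinity filterlim_ident)
  then have "((\<lambda>t. (c - 2 * L) / t + L) \<longlongrightarrow> L) at_top" by simp
  then show ?thesis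
  proof (rule Lim_transform_eventually)
    show "\<forall>\<^sub>F t in at_top. (c - 2 * L) / t + L = (c + (t - 2) * L) / t"
      using eventually_gt_at_top[of 0] by eventually_elim (simp add: field_simps)
  qed
qed

text \<open>The two buffers replace t by t - 2 and all comparison constants are bounded; both
  effects disappear after division by t.\<close>

theorem ln_annealed_tendsto: "((\<lambda>t. ln (annealed t) / t) \<longlongrightarrow> top) at_top"
proof (rule order_tendstoI)
  fix a assume "a < top"
  then obtain L where L: "a < L" "L < top" using dense by blast
  obtain b where b: "b > 0" "\<And>T. T > 0 \<Longrightarrow> b * exp (T * L) \<le> annealed_mid (T + 2)"
    using annealed_mid_ge[OF L(2)] by blast
  have "\<forall>\<^sub>F t in at_top. a < (ln b + (t - 2) * L) / t"
    using order_tendstoD(1)[OF affine_over_tendsto L(1)] .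
  then show "\<forall>\<^sub>F t in at_top. a < ln (annealed t) / t"
    using eventually_gt_at_top[of 2]
  proof eventually_elim
    case (elim t)
    have "b * exp ((t - 2) * L) \<le> annealed t"
      using b(2)[of "t - 2"] annealed_compare(1)[of t] elim by simp
    then have "ln (b * exp ((t - 2) * L)) \<le> ln (annealed t)"
      using b(1) annealed_ge_1[of t] elim by (subst ln_le_cancel_iff) auto
    then have "(ln b + (t - 2) * L) / t \<le> ln (annealed t) / t"
      using b(1) elim by (intro divide_right_mono) (auto simp: ln_mult)
    then show ?case using elim by linarith
  qed
next
  fix a assume "top < a"
  then obtain L where L: "L < a" "top < L" using dense by blast
  obtain C where C: "C \<ge> 0" "\<And>T. T > 0 \<Longrightarrow> annealed_mid (T + 2) \<le> C * exp (T * L)"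
    using annealed_mid_le[OF L(2)] by blast
  define B where "B = exp (2 * real n) ^ p * (C + 1)"
  have B: "B > 0" using C by (auto simp: B_def)
  have "\<forall>\<^sub>F t in at_top. (ln B + (t - 2) * L) / t < a"
    using order_tendstoD(2)[OF affine_over_tendsto L(1)] .
  then show "\<forall>\<^sub>F t in at_top. ln (annealed t) / t < a"
    using eventually_gt_at_top[of 2]
  proof eventually_elim
    case (elim t)
    have "annealed t \<le> exp (2 * real n) ^ p * annealed_mid t" using annealed_compare(2)[of t] elim by simp
    also have "\<dots> \<le> exp (2 * real n) ^ p * (C * exp ((t - 2) * L))"
      using C(2)[of "t - 2"] elim by (intro mult_left_mono) auto
    also have "\<dots> \<le> B * exp ((t - 2) * L)" by (simp add: B_def algebra_simps)
    finally have "ln (annealed t) \<le> ln (B * exp ((t - 2) * L))"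
      using B annealed_ge_1[of t] elim by (subst ln_le_cancel_iff) auto
    then have "ln (annealed t) / t \<le> (ln B + (t - 2) * L) / t"
      using B elim by (intro divide_right_mono) (auto simp: ln_mult)
    then show ?case using elim by linarith
  qed
qed

text \<open>Because the potential is nonnegative, the moment is at least 1.\<close>

lemma top_nonneg: "0 \<le> top"
proof (rule tendsto_lowerbound[OF ln_annealed_tendsto])
  show "\<forall>\<^sub>F t in at_top. 0 \<le> ln (annealed t) / t"
    using eventually_gt_at_top[of 2] by eventually_elim (use annealed_ge_1 in auto)
qed simp

lemma lyapunov_eq:
  assumes "p \<ge> 1"
  shows "Lim at_top (\<lambda>t. 1 / (real p * t) * ln (annealed t)) = top / p"
proof (rule tendsto_Lim)
  have "((\<lambda>t. ln (annealed t) / t / p) \<longlongrightarrow> top / p) at_top"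
    using assms by (intro tendsto_divide ln_annealed_tendsto) auto
  then show "((\<lambda>t. 1 / (real p * t) * ln (annealed t)) \<longlongrightarrow> top / p) at_top"
    by (simp add: mult.commute)
qed simp

end

section \<open>Dirichlet forms of a single walker\<close>

definition dirichlet :: "(int ^ 'd \<Rightarrow> real) \<Rightarrow> real" where
  "dirichlet g = (\<Sum>v\<in>steps. \<Sum>\<^sub>\<infinity>z. (g (z + v) - g z)\<^sup>2) / 2"

lemma bij_translate: "bij (\<lambda>z :: int ^ 'd. z + a)"
  by (rule bij_betw_byWitness[of _ "\<lambda>z. z - a"]) auto

lemma fin_supp_translate: "fin_supp f \<Longrightarrow> fin_supp (\<lambda>z :: int ^ 'd. f (z + a))"
  by (rule fin_supp_bij[OF bij_translate])

lemma infsum_translate: "(\<Sum>\<^sub>\<infinity>z :: int ^ 'd. f (z + a)) = (\<Sum>\<^sub>\<infinity>z. f z :: real)"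
  by (rule infsum_bij[OF bij_translate])

lemma dirichlet_nonneg: "0 \<le> dirichlet g"
  unfolding dirichlet_def by (intro divide_nonneg_pos sum_nonneg infsum_nonneg) auto

lemma dirichlet_translate: "dirichlet (\<lambda>z. g (z + a)) = dirichlet g"
proof -
  have "(\<Sum>\<^sub>\<infinity>z. (g (z + v + a) - g (z + a))\<^sup>2) = (\<Sum>\<^sub>\<infinity>z. (g (z + v) - g z)\<^sup>2)" for v
    using infsum_translate[of "\<lambda>z. (g (z + v) - g z)\<^sup>2" a] by (simp add: add_ac)
  then show ?thesis by (simp add: dirichlet_def)
qed

lemma ip_translate: "ip (\<lambda>z :: int ^ 'd. g (z + a)) (\<lambda>z. h (z + a)) = ip g h"
  unfolding ip_def by (rule infsum_translate)

lemma fin_supp_adj: "fin_supp f \<Longrightarrow> fin_supp (adj f)"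
  unfolding adj_def[abs_def] by (intro fin_supp_sum finite_steps fin_supp_translate)

lemma ip_adj:
  fixes f g :: "int ^ 'd \<Rightarrow> real"
  assumes "fin_supp f"
  shows "ip f (adj g) = ip (adj f) g"
proof -
  have "ip f (adj g) = (\<Sum>v\<in>steps. \<Sum>\<^sub>\<infinity>z. f z * g (z + v))"
    unfolding ip_def adj_def sum_distrib_left
    by (intro infsum_sum_fin finite_steps fin_supp_intros assms)
  also have "\<dots> = (\<Sum>v\<in>steps. \<Sum>\<^sub>\<infinity>z. f (z + - v) * g z)"
  proof (intro sum.cong refl)
    fix a :: "int ^ 'd"
    show "(\<Sum>\<^sub>\<infinity>z. f z * g (z + a)) = (\<Sum>\<^sub>\<infinity>z. f (z + - a) * g z)"
      using infsum_translate[of "\<lambda>z. f z * g (z + a)" "- a"] by simp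
  qed
  also have "\<dots> = (\<Sum>v\<in>steps. \<Sum>\<^sub>\<infinity>z. f (z + v) * g z)"
    by (rule sum.reindex_bij_witness[of _ uminus uminus]) (auto simp: steps_uminus)
  also have "\<dots> = ip (adj f) g"
    unfolding ip_def adj_def sum_distrib_right
    by (intro infsum_sum_fin[symmetric] finite_steps fin_supp_intros fin_supp_translate assms)
  finally show ?thesis .
qed

lemma dirichlet_eq:
  fixes f :: "int ^ 'd \<Rightarrow> real"
  assumes f: "fin_supp f"
  shows "dirichlet f = deg TYPE('d) * ip f f - ip f (adj f)"
proof -
  have "(\<Sum>\<^sub>\<infinity>z. (f (z + v) - f z)\<^sup>2) = 2 * ip f f - 2 * (\<Sum>\<^sub>\<infinity>z. f z * f (z + v))" for v
  proof -
    have "(\<Sum>\<^sub>\<infinity>z. (f (z + v) - f z)\<^sup>2) =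
        (\<Sum>\<^sub>\<infinity>z. ((f (z + v))\<^sup>2 + (f z)\<^sup>2) - 2 * (f z * f (z + v)))"
      by (simp add: power2_diff algebra_simps)
    also have "\<dots> = (\<Sum>\<^sub>\<infinity>z. (f (z + v))\<^sup>2) + (\<Sum>\<^sub>\<infinity>z. (f z)\<^sup>2) - 2 * (\<Sum>\<^sub>\<infinity>z. f z * f (z + v))"
    proof -
      have fs: "fin_supp (\<lambda>z. (f (z + v))\<^sup>2)" "fin_supp (\<lambda>z. (f z)\<^sup>2)" "fin_supp (\<lambda>z. 2 * (f z * f (z + v)))"
        using fin_supp_intros(5)[OF fin_supp_translate[OF f]] fin_supp_intros(5)[OF f]
          fin_supp_intros(4)[OF fin_supp_intros(3)[OF f]] by auto
      show ?thesis
        by (simp only: infsum_diff_fin[OF fin_supp_intros(1)[OF fs(1,2)] fs(3)] infsum_add_fin[OF fs(1,2)] infsum_cmult_fin)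
    qed
    also have "(\<Sum>\<^sub>\<infinity>z. (f (z + v))\<^sup>2) = ip f f"
      unfolding ip_self by (rule infsum_translate)
    also have "(\<Sum>\<^sub>\<infinity>z. (f z)\<^sup>2) = ip f f" by (rule ip_self[symmetric])
    finally show ?thesis by (simp only: mult_2)
  qed
  moreover have "ip f (adj f) = (\<Sum>v\<in>steps. \<Sum>\<^sub>\<infinity>z. f z * f (z + v))"
    unfolding ip_def adj_def sum_distrib_left
    by (intro infsum_sum_fin finite_steps fin_supp_intros f)
  ultimately show ?thesis
    by (simp add: dirichlet_def sum_subtractf sum_distrib_left[symmetric])
qed

lemma dirichlet_le_deg:
  fixes f :: "int ^ 'd \<Rightarrow> real"
  assumes "fin_supp f" "\<And>z. 0 \<le> f z"
  shows "dirichlet f \<le> deg TYPE('d) * ip f f"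
proof -
  have "0 \<le> ip f (adj f)"
    unfolding ip_def adj_def using assms(2) by (intro infsum_nonneg mult_nonneg_nonneg sum_nonneg)
  then show ?thesis using dirichlet_eq[OF assms(1)] by simp
qed

lemma square_sum_le: "(\<Sum>l<m. a l)\<^sup>2 \<le> real m * (\<Sum>l<m. (a l)\<^sup>2)" for a :: "nat \<Rightarrow> real"
  using Cauchy_Schwarz_ineq_sum[of "\<lambda>_. 1" a "{..<m}"] by simp

lemma fin_sum_le_infsum:
  "finite A \<Longrightarrow> fin_supp f \<Longrightarrow> (\<And>z. 0 \<le> f z) \<Longrightarrow> sum f A \<le> (\<Sum>\<^sub>\<infinity>z. f z :: real)"
  using finite_sum_le_infsum[OF fin_supp_summable, of f A] by auto

text \<open>Walk along a ray of length \<open>L\<close> and average over its end point.\<close>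

lemma point_le_dirichlet:
  fixes g :: "int ^ 'd \<Rightarrow> real"
  assumes g: "fin_supp g" and L: "L > 0"
  shows "(g 0)\<^sup>2 \<le> 2 / real L * ip g g + 4 * real L * dirichlet g"
proof -
  obtain i :: 'd where True by simp
  define e :: "int ^ 'd" where "e = axis i 1"
  define r where "r m = axis i (int m)" for m
  have e: "e \<in> steps" by (simp add: e_def axis_in_steps)
  have r_Suc: "r (Suc m) = r m + e" for m
    by (simp add: r_def e_def vec_eq_iff axis_def)
  have inj: "inj_on r A" for A
    by (auto simp: inj_on_def r_def vec_eq_iff axis_def split: if_splits)
  have r0: "r 0 = 0" by (simp add: r_def vec_eq_iff axis_def)
  have ds: "fin_supp (\<lambda>z. (g (z + e) - g z)\<^sup>2)"
    by (rule fin_supp_intros(5), rule fin_supp_intros(2)) (auto intro: fin_supp_translate g)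
  \<comment> \<open>The edges of the ray are distinct; the factor 2 undoes the halving in
    \<open>dirichlet\<close>.\<close>
  have E: "(\<Sum>l<m. (g (r (Suc l)) - g (r l))\<^sup>2) \<le> 2 * dirichlet g" for m
  proof -
    have "(\<Sum>l<m. (g (r (Suc l)) - g (r l))\<^sup>2) = (\<Sum>z\<in>r ` {..<m}. (g (z + e) - g z)\<^sup>2)"
      by (subst sum.reindex[OF inj]) (simp add: r_Suc)
    also have "\<dots> \<le> (\<Sum>\<^sub>\<infinity>z. (g (z + e) - g z)\<^sup>2)"
      by (intro fin_sum_le_infsum ds) auto
    also have "\<dots> \<le> (\<Sum>v\<in>steps. \<Sum>\<^sub>\<infinity>z. (g (z + v) - g z)\<^sup>2)"
      using e finite_steps by (intro member_le_sum infsum_nonneg) auto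
    finally show ?thesis by (simp add: dirichlet_def)
  qed
  have "(g 0)\<^sup>2 \<le> 2 * (g (r m))\<^sup>2 + 4 * real L * dirichlet g" if "m < L" for m
  proof -
    have "g 0 = g (r m) - (\<Sum>l<m. g (r (Suc l)) - g (r l))"
      using sum_lessThan_telescope[of "\<lambda>l. g (r l)" m] by (simp add: r0)
    then have "(g 0)\<^sup>2 \<le> 2 * (g (r m))\<^sup>2 + 2 * (\<Sum>l<m. g (r (Suc l)) - g (r l))\<^sup>2"
      by (simp only:) (smt (verit) power2_diff power2_sum zero_le_power2)
    also have "(\<Sum>l<m. g (r (Suc l)) - g (r l))\<^sup>2 \<le> real m * (\<Sum>l<m. (g (r (Suc l)) - g (r l))\<^sup>2)"
      by (rule square_sum_le)
    also have "\<dots> \<le> real L * (2 * dirichlet g)"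
      using that E[of m] by (intro mult_mono sum_nonneg) auto
    finally show ?thesis by simp
  qed
  then have "(\<Sum>m<L. (g 0)\<^sup>2) \<le> (\<Sum>m<L. 2 * (g (r m))\<^sup>2 + 4 * real L * dirichlet g)"
    by (intro sum_mono) auto
  also have "\<dots> = 2 * (\<Sum>z\<in>r ` {..<L}. (g z)\<^sup>2) + real L * (4 * real L * dirichlet g)"
    by (subst sum.reindex[OF inj]) (simp add: sum.distrib sum_distrib_left)
  also have "(\<Sum>z\<in>r ` {..<L}. (g z)\<^sup>2) \<le> ip g g"
    unfolding ip_self by (intro fin_sum_le_infsum fin_supp_intros g) auto
  finally show ?thesis using L by (simp add: field_simps)
qed

text \<open>The truncated Green functions \<open>g\<^sub>m = \<Sum>\<^sub>k\<^sub>\<le>\<^sub>m deg\<^sup>-\<^sup>k\<^sup>-\<^sup>1 adj\<^sup>k \<delta>\<^sub>0\<close> satisfy \<open>-\<Delta> g\<^sub>m = \<delta>\<^sub>0 - q\<close> with a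
  remainder \<open>q\<close> that vanishes in the transient case.\<close>

lemma point_le_green:
  fixes f :: "int ^ 'd \<Rightarrow> real"
  assumes f: "fin_supp f"
    and G: "\<And>m. (\<Sum>k\<le>m. walk_count k (0 :: int ^ 'd) 0 / deg TYPE('d) ^ Suc k) \<le> G"
  shows "(f 0)\<^sup>2 \<le> G * dirichlet f"
proof -
  define D where "D = deg TYPE('d)"
  have D: "D > 0" using deg_pos by (simp add: D_def)
  define u where "u k z = walk_count k z (0 :: int ^ 'd)" for k z
  have u_fin: "fin_supp (u k)" for k
  proof (induction k)
    case (Suc k)
    have "u (Suc k) = adj (u k)" by (auto simp: u_def walk_count_Suc adj_def)
    then show ?case using fin_supp_adj[OF Suc] by simp
  qed (simp add: u_def walk_count_0 indicator_def)
  have u_adj: "adj (u k) = u (Suc k)" for k by (auto simp: u_def walk_count_Suc adj_def)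
  define g where "g m z = (\<Sum>k\<le>m. u k z / D ^ Suc k)" for m z
  have g_fin: "fin_supp (g m)" for m
    unfolding g_def divide_inverse by (intro fin_supp_sum fin_supp_intros u_fin) auto
  have g_adj: "adj (g m) z = (\<Sum>k\<le>m. u (Suc k) z / D ^ Suc k)" for m z
    unfolding u_adj[symmetric] adj_def g_def by (subst sum.swap) (simp add: sum_divide_distrib)
  \<comment> \<open>Telescoping: \<open>adj\<close> shifts the index of the series by one, so only
    the first and the last terms are left.\<close>
  have green: "D * g m z - adj (g m) z = indicator {0} z - u (Suc m) z / D ^ Suc m" for m z
  proof (induction m)
    case 0
    then show ?case using D unfolding g_adj by (simp add: g_def u_def walk_count_0)
  next
    case (Suc m)
    then show ?case using D unfolding g_adj by (simp add: g_def algebra_simps)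
  qed
  define q where "q m z = u (Suc m) z / D ^ Suc m" for m z
  have q_fin: "fin_supp (q m)" for m
    unfolding q_def[abs_def] divide_inverse by (intro fin_supp_intros u_fin)
  have ip_delta: "ip h (indicator {0}) = h 0" for h :: "int ^ 'd \<Rightarrow> real"
    unfolding ip_def by (subst infsum_fin_supp[of "{0}"]) auto
  have ip_green: "D * ip h (g m) - ip h (adj (g m)) = h 0 - ip h (q m)" if h: "fin_supp h" for h m
  proof -
    have "D * ip h (g m) - ip h (adj (g m)) = ip h (\<lambda>z. D * g m z - adj (g m) z)"
      by (simp add: ip_diff_right[OF h] ip_cmult_right)
    also have "\<dots> = ip h (\<lambda>z. indicator {0} z - q m z)" unfolding green q_def ..
    finally show ?thesis by (simp add: ip_diff_right[OF h] ip_delta)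
  qed
  have G0: "G > 0"
  proof -
    have "0 < walk_count 0 (0 :: int ^ 'd) 0 / D ^ Suc 0" using D by (simp add: walk_count_0)
    then show ?thesis using G[of 0] by (simp add: D_def)
  qed
  have main: "(f 0 - ip f (q m))\<^sup>2 \<le> G * dirichlet f" for m
  proof -
    define B where "B = f 0 - ip f (q m)"
    have dg: "dirichlet (g m) \<le> G"
    proof -
      have "dirichlet (g m) = g m 0 - ip (g m) (q m)"
        unfolding dirichlet_eq[OF g_fin] D_def[symmetric] by (rule ip_green[OF g_fin])
      moreover have "0 \<le> ip (g m) (q m)"
        unfolding ip_def g_def q_def u_def using D
        by (intro infsum_nonneg mult_nonneg_nonneg sum_nonneg divide_nonneg_pos walk_count_nonneg) auto
      moreover have "g m 0 \<le> G" using G[of m] by (simp add: g_def u_def D_def)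
      ultimately show ?thesis by linarith
    qed
    \<comment> \<open>A nonnegative quadratic in t, as in the Cauchy-Schwarz inequality for the
      Dirichlet form. Below, t = B / G is its minimiser after \<open>dirichlet (g m)\<close> is
      replaced by the bound G.\<close>
    have fg: "dirichlet (\<lambda>z. f z - t * g m z) = dirichlet f - 2 * t * B + t\<^sup>2 * dirichlet (g m)" for t
    proof -
      have tg: "fin_supp (\<lambda>z. t * g m z)" by (intro fin_supp_intros g_fin)
      have "adj (\<lambda>z. f z - t * g m z) = (\<lambda>z. adj f z - t * adj (g m) z)"
        by (auto simp: adj_def sum_subtractf sum_distrib_left)
      moreover have "ip (g m) (adj f) = ip f (adj (g m))"
        using ip_adj[OF f, of "g m"] by (simp add: ip_sym)
      moreover have "B = D * ip f (g m) - ip f (adj (g m))"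
        unfolding B_def by (rule ip_green[OF f, symmetric])
      ultimately show ?thesis
        unfolding dirichlet_eq[OF fin_supp_intros(2)[OF f tg]] dirichlet_eq[OF f] dirichlet_eq[OF g_fin] D_def[symmetric]
        by (simp only: ip_diff[OF f tg] ip_cmult ip_diff_right[OF f] ip_diff_right[OF g_fin] ip_cmult_right ip_sym[of "g m" f])
          (simp add: power2_eq_square algebra_simps)
    qed
    have "0 \<le> dirichlet f - 2 * (B / G) * B + (B / G)\<^sup>2 * dirichlet (g m)"
      using dirichlet_nonneg[of "\<lambda>z. f z - (B / G) * g m z"] unfolding fg .
    also have "\<dots> \<le> dirichlet f - 2 * (B / G) * B + (B / G)\<^sup>2 * G"
      using dg by (intro add_left_mono mult_left_mono) auto
    also have "\<dots> = dirichlet f - B\<^sup>2 / G" using G0 by (simp add: field_simps power2_eq_square)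
    finally show ?thesis using G0 by (simp add: B_def field_simps)
  qed
  \<comment> \<open>Going to \<open>z\<close> and back in k steps each shows that (u k z)^2 is at
    most the number of loops of length 2 k; the normalised loop counts are summable, hence tend to
    0.\<close>
  have "(\<lambda>k. u k z / D ^ k) \<longlonglongrightarrow> 0" for z
  proof -
    let ?a = "\<lambda>k. walk_count k (0 :: int ^ 'd) 0 / D ^ Suc k"
    have a0: "0 \<le> ?a k" for k using D by (intro divide_nonneg_pos walk_count_nonneg) auto
    have "summable ?a"
    proof (rule summableI_nonneg_bounded[OF a0])
      show "(\<Sum>k<m. ?a k) \<le> G" for m
        using G[of m] a0[of m] by (simp add: lessThan_Suc_atMost[symmetric] D_def)
    qed
    then have "(\<lambda>k. ?a (k + k)) \<longlonglongrightarrow> 0"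
      using summable_LIMSEQ_zero LIMSEQ_subseq_LIMSEQ[of ?a 0 "\<lambda>k. k + k"] by (auto simp: strict_mono_def o_def)
    then have "(\<lambda>k. D * ?a (k + k)) \<longlonglongrightarrow> D * 0" by (rule tendsto_mult_left)
    then have lim: "(\<lambda>k. sqrt (D * ?a (k + k))) \<longlonglongrightarrow> sqrt (D * 0)" by (rule tendsto_real_sqrt)
    have "\<bar>u k z / D ^ k\<bar> \<le> sqrt (D * ?a (k + k))" for k
    proof (rule real_le_rsqrt)
      have "(u k z)\<^sup>2 \<le> walk_count (k + k) (0 :: int ^ 'd) 0"
        using walk_count_add_ge[of k 0 z k 0] by (simp add: u_def power2_eq_square walk_count_sym[of k 0])
      then have "(u k z)\<^sup>2 / D ^ (k + k) \<le> walk_count (k + k) (0 :: int ^ 'd) 0 / D ^ (k + k)"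
        using D by (intro divide_right_mono) auto
      then show "\<bar>u k z / D ^ k\<bar>\<^sup>2 \<le> D * ?a (k + k)"
        using D by (simp add: power_divide power_add power2_eq_square)
    qed
    then show ?thesis
      by (intro Lim_null_comparison[OF always_eventually lim[unfolded mult_zero_right real_sqrt_zero]] allI)
        (simp only: real_norm_def)
  qed
  then have "(\<lambda>m. q m z) \<longlonglongrightarrow> 0" for z
    unfolding q_def by (rule LIMSEQ_Suc)
  then have "(\<lambda>m. \<Sum>z\<in>{z. f z \<noteq> 0}. f z * q m z) \<longlonglongrightarrow> (\<Sum>z\<in>{z. f z \<noteq> 0}. f z * 0)"
    by (intro tendsto_sum tendsto_mult_left)
  moreover have "ip f (q m) = (\<Sum>z\<in>{z. f z \<noteq> 0}. f z * q m z)" for m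
    unfolding ip_def by (intro infsum_fin_supp f) auto
  ultimately have "(\<lambda>m. ip f (q m)) \<longlonglongrightarrow> 0" by simp
  then have "(\<lambda>m. (f 0 - ip f (q m))\<^sup>2) \<longlonglongrightarrow> (f 0 - 0)\<^sup>2"
    by (intro tendsto_intros)
  then show ?thesis using main by (intro LIMSEQ_le_const2) auto
qed

section \<open>Test functions on boxes\<close>

definition cube :: "nat \<Rightarrow> (int ^ 'd) set" where
  "cube r = {z. \<forall>i. \<bar>z $ i\<bar> \<le> int r}"

text \<open>The sup norm as a natural number; its balls are the cubes.\<close>

definition radius :: "int ^ 'd \<Rightarrow> nat" where
  "radius z = nat (Max (range (\<lambda>i. \<bar>z $ i\<bar>)))"

lemma radius_le_iff: "radius z \<le> r \<longleftrightarrow> z \<in> cube r"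
  by (simp add: radius_def cube_def nat_le_iff Max_le_iff)

lemma finite_cube: "finite (cube r)"
  unfolding cube_def by (rule finite_lattice_box)

lemma card_cube: "card (cube r :: (int ^ 'd) set) = (2 * r + 1) ^ CARD('d)"
proof -
  have "bij_betw vec_nth (cube r :: (int ^ 'd) set) (PiE UNIV (\<lambda>_. {- int r..int r}))"
    by (rule bij_betw_byWitness[of _ vec_lambda])
      (auto simp: cube_def abs_le_iff vec_lambda_inverse minus_le_iff[of _ "int r"] PiE_iff image_subset_iff)
  then have "card (cube r :: (int ^ 'd) set) = card (PiE (UNIV :: 'd set) (\<lambda>_. {- int r..int r}))"
    by (rule bij_betw_same_card)
  also have "\<dots> = (2 * r + 1) ^ CARD('d)"
  proof -
    have "nat (1 + int r + int r) = 2 * r + 1" by linarith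
    then show ?thesis by (subst card_PiE) (simp_all add: add_ac)
  qed
  finally show ?thesis .
qed

lemma radius_step:
  assumes "v \<in> steps"
  shows "radius (z + v) \<le> radius z + 1" "radius z \<le> radius (z + v) + 1"
proof -
  have *: "radius (z + w) \<le> radius z + 1" if "w \<in> steps" for z w :: "int ^ 'd"
    unfolding radius_le_iff cube_def
  proof safe
    fix i
    have "z \<in> cube (radius z)" using radius_le_iff by blast
    then have "\<bar>z $ i\<bar> \<le> int (radius z)" by (simp add: cube_def)
    then show "\<bar>(z + w) $ i\<bar> \<le> int (radius z + 1)"
      using step_component_le[OF that, of i] by simp
  qed
  show "radius (z + v) \<le> radius z + 1" using *[OF assms] .
  show "radius z \<le> radius (z + v) + 1" using *[OF steps_uminus[OF assms], of "z + v"] by simp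
qed

lemma dirichlet_le_sum:
  fixes g :: "int ^ 'd \<Rightarrow> real"
  assumes "finite A" and le: "\<And>z v. v \<in> steps \<Longrightarrow> z \<in> A \<Longrightarrow> (g (z + v) - g z)\<^sup>2 \<le> w z"
    and zero: "\<And>z v. v \<in> steps \<Longrightarrow> z \<notin> A \<Longrightarrow> g (z + v) = g z"
  shows "dirichlet g \<le> deg TYPE('d) / 2 * (\<Sum>z\<in>A. w z)"
proof -
  have "(\<Sum>\<^sub>\<infinity>z. (g (z + v) - g z)\<^sup>2) \<le> (\<Sum>z\<in>A. w z)" if v: "v \<in> steps" for v
  proof -
    have "(\<Sum>\<^sub>\<infinity>z. (g (z + v) - g z)\<^sup>2) = (\<Sum>z\<in>A. (g (z + v) - g z)\<^sup>2)"
      using zero[OF v] by (intro infsum_fin_supp assms) auto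
    also have "\<dots> \<le> (\<Sum>z\<in>A. w z)" by (intro sum_mono le v)
    finally show ?thesis .
  qed
  then have "(\<Sum>v\<in>steps. \<Sum>\<^sub>\<infinity>z. (g (z + v) - g z)\<^sup>2) \<le> (\<Sum>v\<in>(steps :: (int ^ 'd) set). \<Sum>z\<in>A. w z)"
    by (intro sum_mono)
  then show ?thesis by (simp add: dirichlet_def)
qed

text \<open>Tent functions: slowly varying on a large box.\<close>

lemma exists_small_dirichlet:
  fixes dummy :: "'d :: finite itself"
  assumes "\<epsilon> > 0"
  shows "\<exists>g :: int ^ 'd \<Rightarrow> real. fin_supp g \<and> (\<forall>z. 0 \<le> g z) \<and> ip g g = 1 \<and> dirichlet g \<le> \<epsilon>"
proof -
  \<comment> \<open>The Dirichlet form is at most deg / 2 times the volume (4 M + 1)^d, the squared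
    norm at least M^2 (2 M + 1)^d, and the volumes differ by a factor of at most 2^d. The ratio is
    therefore at most C / M^2.\<close>
  define C where "C = deg TYPE('d) / 2 * 2 ^ CARD('d)"
  obtain M :: nat where M: "C / \<epsilon> + 1 < real M" using reals_Archimedean2 by blast
  have C: "C \<ge> 0" by (simp add: C_def)
  have M1: "1 \<le> real M" using M C assms by (smt (verit) divide_nonneg_pos)
  \<comment> \<open>Truncated subtraction gives a tent of slope 1 that vanishes outside the cube of
    size 2 M and is at least M on the cube of size M.\<close>
  define g :: "int ^ 'd \<Rightarrow> real" where "g z = real (2 * M - radius z)" for z
  have g_fin: "fin_supp g"
    by (rule finite_subset[OF _ finite_cube[of "2 * M"]]) (auto simp: g_def radius_le_iff[symmetric])
  have "dirichlet g \<le> deg TYPE('d) / 2 * (\<Sum>z\<in>(cube (2 * M) :: (int ^ 'd) set). 1)"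
  proof (rule dirichlet_le_sum[OF finite_cube])
    fix z v :: "int ^ 'd" assume v: "v \<in> steps"
    have "\<bar>g (z + v) - g z\<bar> \<le> 1" using radius_step[OF v, of z] by (auto simp: g_def of_nat_diff abs_le_iff)
    then show "(g (z + v) - g z)\<^sup>2 \<le> 1" by (simp add: abs_square_le_1)
    assume "z \<notin> cube (2 * M)"
    then have "2 * M < radius z" by (simp add: radius_le_iff[symmetric])
    then show "g (z + v) = g z" using radius_step(2)[OF v, of z] by (simp add: g_def)
  qed
  also have "\<dots> = deg TYPE('d) / 2 * real ((4 * M + 1) ^ CARD('d))" by (simp add: card_cube)
  also have "\<dots> \<le> deg TYPE('d) / 2 * real ((2 * (2 * M + 1)) ^ CARD('d))"
    by (intro mult_left_mono of_nat_mono power_mono) auto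
  also have "\<dots> = C * real ((2 * M + 1) ^ CARD('d))"
    unfolding power_mult_distrib of_nat_mult C_def by simp
  finally have dir: "dirichlet g \<le> C * real ((2 * M + 1) ^ CARD('d))" .
  have "real ((2 * M + 1) ^ CARD('d)) * (real M)\<^sup>2 = (\<Sum>z\<in>(cube M :: (int ^ 'd) set). (real M)\<^sup>2)"
    by (simp add: card_cube)
  also have "\<dots> \<le> (\<Sum>z\<in>cube M. (g z)\<^sup>2)"
    by (intro sum_mono power_mono) (auto simp: g_def radius_le_iff[symmetric])
  also have "\<dots> \<le> ip g g"
    unfolding ip_self by (intro fin_sum_le_infsum finite_cube fin_supp_intros g_fin) auto
  finally have ip: "real ((2 * M + 1) ^ CARD('d)) * (real M)\<^sup>2 \<le> ip g g" .
  have "C \<le> \<epsilon> * real M" using M assms by (simp add: field_simps)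
  also have "\<dots> \<le> \<epsilon> * (real M)\<^sup>2" using M1 assms by (simp add: power2_eq_square)
  finally have "dirichlet g \<le> \<epsilon> * (real M)\<^sup>2 * real ((2 * M + 1) ^ CARD('d))"
    by (intro order_trans[OF dir] mult_right_mono) auto
  also have "\<dots> \<le> \<epsilon> * ip g g" using ip assms by (simp add: mult_left_mono mult_ac)
  finally have dg: "dirichlet g \<le> \<epsilon> * ip g g" .
  have pos: "0 < ip g g"
    by (rule less_le_trans[OF _ ip]) (use M1 in auto)
  define c where "c = 1 / sqrt (ip g g)"
  have c: "c * c = 1 / ip g g" "0 \<le> c" using pos by (auto simp: c_def)
  show ?thesis
  proof (intro exI[of _ "\<lambda>z. c * g z"] conjI allI)
    show "fin_supp (\<lambda>z. c * g z)" by (intro fin_supp_intros g_fin)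
    show "0 \<le> c * g z" for z using c by (simp add: g_def)
    show "ip (\<lambda>z. c * g z) (\<lambda>z. c * g z) = 1" using pos c by (simp add: ip_cmult ip_cmult_right mult.assoc[symmetric])
    have "dirichlet (\<lambda>z. c * g z) = (c * c) * dirichlet g"
      by (simp add: dirichlet_def right_diff_distrib[symmetric] power_mult_distrib infsum_cmult_fin
          sum_distrib_left[symmetric] power2_eq_square[of c])
    also have "\<dots> \<le> \<epsilon>" using dg pos by (simp add: c field_simps)
    finally show "dirichlet (\<lambda>z. c * g z) \<le> \<epsilon>" .
  qed
qed

text \<open>Recurrence: a logarithmic cutoff shows that a point has zero capacity if \<open>d \<le> 2\<close>.\<close>

lemma exists_recurrent:
  fixes C :: real
  assumes d: "CARD('d) \<le> 2"
  shows "\<exists>\<phi> :: int ^ 'd \<Rightarrow> real. fin_supp \<phi> \<and> C * dirichlet \<phi> < (\<phi> 0)\<^sup>2"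
proof -
  \<comment> \<open>For d \<le> 2 the sphere of radius r has at most 8 r points, so the weights 1 /
    r^2 add up to a harmonic series; \<open>max\<close> takes care of the origin.\<close>
  have sphere: "(\<Sum>z\<in>(cube L :: (int ^ 'd) set). 1 / (real (max 1 (radius z)))\<^sup>2) \<le> 1 + 8 * harm L" for L
  proof (induction L)
    case 0
    have "(cube 0 :: (int ^ 'd) set) = {0}" by (auto simp: cube_def vec_eq_iff)
    then show ?case by (simp add: harm_def radius_def)
  next
    case (Suc L)
    let ?S = "cube (Suc L) - cube L :: (int ^ 'd) set"
    have sub: "cube L \<subseteq> (cube (Suc L) :: (int ^ 'd) set)"
    proof
      fix z :: "int ^ 'd" assume "z \<in> cube L"
      then show "z \<in> cube (Suc L)" using radius_le_iff[of z] by (metis le_SucI)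
    qed
    have r: "radius z = Suc L" if "z \<in> ?S" for z
      using that by (auto simp: radius_le_iff[symmetric])
    have "card ?S = (2 * Suc L + 1) ^ CARD('d) - (2 * L + 1) ^ CARD('d)"
      using sub by (simp add: card_Diff_subset finite_cube card_cube)
    also have "\<dots> \<le> 8 * Suc L"
    proof -
      have "CARD('d) = 1 \<or> CARD('d) = 2" using d zero_less_card_finite[where 'a='d] by linarith
      then show ?thesis by (auto simp: power2_eq_square algebra_simps)
    qed
    finally have c: "card ?S \<le> 8 * Suc L" .
    have "(\<Sum>z\<in>(cube (Suc L) :: (int ^ 'd) set). 1 / (real (max 1 (radius z)))\<^sup>2) =
      (\<Sum>z\<in>?S. 1 / (real (max 1 (radius z)))\<^sup>2) + (\<Sum>z\<in>(cube L :: (int ^ 'd) set). 1 / (real (max 1 (radius z)))\<^sup>2)"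
      using sub by (intro sum.subset_diff finite_cube)
    also have "(\<Sum>z\<in>?S. 1 / (real (max 1 (radius z)))\<^sup>2) = (\<Sum>z\<in>?S. 1 / (real (Suc L))\<^sup>2)"
      by (intro sum.cong refl) (simp add: r)
    also have "\<dots> = real (card ?S) / (real (Suc L))\<^sup>2" by simp
    also have "\<dots> \<le> (8 * real (Suc L)) / (real (Suc L))\<^sup>2"
    proof (rule divide_right_mono)
      have "real (card ?S) \<le> real (8 * Suc L)" using c by (rule of_nat_mono)
      then show "real (card ?S) \<le> 8 * real (Suc L)" by simp
    qed simp
    also have "\<dots> = 8 / real (Suc L)" by (simp add: power2_eq_square del: of_nat_Suc)
    finally show ?case using Suc by (simp add: harm_Suc inverse_eq_divide)
  qed
  define C' where "C' = \<bar>C\<bar> * (deg TYPE('d) / 2)"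
  have C': "0 \<le> C'" by (simp add: C'_def)
  \<comment> \<open>The Dirichlet form grows at most like harm L, the square at the origin like
    (harm L)^2. The summand 1 gives harm L \<ge> 1, hence 1 + 8 harm L \<le> 9 harm L.\<close>
  have "eventually (\<lambda>L. 9 * C' + 1 < (harm L :: real)) sequentially"
    using harm_at_top by (simp add: filterlim_at_top_dense)
  then obtain L where L: "9 * C' + 1 < (harm L :: real)" by (auto simp: eventually_sequentially)
  \<comment> \<open>A discrete logarithm: below L the increment from r to r + 1 has size 1 / (r +
    1).\<close>
  define \<psi> where "\<psi> r = harm L - (harm (min r L) :: real)" for r
  define \<phi> :: "int ^ 'd \<Rightarrow> real" where "\<phi> z = \<psi> (radius z)" for z
  have \<psi>_Suc: "\<bar>\<psi> (Suc r) - \<psi> r\<bar> \<le> 1 / real (Suc r)" "r \<ge> L \<Longrightarrow> \<psi> r = 0" for r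
  proof -
    show "\<bar>\<psi> (Suc r) - \<psi> r\<bar> \<le> 1 / real (Suc r)"
    proof (cases "r < L")
      case True
      then show ?thesis by (simp add: \<psi>_def harm_Suc inverse_eq_divide)
    next
      case False
      then have "min (Suc r) L = min r L" by auto
      then show ?thesis by (simp add: \<psi>_def)
    qed
    show "r \<ge> L \<Longrightarrow> \<psi> r = 0" by (simp add: \<psi>_def min_def)
  qed
  have \<phi>_fin: "fin_supp \<phi>"
  proof (rule finite_subset[OF _ finite_cube[of L]], rule subsetI)
    fix z :: "int ^ 'd" assume "z \<in> {z. \<phi> z \<noteq> 0}"
    then have "\<not> L \<le> radius z" using \<psi>_Suc(2)[of "radius z"] by (auto simp: \<phi>_def)
    then show "z \<in> cube L" by (simp add: radius_le_iff[symmetric])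
  qed
  have dir: "dirichlet \<phi> \<le> deg TYPE('d) / 2 * (\<Sum>z\<in>(cube L :: (int ^ 'd) set). 1 / (real (max 1 (radius z)))\<^sup>2)"
  proof (rule dirichlet_le_sum[OF finite_cube])
    fix z v :: "int ^ 'd" assume v: "v \<in> steps"
    have "\<bar>\<phi> (z + v) - \<phi> z\<bar> \<le> 1 / real (max 1 (radius z))"
    proof -
      consider "radius (z + v) = radius z" | "radius (z + v) = Suc (radius z)" | "radius z = Suc (radius (z + v))"
        using radius_step[OF v, of z] by linarith
      then show ?thesis
      proof cases
        case 2
        have "\<bar>\<phi> (z + v) - \<phi> z\<bar> \<le> 1 / real (Suc (radius z))" unfolding \<phi>_def 2 by (rule \<psi>_Suc)
        also have "\<dots> \<le> 1 / real (max 1 (radius z))" by (intro divide_left_mono) auto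
        finally show ?thesis .
      next
        case 3
        have "\<bar>\<phi> z - \<phi> (z + v)\<bar> \<le> 1 / real (Suc (radius (z + v)))" unfolding \<phi>_def 3 by (rule \<psi>_Suc)
        then show ?thesis using 3 by (simp add: abs_minus_commute)
      qed (simp add: \<phi>_def)
    qed
    then have "\<bar>\<phi> (z + v) - \<phi> z\<bar>\<^sup>2 \<le> (1 / real (max 1 (radius z)))\<^sup>2" by (rule power_mono) simp
    then show "(\<phi> (z + v) - \<phi> z)\<^sup>2 \<le> 1 / (real (max 1 (radius z)))\<^sup>2" by (simp add: power_divide)
    assume "z \<notin> cube L"
    then have "L < radius z" by (simp add: radius_le_iff[symmetric])
    then show "\<phi> (z + v) = \<phi> z" using radius_step(2)[OF v, of z] \<psi>_Suc(2) by (simp add: \<phi>_def)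
  qed
  have "C * dirichlet \<phi> \<le> \<bar>C\<bar> * dirichlet \<phi>" using dirichlet_nonneg[of \<phi>] by (intro mult_right_mono) auto
  also have "\<dots> \<le> \<bar>C\<bar> * (deg TYPE('d) / 2 * (1 + 8 * harm L))"
    using dir sphere[of L] by (intro mult_left_mono order_trans[OF dir] mult_left_mono) auto
  also have "\<dots> = C' * (1 + 8 * harm L)" by (simp add: C'_def)
  also have "\<dots> \<le> C' * (9 * harm L)" using L C' by (intro mult_left_mono) auto
  also have "\<dots> < harm L * harm L"
  proof -
    have "9 * C' < harm L" "(0 :: real) < harm L" using L C' by linarith+
    then have "9 * C' * harm L < harm L * harm L" by (rule mult_strict_right_mono)
    then show ?thesis by (simp add: mult_ac)
  qed
  also have "harm L * harm L = (\<phi> 0)\<^sup>2" by (simp add: \<phi>_def \<psi>_def radius_def harm_def power2_eq_square)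
  finally show ?thesis using \<phi>_fin by blast
qed

section \<open>Comparison with one-particle problems\<close>

text \<open>The variational form of \<mu>(\<nu>) over real functions of finite support. Energies are
  compared with this form; its identification with the spectrum is a separate matter.\<close>

definition one_top :: "'d::finite itself \<Rightarrow> real \<Rightarrow> real" where
  "one_top _ \<nu> = Sup {(g 0)\<^sup>2 - \<nu> * dirichlet g | g :: int ^ 'd \<Rightarrow> real. fin_supp g \<and> ip g g = 1}"

lemma point_le_ip: "fin_supp g \<Longrightarrow> (g a)\<^sup>2 \<le> ip g g"
  using fin_sum_le_infsum[of "{a}" "\<lambda>z. (g z)\<^sup>2"] by (simp add: ip_self fin_supp_intros)

lemma dirichlet_cmult: "dirichlet (\<lambda>z. c * g z) = c\<^sup>2 * dirichlet g"
  by (simp add: dirichlet_def right_diff_distrib[symmetric] power_mult_distrib infsum_cmult_fin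
      sum_distrib_left[symmetric])

lemma ip_indicator: "ip (indicator {a} :: 'a \<Rightarrow> real) (indicator {a}) = 1"
  unfolding ip_self by (subst infsum_fin_supp[of "{a}"]) auto

lemma fin_supp_indicator: "fin_supp (indicator {a} :: 'a \<Rightarrow> real)"
  by (auto simp: indicator_def)

lemma one_top_props:
  fixes \<nu> :: real and g :: "int ^ 'd \<Rightarrow> real"
  assumes "\<nu> \<ge> 0"
  shows one_top_bdd: "bdd_above {(g 0)\<^sup>2 - \<nu> * dirichlet g | g :: int ^ 'd \<Rightarrow> real. fin_supp g \<and> ip g g = 1}"
    and one_top_nonempty: "{(g 0)\<^sup>2 - \<nu> * dirichlet g | g :: int ^ 'd \<Rightarrow> real. fin_supp g \<and> ip g g = 1} \<noteq> {}"
proof -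
  show "bdd_above {(g 0)\<^sup>2 - \<nu> * dirichlet g | g :: int ^ 'd \<Rightarrow> real. fin_supp g \<and> ip g g = 1}"
  proof (rule bdd_aboveI[of _ 1])
    fix r assume "r \<in> {(g 0)\<^sup>2 - \<nu> * dirichlet g | g :: int ^ 'd \<Rightarrow> real. fin_supp g \<and> ip g g = 1}"
    then obtain g :: "int ^ 'd \<Rightarrow> real" where "fin_supp g" "ip g g = 1" "r = (g 0)\<^sup>2 - \<nu> * dirichlet g" by blast
    then show "r \<le> 1"
      using point_le_ip[of g 0] mult_nonneg_nonneg[OF assms dirichlet_nonneg[of g]] by simp
  qed
  have "fin_supp (indicator {0} :: int ^ 'd \<Rightarrow> real)" "ip (indicator {0} :: int ^ 'd \<Rightarrow> real) (indicator {0}) = 1"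
    by (simp_all add: fin_supp_indicator ip_indicator)
  then show "{(g 0)\<^sup>2 - \<nu> * dirichlet g | g :: int ^ 'd \<Rightarrow> real. fin_supp g \<and> ip g g = 1} \<noteq> {}" by blast
qed

lemma normalise:
  assumes "0 < ip g g"
  obtains c where "c > 0" "c\<^sup>2 = 1 / ip g g" "ip (\<lambda>z. c * g z) (\<lambda>z. c * g z) = 1"
proof
  let ?c = "1 / sqrt (ip g g)"
  show "?c > 0" using assms by simp
  show c: "?c\<^sup>2 = 1 / ip g g" using assms by (simp add: power_divide)
  show "ip (\<lambda>z. ?c * g z) (\<lambda>z. ?c * g z) = 1"
    unfolding ip_cmult ip_cmult_right mult.assoc[symmetric] power2_eq_square[symmetric] c using assms by simp
qed

lemma one_top_ge:
  fixes g :: "int ^ 'd \<Rightarrow> real"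
  assumes "\<nu> \<ge> 0" "fin_supp g"
  shows "(g 0)\<^sup>2 - \<nu> * dirichlet g \<le> one_top TYPE('d) \<nu> * ip g g"
proof (cases "ip g g = 0")
  case True
  then show ?thesis using point_le_ip[OF assms(2), of 0] mult_nonneg_nonneg[OF assms(1) dirichlet_nonneg[of g]] by simp
next
  case False
  then have pos: "0 < ip g g" using ip_self_nonneg[of g] by linarith
  then obtain c where c: "c > 0" "c\<^sup>2 = 1 / ip g g" "ip (\<lambda>z. c * g z) (\<lambda>z. c * g z) = 1" by (rule normalise)
  have "(c * g 0)\<^sup>2 - \<nu> * dirichlet (\<lambda>z. c * g z) \<le> one_top TYPE('d) \<nu>"
    unfolding one_top_def using assms c(3)
    by (intro cSup_upper one_top_bdd) (auto intro!: exI[of _ "\<lambda>z. c * g z"] fin_supp_intros)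
  then have "c\<^sup>2 * ((g 0)\<^sup>2 - \<nu> * dirichlet g) \<le> one_top TYPE('d) \<nu>"
    by (simp add: dirichlet_cmult power_mult_distrib algebra_simps)
  then show ?thesis using pos unfolding c(2) by (simp add: field_simps)
qed

lemma one_top_obtains:
  assumes "\<nu> \<ge> 0" "m < one_top TYPE('d::finite) \<nu>"
  obtains g :: "int ^ 'd \<Rightarrow> real" where "fin_supp g" "ip g g = 1" "m < (g 0)\<^sup>2 - \<nu> * dirichlet g"
  using less_cSupE[OF assms(2)[unfolded one_top_def] one_top_nonempty[OF assms(1)]] by blast

lemma one_top_0: "one_top TYPE('d::finite) 0 = 1"
proof (rule antisym)
  show "one_top TYPE('d) 0 \<le> 1"
    unfolding one_top_def using point_le_ip by (intro cSup_least one_top_nonempty) fastforce+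
  show "1 \<le> one_top TYPE('d) 0"
    using one_top_ge[of 0 "indicator {0} :: int ^ 'd \<Rightarrow> real"] by (simp add: ip_indicator fin_supp_indicator)
qed

text \<open>Fubini along lines in direction \<open>i\<close>, each line being represented by its
  point with i-th coordinate 0.\<close>

lemma infsum_slice:
  fixes F :: "(nat \<Rightarrow> int ^ 'd) \<Rightarrow> real"
  assumes S: "finite S" "\<And>s. s \<in> S \<Longrightarrow> s i = 0" and F: "fin_supp F" "\<And>s. s(i := 0) \<notin> S \<Longrightarrow> F s = 0"
  shows "(\<Sum>\<^sub>\<infinity>s. F s) = (\<Sum>s\<in>S. \<Sum>\<^sub>\<infinity>z. F (s(i := z)))"
proof -
  define Z where "Z = (\<lambda>s. s i) ` {s. F s \<noteq> 0}"
  have Z: "finite Z" using F(1) by (simp add: Z_def)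
  let ?m = "\<lambda>(s, z). s(i := z)"
  have inj: "inj_on ?m (S \<times> Z)"
  proof (rule inj_onI, clarsimp)
    fix s z s' z' assume *: "s \<in> S" "s' \<in> S" "s(i := z) = s'(i := z')"
    have "z = z'" using fun_cong[OF *(3), of i] by simp
    moreover have "s = s'"
    proof
      fix j show "s j = s' j" using fun_cong[OF *(3), of j] S(2)[OF *(1)] S(2)[OF *(2)] by (cases "j = i") auto
    qed
    ultimately show "s = s' \<and> z = z'" by simp
  qed
  have "(\<Sum>\<^sub>\<infinity>s. F s) = sum F (?m ` (S \<times> Z))"
  proof (rule infsum_fin_supp)
    fix s assume *: "s \<notin> ?m ` (S \<times> Z)"
    show "F s = 0"
    proof (rule ccontr)
      assume "F s \<noteq> 0"
      then have "s(i := 0) \<in> S" "s i \<in> Z" using F(2) by (auto simp: Z_def)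
      then have "(s(i := 0), s i) \<in> S \<times> Z" by (rule SigmaI)
      then have "?m (s(i := 0), s i) \<in> ?m ` (S \<times> Z)" by (rule imageI)
      then show False using * by simp
    qed
  qed (use S Z in auto)
  also have "\<dots> = (\<Sum>(s, z)\<in>S \<times> Z. F (s(i := z)))"
    by (subst sum.reindex[OF inj]) (simp add: case_prod_unfold)
  also have "\<dots> = (\<Sum>s\<in>S. \<Sum>z\<in>Z. F (s(i := z)))" by (rule sum.cartesian_product[symmetric])
  also have "\<dots> = (\<Sum>s\<in>S. \<Sum>\<^sub>\<infinity>z. F (s(i := z)))"
  proof (rule sum.cong[OF refl], rule infsum_fin_supp[OF Z, symmetric])
    fix s z assume "z \<notin> Z"
    then show "F (s(i := z)) = 0" by (force simp: Z_def image_iff)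
  qed
  finally show ?thesis .
qed

text \<open>All coordinates but \<open>i\<close> are held fixed. On each such line
  \<open>s k\<close> is constant, and translating by it moves the contact to the origin, where the
  one-particle inequality \<open>Q\<close> applies; then the lines are summed.\<close>

lemma dirichlet_at_transfer:
  fixes f :: "(nat \<Rightarrow> int ^ 'd) \<Rightarrow> real"
  assumes f: "fin_supp f" and ik: "i \<noteq> k"
    and Q: "\<And>g :: int ^ 'd \<Rightarrow> real. fin_supp g \<Longrightarrow> \<alpha> * (g 0)\<^sup>2 \<le> b * ip g g + c * dirichlet g"
  shows "\<alpha> * (\<Sum>\<^sub>\<infinity>s. indicator {s k} (s i) * (f s)\<^sup>2) \<le> b * ip f f + c * dirichlet_at i f"
proof -
  define S where "S = (\<lambda>s. s(i := 0)) ` {s. f s \<noteq> 0}"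
  have S: "finite S" "\<And>s. s \<in> S \<Longrightarrow> s i = 0" using f by (auto simp: S_def)
  have f0: "f s = 0" if "s(i := 0) \<notin> S" for s using that by (auto simp: S_def)
  have f0': "f (shift_at i v s) = 0" if "s(i := 0) \<notin> S" for s v
    using that f0[of "shift_at i v s"] by simp
  let ?g = "\<lambda>s z. f (s(i := z))"
  have g_fin: "fin_supp (?g s)" for s
  proof -
    have "inj (\<lambda>z. s(i := z))" by (rule injI) (metis fun_upd_same)
    then show ?thesis using finite_vimageI[OF f] by (simp add: vimage_def)
  qed
  have 1: "(\<Sum>\<^sub>\<infinity>s. indicator {s k} (s i) * (f s)\<^sup>2) = (\<Sum>s\<in>S. (?g s (s k))\<^sup>2)"
  proof -
    have "(\<Sum>\<^sub>\<infinity>s. indicator {s k} (s i) * (f s)\<^sup>2) = (\<Sum>s\<in>S. \<Sum>\<^sub>\<infinity>z. indicator {(s(i := z)) k} ((s(i := z)) i) * (f (s(i := z)))\<^sup>2)"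
      by (rule infsum_slice[OF S]) (auto intro: fin_supp_intros f simp: f0)
    also have "\<dots> = (\<Sum>s\<in>S. (?g s (s k))\<^sup>2)"
    proof (rule sum.cong[OF refl])
      fix s
      show "(\<Sum>\<^sub>\<infinity>z. indicator {(s(i := z)) k} ((s(i := z)) i) * (f (s(i := z)))\<^sup>2) = (?g s (s k))\<^sup>2"
        using ik by (subst infsum_fin_supp[of "{s k}"]) auto
    qed
    finally show ?thesis .
  qed
  have 2: "ip f f = (\<Sum>s\<in>S. ip (?g s) (?g s))"
    unfolding ip_self by (rule infsum_slice[OF S]) (auto intro: fin_supp_intros f simp: f0)
  have 3: "dirichlet_at i f = (\<Sum>s\<in>S. dirichlet (?g s))"
  proof -
    have "(\<Sum>\<^sub>\<infinity>s. (f (shift_at i v s) - f s)\<^sup>2) = (\<Sum>s\<in>S. \<Sum>\<^sub>\<infinity>z. (?g s (z + v) - ?g s z)\<^sup>2)" for v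
    proof -
      have "fin_supp (\<lambda>s. (f (shift_at i v s) - f s)\<^sup>2)"
        using fin_supp_intros(5)[OF fin_supp_intros(2)[OF fin_supp_shift[OF f] f]] .
      from infsum_slice[OF S this] have "(\<Sum>\<^sub>\<infinity>s. (f (shift_at i v s) - f s)\<^sup>2) =
          (\<Sum>s\<in>S. \<Sum>\<^sub>\<infinity>z. (f (shift_at i v (s(i := z))) - f (s(i := z)))\<^sup>2)"
        by (simp add: f0 f0')
      then show ?thesis by simp
    qed
    then show ?thesis
      unfolding dirichlet_at_def dirichlet_def by (simp only: sum_divide_distrib[symmetric] sum.swap[of _ S])
  qed
  have "\<alpha> * (?g s (s k))\<^sup>2 \<le> b * ip (?g s) (?g s) + c * dirichlet (?g s)" for s
    using Q[OF fin_supp_translate[OF g_fin[of s], of "s k"]]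
      ip_translate[of "?g s" "s k" "?g s"] dirichlet_translate[of "?g s" "s k"] by simp
  then have "(\<Sum>s\<in>S. \<alpha> * (?g s (s k))\<^sup>2) \<le> (\<Sum>s\<in>S. b * ip (?g s) (?g s) + c * dirichlet (?g s))"
    by (intro sum_mono)
  then show ?thesis unfolding 1 2 3 by (simp add: sum.distrib sum_distrib_left)
qed

section \<open>Normalised product functions\<close>

definition agrees_off :: "nat set \<Rightarrow> (nat \<Rightarrow> 'a) \<Rightarrow> (nat \<Rightarrow> 'a) \<Rightarrow> bool" where
  "agrees_off I b s \<longleftrightarrow> (\<forall>i. i \<notin> I \<longrightarrow> s i = b i)"

text \<open>A tensor product; the coordinates outside \<open>I\<close> are tied to \<open>b\<close>
  to keep the support finite.\<close>

definition prod_fun :: "nat set \<Rightarrow> (nat \<Rightarrow> int ^ 'd) \<Rightarrow> (nat \<Rightarrow> int ^ 'd \<Rightarrow> real) \<Rightarrow> (nat \<Rightarrow> int ^ 'd) \<Rightarrow> real" where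
  "prod_fun I b g s = (if agrees_off I b s then \<Prod>i\<in>I. g i (s i) else 0)"

lemma infsum_prod_fun:
  assumes I: "finite I" and g: "\<And>i. i \<in> I \<Longrightarrow> fin_supp (g i)"
  shows fin_supp_prod_fun: "fin_supp (prod_fun I b g)"
    and "(\<Sum>\<^sub>\<infinity>s. prod_fun I b g s) = (\<Prod>i\<in>I. \<Sum>\<^sub>\<infinity>z. g i z)"
proof -
  define A where "A i = {z. g i z \<noteq> 0}" for i
  let ?e = "\<lambda>y i. if i \<in> I then y i else b i"
  have fin: "finite (?e ` PiE I A)" using g I by (intro finite_imageI finite_PiE) (auto simp: A_def)
  have out: "prod_fun I b g s = 0" if "s \<notin> ?e ` PiE I A" for s
  proof (rule ccontr)
    assume *: "prod_fun I b g s \<noteq> 0"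
    then have "\<forall>i. i \<notin> I \<longrightarrow> s i = b i" "\<forall>i\<in>I. g i (s i) \<noteq> 0"
      using I by (auto simp: prod_fun_def agrees_off_def split: if_splits)
    then have "s = ?e (restrict s I)" "restrict s I \<in> PiE I A" by (auto simp: A_def)
    then show False using that by blast
  qed
  show "fin_supp (prod_fun I b g)" by (rule finite_subset[OF _ fin]) (use out in blast)
  have inj: "inj_on ?e (PiE I A)"
  proof (rule inj_onI)
    fix y y' assume *: "y \<in> PiE I A" "y' \<in> PiE I A" "?e y = ?e y'"
    show "y = y'"
    proof (rule PiE_ext[OF *(1,2)])
      fix i assume "i \<in> I"
      then show "y i = y' i" using fun_cong[OF *(3), of i] by simp
    qed
  qed
  have "(\<Sum>\<^sub>\<infinity>s. prod_fun I b g s) = (\<Sum>s\<in>?e ` PiE I A. prod_fun I b g s)"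
    by (rule infsum_fin_supp[OF fin out])
  also have "\<dots> = (\<Sum>y\<in>PiE I A. \<Prod>i\<in>I. g i (y i))"
    by (subst sum.reindex[OF inj]) (simp add: prod_fun_def agrees_off_def)
  also have "\<dots> = (\<Prod>i\<in>I. \<Sum>z\<in>A i. g i z)"
    using I g by (intro prod_sum_PiE[symmetric]) (auto simp: A_def)
  also have "\<dots> = (\<Prod>i\<in>I. \<Sum>\<^sub>\<infinity>z. g i z)"
    using g by (intro prod.cong refl infsum_fin_supp[symmetric]) (auto simp: A_def)
  finally show "(\<Sum>\<^sub>\<infinity>s. prod_fun I b g s) = (\<Prod>i\<in>I. \<Sum>\<^sub>\<infinity>z. g i z)" .
qed

context
  fixes I :: "nat set" and b :: "nat \<Rightarrow> int ^ 'd" and g :: "nat \<Rightarrow> int ^ 'd \<Rightarrow> real"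
  assumes I: "finite I" and g: "\<And>i. i \<in> I \<Longrightarrow> fin_supp (g i)" and g1: "\<And>i. i \<in> I \<Longrightarrow> ip (g i) (g i) = 1"
begin

text \<open>All factors except the one at \<open>a\<close> are squares of normalised functions and
  contribute 1.\<close>

lemma infsum_prod_fun_one:
  assumes a: "a \<in> I" and w: "fin_supp w"
  shows "(\<Sum>\<^sub>\<infinity>s. prod_fun I b (\<lambda>j z. if j = a then w z else (g j z)\<^sup>2) s) = (\<Sum>\<^sub>\<infinity>z. w z)"
proof -
  have "(\<Sum>\<^sub>\<infinity>s. prod_fun I b (\<lambda>j z. if j = a then w z else (g j z)\<^sup>2) s) =
      (\<Prod>j\<in>I. \<Sum>\<^sub>\<infinity>z. if j = a then w z else (g j z)\<^sup>2)"
  proof (rule infsum_prod_fun(2)[OF I])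
    fix j assume "j \<in> I"
    then show "fin_supp (\<lambda>z. if j = a then w z else (g j z)\<^sup>2)"
      using w fin_supp_intros(5)[OF g] by (cases "j = a") auto
  qed
  also have "\<dots> = (\<Sum>\<^sub>\<infinity>z. w z) * (\<Prod>j\<in>I - {a}. \<Sum>\<^sub>\<infinity>z. if j = a then w z else (g j z)\<^sup>2)"
    by (subst prod.remove[OF I a]) simp
  also have "(\<Prod>j\<in>I - {a}. \<Sum>\<^sub>\<infinity>z. if j = a then w z else (g j z)\<^sup>2) = (\<Prod>j\<in>I - {a}. 1)"
    using g1 by (intro prod.cong refl) (auto simp: ip_self)
  finally show ?thesis by simp
qed

lemma prod_fun_remove:
  "a \<in> I \<Longrightarrow> prod_fun I b g s = (if agrees_off I b s then g a (s a) * (\<Prod>j\<in>I - {a}. g j (s j)) else 0)"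
  by (simp add: prod_fun_def prod.remove[OF I])

lemma weighted_prod_fun:
  assumes a: "a \<in> I"
  shows "(if agrees_off I b s then w (s a) * (\<Prod>j\<in>I - {a}. g j (s j))\<^sup>2 else 0) =
    prod_fun I b (\<lambda>j z. if j = a then w z else (g j z)\<^sup>2) s"
proof -
  have "(\<Prod>j\<in>I. if j = a then w (s j) else (g j (s j))\<^sup>2) = w (s a) * (\<Prod>j\<in>I - {a}. (g j (s j))\<^sup>2)"
    by (subst prod.remove[OF I a]) (auto intro!: prod.cong)
  then show ?thesis by (simp add: prod_fun_def prod_power_distrib)
qed

lemma ip_prod_fun: "ip (prod_fun I b g) (prod_fun I b g) = 1"
proof -
  have "(prod_fun I b g s)\<^sup>2 = prod_fun I b (\<lambda>j z. (g j z)\<^sup>2) s" for s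
    by (simp add: prod_fun_def prod_power_distrib)
  then have "ip (prod_fun I b g) (prod_fun I b g) = (\<Prod>i\<in>I. \<Sum>\<^sub>\<infinity>z. (g i z)\<^sup>2)"
    unfolding ip_self by (simp only:, intro infsum_prod_fun(2) I fin_supp_intros g)
  also have "\<dots> = (\<Prod>i\<in>I. 1)" using g1 by (intro prod.cong refl) (simp add: ip_self)
  finally show ?thesis by simp
qed

lemma dirichlet_at_prod_fun:
  assumes a: "a \<in> I"
  shows "dirichlet_at a (prod_fun I b g) = dirichlet (g a)"
proof -
  have "(\<Sum>\<^sub>\<infinity>s. (prod_fun I b g (shift_at a v s) - prod_fun I b g s)\<^sup>2) = (\<Sum>\<^sub>\<infinity>z. (g a (z + v) - g a z)\<^sup>2)" for v
  proof -
    have "(prod_fun I b g (shift_at a v s) - prod_fun I b g s)\<^sup>2 =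
        prod_fun I b (\<lambda>j z. if j = a then (g a (z + v) - g a z)\<^sup>2 else (g j z)\<^sup>2) s" for s
    proof -
      have c: "agrees_off I b (shift_at a v s) \<longleftrightarrow> agrees_off I b s" using a by (auto simp: agrees_off_def)
      have "(\<Prod>j\<in>I - {a}. g j ((shift_at a v s) j)) = (\<Prod>j\<in>I - {a}. g j (s j))" by (intro prod.cong) auto
      then show ?thesis
        unfolding prod_fun_remove[OF a] weighted_prod_fun[OF a, symmetric] c
        by (simp add: left_diff_distrib[symmetric] power_mult_distrib)
    qed
    then show ?thesis
      using infsum_prod_fun_one[OF a, of "\<lambda>z. (g a (z + v) - g a z)\<^sup>2"]
        fin_supp_intros(5)[OF fin_supp_intros(2)[OF fin_supp_translate[OF g[OF a]] g[OF a]]] by simp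
  qed
  then show ?thesis by (simp add: dirichlet_at_def dirichlet_def)
qed

lemma infsum_indicator_prod_fun:
  assumes a: "a \<in> I"
  shows "(\<Sum>\<^sub>\<infinity>s. indicator {w} (s a) * (prod_fun I b g s)\<^sup>2) = (g a w)\<^sup>2"
proof -
  have "indicator {w} (s a) * (prod_fun I b g s)\<^sup>2 = prod_fun I b (\<lambda>j z. if j = a then indicator {w} z * (g a z)\<^sup>2 else (g j z)\<^sup>2) s" for s
    unfolding weighted_prod_fun[OF a, symmetric] prod_fun_remove[OF a] by (simp add: power_mult_distrib)
  then have "(\<Sum>\<^sub>\<infinity>s. indicator {w} (s a) * (prod_fun I b g s)\<^sup>2) = (\<Sum>\<^sub>\<infinity>z. indicator {w} z * (g a z)\<^sup>2)"
    using infsum_prod_fun_one[OF a, of "\<lambda>z. indicator {w} z * (g a z)\<^sup>2"] fin_supp_intros(4)[OF fin_supp_intros(5)[OF g[OF a]]] by simp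
  also have "\<dots> = (g a w)\<^sup>2" by (subst infsum_fin_supp[of "{w}"]) auto
  finally show ?thesis .
qed

end

section \<open>Upper and lower bounds for the growth rate\<close>

context catalysts
begin

lemma energy_eq:
  assumes f: "fin_supp f"
  shows "energy f = (\<Sum>j\<in>J. \<Sum>k\<in>K. \<Sum>\<^sub>\<infinity>s. indicator {s k} (s j) * (f s)\<^sup>2)
    - \<kappa> * (\<Sum>j\<in>J. dirichlet_at j f) - \<rho> * (\<Sum>k\<in>K. dirichlet_at k f)"
proof -
  have "ip f (\<lambda>s. pot s * f s) = (\<Sum>\<^sub>\<infinity>s. \<Sum>j\<in>J. \<Sum>k\<in>K. indicator {s k} (s j) * (f s)\<^sup>2)"
    unfolding ip_def pot_def
    by (intro infsum_cong) (simp add: sum_distrib_left sum_distrib_right power2_eq_square mult_ac)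
  also have "\<dots> = (\<Sum>j\<in>J. \<Sum>k\<in>K. \<Sum>\<^sub>\<infinity>s. indicator {s k} (s j) * (f s)\<^sup>2)"
  proof -
    have fs: "fin_supp (\<lambda>s. indicator {s k} (s j) * (f s)\<^sup>2)" for j k by (intro fin_supp_intros f)
    have "(\<Sum>\<^sub>\<infinity>s. \<Sum>j\<in>J. \<Sum>k\<in>K. indicator {s k} (s j) * (f s)\<^sup>2) = (\<Sum>j\<in>J. \<Sum>\<^sub>\<infinity>s. \<Sum>k\<in>K. indicator {s k} (s j) * (f s)\<^sup>2)"
      by (intro infsum_sum_fin fin_supp_sum finite_KJ fs)
    also have "\<dots> = (\<Sum>j\<in>J. \<Sum>k\<in>K. \<Sum>\<^sub>\<infinity>s. indicator {s k} (s j) * (f s)\<^sup>2)"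
      by (intro sum.cong refl infsum_sum_fin finite_KJ fs)
    finally show ?thesis .
  qed
  finally have 1: "ip f (\<lambda>s. pot s * f s) = (\<Sum>j\<in>J. \<Sum>k\<in>K. \<Sum>\<^sub>\<infinity>s. indicator {s k} (s j) * (f s)\<^sup>2)" .
  have "(\<Sum>i\<in>K \<union> J. rates i * dirichlet_at i f) = (\<Sum>i\<in>K. rates i * dirichlet_at i f) + (\<Sum>i\<in>J. rates i * dirichlet_at i f)"
    by (intro sum.union_disjoint finite_KJ KJ_disjoint)
  moreover have "(\<Sum>i\<in>K. rates i * dirichlet_at i f) = \<rho> * (\<Sum>k\<in>K. dirichlet_at k f)"
    unfolding sum_distrib_left by (intro sum.cong) (auto simp: rates_def)
  moreover have "(\<Sum>i\<in>J. rates i * dirichlet_at i f) = \<kappa> * (\<Sum>j\<in>J. dirichlet_at j f)"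
    unfolding sum_distrib_left using KJ_disjoint by (intro sum.cong) (auto simp: rates_def)
  ultimately show ?thesis unfolding energy_def 1 by simp
qed

lemma card_KJ: "card K = n" "card J = p" by (auto simp: K_def J_def)

lemma indicator_swap: "(\<Sum>\<^sub>\<infinity>s. indicator {s k} (s j) * (f s)\<^sup>2) = (\<Sum>\<^sub>\<infinity>s. indicator {s j} (s k) * (f s)\<^sup>2 :: real)"
  for f :: "(nat \<Rightarrow> int ^ 'd) \<Rightarrow> real"
  by (intro infsum_cong) (auto simp: indicator_def)

lemma energy_le_one_top:
  assumes f: "fin_supp f" and p: "p \<ge> 1"
  shows "energy f \<le> real n * real p * one_top TYPE('d) (\<rho> / p) * ip f f"
proof -
  let ?m = "one_top TYPE('d) (\<rho> / p)"
  have Q: "real p * (g 0)\<^sup>2 \<le> (p * ?m) * ip g g + \<rho> * dirichlet g" if "fin_supp g" for g :: "int ^ 'd \<Rightarrow> real"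
  proof -
    have "(g 0)\<^sup>2 - \<rho> / p * dirichlet g \<le> ?m * ip g g" using rates_nonneg that by (intro one_top_ge) auto
    then have "real p * ((g 0)\<^sup>2 - \<rho> / p * dirichlet g) \<le> real p * (?m * ip g g)" by (intro mult_left_mono) auto
    then show ?thesis using p by (simp add: right_diff_distrib mult_ac)
  qed
  \<comment> \<open>The catalyst is the moving particle and the replica the fixed site. Multiplying
    by p lets each of the p replicas charge the full \<rho> D_k; the factor is divided out after
    summation.\<close>
  have jk: "real p * (\<Sum>\<^sub>\<infinity>s. indicator {s k} (s j) * (f s)\<^sup>2) \<le> (p * ?m) * ip f f + \<rho> * dirichlet_at k f" if "j \<in> J" "k \<in> K" for j k
    unfolding indicator_swap[of k j] using that KJ_disjoint by (intro dirichlet_at_transfer f Q) auto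
  have "real p * (\<Sum>k\<in>K. \<Sum>j\<in>J. \<Sum>\<^sub>\<infinity>s. indicator {s k} (s j) * (f s)\<^sup>2) \<le> (\<Sum>k\<in>K. \<Sum>j\<in>J. (p * ?m) * ip f f + \<rho> * dirichlet_at k f)"
    unfolding sum_distrib_left by (intro sum_mono jk)
  also have "\<dots> = real p * (\<Sum>k\<in>K. (p * ?m) * ip f f + \<rho> * dirichlet_at k f)"
    by (simp add: card_KJ sum_distrib_left)
  finally have "(\<Sum>k\<in>K. \<Sum>j\<in>J. \<Sum>\<^sub>\<infinity>s. indicator {s k} (s j) * (f s)\<^sup>2) \<le> (\<Sum>k\<in>K. (p * ?m) * ip f f + \<rho> * dirichlet_at k f)"
    using p by simp
  moreover have "(\<Sum>k\<in>K. \<Sum>j\<in>J. \<Sum>\<^sub>\<infinity>s. indicator {s k} (s j) * (f s)\<^sup>2) = (\<Sum>j\<in>J. \<Sum>k\<in>K. \<Sum>\<^sub>\<infinity>s. indicator {s k} (s j) * (f s)\<^sup>2)"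
    by (rule sum.swap)
  moreover have "0 \<le> \<kappa> * (\<Sum>j\<in>J. dirichlet_at j f)"
    by (intro mult_nonneg_nonneg sum_nonneg dirichlet_at_nonneg rates_nonneg)
  ultimately show ?thesis
    unfolding energy_eq[OF f] by (simp add: sum.distrib sum_distrib_left[symmetric] card_KJ mult_ac)
qed

lemma top_le_one_top: "p \<ge> 1 \<Longrightarrow> top \<le> real n * real p * one_top TYPE('d) (\<rho> / p)"
  by (intro top_le energy_le_one_top tests_fin_supp)

text \<open>Here the replica moves. It meets n catalysts and pays \<open>c\<close> times its
  Dirichlet form for each, which \<kappa> has to cover.\<close>

lemma energy_le_moving:
  assumes f: "fin_supp f"
    and Q: "\<And>g :: int ^ 'd \<Rightarrow> real. fin_supp g \<Longrightarrow> (g 0)\<^sup>2 \<le> b * ip g g + c * dirichlet g" and c: "real n * c \<le> \<kappa>"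
  shows "energy f \<le> real n * real p * b * ip f f"
proof -
  have jk: "(\<Sum>\<^sub>\<infinity>s. indicator {s k} (s j) * (f s)\<^sup>2) \<le> b * ip f f + c * dirichlet_at j f" if "j \<in> J" "k \<in> K" for j k
    using dirichlet_at_transfer[OF f, of j k 1 b c] Q that KJ_disjoint by auto
  have "(\<Sum>j\<in>J. \<Sum>k\<in>K. \<Sum>\<^sub>\<infinity>s. indicator {s k} (s j) * (f s)\<^sup>2) \<le> (\<Sum>j\<in>J. \<Sum>k\<in>K. b * ip f f + c * dirichlet_at j f)"
    by (intro sum_mono jk)
  also have "\<dots> = real n * real p * b * ip f f + real n * c * (\<Sum>j\<in>J. dirichlet_at j f)"
    by (simp add: card_KJ sum.distrib sum_distrib_left algebra_simps)
  also have "\<dots> \<le> real n * real p * b * ip f f + \<kappa> * (\<Sum>j\<in>J. dirichlet_at j f)"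
    by (intro add_left_mono mult_right_mono c sum_nonneg dirichlet_at_nonneg)
  finally have "(\<Sum>j\<in>J. \<Sum>k\<in>K. \<Sum>\<^sub>\<infinity>s. indicator {s k} (s j) * (f s)\<^sup>2)
    \<le> real n * real p * b * ip f f + \<kappa> * (\<Sum>j\<in>J. dirichlet_at j f)" .
  moreover have "0 \<le> \<rho> * (\<Sum>k\<in>K. dirichlet_at k f)"
    by (intro mult_nonneg_nonneg sum_nonneg dirichlet_at_nonneg rates_nonneg)
  ultimately show ?thesis unfolding energy_eq[OF f] by linarith
qed

text \<open>The ray estimate is valid in every dimension; with L of order \<kappa> / n it yields
  decay of order 1 / \<kappa>.\<close>

lemma top_le_large:
  assumes "L > 0" "4 * real L * real n \<le> \<kappa>"
  shows "top \<le> real n * real p * (2 / real L)"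
proof (rule top_le)
  fix f assume "f \<in> tests"
  then show "energy f \<le> real n * real p * (2 / real L) * ip f f"
    using assms by (intro energy_le_moving[where c = "4 * real L"] point_le_dirichlet tests_fin_supp) (auto simp: mult_ac)
qed

lemma top_le_transient:
  assumes G: "\<And>m. (\<Sum>k\<le>m. walk_count k (0 :: int ^ 'd) 0 / deg TYPE('d) ^ Suc k) \<le> G" and \<kappa>: "real n * G \<le> \<kappa>"
  shows "top \<le> 0"
proof (rule top_le)
  fix f assume "f \<in> tests"
  then show "energy f \<le> 0 * ip f f"
    using energy_le_moving[of f 0 G] point_le_green[OF _ G] \<kappa> by (simp add: tests_fin_supp)
qed

text \<open>Trial function: all replicas sit at one site \<open>c\<close>, at a cost of at most deg
  per Dirichlet form, and every catalyst has a near-optimal one-particle profile around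
  \<open>c\<close>. The correction is linear in \<kappa>, which serves both for the value at
  \<kappa> = 0 and for continuity there. If nothing moves, contact is possible only for x =
  0.\<close>

lemma top_ge_one_top:
  assumes p: "p \<ge> 1" and frozen: "\<kappa> = 0 \<and> \<rho> = 0 \<longrightarrow> x = 0"
  shows "real n * real p * one_top TYPE('d) (\<rho> / p) - \<kappa> * real p * deg TYPE('d) \<le> top"
proof (rule field_le_epsilon)
  fix e :: real assume e: "e > 0"
  let ?m = "one_top TYPE('d) (\<rho> / p)"
  \<comment> \<open>Each of the n p contacts may lose \<delta>.\<close>
  define \<delta> where "\<delta> = e / (real n * real p + 1)"
  have \<delta>: "\<delta> > 0" "real n * real p * \<delta> \<le> e"
  proof -
    have q: "0 \<le> real n * real p" by simp
    have "0 < real n * real p + 1" using q by linarith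
    then show "\<delta> > 0" using e unfolding \<delta>_def by (rule divide_pos_pos[rotated])
    have "real n * real p * \<delta> = e * (real n * real p / (real n * real p + 1))" by (simp add: \<delta>_def)
    also have "\<dots> \<le> e * 1" proof (rule mult_left_mono)
      show "real n * real p / (real n * real p + 1) \<le> 1" using q by (subst divide_le_eq_1_pos) linarith+
    qed (use e in simp)
    finally show "real n * real p * \<delta> \<le> e" by simp
  qed
  \<comment> \<open>For \<rho> = 0 the catalysts cannot leave the origin, so the profile must be a
    point mass for the trial function to lie in \<open>tests\<close>.\<close>
  have "\<exists>g :: int ^ 'd \<Rightarrow> real. fin_supp g \<and> ip g g = 1 \<and> ?m - \<delta> < (g 0)\<^sup>2 - \<rho> / p * dirichlet g \<and> (\<rho> = 0 \<longrightarrow> g = indicator {0})"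
  proof (cases "\<rho> = 0")
    case True
    then show ?thesis using \<delta> by (intro exI[of _ "indicator {0}"]) (simp add: one_top_0 ip_indicator fin_supp_indicator)
  next
    case False
    obtain g :: "int ^ 'd \<Rightarrow> real" where "fin_supp g" "ip g g = 1" "?m - \<delta> < (g 0)\<^sup>2 - \<rho> / p * dirichlet g"
    proof (rule one_top_obtains)
      show "0 \<le> \<rho> / p" using rates_nonneg by simp
      show "?m - \<delta> < ?m" using \<delta> by simp
    qed
    then show ?thesis using False by blast
  qed
  then obtain g :: "int ^ 'd \<Rightarrow> real" where g: "fin_supp g" "ip g g = 1" "?m - \<delta> < (g 0)\<^sup>2 - \<rho> / p * dirichlet g"
    "\<rho> = 0 \<Longrightarrow> g = indicator {0}" by blast
  \<comment> \<open>A frozen species dictates the meeting point: the origin for the catalysts,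
    \<open>x\<close> for the replicas.\<close>
  define c where "c = (if \<rho> = 0 then 0 else x)"
  define G where "G i = (if i \<in> K then (\<lambda>z. g (z + - c)) else indicator {c})" for i
  have G: "fin_supp (G i)" "ip (G i) (G i) = 1" for i
    using g fin_supp_translate[OF g(1), of "- c"] ip_translate[of g "- c" g]
    by (auto simp: G_def fin_supp_indicator ip_indicator)
  define f where "f = prod_fun (K \<union> J) start G"
  have fin: "finite (K \<union> J)" using finite_KJ by simp
  have f_fin: "fin_supp f" unfolding f_def by (intro fin_supp_prod_fun fin G)
  have ip1: "ip f f = 1" unfolding f_def by (intro ip_prod_fun fin G)
  have dir: "dirichlet_at i f = dirichlet (G i)" if "i \<in> K \<union> J" for i
    unfolding f_def by (intro dirichlet_at_prod_fun fin G that)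
  have fJ: "s j = c" if "f s \<noteq> 0" "j \<in> J" for s j
  proof -
    have "(\<Prod>i\<in>K \<union> J. G i (s i)) \<noteq> 0" using that(1) by (auto simp: f_def prod_fun_def split: if_splits)
    then have "G j (s j) \<noteq> 0" using that(2) fin by auto
    then show ?thesis using that(2) KJ_disjoint by (auto simp: G_def indicator_def split: if_splits)
  qed
  have "f \<in> tests"
  proof -
    have "s \<in> reach" if s: "f s \<noteq> 0" for s
      unfolding reach_def
    proof (rule CollectI, intro allI impI)
      fix i assume i: "rates i = 0 \<or> i \<notin> K \<union> J"
      have off: "\<And>i. i \<notin> K \<union> J \<Longrightarrow> s i = start i" and nz: "(\<Prod>i\<in>K \<union> J. G i (s i)) \<noteq> 0"
        using s by (auto simp: f_def prod_fun_def agrees_off_def split: if_splits)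
      show "s i = start i"
      proof (cases "i \<in> K \<union> J")
        case True
        then have r: "rates i = 0" using i by blast
        show ?thesis
        proof (cases "i \<in> K")
          case True
          then have "\<rho> = 0" using r by (simp add: rates_def)
          moreover have "G i (s i) \<noteq> 0" using nz True fin by auto
          ultimately show ?thesis using True g(4) KJ_disjoint
            by (auto simp: G_def c_def start_def indicator_def split: if_splits)
        next
          case False
          then have iJ: "i \<in> J" using True by blast
          then have "\<kappa> = 0" using r False by (simp add: rates_def)
          then have "c = x" using frozen by (auto simp: c_def)
          then show ?thesis using fJ[OF s iJ] iJ by (simp add: start_def)
        qed
      qed (use off in blast)
    qed
    then show ?thesis using f_fin by (auto simp: tests_def)
  qed
  then have "energy f \<le> top" using energy_le_top[of f] ip1 by simp
  moreover have "energy f \<ge> real n * real p * ((g 0)\<^sup>2 - \<rho> / p * dirichlet g) - \<kappa> * real p * deg TYPE('d)"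
  proof -
    have "(\<Sum>\<^sub>\<infinity>s. indicator {s k} (s j) * (f s)\<^sup>2) = (g 0)\<^sup>2" if "j \<in> J" "k \<in> K" for j k
    proof -
      have "(\<Sum>\<^sub>\<infinity>s. indicator {s k} (s j) * (f s)\<^sup>2) = (\<Sum>\<^sub>\<infinity>s. indicator {c} (s k) * (f s)\<^sup>2)"
      proof (rule infsum_cong)
        fix s show "indicator {s k} (s j) * (f s)\<^sup>2 = indicator {c} (s k) * (f s)\<^sup>2"
          using fJ[of s j] that by (cases "f s = 0") (auto simp: indicator_def)
      qed
      also have "\<dots> = (G k c)\<^sup>2" unfolding f_def using that by (intro infsum_indicator_prod_fun fin G) auto
      finally show ?thesis using that by (simp add: G_def)
    qed
    then have 1: "(\<Sum>j\<in>J. \<Sum>k\<in>K. \<Sum>\<^sub>\<infinity>s. indicator {s k} (s j) * (f s)\<^sup>2) = real p * (real n * (g 0)\<^sup>2)"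
      by (simp add: card_KJ)
    have "(\<Sum>k\<in>K. dirichlet_at k f) = (\<Sum>k\<in>K. dirichlet g)"
      using dirichlet_translate[of g "- c"] by (intro sum.cong refl) (simp add: dir G_def)
    then have 2: "\<rho> * (\<Sum>k\<in>K. dirichlet_at k f) = \<rho> * (real n * dirichlet g)" by (simp add: card_KJ)
    have "(\<Sum>j\<in>J. dirichlet_at j f) \<le> (\<Sum>j\<in>J. deg TYPE('d))"
    proof (rule sum_mono)
      fix j assume j: "j \<in> J"
      have "dirichlet (G j) \<le> deg TYPE('d) * ip (G j) (G j)"
        using j KJ_disjoint G(1) by (intro dirichlet_le_deg) (auto simp: G_def)
      then show "dirichlet_at j f \<le> deg TYPE('d)" using j by (simp add: dir G)
    qed
    then have 3: "\<kappa> * (\<Sum>j\<in>J. dirichlet_at j f) \<le> \<kappa> * (real p * deg TYPE('d))"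
      using rates_nonneg by (intro mult_left_mono) (auto simp: card_KJ)
    have "real n * real p * ((g 0)\<^sup>2 - \<rho> / p * dirichlet g) = real p * (real n * (g 0)\<^sup>2) - \<rho> * (real n * dirichlet g)"
      using p by (simp add: algebra_simps)
    then show ?thesis unfolding energy_eq[OF f_fin] 1 2 using 3 by (simp add: mult.assoc)
  qed
  moreover have "real n * real p * ((g 0)\<^sup>2 - \<rho> / p * dirichlet g) \<ge> real n * real p * (?m - \<delta>)"
    using g(3) by (intro mult_left_mono) auto
  ultimately show "real n * real p * ?m - \<kappa> * real p * deg TYPE('d) \<le> top + e"
    using \<delta>(2) by (simp add: right_diff_distrib)
qed

text \<open>The first reactant is bound to the first catalyst by the recurrent profile \<open>\<phi>\<close> in the relative
  coordinate \<open>s j - s k\<close>; all other coordinates are spread out.\<close>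

lemma top_pos:
  assumes d: "CARD('d) \<le> 2" and n: "n \<ge> 1" and p: "p \<ge> 1" and \<kappa>: "\<kappa> > 0"
  shows "top > 0"
proof -
  \<comment> \<open>In the relative coordinate the hops of the replica cost \<kappa>, those of the
    catalyst at most 2 \<rho>: they also move its own profile, and the two effects are separated by
    (a + b)^2 \<le> 2 a^2 + 2 b^2.\<close>
  obtain \<phi>' :: "int ^ 'd \<Rightarrow> real" where \<phi>': "fin_supp \<phi>'" "(\<kappa> + 2 * \<rho>) * dirichlet \<phi>' < (\<phi>' 0)\<^sup>2"
    using exists_recurrent[OF d] by blast
  have "0 < (\<phi>' 0)\<^sup>2"
    using \<phi>'(2) mult_nonneg_nonneg[OF _ dirichlet_nonneg[of \<phi>'], of "\<kappa> + 2 * \<rho>"] rates_nonneg by linarith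
  then have "0 < ip \<phi>' \<phi>'" using point_le_ip[OF \<phi>'(1), of 0] by linarith
  then obtain c where c: "c > 0" "ip (\<lambda>z. c * \<phi>' z) (\<lambda>z. c * \<phi>' z) = 1" by (rule normalise)
  define \<phi> where "\<phi> z = c * \<phi>' z" for z
  have \<phi>: "fin_supp \<phi>" "ip \<phi> \<phi> = 1" "(\<kappa> + 2 * \<rho>) * dirichlet \<phi> < (\<phi> 0)\<^sup>2"
  proof -
    show "fin_supp \<phi>" unfolding \<phi>_def by (intro fin_supp_intros \<phi>')
    show "ip \<phi> \<phi> = 1" unfolding \<phi>_def by (rule c(2))
    have "c\<^sup>2 * ((\<kappa> + 2 * \<rho>) * dirichlet \<phi>') < c\<^sup>2 * (\<phi>' 0)\<^sup>2" using c \<phi>'(2) by (intro mult_strict_left_mono) auto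
    then show "(\<kappa> + 2 * \<rho>) * dirichlet \<phi> < (\<phi> 0)\<^sup>2"
      unfolding \<phi>_def dirichlet_cmult by (simp add: power_mult_distrib mult_ac)
  qed
  define \<delta> where "\<delta> = (\<phi> 0)\<^sup>2 - (\<kappa> + 2 * \<rho>) * dirichlet \<phi>"
  \<comment> \<open>The total coefficient of \<epsilon> in the loss, all spread-out profiles having
    Dirichlet form at most \<epsilon>.\<close>
  define w where "w = \<kappa> * p + \<rho> * n + 2 * \<rho>"
  have \<delta>: "\<delta> > 0" using \<phi>(3) by (simp add: \<delta>_def)
  have w: "w \<ge> 0" unfolding w_def using rates_nonneg by (intro add_nonneg_nonneg mult_nonneg_nonneg) auto
  define \<epsilon> where "\<epsilon> = \<delta> / (w + 1)"
  have \<epsilon>: "\<epsilon> > 0" "w * \<epsilon> < \<delta>" using \<delta> w by (auto simp: \<epsilon>_def field_simps)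
  obtain g :: "int ^ 'd \<Rightarrow> real" where g: "fin_supp g" "ip g g = 1" "dirichlet g \<le> \<epsilon>"
    using exists_small_dirichlet[OF \<epsilon>(1)] by blast
  define j1 k1 where "j1 = n + 1" and "k1 = (1 :: nat)"
  have jk: "j1 \<in> J" "k1 \<in> K" "j1 \<notin> K" "k1 \<notin> J" "j1 \<noteq> k1" using n p by (auto simp: j1_def k1_def K_def J_def)
  define G where "G i = (if i = j1 then \<phi> else if i \<in> K \<and> \<rho> = 0 then indicator {0} else g)" for i
  have G: "fin_supp (G i)" "ip (G i) (G i) = 1" for i
    using \<phi> g by (auto simp: G_def fin_supp_indicator ip_indicator)
  define F where "F = prod_fun (K \<union> J) start G"
  have fin: "finite (K \<union> J)" using finite_KJ by simp
  have F_fin: "fin_supp F" unfolding F_def by (intro fin_supp_prod_fun fin G)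
  have F_dir: "dirichlet_at i F = dirichlet (G i)" if "i \<in> K \<union> J" for i
    unfolding F_def by (intro dirichlet_at_prod_fun fin G that)
  \<comment> \<open>Passes to the position of the first replica relative to the first
    catalyst.\<close>
  define sh where "sh s = s(j1 := s j1 - s k1)" for s :: "nat \<Rightarrow> int ^ 'd"
  have sh: "bij sh"
    by (rule bij_betw_byWitness[of _ "\<lambda>s. s(j1 := s j1 + s k1)"]) (use jk in \<open>auto simp: sh_def\<close>)
  define f where "f s = F (sh s)" for s
  have f_fin: "fin_supp f" unfolding f_def by (rule fin_supp_bij[OF sh F_fin])
  have ip1: "ip f f = 1"
  proof -
    have "ip f f = ip F F" unfolding ip_def f_def by (rule infsum_bij[OF sh])
    also have "\<dots> = 1" unfolding F_def by (intro ip_prod_fun fin G)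
    finally show ?thesis .
  qed
  have contact: "(\<Sum>\<^sub>\<infinity>s. indicator {s k1} (s j1) * (f s)\<^sup>2) = (\<phi> 0)\<^sup>2"
  proof -
    have "indicator {s k1} (s j1) * (f s)\<^sup>2 = indicator {0} (sh s j1) * (F (sh s))\<^sup>2" for s
      by (simp add: f_def sh_def indicator_def)
    then have "(\<Sum>\<^sub>\<infinity>s. indicator {s k1} (s j1) * (f s)\<^sup>2) = (\<Sum>\<^sub>\<infinity>s. indicator {0} (s j1) * (F s)\<^sup>2)"
      using infsum_bij[OF sh, of "\<lambda>s. indicator {0} (s j1) * (F s)\<^sup>2"] by simp
    also have "\<dots> = (G j1 0)\<^sup>2" unfolding F_def using jk by (intro infsum_indicator_prod_fun fin G) auto
    finally show ?thesis by (simp add: G_def)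
  qed
  have dir_f: "dirichlet_at i f = dirichlet (G i)" if i: "i \<in> K \<union> J" "i \<noteq> k1" for i
  proof -
    have "sh (shift_at i a s) = shift_at i a (sh s)" for a s
      using i(2) jk by (auto simp: sh_def)
    then have "dirichlet_at i f = (\<Sum>a\<in>steps. \<Sum>\<^sub>\<infinity>s. (F (shift_at i a (sh s)) - F (sh s))\<^sup>2) / 2"
      unfolding dirichlet_at_def f_def by simp
    also have "\<dots> = dirichlet_at i F"
      unfolding dirichlet_at_def infsum_bij[OF sh, of "\<lambda>s. (F (shift_at i a s) - F s)\<^sup>2" for a] ..
    finally show ?thesis using F_dir[OF i(1)] by simp
  qed
  have dir_k1: "dirichlet_at k1 f \<le> 2 * dirichlet (G k1) + 2 * dirichlet \<phi>"
  proof -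
    \<comment> \<open>Moving the catalyst alone moves the relative coordinate in the opposite
      direction.\<close>
    have sh_k1: "sh (shift_at k1 a s) = shift_at k1 a (shift_at j1 (- a) (sh s))" for a s
      using jk by (auto simp: sh_def fun_eq_iff)
    have d_fin: "fin_supp (\<lambda>s. (F (shift_at i a s) - F s)\<^sup>2)" for i a
      using fin_supp_intros(5)[OF fin_supp_intros(2)[OF fin_supp_shift[OF F_fin] F_fin]] .
    have le: "(\<Sum>\<^sub>\<infinity>s. (f (shift_at k1 a s) - f s)\<^sup>2) \<le>
        2 * (\<Sum>\<^sub>\<infinity>s. (F (shift_at k1 a s) - F s)\<^sup>2) + 2 * (\<Sum>\<^sub>\<infinity>s. (F (shift_at j1 (- a) s) - F s)\<^sup>2)" for a
    proof -
      let ?u = "\<lambda>s. shift_at j1 (- a) s"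
      let ?A = "\<lambda>s. (F (shift_at k1 a (?u s)) - F (?u s))\<^sup>2" and ?B = "\<lambda>s. (F (?u s) - F s)\<^sup>2"
      have fA: "fin_supp (\<lambda>s. 2 * ?A s)"
        by (rule fin_supp_intros(4)[OF fin_supp_shift[OF d_fin[of k1 a], of j1 "- a"], of "\<lambda>_. 2"])
      have fB: "fin_supp (\<lambda>s. 2 * ?B s)" by (intro fin_supp_intros(4) d_fin)
      have "(\<Sum>\<^sub>\<infinity>s. (f (shift_at k1 a s) - f s)\<^sup>2) = (\<Sum>\<^sub>\<infinity>s. (F (shift_at k1 a (?u (sh s))) - F (sh s))\<^sup>2)"
        by (simp only: f_def sh_k1)
      also have "\<dots> = (\<Sum>\<^sub>\<infinity>s. (F (shift_at k1 a (?u s)) - F s)\<^sup>2)"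
        by (rule infsum_bij[OF sh])
      also have "\<dots> \<le> (\<Sum>\<^sub>\<infinity>s. 2 * ?A s + 2 * ?B s)"
      proof (rule infsum_mono_fin)
        have "fin_supp (\<lambda>s. F (shift_at k1 a (?u s)))"
          by (rule fin_supp_shift[OF fin_supp_shift[OF F_fin, of k1 a], of j1 "- a"])
        then show "fin_supp (\<lambda>s. (F (shift_at k1 a (?u s)) - F s)\<^sup>2)"
          by (rule fin_supp_intros(5)[OF fin_supp_intros(2)[OF _ F_fin]])
        show "fin_supp (\<lambda>s. 2 * ?A s + 2 * ?B s)" by (rule fin_supp_intros(1)[OF fA fB])
        fix s
        have "(y - z)\<^sup>2 \<le> 2 * (y - q)\<^sup>2 + 2 * (q - z)\<^sup>2" for y z q :: real
          using zero_le_power2[of "y - 2 * q + z"] by (simp add: power2_eq_square algebra_simps)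
        then show "(F (shift_at k1 a (?u s)) - F s)\<^sup>2 \<le> 2 * ?A s + 2 * ?B s" .
      qed
      also have "\<dots> = 2 * (\<Sum>\<^sub>\<infinity>s. ?A s) + 2 * (\<Sum>\<^sub>\<infinity>s. ?B s)"
        by (simp only: infsum_add_fin[OF fA fB] infsum_cmult_fin)
      also have "(\<Sum>\<^sub>\<infinity>s. ?A s) = (\<Sum>\<^sub>\<infinity>s. (F (shift_at k1 a s) - F s)\<^sup>2)"
        by (rule infsum_shift)
      finally show ?thesis .
    qed
    have flip: "(\<Sum>a\<in>steps. \<Sum>\<^sub>\<infinity>s. (F (shift_at j1 (- a) s) - F s)\<^sup>2) = (\<Sum>a\<in>steps. \<Sum>\<^sub>\<infinity>s. (F (shift_at j1 a s) - F s)\<^sup>2)"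
      by (rule sum.reindex_bij_witness[of _ uminus uminus]) (auto simp: steps_uminus)
    have "dirichlet_at k1 f \<le> (\<Sum>a\<in>steps. 2 * (\<Sum>\<^sub>\<infinity>s. (F (shift_at k1 a s) - F s)\<^sup>2) + 2 * (\<Sum>\<^sub>\<infinity>s. (F (shift_at j1 (- a) s) - F s)\<^sup>2)) / 2"
      unfolding dirichlet_at_def by (intro divide_right_mono sum_mono le) simp
    also have "\<dots> = 2 * dirichlet_at k1 F + 2 * dirichlet_at j1 F"
      unfolding dirichlet_at_def flip[symmetric] by (simp add: sum.distrib sum_distrib_left[symmetric] add_divide_distrib)
    finally show ?thesis using jk by (simp add: F_dir) (simp add: G_def)
  qed
  have "f \<in> tests"
  proof -
    have "s \<in> reach" if s: "f s \<noteq> 0" for s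
      unfolding reach_def
    proof (rule CollectI, intro allI impI)
      fix i assume i: "rates i = 0 \<or> i \<notin> K \<union> J"
      have off: "\<And>i. i \<notin> K \<union> J \<Longrightarrow> sh s i = start i" and nz: "(\<Prod>i\<in>K \<union> J. G i (sh s i)) \<noteq> 0"
        using s by (auto simp: f_def F_def prod_fun_def agrees_off_def split: if_splits)
      show "s i = start i"
      proof (cases "i \<in> K \<union> J")
        case True
        then have r: "rates i = 0" using i by blast
        then have iK: "i \<in> K" "\<rho> = 0" using True \<kappa> by (auto simp: rates_def split: if_splits)
        have "G i (sh s i) \<noteq> 0" using nz True fin by auto
        then have "sh s i = 0" using iK jk by (auto simp: G_def indicator_def split: if_splits)
        then show ?thesis using iK jk KJ_disjoint by (auto simp: sh_def start_def split: if_splits)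
      next
        case False
        then show ?thesis using off[OF False] jk by (auto simp: sh_def split: if_splits)
      qed
    qed
    then show ?thesis using f_fin by (auto simp: tests_def)
  qed
  then have "energy f \<le> top" using energy_le_top[of f] ip1 by simp
  moreover have "energy f \<ge> \<delta> - w * \<epsilon>"
  proof -
    have 1: "(\<phi> 0)\<^sup>2 \<le> (\<Sum>j\<in>J. \<Sum>k\<in>K. \<Sum>\<^sub>\<infinity>s. indicator {s k} (s j) * (f s)\<^sup>2)"
    proof -
      have nn: "0 \<le> (\<Sum>\<^sub>\<infinity>s. indicator {s k} (s j) * (f s)\<^sup>2)" for j k by (intro infsum_nonneg) auto
      have "(\<phi> 0)\<^sup>2 \<le> (\<Sum>k\<in>K. \<Sum>\<^sub>\<infinity>s. indicator {s k} (s j1) * (f s)\<^sup>2)"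
        unfolding contact[symmetric] using jk finite_KJ nn by (intro member_le_sum[of k1]) auto
      also have "\<dots> \<le> (\<Sum>j\<in>J. \<Sum>k\<in>K. \<Sum>\<^sub>\<infinity>s. indicator {s k} (s j) * (f s)\<^sup>2)"
        using jk finite_KJ nn by (intro member_le_sum[of j1 J "\<lambda>j. \<Sum>k\<in>K. \<Sum>\<^sub>\<infinity>s. indicator {s k} (s j) * (f s)\<^sup>2"] sum_nonneg) auto
      finally show ?thesis .
    qed
    have 2: "(\<Sum>j\<in>J. dirichlet_at j f) \<le> dirichlet \<phi> + real p * \<epsilon>"
    proof -
      have "(\<Sum>j\<in>J. dirichlet_at j f) = dirichlet_at j1 f + (\<Sum>j\<in>J - {j1}. dirichlet_at j f)"
        using jk finite_KJ by (intro sum.remove) auto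
      also have "dirichlet_at j1 f = dirichlet \<phi>" using jk by (simp add: dir_f) (simp add: G_def)
      also have "(\<Sum>j\<in>J - {j1}. dirichlet_at j f) \<le> (\<Sum>j\<in>J - {j1}. \<epsilon>)"
      proof (rule sum_mono)
        fix j assume "j \<in> J - {j1}"
        then have "j \<in> K \<union> J" "j \<noteq> k1" "G j = g" using jk KJ_disjoint by (auto simp: G_def)
        then show "dirichlet_at j f \<le> \<epsilon>" using g(3) by (simp add: dir_f)
      qed
      also have "(\<Sum>j\<in>J - {j1}. \<epsilon>) \<le> real p * \<epsilon>"
        using \<epsilon>(1) card_mono[OF finite_KJ(2), of "J - {j1}"] by (simp add: card_KJ)
      finally show ?thesis by simp
    qed
    have 3: "\<rho> * (\<Sum>k\<in>K. dirichlet_at k f) \<le> \<rho> * (2 * \<epsilon> + 2 * dirichlet \<phi> + real n * \<epsilon>)"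
    proof (cases "\<rho> = 0")
      case False
      have Gk: "G k = g" if "k \<in> K" for k using that False jk by (auto simp: G_def)
      have "(\<Sum>k\<in>K. dirichlet_at k f) = dirichlet_at k1 f + (\<Sum>k\<in>K - {k1}. dirichlet_at k f)"
        using jk finite_KJ by (intro sum.remove) auto
      also have "dirichlet_at k1 f \<le> 2 * \<epsilon> + 2 * dirichlet \<phi>" using dir_k1 g(3) Gk[OF jk(2)] by simp
      also have "(\<Sum>k\<in>K - {k1}. dirichlet_at k f) \<le> (\<Sum>k\<in>K - {k1}. \<epsilon>)"
        using g(3) by (intro sum_mono) (simp add: dir_f Gk)
      also have "(\<Sum>k\<in>K - {k1}. \<epsilon>) \<le> real n * \<epsilon>"
        using \<epsilon>(1) card_mono[OF finite_KJ(1), of "K - {k1}"] by (simp add: card_KJ)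
      finally show ?thesis using rates_nonneg by (intro mult_left_mono) auto
    qed simp
    have "\<kappa> * (\<Sum>j\<in>J. dirichlet_at j f) \<le> \<kappa> * (dirichlet \<phi> + real p * \<epsilon>)"
      using 2 \<kappa> by (intro mult_left_mono) auto
    moreover have "\<delta> - w * \<epsilon> = (\<phi> 0)\<^sup>2 - \<kappa> * (dirichlet \<phi> + real p * \<epsilon>) - \<rho> * (2 * \<epsilon> + 2 * dirichlet \<phi> + real n * \<epsilon>)"
      by (simp add: \<delta>_def w_def algebra_simps)
    ultimately show ?thesis unfolding energy_eq[OF f_fin] using 1 3 by linarith
  qed
  ultimately show ?thesis using \<epsilon>(2) by linarith
qed

end

section \<open>The Green function\<close>

text \<open>Up to a constant the integrand is the Erlang density, whose total mass is 1.\<close>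

lemma nn_integral_gamma:
  assumes "l > 0"
  shows "(\<integral>\<^sup>+t\<in>{0..}. ennreal (exp (- l * t) * (t ^ k / fact k)) \<partial>lborel) = ennreal (1 / l ^ Suc k)"
proof -
  interpret prob_space "density lborel (erlang_density k l)" using assms by (rule prob_space_erlang_density)
  have "(\<integral>\<^sup>+t. ennreal (erlang_density k l t) \<partial>lborel) = 1"
    using emeasure_space_1 by (simp add: emeasure_density)
  moreover have "ennreal (exp (- l * t) * (t ^ k / fact k)) * indicator {0..} t = ennreal (1 / l ^ Suc k) * ennreal (erlang_density k l t)" for t
    using assms by (auto simp: erlang_density_def ennreal_mult[symmetric] split: split_indicator)
  ultimately show ?thesis by (simp add: nn_integral_cmult)
qed

text \<open>Visits of the embedded jump chain, each lasting 1 / deg on average; this accounts for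
  the exponent \<open>Suc k\<close>.\<close>

lemma nn_integral_walk_kernel:
  fixes x y :: "int ^ 'd"
  shows "(\<integral>\<^sup>+t\<in>{0..}. ennreal (walk_kernel 1 t x y) \<partial>lborel) = (\<Sum>k. ennreal (walk_count k x y / deg TYPE('d) ^ Suc k))"
proof -
  define D where "D = deg TYPE('d)"
  have D: "D > 0" using deg_pos by (simp add: D_def)
  let ?a = "\<lambda>k t. ennreal (exp (- D * t) * (t ^ k / fact k))"
  have "ennreal (walk_kernel 1 t x y) * indicator {0..} t =
      (\<Sum>k. ennreal (walk_count k x y) * (?a k t * indicator {0..} t))" for t
  proof (cases "0 \<le> t")
    case True
    have "(\<Sum>k. ennreal (exp (- D * t) * (t ^ k / fact k * walk_count k x y))) = ennreal (walk_kernel 1 t x y)"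
      using walk_kernel_sums[of 1 t x y] True
      by (subst suminf_ennreal2) (auto simp: walk_count_nonneg sums_iff D_def)
    moreover have "ennreal (exp (- D * t) * (t ^ k / fact k * walk_count k x y)) = ennreal (walk_count k x y) * ?a k t" for k
      using True by (subst ennreal_mult[symmetric]) (auto simp: walk_count_nonneg mult_ac)
    ultimately show ?thesis using True by simp
  qed simp
  then have "(\<integral>\<^sup>+t\<in>{0..}. ennreal (walk_kernel 1 t x y) \<partial>lborel) =
      (\<Sum>k. \<integral>\<^sup>+t. ennreal (walk_count k x y) * (?a k t * indicator {0..} t) \<partial>lborel)"
    by (simp only:) (intro nn_integral_suminf, measurable)
  also have "\<dots> = (\<Sum>k. ennreal (walk_count k x y) * ennreal (1 / D ^ Suc k))"
  proof (rule suminf_cong)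
    fix k
    have m: "(\<lambda>t. ?a k t * indicator {0..} t) \<in> borel_measurable lborel" by measurable
    show "(\<integral>\<^sup>+t. ennreal (walk_count k x y) * (?a k t * indicator {0..} t) \<partial>lborel) = ennreal (walk_count k x y) * ennreal (1 / D ^ Suc k)"
      by (simp only: nn_integral_cmult[OF m] nn_integral_gamma[OF D])
  qed
  also have "\<dots> = (\<Sum>k. ennreal (walk_count k x y / D ^ Suc k))"
    using D by (intro suminf_cong, subst ennreal_mult[symmetric]) (auto simp: walk_count_nonneg)
  finally show ?thesis by (simp add: D_def)
qed

text \<open>A right-continuous path is the limit of its values at grid points to the right. For a
  fixed mesh only countably many times occur, so joint measurability reduces to that at single
  times.\<close>

lemma walk_jointly_measurable:
  fixes X :: "real \<Rightarrow> 'w \<Rightarrow> int ^ 'd"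
  assumes X: "simple_random_walk M X \<nu> x"
  shows "(\<lambda>z. indicator {y} (X (snd z) (fst z)) * indicator {0..} (snd z) :: ennreal) \<in> borel_measurable (M \<Otimes>\<^sub>M lborel)"
proof (rule borel_measurable_LIMSEQ_order)
  \<comment> \<open>The first grid point strictly after \<open>t\<close>: adding 1 to the floor
    keeps the approximation on the right.\<close>
  define u where "u m t = (real_of_int \<lfloor>real (Suc m) * t\<rfloor> + 1) / real (Suc m)" for m t
  show "(\<lambda>z. indicator {y} (X (u m (snd z)) (fst z)) * indicator {0..} (snd z) :: ennreal) \<in> borel_measurable (M \<Otimes>\<^sub>M lborel)" for m
  proof -
    let ?f = "\<lambda>(l :: int) (z :: 'w \<times> real). indicator {y} (X ((real_of_int l + 1) / real (Suc m)) (fst z)) * indicator {0..} (snd z) * indicator {0..} l :: ennreal"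
    have "?f l \<in> borel_measurable (M \<Otimes>\<^sub>M lborel)" for l
    proof (cases "l \<ge> 0")
      case True
      then have "X ((real_of_int l + 1) / real (Suc m)) \<in> M \<rightarrow>\<^sub>M count_space UNIV"
        by (intro walk_measurable[OF X]) simp
      then have "(\<lambda>\<omega>. indicator {y} (X ((real_of_int l + 1) / real (Suc m)) \<omega>) :: ennreal) \<in> borel_measurable M"
        by (rule measurable_compose) simp
      from measurable_compose[OF measurable_fst this]
      have "(\<lambda>z. indicator {y} (X ((real_of_int l + 1) / real (Suc m)) (fst z)) :: ennreal) \<in> borel_measurable (M \<Otimes>\<^sub>M lborel)" .
      moreover have "(\<lambda>z. indicator {0..} (snd z) :: ennreal) \<in> borel_measurable (M \<Otimes>\<^sub>M (lborel :: real measure))"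
        by (rule measurable_compose[OF measurable_snd]) simp
      ultimately show ?thesis by (intro borel_measurable_times_ennreal borel_measurable_const)
    qed simp
    moreover have "(\<lambda>z. \<lfloor>real (Suc m) * snd z\<rfloor>) \<in> M \<Otimes>\<^sub>M lborel \<rightarrow>\<^sub>M count_space UNIV"
      by measurable
    ultimately have "(\<lambda>z. ?f \<lfloor>real (Suc m) * snd z\<rfloor> z) \<in> borel_measurable (M \<Otimes>\<^sub>M lborel)"
      by (rule measurable_compose_countable)
    also have "(\<lambda>z. ?f \<lfloor>real (Suc m) * snd z\<rfloor> z) = (\<lambda>z. indicator {y} (X (u m (snd z)) (fst z)) * indicator {0..} (snd z))"
      by (auto simp: u_def fun_eq_iff indicator_def zero_le_mult_iff)
    finally show ?thesis .
  qed
  fix z :: "'w \<times> real" assume z: "z \<in> space (M \<Otimes>\<^sub>M lborel)"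
  obtain \<omega> t where zz: "z = (\<omega>, t)" by (cases z)
  then have \<omega>: "\<omega> \<in> space M" using z by (auto simp: space_pair_measure)
  show "(\<lambda>m. indicator {y} (X (u m (snd z)) (fst z)) * indicator {0..} (snd z) :: ennreal)
    \<longlonglongrightarrow> indicator {y} (X (snd z) (fst z)) * indicator {0..} (snd z)"
  proof (cases "0 \<le> t")
    case True
    have "continuous (at_right t) (\<lambda>s. X s \<omega>)" using X \<omega> True unfolding simple_random_walk_def by blast
    then have "eventually (\<lambda>r. X r \<omega> = X t \<omega>) (at_right t)"
      by (intro eventually_eq_site) (simp add: continuous_within)
    then obtain b where b: "b > t" "\<And>r. t < r \<Longrightarrow> r < b \<Longrightarrow> X r \<omega> = X t \<omega>"
      by (auto simp: eventually_at_right_field)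
    obtain m0 where m0: "1 / real (Suc m0) < b - t" using reals_Archimedean[of "b - t"] b(1) by (auto simp: inverse_eq_divide)
    have "X (u m t) \<omega> = X t \<omega>" if "m \<ge> m0" for m
    proof (rule b(2))
      have "real (Suc m) * t < real_of_int \<lfloor>real (Suc m) * t\<rfloor> + 1" by linarith
      then show "t < u m t" by (simp add: u_def field_simps)
      have "real_of_int \<lfloor>real (Suc m) * t\<rfloor> \<le> real (Suc m) * t" by linarith
      then have "u m t \<le> (real (Suc m) * t + 1) / real (Suc m)" unfolding u_def by (intro divide_right_mono) auto
      also have "\<dots> = t + 1 / real (Suc m)" by (simp add: add_divide_distrib)
      also have "1 / real (Suc m) \<le> 1 / real (Suc m0)" using that by (intro divide_left_mono) auto
      finally show "u m t < b" using m0 by linarith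
    qed
    then have "eventually (\<lambda>m. X (u m t) \<omega> = X t \<omega>) sequentially" by (auto simp: eventually_sequentially)
    then show ?thesis unfolding zz by (intro tendsto_eventually) (auto elim: eventually_mono)
  qed (simp add: zz)
qed

lemma green_function_eq:
  fixes X :: "real \<Rightarrow> 'w \<Rightarrow> int ^ 'd"
  assumes X: "simple_random_walk M X 1 0"
  shows "green_function M X y = (\<Sum>k. ennreal (walk_count k (0 :: int ^ 'd) y / deg TYPE('d) ^ Suc k))"
proof -
  interpret prob_space M using X by (simp add: simple_random_walk_def)
  interpret pair_sigma_finite M lborel ..
  have "green_function M X y = (\<integral>\<^sup>+\<omega>. \<integral>\<^sup>+t. indicator {y} (X t \<omega>) * indicator {0..} t \<partial>lborel \<partial>M)"
    by (simp add: green_function_def)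
  also have "\<dots> = (\<integral>\<^sup>+t. \<integral>\<^sup>+\<omega>. indicator {y} (X t \<omega>) * indicator {0..} t \<partial>M \<partial>lborel)"
    using Fubini[OF walk_jointly_measurable[OF X, of y]] by simp
  also have "\<dots> = (\<integral>\<^sup>+t\<in>{0..}. ennreal (walk_kernel 1 t 0 y) \<partial>lborel)"
  proof (rule nn_integral_cong)
    fix t :: real
    show "(\<integral>\<^sup>+\<omega>. indicator {y} (X t \<omega>) * indicator {0..} t \<partial>M) = ennreal (walk_kernel 1 t 0 y) * indicator {0..} t"
    proof (cases "0 \<le> t")
      case True
      \<comment> \<open>The cylinder formula requires 0 as the first time, hence a two-point
        grid.\<close>
      define r where "r i = (if i = (0::nat) then 0 else t)" for i
      have "X t \<in> M \<rightarrow>\<^sub>M count_space UNIV" by (rule walk_measurable[OF X True])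
      then have ev: "{\<omega>\<in>space M. X t \<omega> = y} \<in> events" by (simp add: measurable_count_space_eq2_countable vimage_def Int_def conj_commute)
      have "prob {\<omega>\<in>space M. \<forall>i\<le>Suc 0. X (r i) \<omega> = (if i = 0 then 0 else y)} =
        prob {\<omega>\<in>space M. \<forall>i\<le>0. X (r i) \<omega> = (if i = 0 then 0 else y)} * walk_kernel 1 (r (Suc 0) - r 0) 0 y"
        using walk_cylinder_Suc[OF X, of r 0 "\<lambda>i. if i = 0 then 0 else y"] True by (simp add: r_def)
      moreover have "prob {\<omega>\<in>space M. \<forall>i\<le>0::nat. X (r i) \<omega> = (if i = 0 then 0 else y)} = 1"
      proof -
        have "AE \<omega> in M. X 0 \<omega> = 0" by (rule walk_start[OF X])
        moreover have "X 0 \<in> M \<rightarrow>\<^sub>M count_space UNIV" by (rule walk_measurable[OF X]) simp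
        ultimately show ?thesis by (subst prob_eq_1) (auto simp: r_def measurable_count_space_eq2_countable vimage_def Int_def conj_commute)
      qed
      moreover have "prob {\<omega>\<in>space M. \<forall>i\<le>Suc 0. X (r i) \<omega> = (if i = 0 then 0 else y)} = prob {\<omega>\<in>space M. X t \<omega> = y}"
      proof (rule measure_eq_AE)
        show "AE \<omega> in M. \<omega> \<in> {\<omega>\<in>space M. \<forall>i\<le>Suc 0. X (r i) \<omega> = (if i = 0 then 0 else y)} \<longleftrightarrow> \<omega> \<in> {\<omega>\<in>space M. X t \<omega> = y}"
          using walk_start[OF X] by eventually_elim (auto simp: r_def le_Suc_eq)
        have "{\<omega>\<in>space M. \<forall>i\<le>Suc 0. X (r i) \<omega> = (if i = 0 then 0 else y)} = {\<omega>\<in>space M. X 0 \<omega> = 0} \<inter> {\<omega>\<in>space M. X t \<omega> = y}"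
          by (auto simp: r_def le_Suc_eq)
        moreover have "X 0 \<in> M \<rightarrow>\<^sub>M count_space UNIV" by (rule walk_measurable[OF X]) simp
        then have "{\<omega>\<in>space M. X 0 \<omega> = 0} \<in> events" by (simp add: measurable_count_space_eq2_countable vimage_def Int_def conj_commute)
        ultimately show "{\<omega>\<in>space M. \<forall>i\<le>Suc 0. X (r i) \<omega> = (if i = 0 then 0 else y)} \<in> events" using ev by auto
      qed (rule ev)
      ultimately have pr: "prob {\<omega>\<in>space M. X t \<omega> = y} = walk_kernel 1 t 0 y" by (simp add: r_def)
      have "(\<integral>\<^sup>+\<omega>. indicator {y} (X t \<omega>) * indicator {0..} t \<partial>M) = (\<integral>\<^sup>+\<omega>. indicator {\<omega>\<in>space M. X t \<omega> = y} \<omega> \<partial>M)"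
        using True by (intro nn_integral_cong) (auto simp: indicator_def)
      then show ?thesis using True ev pr by (simp add: emeasure_eq_measure)
    qed simp
  qed
  finally show ?thesis unfolding nn_integral_walk_kernel .
qed

section \<open>The spectrum of the pinned Laplacian\<close>

text \<open>The pinned Laplacian plus the constant \<nu> deg, which leaves only nonnegative matrix
  entries for \<nu> \<ge> 0.\<close>

definition pin :: "real \<Rightarrow> (int ^ 'd \<Rightarrow> real) \<Rightarrow> int ^ 'd \<Rightarrow> real" where
  "pin \<nu> g z = indicator {0} z * g z + \<nu> * adj g z"

context
  fixes \<nu> :: real assumes \<nu>: "\<nu> \<ge> 0"
begin

lemma pin_fin_supp: "fin_supp g \<Longrightarrow> fin_supp (pin \<nu> g)"
  unfolding pin_def[abs_def] by (rule fin_supp_intros(1)) (auto intro: fin_supp_intros fin_supp_adj)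

lemma ip_indicator_left: "ip f (\<lambda>z. indicator {0} z * g z) = f 0 * g 0" for f g :: "int ^ 'd \<Rightarrow> real"
  unfolding ip_def by (subst infsum_fin_supp[of "{0}"]) auto

lemma ip_pin: "fin_supp f \<Longrightarrow> ip f (pin \<nu> g) = f 0 * g 0 + \<nu> * ip f (adj g)"
  unfolding pin_def[abs_def] by (simp add: ip_add_right ip_indicator_left ip_cmult_right)

lemma ip_pin_self:
  fixes f :: "int ^ 'd \<Rightarrow> real"
  assumes "fin_supp f"
  shows "ip f (pin \<nu> f) = ((f 0)\<^sup>2 - \<nu> * dirichlet f) + \<nu> * deg TYPE('d) * ip f f"
  using assms by (simp add: ip_pin dirichlet_eq power2_eq_square algebra_simps)

lemma pin_mono: "(\<And>z. f z \<le> g z) \<Longrightarrow> pin \<nu> f z \<le> pin \<nu> g z"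
  unfolding pin_def adj_def using \<nu> by (intro add_mono mult_left_mono sum_mono) auto

lemma pin_lin: "pin \<nu> (\<lambda>z. f z + g z) = (\<lambda>z. pin \<nu> f z + pin \<nu> g z)"
  "pin \<nu> (\<lambda>z. f z - g z) = (\<lambda>z. pin \<nu> f z - pin \<nu> g z)" "pin \<nu> (\<lambda>z. - f z) = (\<lambda>z. - pin \<nu> f z)"
  by (auto simp: pin_def adj_def sum.distrib sum_subtractf sum_negf algebra_simps)

text \<open>The positivity argument used for \<open>hop\<close>: passing to |f| can only increase
  the form, so its upper bound also bounds its absolute value.\<close>

lemma abs_ip_pin_le:
  fixes f :: "int ^ 'd \<Rightarrow> real"
  assumes f: "fin_supp f" and \<beta>: "one_top TYPE('d) \<nu> + \<nu> * deg TYPE('d) \<le> \<beta>"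
  shows "\<bar>ip f (pin \<nu> f)\<bar> \<le> \<beta> * ip f f"
proof -
  let ?f = "\<lambda>z. \<bar>f z\<bar>"
  have af: "fin_supp ?f" by (intro fin_supp_intros f)
  have "\<bar>pin \<nu> f z\<bar> \<le> pin \<nu> ?f z" for z
    unfolding abs_le_iff using pin_mono[of f ?f z] pin_mono[of "\<lambda>z. - f z" ?f z] by (auto simp: pin_lin)
  then have le: "\<bar>f z * pin \<nu> f z\<bar> \<le> ?f z * pin \<nu> ?f z" for z
    unfolding abs_mult by (intro mult_left_mono) auto
  have "ip f (pin \<nu> f) \<le> ip ?f (pin \<nu> ?f)"
    unfolding ip_def using le f by (intro infsum_mono_fin fin_supp_intros) (auto simp: abs_le_iff)
  moreover have "- ip f (pin \<nu> f) \<le> ip ?f (pin \<nu> ?f)"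
    unfolding ip_def infsum_uminus[symmetric] using le f
    by (intro infsum_mono_fin) (auto simp: abs_le_iff fin_supp_intros)
  ultimately have "\<bar>ip f (pin \<nu> f)\<bar> \<le> ip ?f (pin \<nu> ?f)" by (simp add: abs_le_iff)
  also have "\<dots> \<le> (one_top TYPE('d) \<nu> + \<nu> * deg TYPE('d)) * ip ?f ?f"
    unfolding ip_pin_self[OF af] using one_top_ge[OF \<nu> af] by (simp add: algebra_simps)
  also have "\<dots> \<le> \<beta> * ip ?f ?f" by (intro mult_right_mono \<beta> ip_self_nonneg)
  finally show ?thesis by (simp add: ip_self)
qed

text \<open>Polarisation as for \<open>hop\<close>, again tested with f = pin g / \<beta>.\<close>

lemma pin_norm_le:
  fixes g :: "int ^ 'd \<Rightarrow> real"
  assumes g: "fin_supp g" and \<beta>: "one_top TYPE('d) \<nu> + \<nu> * deg TYPE('d) \<le> \<beta>" "0 < \<beta>"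
  shows "ip (pin \<nu> g) (pin \<nu> g) \<le> \<beta>\<^sup>2 * ip g g"
proof -
  have polar: "ip f (pin \<nu> g) \<le> \<beta> / 2 * (ip f f + ip g g)" if f: "fin_supp f" for f
  proof -
    note fs = f g
    have exp: "ip (\<lambda>z. f z + g z) (pin \<nu> (\<lambda>z. f z + g z)) = ip f (pin \<nu> f) + ip f (pin \<nu> g) + ip g (pin \<nu> f) + ip g (pin \<nu> g)"
      "ip (\<lambda>z. f z - g z) (pin \<nu> (\<lambda>z. f z - g z)) = ip f (pin \<nu> f) - ip f (pin \<nu> g) - ip g (pin \<nu> f) + ip g (pin \<nu> g)"
      unfolding pin_lin by (simp_all add: ip_add ip_diff ip_add_right ip_diff_right fs)
    have exp2: "ip (\<lambda>z. f z + g z) (\<lambda>z. f z + g z) = ip f f + ip f g + ip g f + ip g g"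
      "ip (\<lambda>z. f z - g z) (\<lambda>z. f z - g z) = ip f f - ip f g - ip g f + ip g g"
      by (simp_all add: ip_add ip_diff ip_add_right ip_diff_right fs)
    have "ip g (pin \<nu> f) = ip f (pin \<nu> g)"
      unfolding ip_pin[OF f] ip_pin[OF g] ip_adj[OF g] by (simp add: ip_sym[of f] mult.commute)
    then have "4 * ip f (pin \<nu> g) = ip (\<lambda>z. f z + g z) (pin \<nu> (\<lambda>z. f z + g z)) - ip (\<lambda>z. f z - g z) (pin \<nu> (\<lambda>z. f z - g z))"
      by (simp add: exp)
    also have "\<dots> \<le> \<beta> * ip (\<lambda>z. f z + g z) (\<lambda>z. f z + g z) + \<beta> * ip (\<lambda>z. f z - g z) (\<lambda>z. f z - g z)"
      using abs_ip_pin_le[OF fin_supp_intros(1)[OF fs] \<beta>(1)] abs_ip_pin_le[OF fin_supp_intros(2)[OF fs] \<beta>(1)]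
      by (simp add: abs_le_iff)
    also have "\<dots> = \<beta> * (2 * (ip f f + ip g g))"
      unfolding exp2 by (simp add: algebra_simps)
    finally show ?thesis by (simp add: algebra_simps)
  qed
  have "ip (pin \<nu> g) (pin \<nu> g) / \<beta> \<le> \<beta> / 2 * (ip (pin \<nu> g) (pin \<nu> g) / \<beta>\<^sup>2 + ip g g)"
  proof -
    have "ip (\<lambda>z. (1 / \<beta>) * pin \<nu> g z) (pin \<nu> g) = ip (pin \<nu> g) (pin \<nu> g) / \<beta>"
      "ip (\<lambda>z. (1 / \<beta>) * pin \<nu> g z) (\<lambda>z. (1 / \<beta>) * pin \<nu> g z) = ip (pin \<nu> g) (pin \<nu> g) / \<beta>\<^sup>2"
      unfolding ip_cmult ip_cmult_right by (simp_all add: power2_eq_square)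
    moreover have "fin_supp (\<lambda>z. (1 / \<beta>) * pin \<nu> g z)" by (rule fin_supp_intros(4)[OF pin_fin_supp[OF g]])
    ultimately show ?thesis using polar by metis
  qed
  then show ?thesis using \<beta> by (simp add: field_simps power2_eq_square)
qed

end

section \<open>Square summable complex functions and the resolvent\<close>

lemma ell2_finite_le:
  assumes "f \<in> ell2" "finite F"
  shows "L2_set (\<lambda>x. cmod (f x)) F \<le> ell2_norm f"
  unfolding L2_set_def ell2_norm_def
  using assms by (intro real_sqrt_le_mono finite_sum_le_infsum) (auto simp: ell2_def)

text \<open>Finite sections decide both membership and norm; this is how bounds for finitely
  supported functions and pointwise limits pass to \<open>ell2\<close>.\<close>

lemma ell2_leI:
  assumes "\<And>F. finite F \<Longrightarrow> L2_set (\<lambda>x. cmod (f x)) F \<le> B"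
  shows "f \<in> ell2" "ell2_norm f \<le> B"
proof -
  have B: "0 \<le> B" using assms[of "{}"] by simp
  have le: "(\<Sum>x\<in>F. (cmod (f x))\<^sup>2) \<le> B\<^sup>2" if "finite F" for F
  proof -
    have "(L2_set (\<lambda>x. cmod (f x)) F)\<^sup>2 \<le> B\<^sup>2" using assms[OF that] by (intro power_mono) auto
    then show ?thesis by (simp add: L2_set_def sum_nonneg)
  qed
  have s: "(\<lambda>x. (cmod (f x))\<^sup>2) summable_on UNIV"
    using le by (intro nonneg_bdd_above_summable_on bdd_aboveI[of _ "B\<^sup>2"]) auto
  then show "f \<in> ell2" by (simp add: ell2_def)
  have "(\<Sum>\<^sub>\<infinity>x. (cmod (f x))\<^sup>2) \<le> B\<^sup>2" by (rule infsum_le_finite_sums[OF s]) (use le in auto)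
  then show "ell2_norm f \<le> B" unfolding ell2_norm_def by (rule real_le_lsqrt[OF B]) 
qed

lemma ell2_norm_nonneg: "0 \<le> ell2_norm f"
  unfolding ell2_norm_def by (simp add: infsum_nonneg)

lemma ell2_add:
  assumes "f \<in> ell2" "g \<in> ell2"
  shows "(\<lambda>x. f x + g x) \<in> ell2" "ell2_norm (\<lambda>x. f x + g x) \<le> ell2_norm f + ell2_norm g"
proof -
  have le: "L2_set (\<lambda>x. cmod (f x + g x)) F \<le> ell2_norm f + ell2_norm g" if "finite F" for F
  proof -
    have "L2_set (\<lambda>x. cmod (f x + g x)) F \<le> L2_set (\<lambda>x. cmod (f x) + cmod (g x)) F"
      by (intro L2_set_mono norm_triangle_ineq) auto
    also have "\<dots> \<le> L2_set (\<lambda>x. cmod (f x)) F + L2_set (\<lambda>x. cmod (g x)) F" by (rule L2_set_triangle_ineq)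
    also have "\<dots> \<le> ell2_norm f + ell2_norm g" using assms that by (intro add_mono ell2_finite_le)
    finally show ?thesis .
  qed
  show "(\<lambda>x. f x + g x) \<in> ell2" by (rule ell2_leI(1)[OF le])
  show "ell2_norm (\<lambda>x. f x + g x) \<le> ell2_norm f + ell2_norm g" by (rule ell2_leI(2)[OF le])
qed

lemma ell2_cmult:
  assumes "f \<in> ell2"
  shows "(\<lambda>x. c * f x) \<in> ell2" "ell2_norm (\<lambda>x. c * f x) = cmod c * ell2_norm f"
proof -
  show "(\<lambda>x. c * f x) \<in> ell2"
    using assms by (simp add: ell2_def norm_mult power_mult_distrib summable_on_cmult_right)
  show "ell2_norm (\<lambda>x. c * f x) = cmod c * ell2_norm f"
    by (simp add: ell2_norm_def norm_mult power_mult_distrib infsum_cmult_right' real_sqrt_mult)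
qed

lemma ell2_diff:
  assumes "f \<in> ell2" "g \<in> ell2"
  shows "(\<lambda>x. f x - g x) \<in> ell2" "ell2_norm (\<lambda>x. f x - g x) \<le> ell2_norm f + ell2_norm g"
  using ell2_add[OF assms(1) ell2_cmult(1)[OF assms(2), of "-1"]] ell2_cmult(2)[OF assms(2), of "-1"] by auto

lemma ell2_pointwise: "f \<in> ell2 \<Longrightarrow> cmod (f x) \<le> ell2_norm f"
  using ell2_finite_le[of f "{x}"] by (simp add: L2_set_def)

definition cpin :: "real \<Rightarrow> (int ^ 'd \<Rightarrow> complex) \<Rightarrow> int ^ 'd \<Rightarrow> complex" where
  "cpin \<nu> f z = indicator {0} z * f z + of_real \<nu> * adj f z"

lemma pinned_laplacian_eq:
  fixes f :: "int ^ 'd \<Rightarrow> complex"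
  shows "pinned_laplacian \<nu> f z - of_real r * f z = cpin \<nu> f z - of_real (r + \<nu> * deg TYPE('d)) * f z"
proof -
  have "laplacian f z = (\<Sum>v\<in>steps. f (z + v) - f z)"
    unfolding laplacian_def neighbours_eq by (subst sum.reindex) (auto simp: inj_on_def)
  then have lap: "laplacian f z = adj f z - of_nat (card (steps :: (int ^ 'd) set)) * f z"
    by (simp add: sum_subtractf adj_def)
  show ?thesis unfolding pinned_laplacian_def cpin_def lap by (simp add: algebra_simps)
qed

text \<open>On a finite set the values of \<open>cpin \<nu> f\<close> involve only that set and its
  neighbours. There |f| is cut off to a finitely supported \<open>h\<close>, and |cpin f| \<le> pin
  h reduces the norm bound to the real one.\<close>

lemma cpin_bounded:
  fixes f :: "int ^ 'd \<Rightarrow> complex"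
  assumes \<nu>: "\<nu> \<ge> 0" and \<beta>: "one_top TYPE('d) \<nu> + \<nu> * deg TYPE('d) \<le> \<beta>" "0 < \<beta>" and f: "f \<in> ell2"
  shows "cpin \<nu> f \<in> ell2" "ell2_norm (cpin \<nu> f) \<le> \<beta> * ell2_norm f"
proof -
  have bound: "L2_set (\<lambda>z. cmod (cpin \<nu> f z)) F \<le> \<beta> * ell2_norm f" if F: "finite F" for F
  proof -
    define F' where "F' = F \<union> (\<Union>v\<in>steps. (\<lambda>z. z + v) ` F)"
    have F': "finite F'" using F finite_steps by (auto simp: F'_def)
    define h where "h z = (if z \<in> F' then cmod (f z) else 0)" for z
    have h: "fin_supp h" by (rule finite_subset[OF _ F']) (auto simp: h_def)
    have le: "cmod (cpin \<nu> f z) \<le> pin \<nu> h z" if z: "z \<in> F" for z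
    proof -
      have hz: "h z = cmod (f z)" "\<And>v. v \<in> steps \<Longrightarrow> h (z + v) = cmod (f (z + v))"
        using z by (auto simp: h_def F'_def)
      have "cmod (cpin \<nu> f z) \<le> cmod (indicator {0} z * f z) + cmod (of_real \<nu> * adj f z)"
        unfolding cpin_def by (rule norm_triangle_ineq)
      also have "\<dots> = indicator {0} z * h z + \<nu> * cmod (adj f z)"
        using \<nu> by (simp add: norm_mult hz indicator_def)
      also have "\<dots> \<le> indicator {0} z * h z + \<nu> * (\<Sum>v\<in>steps. cmod (f (z + v)))"
        unfolding adj_def using \<nu> by (intro add_left_mono mult_left_mono norm_sum) auto
      also have "(\<Sum>v\<in>steps. cmod (f (z + v))) = adj h z" unfolding adj_def by (intro sum.cong refl) (simp add: hz)
      finally show ?thesis by (simp add: pin_def)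
    qed
    have "(\<Sum>z\<in>F. (cmod (cpin \<nu> f z))\<^sup>2) \<le> (\<Sum>z\<in>F. (pin \<nu> h z)\<^sup>2)"
      by (intro sum_mono power_mono le) auto
    also have "\<dots> \<le> ip (pin \<nu> h) (pin \<nu> h)"
      unfolding ip_self by (intro fin_sum_le_infsum F fin_supp_intros pin_fin_supp[OF \<nu>] h) auto
    also have "\<dots> \<le> \<beta>\<^sup>2 * ip h h" by (rule pin_norm_le[OF \<nu> h \<beta>])
    also have "ip h h = (\<Sum>z\<in>F'. (cmod (f z))\<^sup>2)"
      unfolding ip_self by (subst infsum_fin_supp[OF F']) (auto simp: h_def)
    finally have "L2_set (\<lambda>z. cmod (cpin \<nu> f z)) F \<le> sqrt (\<beta>\<^sup>2 * (\<Sum>z\<in>F'. (cmod (f z))\<^sup>2))"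
      unfolding L2_set_def by (rule real_sqrt_le_mono)
    also have "\<dots> = \<beta> * L2_set (\<lambda>z. cmod (f z)) F'" using \<beta> by (simp add: L2_set_def real_sqrt_mult)
    also have "\<dots> \<le> \<beta> * ell2_norm f" using \<beta> by (intro mult_left_mono ell2_finite_le f F') auto
    finally show ?thesis .
  qed
  show "cpin \<nu> f \<in> ell2" by (rule ell2_leI(1)[OF bound])
  show "ell2_norm (cpin \<nu> f) \<le> \<beta> * ell2_norm f" by (rule ell2_leI(2)[OF bound])
qed

lemma cpin_lin:
  "cpin \<nu> (\<lambda>z. f z - g z) z = cpin \<nu> f z - cpin \<nu> g z"
  by (simp add: cpin_def adj_def sum_subtractf algebra_simps)

text \<open>Above the norm of \<open>cpin \<nu>\<close> the resolvent is given by the Neumann series.\<close>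

lemma resolvent:
  fixes \<beta> r' :: real
  assumes \<nu>: "\<nu> \<ge> 0" and \<beta>: "one_top TYPE('d::finite) \<nu> + \<nu> * deg TYPE('d) \<le> \<beta>" "0 < \<beta>" and r: "\<beta> < r'"
  defines "T \<equiv> \<lambda>f z. cpin \<nu> f z - of_real r' * f z :: complex"
  shows "bij_betw T (ell2 :: (int ^ 'd \<Rightarrow> complex) set) ell2"
    and "\<forall>f\<in>(ell2 :: (int ^ 'd \<Rightarrow> complex) set). ell2_norm f \<le> 1 / (r' - \<beta>) * ell2_norm (T f)"
proof -
  note bounded = cpin_bounded[OF \<nu> \<beta>]
  have T: "T f \<in> ell2" if "f \<in> ell2" for f :: "int ^ 'd \<Rightarrow> complex"
    unfolding T_def using that by (intro ell2_diff bounded ell2_cmult)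
  have lower: "ell2_norm f \<le> 1 / (r' - \<beta>) * ell2_norm (T f)" if f: "f \<in> ell2" for f :: "int ^ 'd \<Rightarrow> complex"
  proof -
    have "r' * ell2_norm f = ell2_norm (\<lambda>z. of_real r' * f z)" using ell2_cmult(2)[OF f, of "of_real r'"] r \<beta> by simp
    also have "(\<lambda>z. of_real r' * f z) = (\<lambda>z. cpin \<nu> f z - T f z)" by (simp add: T_def)
    also have "ell2_norm \<dots> \<le> ell2_norm (cpin \<nu> f) + ell2_norm (T f)"
      by (intro ell2_diff bounded T f)
    also have "\<dots> \<le> \<beta> * ell2_norm f + ell2_norm (T f)" using bounded(2)[OF f] by simp
    finally have "(r' - \<beta>) * ell2_norm f \<le> ell2_norm (T f)" by (simp add: algebra_simps)
    then show ?thesis using r by (simp add: field_simps)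
  qed
  then show "\<forall>f\<in>(ell2 :: (int ^ 'd \<Rightarrow> complex) set). ell2_norm f \<le> 1 / (r' - \<beta>) * ell2_norm (T f)" by blast
  have inj: "inj_on T (ell2 :: (int ^ 'd \<Rightarrow> complex) set)"
  proof (rule inj_onI)
    fix f g :: "int ^ 'd \<Rightarrow> complex" assume fg: "f \<in> ell2" "g \<in> ell2" "T f = T g"
    let ?d = "\<lambda>z. f z - g z"
    have "T ?d = (\<lambda>z. T f z - T g z)" by (auto simp: T_def cpin_lin algebra_simps)
    then have "T ?d = (\<lambda>z. 0)" using fg(3) by simp
    then have "ell2_norm ?d \<le> 0" using lower[OF ell2_diff(1)[OF fg(1,2)]] by (simp add: ell2_norm_def)
    then have "cmod (?d z) \<le> 0" for z using ell2_pointwise[OF ell2_diff(1)[OF fg(1,2)], of z] by linarith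
    then show "f = g" by (auto simp: fun_eq_iff)
  qed
  have "g \<in> T ` ell2" if g: "g \<in> ell2" for g :: "int ^ 'd \<Rightarrow> complex"
  proof -
    define u where "u k = (cpin \<nu> ^^ k) g" for k
    have u: "u k \<in> ell2" "ell2_norm (u k) \<le> \<beta> ^ k * ell2_norm g" for k
    proof (induction k)
      case 0
      { case 1 then show ?case using g by (simp add: u_def) }
      { case 2 then show ?case by (simp add: u_def) }
    next
      case (Suc k)
      { case 1 then show ?case using bounded(1)[OF Suc.IH(1)] by (simp add: u_def) }
      { case 2
        have "ell2_norm (u (Suc k)) \<le> \<beta> * ell2_norm (u k)" using bounded(2)[OF Suc.IH(1)] by (simp add: u_def)
        also have "\<dots> \<le> \<beta> * (\<beta> ^ k * ell2_norm g)" using \<beta> by (intro mult_left_mono Suc.IH(2)) auto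
        finally show ?case by (simp add: mult_ac) }
    qed
    define q where "q = \<beta> / r'"
    have r0: "r' > 0" using r \<beta> by linarith
    have q: "0 \<le> q" "q < 1" using r \<beta> r0 by (auto simp: q_def)
    \<comment> \<open>Term k of the Neumann series for the inverse of r' - cpin. Hence
      \<open>S\<close> solves the equation with right-hand side -g, and its negative is the
      preimage.\<close>
    define a where "a k z = u k z / of_real (r' ^ Suc k)" for k z
    have a: "a k \<in> ell2" "ell2_norm (a k) \<le> q ^ k * (ell2_norm g / r')" for k
    proof -
      have a_eq: "a k = (\<lambda>z. of_real (1 / r' ^ Suc k) * u k z)" by (auto simp: a_def)
      show "a k \<in> ell2" unfolding a_eq by (rule ell2_cmult(1)[OF u(1)])
      have "ell2_norm (a k) = 1 / r' ^ Suc k * ell2_norm (u k)"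
        unfolding a_eq ell2_cmult(2)[OF u(1)] using r0 by (simp add: norm_divide norm_mult norm_power)
      also have "\<dots> \<le> 1 / r' ^ Suc k * (\<beta> ^ k * ell2_norm g)" using r0 by (intro mult_left_mono u(2)) auto
      also have "\<dots> = q ^ k * (ell2_norm g / r')" by (simp add: q_def power_divide)
      finally show "ell2_norm (a k) \<le> q ^ k * (ell2_norm g / r')" .
    qed
    have geo: "summable (\<lambda>k. q ^ k * (ell2_norm g / r'))" using q by (intro summable_mult2 summable_geometric) auto
    have sa: "summable (\<lambda>k. a k z)" for z
      by (rule summable_comparison_test'[OF geo, of 0]) (rule order_trans[OF ell2_pointwise[OF a(1)] a(2)])
    define s where "s N z = (\<Sum>k<N. a k z)" for N z
    have s: "s N \<in> ell2 \<and> ell2_norm (s N) \<le> (\<Sum>k<N. q ^ k * (ell2_norm g / r'))" for N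
    proof (induction N)
      case 0
      have "s 0 = (\<lambda>z. 0 * g z)" by (simp add: s_def fun_eq_iff)
      then show ?case using ell2_cmult[OF g, of 0] by simp
    next
      case (Suc N)
      have e: "s (Suc N) = (\<lambda>z. s N z + a N z)" by (simp add: s_def fun_eq_iff)
      show ?case unfolding e using ell2_add[of "s N" "a N"] Suc a[of N] by (auto intro: order_trans)
    qed
    define S where "S z = (\<Sum>k. a k z)" for z
    have lim: "(\<lambda>N. s N z) \<longlonglongrightarrow> S z" for z
      unfolding s_def S_def by (rule summable_LIMSEQ[OF sa])
    define B where "B = (\<Sum>k. q ^ k * (ell2_norm g / r'))"
    have S: "S \<in> ell2"
    proof (rule ell2_leI(1)[where B = B])
      fix F :: "(int ^ 'd) set" assume F: "finite F"
      have "(\<lambda>N. L2_set (\<lambda>z. cmod (s N z)) F) \<longlonglongrightarrow> L2_set (\<lambda>z. cmod (S z)) F"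
        unfolding L2_set_def by (intro tendsto_intros lim)
      moreover have "L2_set (\<lambda>z. cmod (s N z)) F \<le> B" for N
      proof -
        have "L2_set (\<lambda>z. cmod (s N z)) F \<le> ell2_norm (s N)" using s F by (intro ell2_finite_le) auto
        also have "\<dots> \<le> (\<Sum>k<N. q ^ k * (ell2_norm g / r'))" using s by blast
        also have "\<dots> \<le> B"
          unfolding B_def using q r0 ell2_norm_nonneg[of g] by (intro sum_le_suminf geo) auto
        finally show ?thesis .
      qed
      ultimately show "L2_set (\<lambda>z. cmod (S z)) F \<le> B" by (intro LIMSEQ_le_const2) auto
    qed
    have sums: "(\<lambda>k. a k z) sums S z" for z unfolding S_def by (rule summable_sums[OF sa])
    have "cpin \<nu> S z - of_real r' * S z = - g z" for z
    proof -
      have "(\<lambda>k. cpin \<nu> (a k) z) sums cpin \<nu> S z"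
        unfolding cpin_def adj_def by (intro sums_add sums_mult sums_sum sums)
      moreover have "cpin \<nu> (a k) z = of_real r' * a (Suc k) z" for k
      proof -
        have "cpin \<nu> (a k) z = cpin \<nu> (u k) z / of_real (r' ^ Suc k)"
          by (simp add: cpin_def adj_def a_def sum_divide_distrib[symmetric] add_divide_distrib)
        then show ?thesis using r0 by (simp add: a_def u_def)
      qed
      ultimately have "(\<lambda>k. of_real r' * a (Suc k) z) sums cpin \<nu> S z" by simp
      moreover have "(\<lambda>k. of_real r' * a (Suc k) z) sums (of_real r' * (S z - a 0 z))"
        using sums_split_initial_segment[OF sums, of 1 z] by (intro sums_mult) simp
      ultimately have "cpin \<nu> S z = of_real r' * (S z - a 0 z)" by (rule sums_unique2)
      then show ?thesis using r0 by (simp add: a_def u_def algebra_simps)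
    qed
    then have "T (\<lambda>z. - 1 * S z) = g"
      by (simp add: T_def fun_eq_iff cpin_def adj_def sum_negf) (simp add: algebra_simps minus_equation_iff)
    moreover have "(\<lambda>z. - 1 * S z) \<in> ell2" by (rule ell2_cmult(1)[OF S])
    ultimately show ?thesis by (metis image_eqI)
  qed
  then show "bij_betw T (ell2 :: (int ^ 'd \<Rightarrow> complex) set) ell2"
    using inj T by (auto simp: bij_betw_def)
qed

text \<open>The test function is the point mass at 0. The bound makes \<beta> positive, as the norm
  estimate and the Neumann series require.\<close>

lemma one_top_plus_deg_ge_1:
  assumes "\<nu> \<ge> 0"
  shows "1 \<le> one_top TYPE('d::finite) \<nu> + \<nu> * deg TYPE('d)"
proof -
  have "dirichlet (indicator {0} :: int ^ 'd \<Rightarrow> real) \<le> deg TYPE('d) * 1"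
    using dirichlet_le_deg[OF fin_supp_indicator[of "0 :: int ^ 'd"]] by (simp add: ip_indicator)
  then have "\<nu> * dirichlet (indicator {0} :: int ^ 'd \<Rightarrow> real) \<le> \<nu> * deg TYPE('d)" using assms by (simp add: mult_left_mono)
  moreover have "1 - \<nu> * dirichlet (indicator {0} :: int ^ 'd \<Rightarrow> real) \<le> one_top TYPE('d) \<nu>"
    using one_top_ge[OF assms fin_supp_indicator[of "0 :: int ^ 'd"]] by (simp add: ip_indicator)
  ultimately show ?thesis by linarith
qed

text \<open>Above the norm of the shifted operator the resolvent exists. At the supremum itself
  near-maximisers are approximate eigenfunctions: as the norm of \<open>cpin\<close> is at most
  \<beta>, a form value close to \<beta> forces cpin g to be close to \<beta> g, which excludes a
  bounded inverse.\<close>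

theorem sup_spectrum_eq_one_top:
  assumes \<nu>: "\<nu> \<ge> 0"
  shows "sup_spectrum TYPE('d::finite) \<nu> = one_top TYPE('d) \<nu>"
proof -
  let ?m = "one_top TYPE('d) \<nu>" and ?D = "\<nu> * deg TYPE('d)"
  let ?A = "pinned_laplacian \<nu> :: (int ^ 'd \<Rightarrow> complex) \<Rightarrow> int ^ 'd \<Rightarrow> complex"
  define \<beta> where "\<beta> = ?m + ?D"
  have \<beta>: "1 \<le> \<beta>" using one_top_plus_deg_ge_1[OF \<nu>, where 'd='d] by (simp add: \<beta>_def)
  have spec: "complex_of_real r \<in> ell2_spectrum ?A \<longleftrightarrow>
      \<not> (bij_betw (\<lambda>f z. cpin \<nu> f z - of_real (r + ?D) * f z) ell2 (ell2 :: (int ^ 'd \<Rightarrow> complex) set) \<and>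
        (\<exists>C. \<forall>f\<in>ell2. ell2_norm f \<le> C * ell2_norm (\<lambda>z :: int ^ 'd. cpin \<nu> f z - of_real (r + ?D) * f z)))" for r
    unfolding ell2_spectrum_def mem_Collect_eq pinned_laplacian_eq by (rule refl)
  have upper: "r \<le> ?m" if r: "complex_of_real r \<in> ell2_spectrum ?A" for r
  proof (rule ccontr)
    assume "\<not> r \<le> ?m"
    then have "\<beta> < r + ?D" by (simp add: \<beta>_def)
    note res = resolvent[OF \<nu>, where 'd='d, of \<beta> "r + ?D", OF _ _ this]
    have "?m + ?D \<le> \<beta>" "0 < \<beta>" using \<beta> by (auto simp: \<beta>_def)
    from res(1)[OF this] res(2)[OF this] show False using r unfolding spec by blast
  qed
  have "complex_of_real ?m \<in> ell2_spectrum ?A"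
  proof (rule ccontr)
    assume "complex_of_real ?m \<notin> ell2_spectrum ?A"
    then have "\<exists>C. \<forall>f\<in>ell2. ell2_norm f \<le> C * ell2_norm (\<lambda>z :: int ^ 'd. cpin \<nu> f z - of_real \<beta> * f z)"
      unfolding spec \<beta>_def by blast
    then obtain C where C: "\<And>f. f \<in> ell2 \<Longrightarrow> ell2_norm f \<le> C * ell2_norm (\<lambda>z. cpin \<nu> f z - of_real \<beta> * f (z :: int ^ 'd))"
      by blast
    \<comment> \<open>The squared error will be at most 2 \<beta> \<epsilon>; this choice keeps C^2
      times it below 1 / 2.\<close>
    define \<epsilon> where "\<epsilon> = 1 / (4 * \<beta> * (C\<^sup>2 + 1))"
    have \<epsilon>: "\<epsilon> > 0" using \<beta> by (auto simp: \<epsilon>_def add_nonneg_pos intro!: divide_pos_pos mult_pos_pos)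
    obtain g :: "int ^ 'd \<Rightarrow> real" where g: "fin_supp g" "ip g g = 1" "?m - \<epsilon> < (g 0)\<^sup>2 - \<nu> * dirichlet g"
    proof (rule one_top_obtains[OF \<nu>])
      show "?m - \<epsilon> < ?m" using \<epsilon> by simp
    qed
    define h where "h z = pin \<nu> g z - \<beta> * g z" for z
    have pg: "fin_supp (pin \<nu> g)" by (rule pin_fin_supp[OF \<nu> g(1)])
    have bg: "fin_supp (\<lambda>z. \<beta> * g z)" by (intro fin_supp_intros g)
    have h: "fin_supp h" unfolding h_def[abs_def] by (rule fin_supp_intros(2)[OF pg bg])
    have hh_eq: "ip h h = ip (pin \<nu> g) (pin \<nu> g) - 2 * \<beta> * ip g (pin \<nu> g) + \<beta>\<^sup>2 * ip g g"
      unfolding h_def[abs_def]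
      by (simp only: ip_diff[OF pg bg] ip_cmult ip_diff_right[OF pg] ip_diff_right[OF g(1)] ip_cmult_right ip_sym[of "pin \<nu> g" g])
        (simp add: power2_eq_square algebra_simps)
    have "ip (pin \<nu> g) (pin \<nu> g) \<le> \<beta>\<^sup>2 * ip g g"
      using \<beta> by (intro pin_norm_le \<nu> g) (auto simp: \<beta>_def)
    moreover have "2 * \<beta> * ip g (pin \<nu> g) \<ge> 2 * \<beta> * (\<beta> - \<epsilon>)"
      using \<beta> g unfolding ip_pin_self[OF \<nu> g(1)] by (intro mult_left_mono) (auto simp: \<beta>_def)
    ultimately have hh: "ip h h \<le> 2 * \<beta> * \<epsilon>" using hh_eq g(2) by (simp add: power2_eq_square algebra_simps)
    have norm_real: "(\<lambda>z. complex_of_real (w z)) \<in> ell2 \<and> ell2_norm (\<lambda>z. complex_of_real (w z)) = sqrt (ip w w)" if "fin_supp w" for w :: "int ^ 'd \<Rightarrow> real"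
      using fin_supp_summable[OF fin_supp_intros(5)[OF that]] by (simp add: ell2_def ell2_norm_def ip_self)
    have "(\<lambda>z. cpin \<nu> (\<lambda>z. of_real (g z)) z - of_real \<beta> * of_real (g z)) = (\<lambda>z. complex_of_real (h z))"
      by (auto simp: h_def cpin_def pin_def adj_def indicator_def)
    then have "1 \<le> C * sqrt (ip h h)"
      using C[of "\<lambda>z. of_real (g z)"] norm_real[OF g(1)] norm_real[OF h] g(2) by simp
    then have "1\<^sup>2 \<le> (C * sqrt (ip h h))\<^sup>2" by (intro power_mono) auto
    also have "\<dots> = C\<^sup>2 * ip h h" by (simp add: power_mult_distrib ip_self_nonneg)
    also have "\<dots> \<le> C\<^sup>2 * (2 * \<beta> * \<epsilon>)" by (intro mult_left_mono hh) auto
    also have "\<dots> = (C\<^sup>2 / (C\<^sup>2 + 1)) / 2"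
    proof -
      have "C\<^sup>2 * (2 * \<beta> * (1 / (4 * \<beta> * q))) = C\<^sup>2 / q / 2" if "q > 0" for q
        using \<beta> that by (simp add: field_simps)
      moreover have "0 < C\<^sup>2 + 1" by (simp add: add_nonneg_pos)
      ultimately show ?thesis unfolding \<epsilon>_def by blast
    qed
    also have "\<dots> < 1"
    proof -
      have "C\<^sup>2 / (C\<^sup>2 + 1) \<le> 1" by (simp add: divide_le_eq add_nonneg_pos)
      then have "C\<^sup>2 / (C\<^sup>2 + 1) / 2 \<le> 1 / 2" by (intro divide_right_mono) auto
      then show ?thesis by (rule order_le_less_trans) simp
    qed
    finally show False by simp
  qed
  then show ?thesis
    unfolding sup_spectrum_def by (intro cSup_eq_maximum) (auto intro: upper)
qed

section \<open>The Lyapunov exponents\<close>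

text \<open>\<open>top\<close> belongs to \<open>walkers\<close> and sees the model only through
  rates and potential; this provides a constant with the parameters of the model, so that values for
  different \<kappa> can be compared.\<close>

definition (in catalysts) growth :: real where "growth = top"

text \<open>Take a near-maximiser at \<open>b\<close>. Far out at \<open>c\<close> its energy is at
  most half of \<open>b.top\<close>, so the slope of its affine energy is bounded away from 0, and
  going back from \<open>b\<close> to \<open>a\<close> gains more than the defect
  \<epsilon>.\<close>

lemma growth_strict_antimono:
  assumes d: "CARD('d::finite) \<le> 2" and n: "n \<ge> 1" and p: "p \<ge> 1" and \<rho>: "\<rho> \<ge> 0" and ab: "0 < a" "a < b"
  shows "catalysts.growth n p b \<rho> (x :: int ^ 'd) < catalysts.growth n p a \<rho> x"
proof -
  interpret a: catalysts n p a \<rho> x using ab \<rho> by unfold_locales auto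
  interpret b: catalysts n p b \<rho> x using ab \<rho> by unfold_locales auto
  have tb: "b.top > 0" using ab by (intro b.top_pos d n p) auto
  \<comment> \<open>Large enough for the ray estimate to push the growth rate at \<open>c\<close>
    down to half of \<open>b.top\<close>.\<close>
  obtain L :: nat where L: "4 * real n * real p / b.top < real L" using reals_Archimedean2 by blast
  have "0 < 4 * real n * real p / b.top" using tb n p by simp
  with L have L0: "L > 0" by (metis of_nat_0_less_iff order_less_trans)
  define c where "c = max (b + 1) (4 * real L * real n)"
  have c: "c > b" "4 * real L * real n \<le> c" by (auto simp: c_def)
  interpret c: catalysts n p c \<rho> x using ab c \<rho> by unfold_locales auto
  have tc: "c.top \<le> b.top / 2"
  proof -
    have "c.top \<le> real n * real p * (2 / real L)" by (rule c.top_le_large[OF L0 c(2)])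
    also have "\<dots> \<le> b.top / 2" using L L0 tb by (simp add: field_simps)
    finally show ?thesis .
  qed
  \<comment> \<open>The energy drops by at least b.top / 4 between \<open>b\<close> and
    \<open>c\<close>; \<delta> is the resulting lower bound for the gain between \<open>b\<close>
    and \<open>a\<close>.\<close>
  define \<delta> where "\<delta> = (b - a) * b.top / (4 * (c - b))"
  have \<delta>: "\<delta> > 0" using ab c tb by (simp add: \<delta>_def)
  define \<epsilon> where "\<epsilon> = min (b.top / 4) (\<delta> / 2)"
  have \<epsilon>: "0 < \<epsilon>" "\<epsilon> \<le> b.top / 4" "\<epsilon> < \<delta>" using tb \<delta> by (auto simp: \<epsilon>_def)
  obtain f where f: "f \<in> b.tests" "ip f f = 1" "b.top - \<epsilon> < b.energy f"
    using b.less_top_obtains[of "b.top - \<epsilon>"] \<epsilon>(1) by auto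
  have fa: "f \<in> a.tests" and fc: "f \<in> c.tests"
    using f(1) ab c by (auto simp: a.tests_def b.tests_def c.tests_def a.reach_def b.reach_def c.reach_def
        a.rates_def b.rates_def c.rates_def split: if_splits)
  note supp = b.tests_fin_supp[OF f(1)]
  define D where "D = (\<Sum>j\<in>b.J. dirichlet_at j f)"
  have ea: "a.energy f = b.energy f + (b - a) * D" and ec: "c.energy f = b.energy f - (c - b) * D"
    unfolding a.energy_eq[OF supp] b.energy_eq[OF supp] c.energy_eq[OF supp] D_def by (simp_all add: algebra_simps)
  have "c.energy f \<le> c.top" using c.energy_le_top[OF fc] f(2) by simp
  then have "b.top / 4 \<le> (c - b) * D" using ec f(3) tc \<epsilon>(2) by linarith
  then have "b.top / (4 * (c - b)) \<le> D" using c by (simp add: field_simps)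
  then have "(b - a) * (b.top / (4 * (c - b))) \<le> (b - a) * D" using ab by (intro mult_left_mono) auto
  then have "\<delta> \<le> (b - a) * D" by (simp add: \<delta>_def)
  then have "b.top < a.energy f" using ea f(3) \<epsilon>(3) by linarith
  also have "\<dots> \<le> a.top" using a.energy_le_top[OF fa] f(2) by simp
  finally show ?thesis unfolding a.growth_def b.growth_def .
qed

theorem theorem1p2:
  fixes n p :: nat and \<rho> :: real and x :: "int ^ 'd"
    and MY :: "'v measure" and Y :: "nat \<Rightarrow> real \<Rightarrow> 'v \<Rightarrow> int ^ 'd"
    and MX :: "real \<Rightarrow> int ^ 'd \<Rightarrow> 'w measure"
    and X :: "real \<Rightarrow> int ^ 'd \<Rightarrow> real \<Rightarrow> 'w \<Rightarrow> int ^ 'd"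
    and lyap :: "real \<Rightarrow> real"
  assumes "n \<ge> 1" and "p \<ge> 1" and "\<rho> \<ge> 0"
    and "\<And>k. k \<in> {1..n} \<Longrightarrow> simple_random_walk MY (Y k) \<rho> 0"
    and "indep_processes MY Y {1..n}"
    and "\<And>\<kappa> z. \<kappa> \<ge> 0 \<Longrightarrow> simple_random_walk (MX \<kappa> z) (X \<kappa> z) \<kappa> z"
  defines "lyap \<equiv> (\<lambda>\<kappa>. annealed_lyapunov MY Y MX X x n p \<kappa> \<rho>)"
  shows "((lyap \<longlongrightarrow> lyap 0) (at_right 0) \<and> lyap 0 = real n * sup_spectrum TYPE('d) (\<rho> / real p)) \<and>
    (CARD('d) \<le> 2 \<longrightarrow>
       (\<forall>\<kappa>\<ge>0. lyap \<kappa> > 0) \<and> strict_antimono_on {0..} lyap \<and> (lyap \<longlongrightarrow> 0) at_top) \<and>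
    (CARD('d) \<ge> 3 \<longrightarrow>
       (\<forall>\<kappa>\<ge>0. of_nat n * green_function (MX 1 0) (X 1 0) 0 \<le> ennreal \<kappa> \<longrightarrow> lyap \<kappa> = 0))"
proof -
  note n = assms(1) and p = assms(2) and \<rho> = assms(3)
  \<comment> \<open>Evaluation at the origin in the doubly frozen case is what makes the lower bound
    hold at \<kappa> = \<rho> = 0.\<close>
  define z where "z \<kappa> = (if \<kappa> = 0 \<and> \<rho> = 0 then 0 else x)" for \<kappa> :: real
  define m where "m = one_top TYPE('d) (\<rho> / p)"
  have cat: "catalysts \<kappa> \<rho>" if "\<kappa> \<ge> 0" for \<kappa> using that \<rho> by unfold_locales auto
  have pam: "pam n \<kappa> \<rho> (z \<kappa>) MY Y (MX \<kappa> (z \<kappa>)) (X \<kappa> (z \<kappa>))" if "\<kappa> \<ge> 0" for \<kappa>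
    using assms that by (intro pam.intro cat pam_axioms.intro) (auto simp: catalysts.K_def[OF cat])
  have lyap: "lyap \<kappa> = catalysts.growth n p \<kappa> \<rho> (z \<kappa>) / p" if \<kappa>: "\<kappa> \<ge> 0" for \<kappa>
  proof -
    interpret pam n p \<kappa> \<rho> "z \<kappa>" MY Y "MX \<kappa> (z \<kappa>)" "X \<kappa> (z \<kappa>)" by (rule pam[OF \<kappa>])
    show ?thesis
      unfolding lyap_def annealed_lyapunov_def Let_def z_def[symmetric] growth_def
      using lyapunov_eq[OF p] unfolding annealed_def .
  qed
  \<comment> \<open>Upper and lower bounds coincide at \<kappa> = 0 and squeeze the exponent as
    \<kappa> tends to 0.\<close>
  have nonneg: "0 \<le> lyap \<kappa>" and upper: "lyap \<kappa> \<le> n * m" and lower: "n * m - \<kappa> * deg TYPE('d) \<le> lyap \<kappa>" if \<kappa>: "\<kappa> \<ge> 0" for \<kappa>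
  proof -
    interpret pam n p \<kappa> \<rho> "z \<kappa>" MY Y "MX \<kappa> (z \<kappa>)" "X \<kappa> (z \<kappa>)" by (rule pam[OF \<kappa>])
    have p0: "0 < real p" using p by simp
    show "0 \<le> lyap \<kappa>" using top_nonneg by (simp add: lyap[OF \<kappa>] growth_def)
    show "lyap \<kappa> \<le> n * m"
      using top_le_one_top[OF p] p0 by (simp add: lyap[OF \<kappa>] growth_def m_def field_simps)
    have "n * p * m - \<kappa> * p * deg TYPE('d) \<le> top"
      using top_ge_one_top[OF p] by (simp add: z_def m_def)
    then show "n * m - \<kappa> * deg TYPE('d) \<le> lyap \<kappa>"
      using p0 by (simp add: lyap[OF \<kappa>] growth_def field_simps)
  qed
  have lyap_0: "lyap 0 = n * m" using upper[of 0] lower[of 0] by simp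
  have "((\<lambda>\<kappa>. n * m - \<kappa> * deg TYPE('d)) \<longlongrightarrow> n * m - 0 * deg TYPE('d)) (at_right 0)" by (intro tendsto_intros)
  then have lim: "((\<lambda>\<kappa>. n * m - \<kappa> * deg TYPE('d)) \<longlongrightarrow> n * m) (at_right 0)" by simp
  have "(lyap \<longlongrightarrow> lyap 0) (at_right 0)"
    unfolding lyap_0
  proof (rule real_tendsto_sandwich[OF _ _ lim tendsto_const])
    show "\<forall>\<^sub>F \<kappa> in at_right 0. n * m - \<kappa> * deg TYPE('d) \<le> lyap \<kappa>"
      by (rule eventually_at_rightI[of 0 1]) (use lower in auto)
    show "\<forall>\<^sub>F \<kappa> in at_right 0. lyap \<kappa> \<le> n * m"
      by (rule eventually_at_rightI[of 0 1]) (use upper in auto)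
  qed
  moreover have "lyap 0 = real n * sup_spectrum TYPE('d) (\<rho> / real p)"
    using \<rho> by (simp add: lyap_0 m_def sup_spectrum_eq_one_top)
  moreover have "(\<forall>\<kappa>\<ge>0. lyap \<kappa> > 0) \<and> strict_antimono_on {0..} lyap \<and> (lyap \<longlongrightarrow> 0) at_top" if d: "CARD('d) \<le> 2"
  proof (intro conjI)
    have anti: "lyap b < lyap a" if "0 < a" "a < b" for a b
      using growth_strict_antimono[OF d n p \<rho> that] that p by (simp add: lyap z_def divide_strict_right_mono)
    have pos: "lyap \<kappa> > 0" if "\<kappa> > 0" for \<kappa>
      using anti[of \<kappa> "\<kappa> + 1"] nonneg[of "\<kappa> + 1"] that by simp
    \<comment> \<open>At \<kappa> = 0 the replicas are frozen and the class of test functions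
      changes. Strictness is therefore taken from an intermediate point, which is bounded by n m,
      the value at 0.\<close>
    have anti_0: "lyap b < lyap 0" if "0 < b" for b
      using anti[of "b / 2" b] upper[of "b / 2"] that by (simp add: lyap_0)
    show "\<forall>\<kappa>\<ge>0. lyap \<kappa> > 0" using pos anti_0[of 1] pos[of 1] by (metis less_eq_real_def order_less_trans zero_less_one)
    show "strict_antimono_on {0..} lyap"
      using anti anti_0 by (intro monotone_onI) (metis atLeast_iff less_eq_real_def)
    show "(lyap \<longlongrightarrow> 0) at_top"
    proof (rule order_tendstoI)
      fix e :: real assume e: "e < 0"
      show "\<forall>\<^sub>F \<kappa> in at_top. e < lyap \<kappa>"
        using eventually_ge_at_top[of 0] by eventually_elim (use e nonneg in force)
    next
      fix e :: real assume e: "0 < e"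
      obtain L :: nat where L: "2 * real n / e < real L" using reals_Archimedean2 by blast
      have "0 < 2 * real n / e" using e n by simp
      with L have L0: "L > 0" by (metis of_nat_0_less_iff order_less_trans)
      show "\<forall>\<^sub>F \<kappa> in at_top. lyap \<kappa> < e"
        using eventually_ge_at_top[of "4 * real L * real n"]
      proof eventually_elim
        case (elim \<kappa>)
        have \<kappa>: "0 \<le> \<kappa>" using elim by (meson mult_nonneg_nonneg of_nat_0_le_iff order_trans zero_le_numeral)
        interpret catalysts n p \<kappa> \<rho> "z \<kappa>" by (rule cat[OF \<kappa>])
        have "top \<le> real n * real p * (2 / real L)" by (rule top_le_large[OF L0 elim])
        then have "lyap \<kappa> \<le> 2 * real n / real L" using p L0 by (simp add: lyap[OF \<kappa>] growth_def field_simps)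
        also have "\<dots> < e" using L L0 e by (simp add: field_simps)
        finally show ?case .
      qed
    qed
  qed
  moreover have "lyap \<kappa> = 0" if \<kappa>: "\<kappa> \<ge> 0" and green: "of_nat n * green_function (MX 1 0) (X 1 0) 0 \<le> ennreal \<kappa>" for \<kappa>
  proof -
    interpret catalysts n p \<kappa> \<rho> "z \<kappa>" by (rule cat[OF \<kappa>])
    define q where "q k = walk_count k (0 :: int ^ 'd) 0 / deg TYPE('d) ^ Suc k" for k
    have q: "0 \<le> q k" for k by (simp add: q_def walk_count_nonneg)
    have green_eq: "green_function (MX 1 0) (X 1 0) 0 = (\<Sum>k. ennreal (q k))"
      unfolding q_def by (rule green_function_eq) (use assms(6)[of 1 0] in simp)
    \<comment> \<open>The hypothesis lives in \<open>ennreal\<close> and already contains the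
      finiteness of the Green function; partial sums bring it back to the reals.\<close>
    have "real n * (\<Sum>k\<le>m. q k) \<le> \<kappa>" for m
    proof -
      have "ennreal (real n * (\<Sum>k\<le>m. q k)) = of_nat n * ennreal (\<Sum>k\<le>m. q k)"
        by (subst ennreal_mult) (auto simp: ennreal_of_nat_eq_real_of_nat intro!: sum_nonneg q)
      also have "ennreal (\<Sum>k\<le>m. q k) = (\<Sum>k\<le>m. ennreal (q k))" by (rule sum_ennreal[symmetric]) (rule q)
      also have "of_nat n * \<dots> \<le> of_nat n * (\<Sum>k. ennreal (q k))"
        by (intro mult_left_mono sum_le_suminf) auto
      also have "\<dots> \<le> ennreal \<kappa>" using green by (simp only: green_eq)
      finally show ?thesis using \<kappa> by (simp add: ennreal_le_iff)
    qed
    then have "(\<Sum>k\<le>m. q k) \<le> \<kappa> / n" for m using n by (simp add: field_simps)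
    then have "top \<le> 0" using n by (intro top_le_transient[of "\<kappa> / n"]) (auto simp: q_def)
    then have "lyap \<kappa> \<le> 0" by (simp add: lyap[OF \<kappa>] growth_def divide_nonpos_nonneg)
    then show ?thesis using nonneg[OF \<kappa>] by simp
  qed
  ultimately show ?thesis by blast
qed

end
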